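(* Let $(H,V,a)$ be a triple with $a$ a bounded, $V$-coercive sesquilinear form on $V$ (as specified in the context), let $A$ be the Lax--Milgram operator defined from $(H,V,a)$, and let $0<T<\infty$. For data $f\in L_2(0,T;V^* )$ and $u_T\in H$ consider the final value problem $$\partial_t u+Au=f\ \text{ in } \mathcal{D}'(0,T;V^* ),\qquad u(T)=u_T\ \text{ in } H. \qquad ( * )$$ Then $( * )$ has a solution $u$ belonging to $$X=L_2(0,T;V)\cap C([0,T];H)\cap H^1(0,T;V^* )$$ if and only if $(f,u_T)$ belongs to the subspace $Y\subset L_2(0,T;V^* )\oplus H$ defined by the condition $$u_T-\int_0^T e^{-(T-t)A}f(t)\,dt\ \in\ D(e^{TA}).\qquad ( ** )$$ In the affirmative case, the solution $u$ is uniquely determined in $X$ and, with a constant $c>0$ independent of $(f,u_T)$, $$\|u\|_X\le c\Big(|u_T|^2+\int_0^T\|f(t)\|_*^2\,dt+\Big|e^{TA}\Big(u_T-\int_0^Te^{-(T-t)A}f(t)\,dt\Big)\Big|^2\Big)^{1/2}=c\,\|(f,u_T)\|_Y ,$$ whence the solution operator $(f,u_T)\mapsto u$ is continuous $Y\to X$. Moreover, $$u(t)=e^{-tA}e^{TA}\Big(u_T-\int_0^Te^{-(T-t)A}f(t)\,dt\Big)+\int_0^te^{-(t-s)A}f(s)\,ds ,$$ where all terms belong to $X$ as functions of $t\in[0,T]$, and the difference in $( ** )$ equals $e^{-TA}u(0)$ in $H$.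
   Context: Setting: $V\hookrightarrow H\hookrightarrow V^*$ is a Gelfand triple of separable, densely and continuously injected complex Hilbert spaces with norms $\|\cdot\|$, $|\cdot|$, $\|\cdot\|_*$, respectively; $V^*$ is the antidual of $V$ (with dual norm), $(\,\cdot\,|\,\cdot\,)$ is the inner product of $H$ and $\langle\cdot,\cdot\rangle$ is the duality of $V^*$ and $V$. There are constants $C_1,C_2>0$ with $\|v\|_*\le C_1|v|\le C_2\|v\|$ for $v\in V$. The sesquilinear form $a(\cdot,\cdot)$ on $V$ is bounded and $V$-coercive: there are constants $C_3,C_4>0$ and $k\in\mathbb{R}$ such that for all $u,v\in V$ $$|a(u,v)|\le C_3\|u\|\,\|v\|,\qquad \operatorname{Re}a(v,v)\ge C_4\|v\|^2-k|v|^2 .$$ The Lax--Milgram operator $A$ is the unbounded operator in $H$ whose domain $D(A)$ consists of those $u\in V$ for which there is $f\in H$ with $a(u,v)=(f|v)$ for all $v\in V$; then $Au=f$. It has a unique extension $A\in\mathbb{B}(V,V^* )$, given by $\langle Au,v\rangle=a(u,v)$ for $u,v\in V$. Semigroups: $-A$ generates an analytic semigroup $e^{-tA}$ in $\mathbb{B}(H)$, which extends to an analytic semigroup on $V^*$, also written $e^{-tA}$, generated by minus the extension $A$ regarded as an unbounded operator in $V^*$ with domain $V$. The integrals are Bochner integrals in $V^*$; the vector $\int_0^Te^{-(T-t)A}f(t)\,dt$ in fact lies in $H$. Each $e^{-tA}$, $t>0$, is injective on $H$, and $e^{tA}:=(e^{-tA})^{-1}$ denotes its inverse, a closed, in general unbounded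 operator in $H$ with domain $D(e^{tA})=R(e^{-tA})$, the range of $e^{-tA}$ on $H$. Spaces: $\mathcal{D}'(0,T;V^* )$ is the space of continuous linear maps $C_0^\infty(]0,T[)\to V^*$ (vector distributions), and $\partial_tu=u'$ is the distributional derivative. $H^1(0,T;V^* )=\{u\in L_2(0,T;V^* )\mid \partial_tu\in L_2(0,T;V^* )\}$. The norm on $X$ is $$\|u\|_X=\Big(\int_0^T\|u(t)\|^2\,dt+\sup_{0\le t\le T}|u(t)|^2+\int_0^T(\|u(t)\|_*^2+\|u'(t)\|_*^2)\,dt\Big)^{1/2}.$$ The norm on $Y$ is $$\|(f,u_T)\|_Y=\Big(|u_T|^2+\int_0^T\|f(t)\|_*^2\,dt+\Big|e^{TA}\Big(u_T-\int_0^Te^{-(T-t)A}f(t)\,dt\Big)\Big|^2\Big)^{1/2}.$$ *)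

theory Defs
  imports "HOL-Analysis.Analysis"
begin

section \<open>Complex Banach and Hilbert spaces\<close>

class complex_banach = banach +
  fixes scaleC :: "complex \<Rightarrow> 'a \<Rightarrow> 'a" (infixr "*\<^sub>C" 75)
  assumes scaleC_add_right: "c *\<^sub>C (x + y) = c *\<^sub>C x + c *\<^sub>C y"
    and scaleC_add_left: "(c + d) *\<^sub>C x = c *\<^sub>C x + d *\<^sub>C x"
    and scaleC_scaleC: "c *\<^sub>C d *\<^sub>C x = (c * d) *\<^sub>C x"
    and scaleC_of_real: "complex_of_real r *\<^sub>C x = r *\<^sub>R x"
    and norm_scaleC: "norm (c *\<^sub>C x) = cmod c * norm x"

text \<open>The inner product is linear in the first and antilinear in the second argument.
  Positivity and definiteness follow from the last axiom, because \<^term>\<open>sqrt\<close> is negative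
  on negative arguments.\<close>

class complex_hilbert = complex_banach +
  fixes cinner :: "'a \<Rightarrow> 'a \<Rightarrow> complex"
  assumes cinner_commute: "cinner x y = cnj (cinner y x)"
    and cinner_add_left: "cinner (x + y) z = cinner x z + cinner y z"
    and cinner_scaleC_left: "cinner (c *\<^sub>C x) y = c * cinner x y"
    and norm_eq_sqrt_cinner: "norm x = sqrt (Re (cinner x x))"

definition bounded_clinear :: "('a::complex_banach \<Rightarrow> 'b::complex_banach) \<Rightarrow> bool" where
  "bounded_clinear L \<longleftrightarrow> bounded_linear L \<and> (\<forall>c x. L (c *\<^sub>C x) = c *\<^sub>C L x)"

definition bounded_antilinear :: "('a::complex_banach \<Rightarrow> complex) \<Rightarrow> bool" where
  "bounded_antilinear g \<longleftrightarrow> bounded_linear g \<and> (\<forall>c x. g (c *\<^sub>C x) = cnj c * g x)"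

lemma scaleC_zero_left [simp]: "0 *\<^sub>C x = (0::'a::complex_banach)"
  using scaleC_of_real[of 0 x] by simp

lemma scaleC_one [simp]: "1 *\<^sub>C x = (x::'a::complex_banach)"
  using scaleC_of_real[of 1 x] by simp

lemma cinner_add_right: "cinner x (y + z) = cinner x y + cinner x (z::'a::complex_hilbert)"
  by (subst (1 2 3) cinner_commute) (simp add: cinner_add_left)

lemma cinner_scaleC_right: "cinner x (c *\<^sub>C y) = cnj c * cinner x (y::'a::complex_hilbert)"
  by (subst (1 2) cinner_commute) (simp add: cinner_scaleC_left)

lemma cinner_scaleR_left: "cinner (r *\<^sub>R x) y = of_real r * cinner x (y::'a::complex_hilbert)"
  by (simp flip: scaleC_of_real add: cinner_scaleC_left)

lemma cinner_scaleR_right: "cinner x (r *\<^sub>R y) = of_real r * cinner x (y::'a::complex_hilbert)"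
  by (simp flip: scaleC_of_real add: cinner_scaleC_right)

lemma cinner_minus_left: "cinner (- x) y = - cinner x (y::'a::complex_hilbert)"
  using cinner_scaleR_left[of "-1" x y] by simp

lemma cinner_minus_right: "cinner x (- y) = - cinner x (y::'a::complex_hilbert)"
  using cinner_scaleR_right[of x "-1" y] by simp

lemma cinner_diff_left: "cinner (x - y) z = cinner x z - cinner y (z::'a::complex_hilbert)"
  using cinner_add_left[of x "- y" z] by (simp add: cinner_minus_left)

lemma cinner_diff_right: "cinner x (y - z) = cinner x y - cinner x (z::'a::complex_hilbert)"
  using cinner_add_right[of x y "- z"] by (simp add: cinner_minus_right)

lemma norm_sq_cinner: "(norm (x::'a::complex_hilbert))\<^sup>2 = Re (cinner x x)"
proof -
  have "0 \<le> sqrt (Re (cinner x x))"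
    by (metis norm_eq_sqrt_cinner norm_ge_zero)
  then show ?thesis
    by (simp add: norm_eq_sqrt_cinner)
qed

lemma norm_sq_add:
  "(norm (x + y::'a::complex_hilbert))\<^sup>2 = (norm x)\<^sup>2 + (norm y)\<^sup>2 + 2 * Re (cinner x y)"
proof -
  have "Re (cinner y x) = Re (cinner x y)"
    by (subst cinner_commute) simp
  then show ?thesis
    by (simp add: norm_sq_cinner cinner_add_left cinner_add_right)
qed

lemma norm_sq_diff:
  "(norm (x - y::'a::complex_hilbert))\<^sup>2 = (norm x)\<^sup>2 + (norm y)\<^sup>2 - 2 * Re (cinner x y)"
  using norm_sq_add[of x "- y"] by (simp add: cinner_minus_right)

lemma Im_cinner: "Im (cinner x y) = Re (cinner x (\<i> *\<^sub>C (y::'a::complex_hilbert)))"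
  by (simp add: cinner_scaleC_right)

lemma cinner_self_eq_0: "cinner x x = 0 \<Longrightarrow> x = (0::'a::complex_hilbert)"
  using norm_eq_sqrt_cinner[of x] by simp

lemma Re_cinner_le: "\<bar>Re (cinner x y)\<bar> \<le> norm x * norm (y::'a::complex_hilbert)"
proof -
  have *: "Re (cinner x y) \<le> norm x * norm y" for x y :: 'a
  proof (cases "x = 0 \<or> y = 0")
    case True
    then show ?thesis
      using cinner_scaleC_left[of 0 x y] cinner_scaleC_right[of x 0 y] by auto
  next
    case False
    have "0 \<le> (norm (norm y *\<^sub>R x - norm x *\<^sub>R y))\<^sup>2"
      by simp
    also have "\<dots> = 2 * (norm x * norm y) * (norm x * norm y - Re (cinner x y))"
      by (simp only: norm_sq_diff)
        (simp add: cinner_scaleR_left cinner_scaleR_right algebra_simps power2_eq_square)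
    finally have "0 \<le> 2 * (norm x * norm y) * (norm x * norm y - Re (cinner x y))" .
    moreover have "0 < 2 * (norm x * norm y)"
      using False by simp
    ultimately have "0 \<le> norm x * norm y - Re (cinner x y)"
      by (metis zero_le_mult_iff not_le)
    then show ?thesis by simp
  qed
  from *[of x y] *[of "- x" y] show ?thesis
    by (simp add: cinner_minus_left abs_le_iff)
qed

lemma norm_cinner_le: "cmod (cinner x y) \<le> norm x * norm (y::'a::complex_hilbert)"
proof (cases "cinner x y = 0")
  case False
  define c where "c = cnj (cinner x y) / cmod (cinner x y)"
  have "cmod c = 1"
    using False by (simp add: c_def norm_divide)
  have "cinner (c *\<^sub>C x) y = of_real (cmod (cinner x y))"
    using False
    by (simp add: cinner_scaleC_left c_def complex_norm_square[symmetric] mult.commute power2_eq_square)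
  then have "cmod (cinner x y) = Re (cinner (c *\<^sub>C x) y)"
    by simp
  also have "\<dots> \<le> norm (c *\<^sub>C x) * norm y"
    using Re_cinner_le[of "c *\<^sub>C x" y] by simp
  finally show ?thesis
    by (simp add: norm_scaleC \<open>cmod c = 1\<close>)
qed simp

lemma bounded_antilinear_cinner: "bounded_antilinear (cinner (x::'a::complex_hilbert))"
  unfolding bounded_antilinear_def
proof (intro conjI allI)
  show "bounded_linear (cinner x)"
    by (rule bounded_linear_intro[where K = "norm x"])
      (auto simp: cinner_add_right cinner_scaleR_right scaleR_conv_of_real
        intro: order_trans[OF norm_cinner_le])
qed (rule cinner_scaleC_right)

text \<open>Riesz representation on a closed complex subspace \<open>M\<close>. The case \<open>M = UNIV\<close> yields
  separability of the antidual, the case \<open>g = cinner x\<close> the orthogonal projection.\<close>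

lemma riesz_on_subspace:
  fixes g :: "'a::complex_hilbert \<Rightarrow> complex"
  assumes g: "bounded_antilinear g" and M: "closed M" "0 \<in> M"
    "\<And>x y. x \<in> M \<Longrightarrow> y \<in> M \<Longrightarrow> x + y \<in> M" "\<And>c x. x \<in> M \<Longrightarrow> c *\<^sub>C x \<in> M"
  shows "\<exists>p\<in>M. \<forall>w\<in>M. g w = cinner p w"
proof -
  interpret g: bounded_linear g
    using g by (simp add: bounded_antilinear_def)
  have MR: "r *\<^sub>R x \<in> M" if "x \<in> M" for r x
    using M(4)[OF that, of "of_real r"] by (simp add: scaleC_of_real)
  define J where "J w = (norm w)\<^sup>2 / 2 - Re (g w)" for w
  obtain K where K: "\<And>x. norm (g x) \<le> norm x * K"
    using g.bounded by blast
  have Jlow: "- K\<^sup>2 / 2 \<le> J w" for w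
  proof -
    have "Re (g w) \<le> norm w * K"
      using K[of w] abs_Re_le_cmod[of "g w"] by linarith
    moreover have "0 \<le> (norm w - K)\<^sup>2"
      by simp
    ultimately show ?thesis
      unfolding J_def by (simp add: power2_diff)
  qed
  have bdd: "bdd_below (J ` M)"
    by (rule bdd_belowI2[where m = "- K\<^sup>2 / 2"]) (rule Jlow)
  define d where "d = (INF w\<in>M. J w)"
  have dle: "d \<le> J w" if "w \<in> M" for w
    unfolding d_def by (rule cINF_lower[OF bdd that])
  have "\<exists>x\<in>M. J x < d + 1 / (real n + 1)" for n
    using cINF_less_iff[of M J "d + 1 / (real n + 1)"] bdd M(2) unfolding d_def by auto
  then obtain x where x: "\<And>n. x n \<in> M" "\<And>n. J (x n) < d + 1 / (real n + 1)"
    by metis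
  have par: "(norm (u - v))\<^sup>2 \<le> 4 * (J u + J v - 2 * d)" if "u \<in> M" "v \<in> M" for u v
  proof -
    have "d \<le> J ((1/2) *\<^sub>R (u + v))"
      by (intro dle MR M that)
    moreover have "J ((1/2) *\<^sub>R (u + v)) = (norm (u + v))\<^sup>2 / 8 - (Re (g u) + Re (g v)) / 2"
      unfolding J_def g.scaleR g.add norm_scaleR by (simp add: power_mult_distrib power_divide)
    ultimately show ?thesis
      using norm_sq_add[of u v] norm_sq_diff[of u v] unfolding J_def by argo
  qed
  have "Cauchy x"
  proof (rule metric_CauchyI)
    fix e :: real assume "0 < e"
    obtain N where N: "8 / (e\<^sup>2) < real N"
      using reals_Archimedean2 by blast
    have "dist (x m) (x n) < e" if "N \<le> m" "N \<le> n" for m n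
    proof -
      have "1 / (real k + 1) \<le> 1 / (real N + 1)" if "N \<le> k" for k
        using that by (intro divide_left_mono) auto
      from this[OF \<open>N \<le> m\<close>] this[OF \<open>N \<le> n\<close>] x(2)[of m] x(2)[of n]
      have "(norm (x m - x n))\<^sup>2 \<le> 8 / (real N + 1)"
        using par[OF x(1)[of m] x(1)[of n]] by auto
      also have "\<dots> < e\<^sup>2"
        using N \<open>0 < e\<close> by (simp add: field_simps) (smt (verit) zero_less_power)
      finally show ?thesis
        using \<open>0 < e\<close> by (simp add: dist_norm power2_less_imp_less)
    qed
    then show "\<exists>N. \<forall>m\<ge>N. \<forall>n\<ge>N. dist (x m) (x n) < e"
      by blast
  qed
  then obtain p where p: "x \<longlonglongrightarrow> p"
    by (meson Cauchy_convergent_iff convergent_def)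
  have pM: "p \<in> M"
    using M(1) x(1) p by (metis closed_sequentially)
  have "(\<lambda>n. J (x n)) \<longlonglongrightarrow> J p"
    unfolding J_def by (intro tendsto_intros p g.tendsto) auto
  moreover have "(\<lambda>n. d + 1 / (real n + 1)) \<longlonglongrightarrow> d + 0"
    by (intro tendsto_add tendsto_const)
      (use LIMSEQ_inverse_real_of_nat in \<open>simp add: inverse_eq_divide add.commute\<close>)
  ultimately have Jp: "J p \<le> d"
    using x(2) by (intro LIMSEQ_le[of _ _ "\<lambda>n. d + 1 / (real n + 1)"]) (auto intro!: less_imp_le)
  have Re_eq: "Re (g w) = Re (cinner p w)" if w: "w \<in> M" for w
  proof -
    define b where "b = Re (cinner p w) - Re (g w)"
    define q where "q = (norm w)\<^sup>2"
    have q: "0 \<le> q" by (simp add: q_def)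
    have ge: "0 \<le> t * b + t\<^sup>2 * q / 2" for t
    proof -
      have "J p \<le> J (p + t *\<^sub>R w)"
        using Jp dle[of "p + t *\<^sub>R w"] M(3)[OF pM MR[OF w]] by fastforce
      moreover have "J (p + t *\<^sub>R w) = J p + t * b + t\<^sup>2 * q / 2"
        unfolding J_def norm_sq_add b_def q_def
        by (simp add: cinner_scaleR_right g.add g.scaleR algebra_simps power_mult_distrib)
      ultimately show ?thesis by simp
    qed
    have "b\<^sup>2 \<le> 0"
    proof -
      have "0 \<le> - b / (q + 1) * b + (- b / (q + 1))\<^sup>2 * q / 2"
        by (rule ge)
      also have "\<dots> = - (b\<^sup>2 * (q + 2) / (2 * (q + 1)\<^sup>2))"
      proof -
        have "q + 1 \<noteq> 0" using q by simp
        then show ?thesis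
          by (simp add: divide_simps power2_eq_square) (simp add: algebra_simps)
      qed
      finally have "b\<^sup>2 * (q + 2) / (2 * (q + 1)\<^sup>2) \<le> 0" by simp
      then show ?thesis
        using q by (simp add: divide_le_0_iff mult_le_0_iff)
    qed
    then show ?thesis by (simp add: b_def)
  qed
  have "g w = cinner p w" if w: "w \<in> M" for w
  proof (rule complex_eqI)
    show "Re (g w) = Re (cinner p w)" by (rule Re_eq[OF w])
    have "g (\<i> *\<^sub>C w) = - \<i> * g w"
      using g by (simp add: bounded_antilinear_def)
    then have "Im (g w) = Re (g (\<i> *\<^sub>C w))" by simp
    also have "\<dots> = Re (cinner p (\<i> *\<^sub>C w))" by (rule Re_eq[OF M(4)[OF w]])
    finally show "Im (g w) = Im (cinner p w)" by (simp add: Im_cinner)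
  qed
  with pM show ?thesis by blast
qed

section \<open>The antidual\<close>

typedef (overloaded) 'a antidual =
  "{g :: 'a::complex_hilbert \<Rightarrow>\<^sub>L complex. \<forall>c x. blinfun_apply g (c *\<^sub>C x) = cnj c * blinfun_apply g x}"
  by (rule exI[of _ 0]) simp

setup_lifting type_definition_antidual

lift_definition dual_pairing :: "'a::complex_hilbert antidual \<Rightarrow> 'a \<Rightarrow> complex"
  is blinfun_apply .

text \<open>For a bounded antilinear \<open>g\<close> this is the functional \<open>y\<close> with \<open>dual_pairing y v = g v\<close>
  for all \<open>v\<close>.\<close>

definition antidual_of :: "('a::complex_hilbert \<Rightarrow> complex) \<Rightarrow> 'a antidual" where
  "antidual_of g = Abs_antidual (Blinfun g)"

instantiation antidual :: (complex_hilbert) real_normed_vector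
begin

lift_definition norm_antidual :: "'a antidual \<Rightarrow> real" is norm .
lift_definition zero_antidual :: "'a antidual" is 0 by simp
lift_definition plus_antidual :: "'a antidual \<Rightarrow> 'a antidual \<Rightarrow> 'a antidual" is "(+)"
  by (simp add: blinfun.bilinear_simps algebra_simps)
lift_definition minus_antidual :: "'a antidual \<Rightarrow> 'a antidual \<Rightarrow> 'a antidual" is "(-)"
  by (simp add: blinfun.bilinear_simps algebra_simps)
lift_definition uminus_antidual :: "'a antidual \<Rightarrow> 'a antidual" is uminus
  by (simp add: blinfun.bilinear_simps)
lift_definition scaleR_antidual :: "real \<Rightarrow> 'a antidual \<Rightarrow> 'a antidual" is "scaleR"
  by (simp add: blinfun.bilinear_simps scaleR_conv_of_real)
lift_definition dist_antidual :: "'a antidual \<Rightarrow> 'a antidual \<Rightarrow> real" is dist .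

definition sgn_antidual :: "'a antidual \<Rightarrow> 'a antidual"
  where "sgn_antidual x = scaleR (inverse (norm x)) x"

definition uniformity_antidual :: "('a antidual \<times> 'a antidual) filter"
  where "uniformity_antidual = (INF e\<in>{0<..}. principal {(x, y). dist x y < e})"

definition open_antidual :: "'a antidual set \<Rightarrow> bool"
  where "open_antidual S = (\<forall>x\<in>S. \<forall>\<^sub>F (x', y) in uniformity. x' = x \<longrightarrow> y \<in> S)"

instance
  apply standard
  unfolding open_antidual_def sgn_antidual_def uniformity_antidual_def
  by (rule refl | (transfer, simp add: dist_norm algebra_simps norm_triangle_ineq))+

end

lemma dual_pairing_antidual_of:
  assumes "bounded_antilinear g"
  shows "dual_pairing (antidual_of g) v = g v"
  using assms unfolding bounded_antilinear_def dual_pairing.rep_eq antidual_of_def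
  by (subst Abs_antidual_inverse) (auto simp: bounded_linear_Blinfun_apply)

lemma antidual_eqI: "(\<And>v. dual_pairing x v = dual_pairing y v) \<Longrightarrow> x = y"
  by transfer (rule blinfun_eqI)

lemma bounded_antilinear_dual_pairing: "bounded_antilinear (dual_pairing y)"
  unfolding bounded_antilinear_def by transfer (auto simp: blinfun.bounded_linear_right)

lemma dual_pairing_add: "dual_pairing (x + y) v = dual_pairing x v + dual_pairing y v"
  and dual_pairing_diff: "dual_pairing (x - y) v = dual_pairing x v - dual_pairing y v"
  and dual_pairing_scaleR: "dual_pairing (r *\<^sub>R x) v = r *\<^sub>R dual_pairing x v"
  by (transfer, simp add: blinfun.bilinear_simps)+

lemma norm_dual_pairing_le: "cmod (dual_pairing y v) \<le> norm y * norm v"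
  by transfer (rule norm_blinfun)

lemma norm_antidual_bound:
  "0 \<le> b \<Longrightarrow> (\<And>v. cmod (dual_pairing y v) \<le> b * norm v) \<Longrightarrow> norm y \<le> b"
  by transfer (rule norm_blinfun_bound)

lemma norm_antidual_eq: "norm y = (SUP v. cmod (dual_pairing y v) / norm v)"
  by transfer (simp add: norm_blinfun.rep_eq onorm_def)

instantiation antidual :: (complex_hilbert) complex_banach
begin

lift_definition scaleC_antidual :: "complex \<Rightarrow> 'a antidual \<Rightarrow> 'a antidual"
  is "\<lambda>c g. blinfun_compose (blinfun_mult_right c) g"
  by (simp add: blinfun_mult_right.rep_eq)

lemma dual_pairing_scaleC: "dual_pairing (c *\<^sub>C y) v = c * dual_pairing y v"
  by transfer (simp add: blinfun_mult_right.rep_eq)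

instance
proof
  fix X :: "nat \<Rightarrow> 'a antidual"
  assume X: "Cauchy X"
  define Z where "Z n = Rep_antidual (X n)" for n
  have "dist (Z m) (Z n) = dist (X m) (X n)" for m n
    by (simp add: Z_def dist_antidual.rep_eq)
  then have "Cauchy Z"
    using X by (simp add: Cauchy_def)
  then obtain z where z: "Z \<longlonglongrightarrow> z"
    by (meson Cauchy_convergent_iff convergent_def)
  have lim: "(\<lambda>n. Z n v) \<longlonglongrightarrow> z v" for v
    by (intro tendsto_intros z)
  have "z (c *\<^sub>C v) = cnj c * z v" for c v
  proof (rule LIMSEQ_unique)
    show "(\<lambda>n. Z n (c *\<^sub>C v)) \<longlonglongrightarrow> z (c *\<^sub>C v)" by (rule lim)
    have "Z n (c *\<^sub>C v) = cnj c * Z n v" for n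
      using Rep_antidual[of "X n"] by (simp add: Z_def)
    then show "(\<lambda>n. Z n (c *\<^sub>C v)) \<longlonglongrightarrow> cnj c * z v"
      using tendsto_mult[OF tendsto_const lim] by simp
  qed
  then have "Rep_antidual (Abs_antidual z) = z"
    by (simp add: Abs_antidual_inverse)
  then have "(\<lambda>n. dist (X n) (Abs_antidual z)) = (\<lambda>n. dist (Z n) z)"
    by (simp add: Z_def dist_antidual.rep_eq)
  then have "X \<longlonglongrightarrow> Abs_antidual z"
    using z tendsto_dist_iff by metis
  then show "convergent X" by (auto simp: convergent_def)
next
  fix c d :: complex and r :: real and x y :: "'a antidual"
  show "c *\<^sub>C (x + y) = c *\<^sub>C x + c *\<^sub>C y" "(c + d) *\<^sub>C x = c *\<^sub>C x + d *\<^sub>C x"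
    "c *\<^sub>C d *\<^sub>C x = (c * d) *\<^sub>C x" "complex_of_real r *\<^sub>C x = r *\<^sub>R x"
    by (rule antidual_eqI, simp add: dual_pairing_add dual_pairing_scaleR dual_pairing_scaleC
        algebra_simps scaleR_conv_of_real)+
  have le: "norm (e *\<^sub>C z) \<le> cmod e * norm z" for e and z :: "'a antidual"
  proof (rule norm_antidual_bound)
    fix v
    show "cmod (dual_pairing (e *\<^sub>C z) v) \<le> cmod e * norm z * norm v"
      using mult_left_mono[OF norm_dual_pairing_le[of z v], of "cmod e"]
      by (simp add: dual_pairing_scaleC norm_mult mult.assoc)
  qed simp
  show "norm (c *\<^sub>C x) = cmod c * norm x"
  proof (cases "c = 0")
    case True
    then show ?thesis using le[of c x] by simp
  next
    case False
    have "x = inverse c *\<^sub>C (c *\<^sub>C x)"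
      using False
      by (intro antidual_eqI) (simp add: dual_pairing_scaleC)
    then have "norm x \<le> cmod (inverse c) * norm (c *\<^sub>C x)"
      by (metis le)
    then have "cmod c * norm x \<le> norm (c *\<^sub>C x)"
      using False by (simp add: norm_inverse norm_divide field_simps)
    with le[of c x] show ?thesis by simp
  qed
qed

end

lemma riesz_antidual: "\<exists>p. y = antidual_of (cinner p)"
proof -
  obtain p where "\<forall>w. dual_pairing y w = cinner p w"
    using riesz_on_subspace[OF bounded_antilinear_dual_pairing, of UNIV y] by auto
  then show ?thesis
    by (intro exI[of _ p] antidual_eqI)
      (simp add: dual_pairing_antidual_of bounded_antilinear_cinner)
qed

lemma dist_antidual_of_cinner: "dist (antidual_of (cinner p)) (antidual_of (cinner q)) \<le> dist p q"
  unfolding dist_norm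
  by (rule norm_antidual_bound)
    (simp_all add: dual_pairing_diff dual_pairing_antidual_of bounded_antilinear_cinner
      norm_cinner_le flip: cinner_diff_left)

instance antidual :: ("{complex_hilbert, second_countable_topology}") second_countable_topology
proof
  obtain D :: "'a set" where D: "countable D" "\<And>X. open X \<Longrightarrow> X \<noteq> {} \<Longrightarrow> \<exists>d\<in>D. d \<in> X"
    using countable_dense_setE by blast
  define R :: "'a \<Rightarrow> 'a antidual" where "R p = antidual_of (cinner p)" for p
  define B where "B = (\<lambda>(d, n::nat). ball (R d) (1 / (real n + 1))) ` (D \<times> UNIV)"
  have "countable B"
    unfolding B_def by (intro countable_image countable_SIGMA D) auto
  moreover have "topological_basis B"
  proof (rule topological_basisI)
    show "open b" if "b \<in> B" for b
      using that by (auto simp: B_def)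
  next
    fix U :: "'a antidual set" and y assume U: "open U" "y \<in> U"
    obtain e where e: "0 < e" "ball y e \<subseteq> U"
      using U open_contains_ball by blast
    obtain n where n: "1 / (real n + 1) < e / 2"
      using reals_Archimedean[of "e / 2"] e by (auto simp: inverse_eq_divide add.commute)
    obtain p where p: "y = R p"
      using riesz_antidual R_def by metis
    obtain d where d: "d \<in> D" "d \<in> ball p (1 / (real n + 1))"
      using D(2)[of "ball p (1 / (real n + 1))"] by auto
    have near: "dist (R d) y < 1 / (real n + 1)"
      using d(2) dist_antidual_of_cinner[of d p] by (auto simp: p R_def dist_commute)
    have "ball (R d) (1 / (real n + 1)) \<subseteq> U"
    proof
      fix z assume "z \<in> ball (R d) (1 / (real n + 1))"
      then have "dist y z < e"
        using near n dist_triangle[of y z "R d"] by (simp add: dist_commute)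
      then show "z \<in> U" using e by auto
    qed
    then show "\<exists>b\<in>B. y \<in> b \<and> b \<subseteq> U"
      using d(1) near by (intro bexI[of _ "ball (R d) (1 / (real n + 1))"]) (auto simp: B_def)
  qed
  ultimately show "\<exists>B::'a antidual set set. countable B \<and> open = generate_topology B"
    using topological_basis_imp_subbasis by blast
qed


section \<open>The Gelfand triple\<close>

definition gelfand_embedding ::
  "('v::complex_hilbert \<Rightarrow> 'h::complex_hilbert) \<Rightarrow> bool" where
  "gelfand_embedding i \<longleftrightarrow> bounded_clinear i \<and> inj i \<and> closure (range i) = UNIV"

text \<open>\<open>H\<close> is identified with a subspace of the antidual of \<open>V\<close> by letting \<open>f\<close> act as
  \<open>v \<mapsto> (f | v)\<close>. The lemmas below show that this embedding inherits continuity,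
  injectivity and density of the range from \<open>i\<close>.\<close>

definition dual_embed ::
  "('v::complex_hilbert \<Rightarrow> 'h::complex_hilbert) \<Rightarrow> 'h \<Rightarrow> 'v antidual" where
  "dual_embed i f = antidual_of (\<lambda>v. cinner f (i v))"

lemma dual_pairing_dual_embed:
  assumes "bounded_clinear i"
  shows "dual_pairing (dual_embed i f) v = cinner f (i v)"
proof -
  have "bounded_antilinear (\<lambda>v. cinner f (i v))"
    using assms bounded_antilinear_cinner[of f] bounded_linear_compose[of "cinner f" i]
    by (auto simp: bounded_antilinear_def bounded_clinear_def cinner_scaleC_right)
  then show ?thesis
    by (simp add: dual_embed_def dual_pairing_antidual_of)
qed

lemma bounded_clinear_dual_embed:
  assumes "bounded_clinear i"
  shows "bounded_clinear (dual_embed i)"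
proof -
  obtain K where K: "0 < K" "\<And>v. norm (i v) \<le> norm v * K"
    using assms bounded_linear.pos_bounded unfolding bounded_clinear_def by blast
  have bound: "norm (dual_embed i f) \<le> norm f * K" for f
  proof (rule norm_antidual_bound)
    fix v
    show "cmod (dual_pairing (dual_embed i f) v) \<le> norm f * K * norm v"
      using norm_cinner_le[of f "i v"] mult_left_mono[OF K(2)[of v], of "norm f"]
      by (simp add: dual_pairing_dual_embed[OF assms] mult_ac)
  qed (use K in simp)
  have "bounded_linear (dual_embed i)"
    by (rule bounded_linear_intro[where K = K])
      (auto intro!: antidual_eqI bound simp: dual_pairing_dual_embed[OF assms] dual_pairing_add
        dual_pairing_scaleR cinner_add_left cinner_scaleR_left scaleR_conv_of_real)
  moreover have "dual_embed i (c *\<^sub>C f) = c *\<^sub>C dual_embed i f" for c f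
    by (rule antidual_eqI)
      (simp add: dual_pairing_dual_embed[OF assms] dual_pairing_scaleC cinner_scaleC_left)
  ultimately show ?thesis
    by (simp add: bounded_clinear_def)
qed

lemma gelfand_norm_bounds:
  assumes "gelfand_embedding i"
  shows "\<exists>C1>0. \<exists>C2>0. \<forall>v. norm (dual_embed i (i v)) \<le> C1 * norm (i v) \<and>
    C1 * norm (i v) \<le> C2 * norm v"
proof -
  have "bounded_linear i" "bounded_linear (dual_embed i)"
    using assms bounded_clinear_dual_embed
    by (auto simp: gelfand_embedding_def bounded_clinear_def)
  then obtain K C where "0 < K" "\<And>v. norm (i v) \<le> norm v * K"
    and "0 < C" "\<And>f. norm (dual_embed i f) \<le> norm f * C"
    using bounded_linear.pos_bounded by metis
  then show ?thesis
    by (intro exI[of _ C] exI[of _ "C * K"] conjI allI) (auto simp: mult_ac)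
qed

lemma inj_dual_embed:
  assumes "gelfand_embedding i"
  shows "inj (dual_embed i)"
proof (rule injI)
  fix f g assume eq: "dual_embed i f = dual_embed i g"
  have i: "bounded_clinear i" "closure (range i) = UNIV"
    using assms by (auto simp: gelfand_embedding_def)
  have cont: "continuous_on UNIV (cinner (f - g))"
    using bounded_antilinear_cinner linear_continuous_on bounded_antilinear_def by blast
  have "cinner (f - g) (i v) = 0" for v
    unfolding cinner_diff_left using eq by (simp flip: dual_pairing_dual_embed[OF i(1)])
  then have "cinner (f - g) x = 0" if "x \<in> closure (range i)" for x
    using continuous_constant_on_closure[of "range i" "cinner (f - g)" 0 x] cont that i(2) by auto
  then show "f = g"
    using cinner_self_eq_0[of "f - g"] i(2) by simp
qed

lemma dense_dual_embed:
  assumes "gelfand_embedding i"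
  shows "closure (range (dual_embed i)) = UNIV"
proof -
  have i: "bounded_clinear i" "inj i"
    using assms by (auto simp: gelfand_embedding_def)
  define N where "N = {p. antidual_of (cinner p) \<in> range (dual_embed i)}"
  have pair: "dual_pairing (antidual_of (cinner p)) v = cinner p v" for p v :: 'a
    by (simp add: dual_pairing_antidual_of bounded_antilinear_cinner)
  have N_iff: "p \<in> N \<longleftrightarrow> (\<exists>f. \<forall>v. cinner p v = cinner f (i v))" for p
    unfolding N_def image_iff
    by (auto simp: pair dual_pairing_dual_embed[OF i(1)] intro!: antidual_eqI)
      (metis pair dual_pairing_dual_embed[OF i(1)])
  have "0 \<in> N"
    unfolding N_iff by (rule exI[of _ 0]) (metis cinner_scaleC_left mult_zero_left scaleC_zero_left)
  have Nadd: "p + q \<in> N" if "p \<in> N" "q \<in> N" for p q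
    using that unfolding N_iff by (metis cinner_add_left)
  have Nscale: "c *\<^sub>C p \<in> N" if "p \<in> N" for c p
    using that unfolding N_iff by (metis cinner_scaleC_left)
  have bl: "bounded_linear (scaleC c :: 'a \<Rightarrow> 'a)" for c
    by (rule bounded_linear_intro[where K = "cmod c"])
      (auto simp: scaleC_add_right norm_scaleC scaleC_scaleC mult.commute[of _ c]
        mult.commute[of "cmod c"] simp flip: scaleC_of_real)
  have M: "closed (closure N)" "0 \<in> closure N"
    using \<open>0 \<in> N\<close> closure_subset by auto
  have Madd: "x + y \<in> closure N" if x: "x \<in> closure N" and y: "y \<in> closure N" for x y
  proof -
    obtain X where "\<And>n. X n \<in> N" "X \<longlonglongrightarrow> x"
      using x unfolding closure_sequential by blast
    moreover obtain Y where "\<And>n. Y n \<in> N" "Y \<longlonglongrightarrow> y"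
      using y unfolding closure_sequential by blast
    ultimately show ?thesis
      unfolding closure_sequential
      by (intro exI[of _ "\<lambda>n. X n + Y n"]) (auto intro: Nadd tendsto_add)
  qed
  have Mscale: "c *\<^sub>C x \<in> closure N" if x: "x \<in> closure N" for c x
  proof -
    obtain X where "\<And>n. X n \<in> N" "X \<longlonglongrightarrow> x"
      using x unfolding closure_sequential by blast
    then show ?thesis
      unfolding closure_sequential
      by (intro exI[of _ "\<lambda>n. c *\<^sub>C X n"]) (auto intro: Nscale bounded_linear.tendsto[OF bl])
  qed
  have all: "x \<in> closure N" for x
  proof -
    obtain p where p: "p \<in> closure N" "\<And>w. w \<in> closure N \<Longrightarrow> cinner x w = cinner p w"
      using riesz_on_subspace[OF bounded_antilinear_cinner M Madd Mscale] by blast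
    define v where "v = x - p"
    obtain r where r: "antidual_of (cinner r) = dual_embed i (i v)"
      using riesz_antidual by metis
    then have "r \<in> N" by (simp add: N_def)
    then have "cinner v r = 0"
      using p(2) closure_subset by (auto simp: v_def cinner_diff_left)
    then have "cinner r v = 0"
      by (subst cinner_commute) simp
    then have "cinner (i v) (i v) = 0"
      using pair[of r v] dual_pairing_dual_embed[OF i(1), of "i v" v] r by simp
    then have "i v = i 0"
      using i(1) cinner_self_eq_0 linear_0 bounded_linear.linear by (metis bounded_clinear_def)
    then have "v = 0" using i(2) by (simp add: inj_eq)
    then show ?thesis using p(1) by (simp add: v_def)
  qed
  have "y \<in> closure (range (dual_embed i))" for y
  proof -
    obtain x where x: "y = antidual_of (cinner x)"
      using riesz_antidual by metis
    obtain X where X: "\<And>n. X n \<in> N" "X \<longlonglongrightarrow> x"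
      using all[of x] unfolding closure_sequential by blast
    have "(\<lambda>n. dist (antidual_of (cinner (X n))) y) \<longlonglongrightarrow> 0"
      by (rule tendsto_sandwich[of "\<lambda>_. 0" _ _ "\<lambda>n. dist (X n) x"])
        (use X(2) in \<open>auto simp: x dist_antidual_of_cinner tendsto_dist_iff[of X]\<close>)
    then have "(\<lambda>n. antidual_of (cinner (X n))) \<longlonglongrightarrow> y"
      by (subst tendsto_dist_iff)
    moreover have "\<forall>n. antidual_of (cinner (X n)) \<in> range (dual_embed i)"
      using X(1) by (simp add: N_def)
    ultimately show ?thesis
      unfolding closure_sequential by (intro exI[of _ "\<lambda>n. antidual_of (cinner (X n))"]) simp
  qed
  then show ?thesis by blast
qed

section \<open>The form and the Lax--Milgram operator\<close>

definition bounded_coercive_form ::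
  "('v::complex_hilbert \<Rightarrow> 'h::complex_hilbert) \<Rightarrow> ('v \<Rightarrow> 'v \<Rightarrow> complex) \<Rightarrow> bool" where
  "bounded_coercive_form i a \<longleftrightarrow>
    (\<forall>u v w. a (u + v) w = a u w + a v w) \<and> (\<forall>c u w. a (c *\<^sub>C u) w = c * a u w) \<and>
    (\<forall>u v w. a u (v + w) = a u v + a u w) \<and> (\<forall>c u w. a u (c *\<^sub>C w) = cnj c * a u w) \<and>
    (\<exists>C3>0. \<forall>u v. cmod (a u v) \<le> C3 * norm u * norm v) \<and>
    (\<exists>C4>0. \<exists>k. \<forall>v. Re (a v v) \<ge> C4 * (norm v)\<^sup>2 - k * (norm (i v))\<^sup>2)"

text \<open>Unbounded operators are represented by their graphs.\<close>

definition lax_milgram ::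
  "('v::complex_hilbert \<Rightarrow> 'h::complex_hilbert) \<Rightarrow> ('v \<Rightarrow> 'v \<Rightarrow> complex) \<Rightarrow> ('h \<times> 'h) set" where
  "lax_milgram i a = {(i u, f) | u f. \<forall>v. a u v = cinner f (i v)}"

definition lax_milgram_ext ::
  "('v::complex_hilbert \<Rightarrow> 'v \<Rightarrow> complex) \<Rightarrow> 'v \<Rightarrow> 'v antidual" where
  "lax_milgram_ext a u = antidual_of (a u)"

lemma dual_pairing_lax_milgram_ext:
  assumes "bounded_coercive_form i a"
  shows "dual_pairing (lax_milgram_ext a u) v = a u v"
proof -
  obtain C where C: "\<And>u v. cmod (a u v) \<le> C * norm u * norm v"
    using assms unfolding bounded_coercive_form_def by blast
  have a: "a u (v + w) = a u v + a u w" "a u (c *\<^sub>C w) = cnj c * a u w" for c v w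
    using assms unfolding bounded_coercive_form_def by blast+
  have "bounded_linear (a u)"
    by (rule bounded_linear_intro[where K = "C * norm u"])
      (use C a in \<open>auto simp: scaleR_conv_of_real mult.commute simp flip: scaleC_of_real\<close>)
  then show ?thesis
    using a unfolding lax_milgram_ext_def
    by (intro dual_pairing_antidual_of) (simp add: bounded_antilinear_def)
qed

definition lax_milgram_ext_graph ::
  "('v::complex_hilbert \<Rightarrow> 'h::complex_hilbert) \<Rightarrow> ('v \<Rightarrow> 'v \<Rightarrow> complex) \<Rightarrow>
    ('v antidual \<times> 'v antidual) set" where
  "lax_milgram_ext_graph i a = {(dual_embed i (i u), lax_milgram_ext a u) | u. True}"

definition neg_op :: "('e::ab_group_add \<times> 'e) set \<Rightarrow> ('e \<times> 'e) set" where
  "neg_op B = {(x, - y) | x y. (x, y) \<in> B}"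

section \<open>Analytic semigroups\<close>

definition sector :: "real \<Rightarrow> complex set" where
  "sector \<theta> = {z. z \<noteq> 0 \<and> \<bar>Arg z\<bar> < \<theta>}"

text \<open>Only the values \<open>S t\<close> with \<open>t \<ge> 0\<close> matter. Analyticity is required strongly, which by
  uniform boundedness is the same as analyticity in operator norm.\<close>

definition analytic_semigroup :: "(real \<Rightarrow> 'e::complex_banach \<Rightarrow> 'e) \<Rightarrow> bool" where
  "analytic_semigroup S \<longleftrightarrow>
    (\<exists>\<theta> Z. 0 < \<theta> \<and> \<theta> \<le> pi / 2 \<and> (\<forall>t\<ge>0. S t = Z (complex_of_real t)) \<and>
      Z 0 = id \<and>
      (\<forall>z\<in>sector \<theta>. bounded_clinear (Z z)) \<and>
      (\<forall>z\<in>sector \<theta>. \<forall>w\<in>sector \<theta>. Z (z + w) = Z z \<circ> Z w) \<and>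
      (\<forall>x. \<forall>z\<in>sector \<theta>.
        \<exists>d. ((\<lambda>h. inverse h *\<^sub>C (Z (z + h) x - Z z x)) \<longlongrightarrow> d) (at 0)) \<and>
      (\<forall>x. ((\<lambda>z. Z z x) \<longlongrightarrow> x) (at 0 within sector \<theta>)))"

definition generator :: "(real \<Rightarrow> 'e::real_normed_vector \<Rightarrow> 'e) \<Rightarrow> ('e \<times> 'e) set" where
  "generator S = {(x, y). ((\<lambda>h. (S h x - x) /\<^sub>R h) \<longlongrightarrow> y) (at_right 0)}"

text \<open>A semigroup is determined on \<open>t \<ge> 0\<close> by its generator, so the choice only concerns
  negative times.\<close>

definition generated_semigroup ::
  "('e::complex_banach \<times> 'e) set \<Rightarrow> real \<Rightarrow> 'e \<Rightarrow> 'e" where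
  "generated_semigroup B = (SOME S. analytic_semigroup S \<and> generator S = B)"

text \<open>\<open>e\<^sup>-\<^sup>t\<^sup>A\<close> on \<open>H\<close> and on the antidual of \<open>V\<close>, and \<open>e\<^sup>t\<^sup>A = (e\<^sup>-\<^sup>t\<^sup>A)\<^sup>-\<^sup>1\<close> on its domain
  \<open>D(e\<^sup>t\<^sup>A) = R(e\<^sup>-\<^sup>t\<^sup>A)\<close>.\<close>

definition exp_minus ::
  "('v::complex_hilbert \<Rightarrow> 'h::complex_hilbert) \<Rightarrow> ('v \<Rightarrow> 'v \<Rightarrow> complex) \<Rightarrow> real \<Rightarrow> 'h \<Rightarrow> 'h" where
  "exp_minus i a = generated_semigroup (neg_op (lax_milgram i a))"

definition exp_minus_ext ::
  "('v::complex_hilbert \<Rightarrow> 'h::complex_hilbert) \<Rightarrow> ('v \<Rightarrow> 'v \<Rightarrow> complex) \<Rightarrow>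
    real \<Rightarrow> 'v antidual \<Rightarrow> 'v antidual" where
  "exp_minus_ext i a = generated_semigroup (neg_op (lax_milgram_ext_graph i a))"

definition exp_plus ::
  "('v::complex_hilbert \<Rightarrow> 'h::complex_hilbert) \<Rightarrow> ('v \<Rightarrow> 'v \<Rightarrow> complex) \<Rightarrow> real \<Rightarrow> 'h \<Rightarrow> 'h" where
  "exp_plus i a t = inv (exp_minus i a t)"

definition exp_plus_dom ::
  "('v::complex_hilbert \<Rightarrow> 'h::complex_hilbert) \<Rightarrow> ('v \<Rightarrow> 'v \<Rightarrow> complex) \<Rightarrow> real \<Rightarrow> 'h set" where
  "exp_plus_dom i a t = range (exp_minus i a t)"

section \<open>Vector distributions and function spaces on \<open>]0,T[\<close>\<close>

definition nth_deriv :: "nat \<Rightarrow> (real \<Rightarrow> complex) \<Rightarrow> real \<Rightarrow> complex" where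
  "nth_deriv n \<phi> = ((\<lambda>\<psi> t. vector_derivative \<psi> (at t)) ^^ n) \<phi>"

definition test_functions :: "real \<Rightarrow> (real \<Rightarrow> complex) set" where
  "test_functions T = {\<phi>. (\<forall>n t. nth_deriv n \<phi> differentiable (at t)) \<and>
    closure {t. \<phi> t \<noteq> 0} \<subseteq> {0<..<T}}"

text \<open>Continuity on the space of test functions is expressed by the usual seminorm estimates on
  each compact subset. Functionals are compared on test functions only.\<close>

definition distributions :: "real \<Rightarrow> ((real \<Rightarrow> complex) \<Rightarrow> 'e::complex_banach) set" where
  "distributions T = {\<Lambda>.
    (\<forall>\<phi>\<in>test_functions T. \<forall>\<psi>\<in>test_functions T. \<Lambda> (\<lambda>t. \<phi> t + \<psi> t) = \<Lambda> \<phi> + \<Lambda> \<psi>) \<and>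
    (\<forall>c. \<forall>\<phi>\<in>test_functions T. \<Lambda> (\<lambda>t. c * \<phi> t) = c *\<^sub>C \<Lambda> \<phi>) \<and>
    (\<forall>K. compact K \<and> K \<subseteq> {0<..<T} \<longrightarrow>
      (\<exists>C N. \<forall>\<phi>\<in>test_functions T. {t. \<phi> t \<noteq> 0} \<subseteq> K \<longrightarrow>
        norm (\<Lambda> \<phi>) \<le> C * (\<Sum>n\<le>N. SUP t. cmod (nth_deriv n \<phi> t))))}"

definition distr_eq ::
  "real \<Rightarrow> ((real \<Rightarrow> complex) \<Rightarrow> 'e::complex_banach) \<Rightarrow> ((real \<Rightarrow> complex) \<Rightarrow> 'e) \<Rightarrow> bool" where
  "distr_eq T \<Lambda> \<Lambda>' \<longleftrightarrow>
    \<Lambda> \<in> distributions T \<and> \<Lambda>' \<in> distributions T \<and> (\<forall>\<phi>\<in>test_functions T. \<Lambda> \<phi> = \<Lambda>' \<phi>)"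

definition distr_deriv ::
  "((real \<Rightarrow> complex) \<Rightarrow> 'e::complex_banach) \<Rightarrow> (real \<Rightarrow> complex) \<Rightarrow> 'e" where
  "distr_deriv \<Lambda> \<phi> = - \<Lambda> (\<lambda>t. vector_derivative \<phi> (at t))"

lemma distr_deriv_mem_distributions:
  assumes \<Lambda>: "\<Lambda> \<in> distributions T"
  shows "distr_deriv \<Lambda> \<in> distributions T"
proof -
  define D where "D \<phi> = (\<lambda>t. vector_derivative \<phi> (at t))" for \<phi> :: "real \<Rightarrow> complex"
  have nth: "nth_deriv n (D \<phi>) = nth_deriv (Suc n) \<phi>" for n \<phi>
    unfolding nth_deriv_def D_def by (simp add: funpow_Suc_right del: funpow.simps)
  have diff: "\<phi> differentiable (at t)" if "\<phi> \<in> test_functions T" for \<phi> t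
  proof -
    have "nth_deriv 0 \<phi> differentiable (at t)"
      using that unfolding test_functions_def by blast
    then show ?thesis by (simp add: nth_deriv_def)
  qed
  have supp: "{t. D \<phi> t \<noteq> 0} \<subseteq> closure {t. \<phi> t \<noteq> 0}" for \<phi>
  proof
    fix t assume "t \<in> {t. D \<phi> t \<noteq> 0}"
    then have t: "D \<phi> t \<noteq> 0" by simp
    show "t \<in> closure {t. \<phi> t \<noteq> 0}"
    proof (rule ccontr)
      assume nt: "t \<notin> closure {t. \<phi> t \<noteq> 0}"
      have "((\<lambda>_. 0) has_vector_derivative (0::complex)) (at t)" by simp
      then have "(\<phi> has_vector_derivative 0) (at t)"
        by (rule has_vector_derivative_transform_within_open[where S = "- closure {t. \<phi> t \<noteq> 0}"])
          (use nt closure_subset[of "{t. \<phi> t \<noteq> 0}"] in auto)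
      with t show False by (simp add: D_def vector_derivative_at)
    qed
  qed
  have mem: "D \<phi> \<in> test_functions T" if "\<phi> \<in> test_functions T" for \<phi>
  proof -
    have "closure {t. D \<phi> t \<noteq> 0} \<subseteq> closure {t. \<phi> t \<noteq> 0}"
      using supp by (intro closure_minimal) auto
    then show ?thesis
      using that unfolding test_functions_def by (auto simp: nth)
  qed
  have add: "D (\<lambda>t. \<phi> t + \<psi> t) = (\<lambda>t. D \<phi> t + D \<psi> t)"
    if "\<phi> \<in> test_functions T" "\<psi> \<in> test_functions T" for \<phi> \<psi>
    unfolding D_def using diff[OF that(1)] diff[OF that(2)]
    by (intro ext vector_derivative_add_at)
  have mult: "D (\<lambda>t. c * \<phi> t) = (\<lambda>t. c * D \<phi> t)" if "\<phi> \<in> test_functions T" for c \<phi>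
    unfolding D_def using vector_derivative_mult_at[OF differentiable_const[of c] diff[OF that]] by simp
  have est: "\<exists>C N. \<forall>\<phi>\<in>test_functions T. {t. \<phi> t \<noteq> 0} \<subseteq> K \<longrightarrow>
        norm (\<Lambda> (D \<phi>)) \<le> C * (\<Sum>n\<le>N. SUP t. cmod (nth_deriv n \<phi> t))"
    if K: "compact K" "K \<subseteq> {0<..<T}" for K
  proof -
    have "\<exists>C N. \<forall>\<phi>\<in>test_functions T. {t. \<phi> t \<noteq> 0} \<subseteq> K \<longrightarrow>
        norm (\<Lambda> \<phi>) \<le> C * (\<Sum>n\<le>N. SUP t. cmod (nth_deriv n \<phi> t))"
      using \<Lambda> K by (simp add: distributions_def)
    then obtain C N where CN: "\<forall>\<phi>\<in>test_functions T. {t. \<phi> t \<noteq> 0} \<subseteq> K \<longrightarrow>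
        norm (\<Lambda> \<phi>) \<le> C * (\<Sum>n\<le>N. SUP t. cmod (nth_deriv n \<phi> t))"
      by (elim exE) (rule that)
    have "norm (\<Lambda> (D \<phi>)) \<le> \<bar>C\<bar> * (\<Sum>n\<le>Suc N. SUP t. cmod (nth_deriv n \<phi> t))"
      if \<phi>: "\<phi> \<in> test_functions T" and "{t. \<phi> t \<noteq> 0} \<subseteq> K" for \<phi>
    proof -
      have cK: "closure {t. \<phi> t \<noteq> 0} \<subseteq> K"
        using that(2) K(1) by (simp add: closure_minimal compact_imp_closed)
      have nonneg: "0 \<le> (SUP t. cmod (nth_deriv n \<phi> t))" for n
      proof -
        define q where "q = nth_deriv n \<phi>"
        have qsupp: "{t. q t \<noteq> 0} \<subseteq> closure {t. \<phi> t \<noteq> 0}"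
          unfolding q_def
        proof (induction n)
          case 0
          then show ?case by (simp add: nth_deriv_def closure_subset)
        next
          case (Suc n)
          have "nth_deriv (Suc n) \<phi> = D (nth_deriv n \<phi>)"
            by (simp add: nth_deriv_def D_def)
          then have "{t. nth_deriv (Suc n) \<phi> t \<noteq> 0} \<subseteq> closure {t. nth_deriv n \<phi> t \<noteq> 0}"
            using supp by metis
          also have "\<dots> \<subseteq> closure {t. \<phi> t \<noteq> 0}"
            using Suc by (intro closure_minimal) auto
          finally show ?case .
        qed
        have "continuous_on K q"
          using \<phi> unfolding q_def test_functions_def
          by (auto intro!: continuous_at_imp_continuous_on differentiable_imp_continuous_within)
        then have "bounded (q ` K)"
          using K(1) compact_continuous_image compact_imp_bounded by blast
        then obtain B where B: "\<And>t. t \<in> K \<Longrightarrow> cmod (q t) \<le> B"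
          unfolding bounded_iff by auto
        have "cmod (q t) \<le> max B 0" for t
        proof (cases "q t = 0")
          case False
          then have "t \<in> K" using qsupp cK by blast
          then show ?thesis using B[of t] by simp
        qed simp
        then have "bdd_above (range (\<lambda>t. cmod (q t)))"
          by (rule bdd_aboveI2)
        then show ?thesis
          unfolding q_def by (rule cSUP_upper2[of _ _ 0]) auto
      qed
      have "norm (\<Lambda> (D \<phi>)) \<le> C * (\<Sum>n\<le>N. SUP t. cmod (nth_deriv (Suc n) \<phi> t))"
        using bspec[OF CN mem[OF \<phi>]] order_trans[OF supp[of \<phi>] cK] by (simp add: nth)
      also have "\<dots> \<le> \<bar>C\<bar> * (\<Sum>n\<le>N. SUP t. cmod (nth_deriv (Suc n) \<phi> t))"
        by (intro mult_right_mono sum_nonneg nonneg) auto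
      also have "\<dots> \<le> \<bar>C\<bar> * (\<Sum>n\<le>Suc N. SUP t. cmod (nth_deriv n \<phi> t))"
        unfolding sum.atMost_Suc_shift using nonneg[of 0] by (intro mult_left_mono) auto
      finally show ?thesis .
    qed
    then show ?thesis
      by (intro exI[of _ "\<bar>C\<bar>"] exI[of _ "Suc N"] ballI impI)
  qed
  have neg_scaleC: "- (c *\<^sub>C x) = c *\<^sub>C (- x)" for c and x :: 'a
    using scaleC_add_right[of c x "- x"] scaleC_scaleC[of c 0 x] by (simp add: minus_unique)
  have \<Lambda>': "\<Lambda> (\<lambda>t. \<phi> t + \<psi> t) = \<Lambda> \<phi> + \<Lambda> \<psi>" "\<Lambda> (\<lambda>t. c * \<phi> t) = c *\<^sub>C \<Lambda> \<phi>"
    if "\<phi> \<in> test_functions T" "\<psi> \<in> test_functions T" for c \<phi> \<psi>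
    using \<Lambda> that by (simp_all add: distributions_def)
  have dd: "distr_deriv \<Lambda> \<phi> = - \<Lambda> (D \<phi>)" for \<phi>
    by (simp add: distr_deriv_def D_def)
  show ?thesis
    unfolding distributions_def mem_Collect_eq
  proof (intro conjI ballI allI impI)
    fix \<phi> \<psi> assume "\<phi> \<in> test_functions T" "\<psi> \<in> test_functions T"
    then show "distr_deriv \<Lambda> (\<lambda>t. \<phi> t + \<psi> t) = distr_deriv \<Lambda> \<phi> + distr_deriv \<Lambda> \<psi>"
      by (simp add: dd add \<Lambda>' mem)
  next
    fix c \<phi> assume \<phi>: "\<phi> \<in> test_functions T"
    then show "distr_deriv \<Lambda> (\<lambda>t. c * \<phi> t) = c *\<^sub>C distr_deriv \<Lambda> \<phi>"
      using \<Lambda>'(2)[OF mem[OF \<phi>] mem[OF \<phi>]] by (simp add: dd mult neg_scaleC)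
  next
    fix K assume "compact K \<and> K \<subseteq> {0<..<T}"
    then show "\<exists>C N. \<forall>\<phi>\<in>test_functions T. {t. \<phi> t \<noteq> 0} \<subseteq> K \<longrightarrow>
        norm (distr_deriv \<Lambda> \<phi>) \<le> C * (\<Sum>n\<le>N. SUP t. cmod (nth_deriv n \<phi> t))"
      unfolding dd norm_minus_cancel by (intro est) simp_all
  qed
qed

lemma bounded_bilinear_scaleC: "bounded_bilinear (scaleC :: complex \<Rightarrow> 'e \<Rightarrow> 'e::complex_banach)"
proof
  show "\<exists>K. \<forall>c x::'e. norm (c *\<^sub>C x) \<le> norm c * norm x * K"
    by (rule exI[of _ 1]) (simp add: norm_scaleC)
qed (simp_all add: scaleC_add_left scaleC_add_right scaleR_conv_of_real scaleC_scaleC mult.commute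
    flip: scaleC_of_real)

definition regular_distr ::
  "real \<Rightarrow> (real \<Rightarrow> 'e::{complex_banach, second_countable_topology}) \<Rightarrow>
    (real \<Rightarrow> complex) \<Rightarrow> 'e" where
  "regular_distr T g \<phi> = (LINT t:{0<..<T}|lebesgue. \<phi> t *\<^sub>C g t)"

text \<open>Elements of \<open>L\<^sub>2\<close> are represented by functions, whose values outside \<open>]0,T[\<close> are
  irrelevant.\<close>

definition L2_space ::
  "real \<Rightarrow> (real \<Rightarrow> 'e::{complex_banach, second_countable_topology}) set" where
  "L2_space T = {g. set_borel_measurable lebesgue {0<..<T} g \<and>
    set_integrable lebesgue {0<..<T} (\<lambda>t. (norm (g t))\<^sup>2)}"

lemma L2_space_imp_integrable:
  assumes "g \<in> L2_space T"
  shows "set_integrable lebesgue {0<..<T} g"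
proof -
  have "set_integrable lebesgue {0<..<T} (\<lambda>t. 1 + (norm (g t))\<^sup>2)"
    using assms unfolding L2_space_def
    by (intro set_integral_add) (auto simp: set_integrable_def simp flip: lmeasurable_iff_integrable)
  then show ?thesis
  proof (rule set_integrable_bound)
    show "set_borel_measurable lebesgue {0<..<T} g"
      using assms by (simp add: L2_space_def)
    have "norm (g t) \<le> 1 + (norm (g t))\<^sup>2" for t
    proof -
      have "0 \<le> (norm (g t) - 1 / 2)\<^sup>2" by simp
      then show ?thesis by (simp add: power2_diff) (simp add: power2_eq_square)
    qed
    then show "AE t in lebesgue. t \<in> {0<..<T} \<longrightarrow> norm (g t) \<le> norm (1 + (norm (g t))\<^sup>2)"
      by simp
  qed
qed

lemma regular_distr_mem_distributions:
  fixes g :: "real \<Rightarrow> 'e::{complex_banach, second_countable_topology}"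
  assumes g: "g \<in> L2_space T"
  shows "regular_distr T g \<in> distributions T"
proof -
  let ?I = "{0<..<T}"
  interpret sc: bounded_bilinear "scaleC :: complex \<Rightarrow> 'e \<Rightarrow> 'e"
    by (rule bounded_bilinear_scaleC)
  have gi: "set_integrable lebesgue ?I g"
    by (rule L2_space_imp_integrable[OF g])
  have cont: "continuous_on UNIV \<phi>" if "\<phi> \<in> test_functions T" for \<phi>
  proof -
    have "nth_deriv 0 \<phi> differentiable (at t)" for t
      using that unfolding test_functions_def by blast
    then show ?thesis
      by (auto simp: nth_deriv_def intro!: continuous_at_imp_continuous_on
          differentiable_imp_continuous_within)
  qed
  have bdd: "bdd_above (range (\<lambda>t. cmod (\<phi> t)))" if \<phi>: "\<phi> \<in> test_functions T" for \<phi>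
  proof -
    have "bounded (\<phi> ` {0..T})"
      by (intro compact_imp_bounded compact_continuous_image compact_Icc
          continuous_on_subset[OF cont[OF \<phi>]]) simp
    then obtain B where B: "\<And>t. t \<in> {0..T} \<Longrightarrow> cmod (\<phi> t) \<le> B"
      unfolding bounded_iff by blast
    have "closure {t. \<phi> t \<noteq> 0} \<subseteq> {0<..<T}"
      using \<phi> by (simp add: test_functions_def)
    then have "{t. \<phi> t \<noteq> 0} \<subseteq> {0<..<T}"
      using closure_subset by (rule order_trans[rotated])
    then have "\<phi> t = 0" if "t \<notin> {0..T}" for t
      using that by auto
    then have "cmod (\<phi> t) \<le> max B 0" for t
      using B[of t] by (cases "t \<in> {0..T}") auto
    then show ?thesis by (rule bdd_aboveI2)
  qed
  have le: "cmod (\<phi> t) \<le> (SUP t. cmod (\<phi> t))" if "\<phi> \<in> test_functions T" for \<phi> t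
    by (rule cSUP_upper[OF _ bdd[OF that]]) simp
  have ii: "integrable lebesgue (\<lambda>t. \<phi> t *\<^sub>C (indicat_real ?I t *\<^sub>R g t))"
    if \<phi>: "\<phi> \<in> test_functions T" for \<phi>
  proof (rule Bochner_Integration.integrable_bound)
    show "integrable lebesgue (\<lambda>t. (SUP t. cmod (\<phi> t)) *\<^sub>R (indicat_real ?I t *\<^sub>R g t))"
      using gi unfolding set_integrable_def by (rule integrable_scaleR_right)
    have "\<phi> \<in> borel_measurable lebesgue"
      using borel_measurable_continuous_onI[OF cont[OF \<phi>]] by (intro measurable_completion) simp
    moreover have "(\<lambda>t. indicat_real ?I t *\<^sub>R g t) \<in> borel_measurable lebesgue"
      using gi unfolding set_integrable_def by (rule borel_measurable_integrable)
    ultimately show "(\<lambda>t. \<phi> t *\<^sub>C (indicat_real ?I t *\<^sub>R g t)) \<in> borel_measurable lebesgue"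
      by (rule borel_measurable_continuous_Pair)
        (intro sc.continuous_on continuous_intros)
    show "AE t in lebesgue. norm (\<phi> t *\<^sub>C (indicat_real ?I t *\<^sub>R g t)) \<le>
        norm ((SUP t. cmod (\<phi> t)) *\<^sub>R (indicat_real ?I t *\<^sub>R g t))"
      unfolding norm_scaleC norm_scaleR real_norm_def
      by (intro AE_I2 mult_right_mono order_trans[OF le[OF \<phi>] abs_ge_self]) simp
  qed
  have reg: "regular_distr T g \<phi> = (\<integral>t. \<phi> t *\<^sub>C (indicat_real ?I t *\<^sub>R g t) \<partial>lebesgue)" for \<phi>
    unfolding regular_distr_def set_lebesgue_integral_def by (simp add: sc.scaleR_right)
  show ?thesis
    unfolding distributions_def mem_Collect_eq
  proof (intro conjI ballI allI impI)
    fix \<phi> \<psi> assume "\<phi> \<in> test_functions T" "\<psi> \<in> test_functions T"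
    then show "regular_distr T g (\<lambda>t. \<phi> t + \<psi> t) = regular_distr T g \<phi> + regular_distr T g \<psi>"
      unfolding reg scaleC_add_left by (intro Bochner_Integration.integral_add ii)
  next
    fix c \<phi> assume "\<phi> \<in> test_functions T"
    then show "regular_distr T g (\<lambda>t. c * \<phi> t) = c *\<^sub>C regular_distr T g \<phi>"
      unfolding reg scaleC_scaleC[symmetric]
      by (intro integral_bounded_linear[OF sc.bounded_linear_right] ii)
  next
    fix K assume "compact K \<and> K \<subseteq> ?I"
    have "norm (regular_distr T g \<phi>) \<le>
        (\<integral>t. norm (indicat_real ?I t *\<^sub>R g t) \<partial>lebesgue) * (\<Sum>n\<le>0. SUP t. cmod (nth_deriv n \<phi> t))"
      if \<phi>: "\<phi> \<in> test_functions T" for \<phi>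
    proof -
      have "norm (regular_distr T g \<phi>) \<le>
          (\<integral>t. (SUP t. cmod (\<phi> t)) * norm (indicat_real ?I t *\<^sub>R g t) \<partial>lebesgue)"
        unfolding reg
      proof (rule Bochner_Integration.integral_norm_bound_integral[OF ii[OF \<phi>]])
        show "integrable lebesgue (\<lambda>t. (SUP t. cmod (\<phi> t)) * norm (indicat_real ?I t *\<^sub>R g t))"
          using gi unfolding set_integrable_def by (intro integrable_mult_right integrable_norm)
        show "norm (\<phi> t *\<^sub>C (indicat_real ?I t *\<^sub>R g t)) \<le>
            (SUP t. cmod (\<phi> t)) * norm (indicat_real ?I t *\<^sub>R g t)" for t
          unfolding norm_scaleC by (intro mult_right_mono le \<phi> norm_ge_zero)
      qed
      then show ?thesis by (simp add: nth_deriv_def mult.commute)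
    qed
    then show "\<exists>C N. \<forall>\<phi>\<in>test_functions T. {t. \<phi> t \<noteq> 0} \<subseteq> K \<longrightarrow>
        norm (regular_distr T g \<phi>) \<le> C * (\<Sum>n\<le>N. SUP t. cmod (nth_deriv n \<phi> t))"
      by (intro exI[of _ "\<integral>t. norm (indicat_real ?I t *\<^sub>R g t) \<partial>lebesgue"] exI[of _ 0] ballI impI)
  qed
qed

definition is_weak_deriv ::
  "real \<Rightarrow> (real \<Rightarrow> 'e::{complex_banach, second_countable_topology}) \<Rightarrow> (real \<Rightarrow> 'e) \<Rightarrow> bool" where
  "is_weak_deriv T w g \<longleftrightarrow> g \<in> L2_space T \<and>
    distr_eq T (distr_deriv (regular_distr T w)) (regular_distr T g)"

definition H1_space ::
  "real \<Rightarrow> (real \<Rightarrow> 'e::{complex_banach, second_countable_topology}) set" where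
  "H1_space T = {w \<in> L2_space T. \<exists>g. is_weak_deriv T w g}"

definition weak_deriv ::
  "real \<Rightarrow> (real \<Rightarrow> 'e::{complex_banach, second_countable_topology}) \<Rightarrow> real \<Rightarrow> 'e" where
  "weak_deriv T w = (SOME g. is_weak_deriv T w g)"

section \<open>The final value problem\<close>

text \<open>Elements of \<open>X\<close> are represented by \<open>H\<close>-valued functions, for which only the values on
  \<open>[0,T]\<close> matter. Almost all of these values lie in \<open>V\<close>; \<open>inv i\<close> takes them back to \<open>V\<close>.\<close>

definition X_space ::
  "('v::{complex_hilbert, second_countable_topology} \<Rightarrow>
    'h::{complex_hilbert, second_countable_topology}) \<Rightarrow> real \<Rightarrow> (real \<Rightarrow> 'h) set" where
  "X_space i T = {u. (AE t\<in>{0<..<T} in lebesgue. u t \<in> range i) \<and>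
    (\<lambda>t. inv i (u t)) \<in> L2_space T \<and>
    continuous_on {0..T} u \<and>
    (\<lambda>t. dual_embed i (u t)) \<in> H1_space T}"

definition X_norm ::
  "('v::{complex_hilbert, second_countable_topology} \<Rightarrow>
    'h::{complex_hilbert, second_countable_topology}) \<Rightarrow> real \<Rightarrow> (real \<Rightarrow> 'h) \<Rightarrow> real" where
  "X_norm i T u = sqrt (
    (LINT t:{0<..<T}|lebesgue. (norm (inv i (u t)))\<^sup>2) +
    (SUP t\<in>{0..T}. (norm (u t))\<^sup>2) +
    (LINT t:{0<..<T}|lebesgue. (norm (dual_embed i (u t)))\<^sup>2 +
      (norm (weak_deriv T (\<lambda>s. dual_embed i (u s)) t))\<^sup>2))"

definition solves_fvp ::
  "('v::{complex_hilbert, second_countable_topology} \<Rightarrow>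
    'h::{complex_hilbert, second_countable_topology}) \<Rightarrow> ('v \<Rightarrow> 'v \<Rightarrow> complex) \<Rightarrow> real \<Rightarrow>
    (real \<Rightarrow> 'v antidual) \<Rightarrow> 'h \<Rightarrow> (real \<Rightarrow> 'h) \<Rightarrow> bool" where
  "solves_fvp i a T f u\<^sub>T u \<longleftrightarrow>
    distr_eq T
      (\<lambda>\<phi>. distr_deriv (regular_distr T (\<lambda>t. dual_embed i (u t))) \<phi> +
        regular_distr T (\<lambda>t. lax_milgram_ext a (inv i (u t))) \<phi>)
      (regular_distr T f) \<and>
    u T = u\<^sub>T"

definition duhamel ::
  "('v::{complex_hilbert, second_countable_topology} \<Rightarrow>
    'h::{complex_hilbert, second_countable_topology}) \<Rightarrow> ('v \<Rightarrow> 'v \<Rightarrow> complex) \<Rightarrow>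
    (real \<Rightarrow> 'v antidual) \<Rightarrow> real \<Rightarrow> 'v antidual" where
  "duhamel i a f t = (LINT s:{0<..<t}|lebesgue. exp_minus_ext i a (t - s) (f s))"

text \<open>The difference \<open>u\<^sub>T - \<integral>\<^sub>0\<^sup>T e\<^sup>-\<^sup>(\<^sup>T\<^sup>-\<^sup>t\<^sup>)\<^sup>A f(t) dt\<close> is formed in the antidual of \<open>V\<close>, where the
  integral is defined; \<open>inv (dual_embed i)\<close> takes functionals that lie in \<open>H\<close> back to \<open>H\<close>.\<close>

definition final_difference ::
  "('v::{complex_hilbert, second_countable_topology} \<Rightarrow>
    'h::{complex_hilbert, second_countable_topology}) \<Rightarrow> ('v \<Rightarrow> 'v \<Rightarrow> complex) \<Rightarrow> real \<Rightarrow>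
    (real \<Rightarrow> 'v antidual) \<Rightarrow> 'h \<Rightarrow> 'v antidual" where
  "final_difference i a T f u\<^sub>T = dual_embed i u\<^sub>T - duhamel i a f T"

definition Y_space ::
  "('v::{complex_hilbert, second_countable_topology} \<Rightarrow>
    'h::{complex_hilbert, second_countable_topology}) \<Rightarrow> ('v \<Rightarrow> 'v \<Rightarrow> complex) \<Rightarrow> real \<Rightarrow>
    ((real \<Rightarrow> 'v antidual) \<times> 'h) set" where
  "Y_space i a T = {(f, u\<^sub>T). f \<in> L2_space T \<and>
    final_difference i a T f u\<^sub>T \<in> dual_embed i ` exp_plus_dom i a T}"

definition Y_norm ::
  "('v::{complex_hilbert, second_countable_topology} \<Rightarrow>
    'h::{complex_hilbert, second_countable_topology}) \<Rightarrow> ('v \<Rightarrow> 'v \<Rightarrow> complex) \<Rightarrow> real \<Rightarrow>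
    (real \<Rightarrow> 'v antidual) \<Rightarrow> 'h \<Rightarrow> real" where
  "Y_norm i a T f u\<^sub>T = sqrt (
    (norm u\<^sub>T)\<^sup>2 + (LINT t:{0<..<T}|lebesgue. (norm (f t))\<^sup>2) +
    (norm (exp_plus i a T (inv (dual_embed i) (final_difference i a T f u\<^sub>T))))\<^sup>2)"

definition solution_operator ::
  "('v::{complex_hilbert, second_countable_topology} \<Rightarrow>
    'h::{complex_hilbert, second_countable_topology}) \<Rightarrow> ('v \<Rightarrow> 'v \<Rightarrow> complex) \<Rightarrow> real \<Rightarrow>
    (real \<Rightarrow> 'v antidual) \<Rightarrow> 'h \<Rightarrow> real \<Rightarrow> 'h" where
  "solution_operator i a T f u\<^sub>T = (SOME u. u \<in> X_space i T \<and> solves_fvp i a T f u\<^sub>T u)"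

end

theory Submission
  imports Defs "HOL-Complex_Analysis.Complex_Analysis" "HOL-Computational_Algebra.Polynomial"
begin

text \<open>Adding a multiple \<open>\<kappa>\<close> of the inner product of \<open>H\<close> makes the form coercive, so Lax--Milgram
  yields the resolvents of \<open>A\<close> in a sector. The powers \<open>(1 + z(A + \<kappa>)/m)\<^sup>-\<^sup>m\<close> with \<open>m = 2\<^sup>k\<close> converge,
  locally uniformly in \<open>z\<close>, to a holomorphic semigroup on \<open>H\<close>, which is carried over to the antidual of \<open>V\<close>
  by the isomorphism \<open>A + \<kappa>\<close> once it is known to be bounded on \<open>V\<close>.

  A function \<open>u\<close> in \<open>X\<close> solves \<open>u' + Au = f\<close> if and only if it is a mild solution: it is continuous and
  satisfies the equation after integration in time and smoothing by \<open>J = (A + \<kappa>)\<^sup>-\<^sup>1\<close>. This notion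
  suits the variation of constants formula, which follows from Fubini's theorem. Conversely, the energy
  estimate, applied to smoothed solutions, shows that a mild solution belongs to \<open>X\<close>, with norm
  controlled by \<open>u(0)\<close> and \<open>f\<close>, and is determined by them. At \<open>t = T\<close> the formula says that the
  difference in the compatibility condition equals \<open>e\<^sup>-\<^sup>T\<^sup>Au(0)\<close>, and since \<open>e\<^sup>-\<^sup>T\<^sup>A\<close> is injective by
  analyticity, \<open>u(0)\<close> can be recovered from the data.\<close>

section \<open>The Lax--Milgram lemma and the resolvents of the shifted form\<close>

text \<open>Three obstacles shape the argument. First, \<open>exp_minus\<close> and
  \<open>exp_minus_ext\<close> are Hilbert choices, so nothing is known of them before some analytic
  semigroup with the prescribed generator is exhibited; the chosen extension is then identified with
  the explicit one, and both are seen to be compatible, by uniqueness for the initial value problem.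
  Second, accretivity gives contractions on \<open>H\<close> but not in the norm of
  \<open>V\<close>, since the form need not be symmetric; a Lyapunov function is what makes the
  transfer to the antidual possible. Third, a function in \<open>X\<close> has values in
  \<open>V\<close> almost everywhere but a derivative only in the antidual, so its squared norm in
  \<open>H\<close> cannot be differentiated by the plain product rule; smoothing by resolvents
  brings the derivative into \<open>V\<close>, and the resulting estimates survive the limit.

  The exponents are powers of two because doubling replaces every step by two half steps: a single
  comparison of two consecutive steps with one combined step yields both the convergence and the
  semigroup law.\<close>

interpretation scaleC: bounded_bilinear "scaleC :: complex \<Rightarrow> 'e \<Rightarrow> 'e::complex_banach"
  by (rule bounded_bilinear_scaleC)

interpretation cinner: bounded_bilinear "cinner :: 'e \<Rightarrow> 'e::complex_hilbert \<Rightarrow> complex"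
proof
  show "\<exists>K. \<forall>x y::'e. cmod (cinner x y) \<le> norm x * norm y * K"
    by (rule exI[of _ 1]) (simp add: norm_cinner_le)
qed (simp_all add: cinner_add_left cinner_add_right cinner_scaleR_left cinner_scaleR_right
    scaleR_conv_of_real)

interpretation dual_pairing:
  bounded_bilinear "dual_pairing :: 'e antidual \<Rightarrow> 'e::complex_hilbert \<Rightarrow> complex"
proof
  show "dual_pairing x (v + w) = dual_pairing x v + dual_pairing x w" for x and v w :: 'e
    by transfer (simp add: blinfun.add_right)
  show "dual_pairing x (r *\<^sub>R v) = r *\<^sub>R dual_pairing x v" for r x and v :: 'e
    by transfer (simp add: blinfun.scaleR_right)
  show "\<exists>K. \<forall>x (v::'e). cmod (dual_pairing x v) \<le> norm x * norm v * K"
    by (rule exI[of _ 1]) (simp add: norm_dual_pairing_le)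
qed (simp_all add: dual_pairing_add dual_pairing_scaleR)

lemma Re_cinner_commute: "Re (cinner x y) = Re (cinner y (x::'a::complex_hilbert))"
  by (subst cinner_commute) simp

lemma cinner_self: "cinner x x = of_real ((norm (x::'a::complex_hilbert))\<^sup>2)"
proof (rule complex_eqI)
  have "Im (cinner x x) = - Im (cinner x x)"
    by (subst cinner_commute) simp
  then show "Im (cinner x x) = Im (of_real ((norm x)\<^sup>2))" by simp
qed (simp add: norm_sq_cinner)

lemma norm_le_of_sq_le:
  assumes "(norm x)\<^sup>2 \<le> B * norm x" "0 \<le> B"
  shows "norm x \<le> B"
proof (cases "norm x = 0")
  case False
  then have "0 < norm x" by simp
  then show ?thesis using assms by (simp add: power2_eq_square)
qed (use assms in simp)

lemma norm_le_of_cinner_le: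
  fixes x :: "'a::complex_hilbert"
  assumes "\<And>y. cmod (cinner x y) \<le> B * norm y" "0 \<le> B"
  shows "norm x \<le> B"
proof (rule norm_le_of_sq_le)
  show "(norm x)\<^sup>2 \<le> B * norm x"
    using assms(1)[of x] abs_Re_le_cmod[of "cinner x x"] by (simp add: norm_sq_cinner)
qed fact

text \<open>Lax--Milgram: the contraction \<open>u \<mapsto> u - \<rho> (B u - p)\<close> with small \<open>\<rho>\<close> has a unique fixed point,
  where \<open>B\<close> and \<open>p\<close> represent the form and the functional.\<close>

lemma lax_milgram:
  fixes b :: "'v::complex_hilbert \<Rightarrow> 'v \<Rightarrow> complex"
  assumes add: "\<And>u v w. b (u + v) w = b u w + b v w" and scale: "\<And>c u w. b (c *\<^sub>C u) w = c * b u w"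
    and add2: "\<And>u v w. b u (v + w) = b u v + b u w"
    and scale2: "\<And>c u w. b u (c *\<^sub>C w) = cnj c * b u w"
    and bound: "\<And>u v. cmod (b u v) \<le> M * norm u * norm v"
    and coercive: "\<And>v. m * (norm v)\<^sup>2 \<le> Re (b v v)" and m: "0 < m"
  shows "\<exists>!u. \<forall>v. b u v = dual_pairing x v"
proof -
  have "bounded_antilinear (b u)" for u
    unfolding bounded_antilinear_def
    by (intro conjI allI scale2 bounded_linear_intro[where K = "M * norm u"])
      (use bound in \<open>auto simp: add2 scale2 mult.commute scaleR_conv_of_real simp flip: scaleC_of_real\<close>)
  then have "\<exists>p. \<forall>v. b u v = cinner p v" for u
    using riesz_on_subspace[of "b u" UNIV] by auto
  then obtain B where B: "\<And>u v. b u v = cinner (B u) v" by metis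
  obtain p where p: "\<And>v. dual_pairing x v = cinner p v"
    using riesz_on_subspace[OF bounded_antilinear_dual_pairing, of UNIV x] by auto
  have ext: "u = w" if "\<And>v. cinner u v = cinner w v" for u w :: 'v
    using cinner_self_eq_0[of "u - w"] that by (simp add: cinner_diff_left)
  have Bdiff: "B (u - w) = B u - B w" for u w
  proof (rule ext)
    fix v show "cinner (B (u - w)) v = cinner (B u - B w) v"
      using add[of "u - w" w v] by (simp add: cinner_diff_left flip: B)
  qed
  \<comment> \<open>A nonzero vector forces \<open>m \<le> M\<close>; the maximum covers the trivial
    space, where \<open>M\<close> may be any number, and keeps \<open>1 - (m / N)\<^sup>2\<close>
    nonnegative.\<close>
  define N where "N = max M m"
  have N: "0 < N" "m \<le> N" using m by (auto simp: N_def)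
  have nB: "norm (B u) \<le> N * norm u" for u
  proof (rule norm_le_of_cinner_le)
    fix y
    have "cmod (b u y) \<le> M * norm u * norm y" by (rule bound)
    also have "\<dots> \<le> N * norm u * norm y"
      by (intro mult_right_mono) (auto simp: N_def)
    finally show "cmod (cinner (B u) y) \<le> N * norm u * norm y" by (simp add: B)
  qed (use N in simp)
  \<comment> \<open>\<open>\<rho>\<close> minimises
    \<open>1 - 2 \<rho> m + \<rho>\<^sup>2 N\<^sup>2\<close>, the bound for the squared Lipschitz
    constant of \<open>f\<close>; the minimum is \<open>1 - (m / N)\<^sup>2\<close>.\<close>
  define \<rho> where "\<rho> = m / N\<^sup>2"
  define q where "q = sqrt (1 - (m / N)\<^sup>2)"
  have mN: "0 < m / N" "m / N \<le> 1" using m N by auto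
  have q: "0 \<le> q" "q < 1"
    using mN power_le_one[of "m / N" 2] by (auto simp: q_def)
  define f where "f u = u - \<rho> *\<^sub>R (B u - p)" for u
  have "dist (f u) (f w) \<le> q * dist u w" for u w
  proof -
    define d where "d = u - w"
    have "f u - f w = d - \<rho> *\<^sub>R B d"
      by (simp add: f_def d_def Bdiff algebra_simps)
    then have "(norm (f u - f w))\<^sup>2 = (norm d)\<^sup>2 + \<rho>\<^sup>2 * (norm (B d))\<^sup>2 - 2 * \<rho> * Re (b d d)"
      by (simp only: norm_sq_diff) (simp add: cinner_scaleR_right power_mult_distrib B Re_cinner_commute[of d])
    also have "\<dots> \<le> (norm d)\<^sup>2 + \<rho>\<^sup>2 * (N * norm d)\<^sup>2 - 2 * \<rho> * (m * (norm d)\<^sup>2)"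
    proof -
      have "0 \<le> \<rho>" using m by (simp add: \<rho>_def)
      then have "2 * \<rho> * (m * (norm d)\<^sup>2) \<le> 2 * \<rho> * Re (b d d)"
        by (intro mult_left_mono coercive) simp
      moreover have "\<rho>\<^sup>2 * (norm (B d))\<^sup>2 \<le> \<rho>\<^sup>2 * (N * norm d)\<^sup>2"
        by (intro mult_left_mono power_mono nB) auto
      ultimately show ?thesis by simp
    qed
    also have "\<dots> = (1 - (m / N)\<^sup>2) * (norm d)\<^sup>2"
      using N by (simp add: \<rho>_def field_simps power2_eq_square)
    also have "\<dots> = (q * norm d)\<^sup>2"
      using mN power_le_one[of "m / N" 2] by (simp add: q_def power_mult_distrib)
    finally have "norm (f u - f w) \<le> q * norm d"
      by (rule power2_le_imp_le) (use q in simp)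
    then show ?thesis
      by (simp add: dist_norm d_def)
  qed
  then have "\<exists>!u. f u = u"
    using banach_fix_type[OF q] by blast
  moreover have "f u = u \<longleftrightarrow> (\<forall>v. b u v = dual_pairing x v)" for u
  proof -
    have "f u = u \<longleftrightarrow> B u = p"
      using m N by (auto simp: f_def \<rho>_def)
    also have "\<dots> \<longleftrightarrow> (\<forall>v. b u v = dual_pairing x v)"
      using ext by (auto simp: B p)
    finally show ?thesis .
  qed
  ultimately show ?thesis by simp
qed

text \<open>The original form \<open>a\<close> stays a parameter because the problem is posed with
  \<open>A\<close>; \<open>\<kappa>\<close>, \<open>c\<close> and \<open>C\<close> belong to the
  shifted form and are supplied by \<open>shifted_form_exists\<close>. The semigroups are built for
  \<open>A + \<kappa>\<close>, and a factor \<open>exp (\<kappa> * t)\<close> undoes the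
  shift.\<close>

locale shifted_form =
  fixes i :: "'v::{complex_hilbert, second_countable_topology} \<Rightarrow>
      'h::{complex_hilbert, second_countable_topology}"
    and a :: "'v \<Rightarrow> 'v \<Rightarrow> complex" and \<kappa> c C :: real
  assumes emb: "gelfand_embedding i"
    and form: "bounded_coercive_form i a"
    and kappa_nonneg: "0 \<le> \<kappa>" and c_pos: "0 < c" and C_pos: "0 < C"
    and form_bounded: "\<And>u v. cmod (a u v + \<kappa> * cinner (i u) (i v)) \<le> C * norm u * norm v"
    and form_coercive: "\<And>v. c * (norm v)\<^sup>2 \<le> Re (a v v + \<kappa> * cinner (i v) (i v))"
begin

abbreviation "j \<equiv> dual_embed i"
abbreviation "\<iota> v \<equiv> dual_embed i (i v)"

definition ap :: "'v \<Rightarrow> 'v \<Rightarrow> complex" where "ap u v = a u v + \<kappa> * cinner (i u) (i v)"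

text \<open>The extension of \<open>A + \<kappa>\<close> to a map from \<open>V\<close> onto the
  antidual; its inverse is \<open>J\<close>.\<close>

definition Lp :: "'v \<Rightarrow> 'v antidual" where "Lp u = lax_milgram_ext a u + \<kappa> *\<^sub>R \<iota> u"

text \<open>The directions in which the form stays coercive after rotation. Giving up half of
  \<open>c\<close> leaves room for a whole sector, while closure under sums and positive multiples
  is immediate from the definition, so that no angles have to be tracked later.\<close>

definition cone :: "complex set" where
  "cone = {z. \<forall>v. c / 2 * cmod z * (norm v)\<^sup>2 \<le> Re (z * ap v v)}"

lemma i_clinear: "bounded_clinear i"
  using emb by (simp add: gelfand_embedding_def)

lemma i_bl: "bounded_linear i"
  using i_clinear by (simp add: bounded_clinear_def)

sublocale i: bounded_linear i by (rule i_bl)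

sublocale j: bounded_linear j
  using bounded_clinear_dual_embed[OF i_clinear] by (simp add: bounded_clinear_def)

lemma i_scaleC: "i (z *\<^sub>C v) = z *\<^sub>C i v"
  using i_clinear by (simp add: bounded_clinear_def)

lemma j_scaleC: "j (z *\<^sub>C v) = z *\<^sub>C j v"
  using bounded_clinear_dual_embed[OF i_clinear] by (simp add: bounded_clinear_def)

lemma inj_i: "inj i" and inj_j: "inj j"
  using emb inj_dual_embed[OF emb] by (auto simp: gelfand_embedding_def)

lemma i_eq_iff [simp]: "i u = i v \<longleftrightarrow> u = v"
  using inj_i by (auto dest: injD)

lemma j_eq_iff [simp]: "j u = j v \<longleftrightarrow> u = v"
  using inj_j by (auto dest: injD)

lemma inv_i [simp]: "inv i (i v) = v"
  using inj_i by simp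

lemma inv_j [simp]: "inv j (j v) = v"
  using inj_j by simp

lemma pair_j: "dual_pairing (j x) v = cinner x (i v)"
  by (rule dual_pairing_dual_embed[OF i_clinear])

lemma pair_Lp: "dual_pairing (Lp u) v = ap u v"
  by (simp add: Lp_def ap_def dual_pairing_add dual_pairing_scaleR pair_j scaleR_conv_of_real
      dual_pairing_lax_milgram_ext[OF form])

lemma ap_add_left: "ap (u + v) w = ap u w + ap v w"
  and ap_scaleC_left: "ap (z *\<^sub>C u) w = z * ap u w"
  and ap_add_right: "ap u (v + w) = ap u v + ap u w"
  and ap_scaleC_right: "ap u (z *\<^sub>C w) = cnj z * ap u w"
  using form unfolding bounded_coercive_form_def ap_def
  by (simp_all add: i.add i_scaleC cinner_add_left cinner_add_right cinner_scaleC_left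
      cinner_scaleC_right algebra_simps)

lemma ap_bound: "cmod (ap u v) \<le> C * norm u * norm v"
  using form_bounded by (simp add: ap_def)

lemma ap_coercive: "c * (norm v)\<^sup>2 \<le> Re (ap v v)"
  using form_coercive by (simp add: ap_def)

sublocale ap: bounded_bilinear ap
proof
  show "\<exists>K. \<forall>u v. cmod (ap u v) \<le> norm u * norm v * K"
    by (rule exI[of _ C]) (use ap_bound in \<open>simp add: mult_ac\<close>)
qed (simp_all add: ap_add_left ap_add_right ap_scaleC_left ap_scaleC_right scaleR_conv_of_real
    flip: scaleC_of_real)

lemma Lp_scaleC: "Lp (z *\<^sub>C u) = z *\<^sub>C Lp u"
  by (rule antidual_eqI) (simp add: pair_Lp ap_scaleC_left dual_pairing_scaleC)

lemma norm_Lp: "norm (Lp u) \<le> C * norm u"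
  by (rule norm_antidual_bound) (use C_pos ap_bound in \<open>simp_all add: pair_Lp\<close>)

sublocale Lp: bounded_linear Lp
proof (rule bounded_linear_intro[where K = C])
  show "Lp (u + v) = Lp u + Lp v" for u v
    by (rule antidual_eqI) (simp add: pair_Lp ap_add_left dual_pairing_add)
  show "Lp (r *\<^sub>R u) = r *\<^sub>R Lp u" for r u
    using Lp_scaleC[of "of_real r" u] by (simp add: scaleC_of_real)
qed (use norm_Lp in \<open>simp add: mult.commute\<close>)

lemma coneD: "z \<in> cone \<Longrightarrow> c / 2 * cmod z * (norm v)\<^sup>2 \<le> Re (z * ap v v)"
  by (simp add: cone_def)

lemma cone_Re_nonneg: "z \<in> cone \<Longrightarrow> 0 \<le> Re (z * ap v v)"
  by (rule order_trans[OF _ coneD]) (use c_pos in simp_all)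

lemma cone_of_real: "0 \<le> r \<Longrightarrow> of_real r \<in> cone"
proof -
  assume r: "0 \<le> r"
  have "c / 2 * (norm v)\<^sup>2 \<le> Re (ap v v)" for v
  proof -
    have "0 \<le> c * (norm v)\<^sup>2" using c_pos by simp
    then show ?thesis using ap_coercive[of v] by linarith
  qed
  then have "r * (c / 2 * (norm v)\<^sup>2) \<le> r * Re (ap v v)" for v
    using r by (rule mult_left_mono)
  then show ?thesis using r by (simp add: cone_def mult_ac)
qed

lemma cone_0 [simp]: "0 \<in> cone" and cone_1 [simp]: "1 \<in> cone"
  using cone_of_real[of 0] cone_of_real[of 1] by auto

lemma cone_scale: "z \<in> cone \<Longrightarrow> 0 \<le> r \<Longrightarrow> of_real r * z \<in> cone"
proof -
  assume z: "z \<in> cone" and r: "0 \<le> r"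
  have "r * (c / 2 * cmod z * (norm v)\<^sup>2) \<le> r * Re (z * ap v v)" for v
    using coneD[OF z] r by (rule mult_left_mono)
  then show ?thesis using r unfolding cone_def by (simp add: norm_mult mult_ac distrib_left right_diff_distrib)
qed

lemma cone_divide: "z \<in> cone \<Longrightarrow> 0 \<le> r \<Longrightarrow> z / of_real r \<in> cone"
  using cone_scale[of z "inverse r"] by (simp add: divide_inverse mult.commute)

lemma cone_add: "z \<in> cone \<Longrightarrow> w \<in> cone \<Longrightarrow> z + w \<in> cone"
proof -
  assume zw: "z \<in> cone" "w \<in> cone"
  have "c / 2 * cmod (z + w) * (norm v)\<^sup>2 \<le> Re ((z + w) * ap v v)" for v
  proof -
    have "c / 2 * cmod (z + w) * (norm v)\<^sup>2 \<le> c / 2 * (cmod z + cmod w) * (norm v)\<^sup>2"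
      using c_pos by (intro mult_right_mono mult_left_mono norm_triangle_ineq) auto
    also have "\<dots> \<le> Re (z * ap v v) + Re (w * ap v v)"
      using add_mono[OF coneD[OF zw(1), of v] coneD[OF zw(2), of v]] by (simp only: distrib_left distrib_right)
    finally show ?thesis by (simp add: distrib_right)
  qed
  then show ?thesis by (simp add: cone_def)
qed

lemma sector_subset_cone: "\<exists>\<theta>. 0 < \<theta> \<and> \<theta> \<le> 1 \<and> sector \<theta> \<subseteq> cone"
proof -
  \<comment> \<open>For \<open>\<bar>\<alpha>\<bar> < \<theta>\<close> the cosine is at least 3/4,
    and the sine times the imaginary part of the form costs at most \<open>c / 4\<close>; the
    difference 3/4 - 1/4 is the constant 1/2 in \<open>cone\<close>.\<close>
  define \<theta> where "\<theta> = min (1 / 2) (c / (4 * C))"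
  have \<theta>: "0 < \<theta>" "\<theta> \<le> 1 / 2" "C * \<theta> \<le> c / 4"
    using c_pos C_pos by (auto simp: \<theta>_def min_def field_simps)
  have "z \<in> cone" if z: "z \<in> sector \<theta>" for z
    unfolding cone_def mem_Collect_eq
  proof
    fix v
    define \<alpha> q where "\<alpha> = Arg z" and "q = ap v v"
    have \<alpha>: "\<bar>\<alpha>\<bar> < \<theta>" "z \<noteq> 0" using z by (auto simp: sector_def \<alpha>_def)
    have z_eq: "z = of_real (cmod z) * cis \<alpha>"
      using \<alpha>(2) by (simp add: \<alpha>_def cis_Arg sgn_eq complex_eq_iff)
    have cos: "3 / 4 \<le> cos \<alpha>"
    proof -
      have "\<bar>sin (\<alpha> / 2)\<bar> \<le> 1 / 4"
        using abs_sin_x_le_abs_x[of "\<alpha> / 2"] \<alpha> \<theta> by simp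
      then have "(sin (\<alpha> / 2))\<^sup>2 \<le> (1 / 4)\<^sup>2"
        by (intro abs_le_square_iff[THEN iffD1]) simp
      then show ?thesis
        using cos_double_sin[of "\<alpha> / 2"] by (simp add: power2_eq_square)
    qed
    have q: "c * (norm v)\<^sup>2 \<le> Re q" "\<bar>Im q\<bar> \<le> C * (norm v)\<^sup>2"
      using ap_coercive[of v] ap_bound[of v v] abs_Im_le_cmod[of q]
      by (auto simp: q_def power2_eq_square mult.assoc)
    have "c / 2 * (norm v)\<^sup>2 \<le> 3 / 4 * (c * (norm v)\<^sup>2) - c / 4 * (norm v)\<^sup>2"
      by simp
    also have "\<dots> \<le> cos \<alpha> * Re q - sin \<alpha> * Im q"
    proof -
      have "3 / 4 * (c * (norm v)\<^sup>2) \<le> cos \<alpha> * Re q"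
        using cos q(1) c_pos by (intro mult_mono) auto
      moreover have "sin \<alpha> * Im q \<le> c / 4 * (norm v)\<^sup>2"
      proof -
        have "sin \<alpha> * Im q \<le> \<bar>sin \<alpha>\<bar> * \<bar>Im q\<bar>" by (simp flip: abs_mult)
        also have "\<dots> \<le> \<theta> * (C * (norm v)\<^sup>2)"
          using abs_sin_x_le_abs_x[of \<alpha>] \<alpha> q(2) \<theta> by (intro mult_mono) auto
        also have "\<dots> \<le> c / 4 * (norm v)\<^sup>2"
          using mult_right_mono[OF \<theta>(3), of "(norm v)\<^sup>2"] by (simp add: mult_ac)
        finally show ?thesis .
      qed
      ultimately show ?thesis by simp
    qed
    finally have "cmod z * (c / 2 * (norm v)\<^sup>2) \<le> cmod z * (cos \<alpha> * Re q - sin \<alpha> * Im q)"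
      by (rule mult_left_mono) simp
    also have "\<dots> = Re (z * q)"
      by (subst (2) z_eq) (simp add: algebra_simps)
    finally show "c / 2 * cmod z * (norm v)\<^sup>2 \<le> Re (z * ap v v)"
      by (simp add: q_def mult_ac)
  qed
  then show ?thesis using \<theta> by (intro exI[of _ \<theta>]) auto
qed

text \<open>The inverse of \<open>\<mu> + z (A + \<kappa>)\<close> as a map from the antidual into
  \<open>V\<close>. The parameter \<open>\<mu>\<close> lets one family serve two purposes:
  \<open>\<mu> = 1\<close> gives the resolvents, \<open>\<mu> = 0\<close> and \<open>z = 1\<close>
  give \<open>J\<close>.\<close>

definition Rv :: "real \<Rightarrow> complex \<Rightarrow> 'v antidual \<Rightarrow> 'v" where
  "Rv \<mu> z x = (THE u. \<mu> *\<^sub>R \<iota> u + z *\<^sub>C Lp u = x)"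

text \<open>Coercivity comes from the part with \<open>z \<in> cone\<close> alone; the term with
  \<open>\<mu> \<ge> 0\<close> can only increase the real part.\<close>

lemma Rv_ex1:
  assumes "0 \<le> \<mu>" "z \<in> cone" "z \<noteq> 0"
  shows "\<exists>!u. \<mu> *\<^sub>R \<iota> u + z *\<^sub>C Lp u = x"
proof -
  define b where "b u v = \<mu> * cinner (i u) (i v) + z * ap u v" for u v
  obtain B where B: "0 < B" "\<And>v. norm (i v) \<le> norm v * B"
    using i.pos_bounded by blast
  have "\<exists>!u. \<forall>v. b u v = dual_pairing x v"
  proof (rule lax_milgram)
    show "cmod (b u v) \<le> (\<mu> * B * B + cmod z * C) * norm u * norm v" for u v
    proof -
      have "cmod (b u v) \<le> \<mu> * cmod (cinner (i u) (i v)) + cmod z * cmod (ap u v)"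
        unfolding b_def using assms(1) by (intro order_trans[OF norm_triangle_ineq]) (simp add: norm_mult)
      also have "\<dots> \<le> \<mu> * ((norm u * B) * (norm v * B)) + cmod z * (C * norm u * norm v)"
        using assms(1) B by (intro add_mono mult_left_mono ap_bound order_trans[OF norm_cinner_le] mult_mono) auto
      finally show ?thesis by (simp add: algebra_simps)
    qed
    show "c / 2 * cmod z * (norm v)\<^sup>2 \<le> Re (b v v)" for v
    proof -
      have "0 \<le> \<mu> * (norm (i v))\<^sup>2" using assms(1) by simp
      moreover have "Re (b v v) = \<mu> * (norm (i v))\<^sup>2 + Re (z * ap v v)"
        by (simp add: b_def cinner_self)
      ultimately show ?thesis using coneD[OF assms(2), of v] by linarith
    qed
    show "0 < c / 2 * cmod z" using c_pos assms by simp
    show "b (u + v) w = b u w + b v w" "b u (v + w) = b u v + b u w" for u v w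
      by (simp_all add: b_def ap_add_left ap_add_right i.add cinner_add_left cinner_add_right distrib_left)
    show "b (y *\<^sub>C u) w = y * b u w" "b u (y *\<^sub>C w) = cnj y * b u w" for y u w
      by (simp_all add: b_def ap_scaleC_left ap_scaleC_right i_scaleC cinner_scaleC_left
          cinner_scaleC_right distrib_left mult_ac)
  qed
  moreover have "dual_pairing (\<mu> *\<^sub>R \<iota> u + z *\<^sub>C Lp u) v = b u v" for u v
    by (simp add: b_def dual_pairing_add dual_pairing_scaleR dual_pairing_scaleC pair_j pair_Lp
        scaleR_conv_of_real)
  then have "\<mu> *\<^sub>R \<iota> u + z *\<^sub>C Lp u = x \<longleftrightarrow> (\<forall>v. b u v = dual_pairing x v)" for u
    by (metis antidual_eqI)
  ultimately show ?thesis by simp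
qed

lemma Rv_eq:
  assumes "0 \<le> \<mu>" "z \<in> cone" "z \<noteq> 0"
  shows "\<mu> *\<^sub>R \<iota> (Rv \<mu> z x) + z *\<^sub>C Lp (Rv \<mu> z x) = x"
  unfolding Rv_def by (rule theI'[OF Rv_ex1[OF assms, of x]])

lemma Rv_unique:
  assumes "0 \<le> \<mu>" "z \<in> cone" "z \<noteq> 0" "\<mu> *\<^sub>R \<iota> u + z *\<^sub>C Lp u = x"
  shows "Rv \<mu> z x = u"
  unfolding Rv_def by (rule the1_equality[OF Rv_ex1[OF assms(1-3)] assms(4)])

lemma Rv_energy:
  assumes "0 \<le> \<mu>" "z \<in> cone" "z \<noteq> 0"
  shows "\<mu> * (norm (i (Rv \<mu> z x)))\<^sup>2 + Re (z * ap (Rv \<mu> z x) (Rv \<mu> z x))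
    = Re (dual_pairing x (Rv \<mu> z x))"
proof -
  let ?u = "Rv \<mu> z x"
  have "dual_pairing x ?u = dual_pairing (\<mu> *\<^sub>R \<iota> ?u + z *\<^sub>C Lp ?u) ?u"
    by (subst Rv_eq[OF assms]) (rule refl)
  then show ?thesis
    unfolding dual_pairing_add dual_pairing_scaleR dual_pairing_scaleC pair_j pair_Lp cinner_self
    by simp
qed

lemma norm_Rv:
  assumes "0 \<le> \<mu>" "z \<in> cone" "z \<noteq> 0"
  shows "norm (Rv \<mu> z x) \<le> 2 / (c * cmod z) * norm x"
proof (rule norm_le_of_sq_le)
  let ?u = "Rv \<mu> z x"
  have "c / 2 * cmod z * (norm ?u)\<^sup>2 \<le> Re (dual_pairing x ?u)"
  proof -
    have "0 \<le> \<mu> * (norm (i ?u))\<^sup>2" using assms(1) by simp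
    then show ?thesis using coneD[OF assms(2), of ?u] Rv_energy[OF assms, of x] by linarith
  qed
  also have "\<dots> \<le> norm x * norm ?u"
    using norm_dual_pairing_le[of x ?u] complex_Re_le_cmod order_trans by blast
  finally show "(norm ?u)\<^sup>2 \<le> 2 / (c * cmod z) * norm x * norm ?u"
    using c_pos assms by (simp add: field_simps)
qed (use c_pos assms in simp)

lemma Rv_add:
  assumes "0 \<le> \<mu>" "z \<in> cone" "z \<noteq> 0"
  shows "Rv \<mu> z (x + y) = Rv \<mu> z x + Rv \<mu> z y"
proof (rule Rv_unique[OF assms])
  show "\<mu> *\<^sub>R \<iota> (Rv \<mu> z x + Rv \<mu> z y) + z *\<^sub>C Lp (Rv \<mu> z x + Rv \<mu> z y) = x + y"
    using arg_cong2[OF Rv_eq[OF assms, of x] Rv_eq[OF assms, of y], of "(+)"]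
    by (simp add: i.add j.add Lp.add scaleR_add_right scaleC_add_right add_ac)
qed

lemma Rv_scaleC:
  assumes "0 \<le> \<mu>" "z \<in> cone" "z \<noteq> 0"
  shows "Rv \<mu> z (w *\<^sub>C x) = w *\<^sub>C Rv \<mu> z x"
proof (rule Rv_unique[OF assms])
  show "\<mu> *\<^sub>R \<iota> (w *\<^sub>C Rv \<mu> z x) + z *\<^sub>C Lp (w *\<^sub>C Rv \<mu> z x) = w *\<^sub>C x"
    using arg_cong[OF Rv_eq[OF assms, of x], of "scaleC w"]
    unfolding i_scaleC j_scaleC Lp_scaleC scaleC_add_right scaleC_scaleC scaleC_of_real[symmetric]
    by (simp add: mult.commute)
qed

lemma Rv_bounded_linear:
  assumes "0 \<le> \<mu>" "z \<in> cone" "z \<noteq> 0"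
  shows "bounded_linear (Rv \<mu> z)"
  by (rule bounded_linear_intro[where K = "2 / (c * cmod z)"])
    (use norm_Rv[OF assms] Rv_scaleC[OF assms, of "of_real r" for r] in
      \<open>simp_all add: Rv_add[OF assms] scaleC_of_real mult.commute\<close>)

lemma Rv_commute:
  assumes "0 \<le> \<mu>" "z \<in> cone" "z \<noteq> 0" "0 \<le> \<mu>'" "z' \<in> cone" "z' \<noteq> 0"
  shows "Rv \<mu> z (\<iota> (Rv \<mu>' z' x)) = Rv \<mu>' z' (\<iota> (Rv \<mu> z x))"
proof (rule Rv_unique[OF assms(1-3)])
  define u w where "u = Rv \<mu> z x" and "w = Rv \<mu>' z' (\<iota> u)"
  \<comment> \<open>The equation for \<open>w\<close> has its right-hand side in \<open>V\<close>,
    so \<open>Lp w\<close> is itself the image of an element of \<open>V\<close>, namely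
    \<open>q\<close>. This additional regularity is what allows the two inverses to be
    exchanged.\<close>
  define q where "q = inverse z' *\<^sub>C (u - \<mu>' *\<^sub>R w)"
  have u: "\<mu> *\<^sub>R \<iota> u + z *\<^sub>C Lp u = x"
    unfolding u_def by (rule Rv_eq[OF assms(1-3)])
  have w: "\<mu>' *\<^sub>R \<iota> w + z' *\<^sub>C Lp w = \<iota> u"
    unfolding w_def by (rule Rv_eq[OF assms(4-6)])
  have zq: "z' *\<^sub>C q = u - \<mu>' *\<^sub>R w"
    using assms(6) by (simp add: q_def scaleC_scaleC)
  have iq: "\<iota> q = Lp w"
  proof -
    have "z' *\<^sub>C Lp w = \<iota> u - \<mu>' *\<^sub>R \<iota> w" using w by (simp add: algebra_simps)
    also have "\<dots> = \<iota> (z' *\<^sub>C q)" by (simp add: zq i.diff j.diff i.scaleR j.scaleR)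
    finally have "inverse z' *\<^sub>C z' *\<^sub>C Lp w = inverse z' *\<^sub>C z' *\<^sub>C \<iota> q"
      by (simp add: i_scaleC j_scaleC)
    then show ?thesis using assms(6) by (simp add: scaleC_scaleC)
  qed
  have "Rv \<mu>' z' x = \<mu> *\<^sub>R w + z *\<^sub>C q"
  proof (rule Rv_unique[OF assms(4-6)])
    have "\<mu>' *\<^sub>R \<iota> q + z' *\<^sub>C Lp q = Lp (\<mu>' *\<^sub>R w + z' *\<^sub>C q)"
      by (simp add: iq Lp.add Lp.scaleR Lp_scaleC)
    then have q: "\<mu>' *\<^sub>R \<iota> q + z' *\<^sub>C Lp q = Lp u" by (simp add: zq)
    have "\<mu>' *\<^sub>R \<iota> (\<mu> *\<^sub>R w + z *\<^sub>C q) + z' *\<^sub>C Lp (\<mu> *\<^sub>R w + z *\<^sub>C q)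
      = \<mu> *\<^sub>R (\<mu>' *\<^sub>R \<iota> w + z' *\<^sub>C Lp w) + z *\<^sub>C (\<mu>' *\<^sub>R \<iota> q + z' *\<^sub>C Lp q)"
      unfolding scaleC_of_real[symmetric] i.add j.add i_scaleC j_scaleC Lp.add Lp_scaleC
        scaleC_add_right scaleC_scaleC by (simp add: mult_ac add_ac)
    then show "\<mu>' *\<^sub>R \<iota> (\<mu> *\<^sub>R w + z *\<^sub>C q) + z' *\<^sub>C Lp (\<mu> *\<^sub>R w + z *\<^sub>C q) = x"
      by (simp add: q w u)
  qed
  then show "\<mu> *\<^sub>R \<iota> (Rv \<mu>' z' (\<iota> (Rv \<mu> z x))) + z *\<^sub>C Lp (Rv \<mu>' z' (\<iota> (Rv \<mu> z x)))
      = \<iota> (Rv \<mu>' z' x)"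
    by (simp add: i.add j.add i.scaleR j.scaleR i_scaleC j_scaleC iq flip: u_def w_def)
qed

end

section \<open>The semigroup of the shifted form on \<open>H\<close>\<close>

text \<open>Telescoping: the factors \<open>Q\<close> are replaced by \<open>P\<close> one at a
  time, and since \<open>P\<close> does not expand distances the errors only add up. Errors of order
  \<open>1 / N\<^sup>2\<close> per step thus leave a total of order \<open>1 / N\<close>.\<close>

lemma funpow_diff_le:
  fixes P Q :: "'e::real_normed_vector \<Rightarrow> 'e"
  assumes "\<And>u v. norm (P u - P v) \<le> norm (u - v)"
    and "\<And>k. k < N \<Longrightarrow> norm (P ((Q ^^ k) x) - Q ((Q ^^ k) x)) \<le> \<delta>"
  shows "norm ((P ^^ N) x - (Q ^^ N) x) \<le> N * \<delta>"
  using assms(2)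
proof (induction N)
  case (Suc N)
  have "norm ((P ^^ Suc N) x - (Q ^^ Suc N) x) \<le>
      norm (P ((P ^^ N) x) - P ((Q ^^ N) x)) + norm (P ((Q ^^ N) x) - Q ((Q ^^ N) x))"
    using norm_triangle_ineq[of "P ((P ^^ N) x) - P ((Q ^^ N) x)" "P ((Q ^^ N) x) - Q ((Q ^^ N) x)"] by simp
  also have "\<dots> \<le> N * \<delta> + \<delta>"
    by (intro add_mono order_trans[OF assms(1)] Suc) auto
  finally show ?case by (simp add: algebra_simps)
qed simp

lemma funpow_comp_commute:
  assumes "\<And>x. f (g x) = g (f x)"
  shows "((\<lambda>x. f (g x)) ^^ n) x = (f ^^ n) ((g ^^ n) x)"
proof (induction n)
  case (Suc n)
  have "g ((f ^^ n) x) = (f ^^ n) (g x)" for x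
    by (induction n) (simp_all flip: assms)
  then show ?case by (simp add: Suc)
qed simp

text \<open>Equicontinuity carries convergence from a dense set to the whole space, by splitting the
  error in three. Linearity is not assumed and the filter is arbitrary, so the lemma covers
  sequences as well as limits in real and complex parameters.\<close>

lemma tendsto_dense:
  fixes S :: "'b \<Rightarrow> 'e::real_normed_vector \<Rightarrow> 'f::real_normed_vector"
  assumes lip: "\<forall>\<^sub>F r in F. \<forall>x y. norm (S r x - S r y) \<le> M * norm (x - y)"
    and lipL: "\<And>x y. norm (L x - L y) \<le> M * norm (x - y)"
    and D: "closure D = UNIV" "\<And>x. x \<in> D \<Longrightarrow> ((\<lambda>r. S r x) \<longlongrightarrow> L x) F"
  shows "((\<lambda>r. S r x) \<longlongrightarrow> L x) F"
proof (rule tendstoI)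
  fix e :: real assume e: "0 < e"
  define N where "N = max M 1"
  have N: "M \<le> N" "0 < N" by (auto simp: N_def)
  have "x \<in> closure D" by (simp add: D)
  then obtain d where d: "d \<in> D" "dist d x < e / (3 * N)"
    using e N unfolding closure_approachable by (meson divide_pos_pos mult_pos_pos zero_less_numeral)
  have small: "N * norm (x - d) < e / 3"
    using d(2) N by (simp add: dist_norm norm_minus_commute field_simps)
  have "\<forall>\<^sub>F r in F. dist (S r d) (L d) < e / 3"
    using tendstoD[OF D(2)[OF d(1)], of "e / 3"] e by simp
  with lip show "\<forall>\<^sub>F r in F. dist (S r x) (L x) < e"
  proof eventually_elim
    case (elim r)
    have 1: "norm (S r x - S r d) < e / 3"
      using elim(1) N(1) small mult_right_mono[OF N(1), of "norm (x - d)"]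
      by (meson norm_ge_zero order.strict_trans1 order_trans)
    have 2: "norm (L d - L x) < e / 3"
      using lipL[of d x] small mult_right_mono[OF N(1), of "norm (x - d)"]
      by (simp add: norm_minus_commute)
    have "norm (S r x - L x) = norm ((S r x - S r d) + (S r d - L d) + (L d - L x))" by simp
    also have "\<dots> < e / 3 + e / 3 + e / 3"
      using 1 2 elim(2) e by (intro order.strict_trans1[OF norm_triangle_ineq]
        add_strict_mono order.strict_trans1[OF norm_triangle_ineq]) (auto simp: dist_norm)
    finally show ?case by (simp add: dist_norm)
  qed
qed

lemma closureI_tendsto:
  assumes "(f \<longlongrightarrow> x) F" "F \<noteq> bot" "\<forall>\<^sub>F r in F. f r \<in> D"
  shows "x \<in> closure D"
  using Lim_in_closed_set[of "closure D" f F x] assms closure_subset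
  by (meson closed_closure eventually_mono in_mono)

text \<open>Complex differentiability of a vector-valued function, in exactly the form in which
  \<open>analytic_semigroup\<close> demands it; \<open>has_field_derivative\<close> is reserved for
  scalar functions.\<close>

definition cderiv :: "(complex \<Rightarrow> 'e::complex_banach) \<Rightarrow> 'e \<Rightarrow> complex \<Rightarrow> bool" where
  "cderiv f d z \<longleftrightarrow> ((\<lambda>h. inverse h *\<^sub>C (f (z + h) - f z)) \<longlongrightarrow> d) (at 0)"

lemma cderiv_imp_DERIV:
  assumes "cderiv f d z" "bounded_linear L" "\<And>c x. L (c *\<^sub>C x) = c * L x"
  shows "((\<lambda>w. L (f w)) has_field_derivative L d) (at z)"
proof -
  interpret L: bounded_linear L by fact
  show ?thesis
    using L.tendsto[OF assms(1)[unfolded cderiv_def]]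
    by (simp add: DERIV_def assms(3) L.diff divide_inverse mult.commute)
qed

text \<open>Around a point of the ball of radius \<open>r / 2\<close>, Cauchy's inequality with
  radius \<open>r / 4\<close> bounds the second derivative by
  \<open>2 * M / (r / 4)\<^sup>2\<close>, which is the constant \<open>32 * M / r\<^sup>2\<close>.
  What matters is that \<open>\<phi>\<close> enters only through \<open>M\<close>.\<close>

lemma second_order_Taylor:
  assumes \<phi>: "\<phi> holomorphic_on ball z r" and M: "\<And>w. w \<in> ball z r \<Longrightarrow> cmod (\<phi> w) \<le> M"
    and h: "cmod h < r / 2"
  shows "cmod (\<phi> (z + h) - \<phi> z - deriv \<phi> z * h) \<le> 32 * M / r\<^sup>2 * (cmod h)\<^sup>2"
proof -
  have r: "0 < r" using h norm_ge_zero[of h] by linarith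
  define f where "f n = (deriv ^^ n) \<phi>" for n
  have "cmod (f 0 (z + h) - (\<Sum>k\<le>1. f k z * (z + h - z) ^ k / fact k))
      \<le> 32 * M / r\<^sup>2 * cmod (z + h - z) ^ Suc 1 / fact 1"
  proof (rule complex_Taylor)
    show "convex (ball z (r / 2))" by simp
    show "z \<in> ball z (r / 2)" "z + h \<in> ball z (r / 2)" using r h by (auto simp: dist_norm)
    show "(f n has_field_derivative f (Suc n) x) (at x within ball z (r / 2))"
      if "x \<in> ball z (r / 2)" for n x
    proof -
      have "f n holomorphic_on ball z r"
        unfolding f_def by (intro holomorphic_higher_deriv \<phi>) simp
      moreover have "x \<in> ball z r" using that r by auto
      ultimately have "(f n has_field_derivative deriv (f n) x) (at x)"
        by (intro holomorphic_derivI[where S = "ball z r"]) auto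
      then show ?thesis by (simp add: f_def has_field_derivative_at_within)
    qed
    show "cmod (f (Suc 1) x) \<le> 32 * M / r\<^sup>2" if x: "x \<in> ball z (r / 2)" for x
    proof -
      have sub: "cball x (r / 4) \<subseteq> ball z r"
      proof
        fix y assume "y \<in> cball x (r / 4)"
        then show "y \<in> ball z r"
          using x r dist_triangle[of z y x] by simp
      qed
      have "cmod ((deriv ^^ 2) \<phi> x) \<le> fact 2 * M / (r / 4) ^ 2"
      proof (rule Cauchy_inequality)
        show "\<phi> holomorphic_on ball x (r / 4)" "continuous_on (cball x (r / 4)) \<phi>"
          using holomorphic_on_subset[OF \<phi> order_trans[OF ball_subset_cball sub]]
            continuous_on_subset[OF holomorphic_on_imp_continuous_on[OF \<phi>] sub] by auto
        show "cmod (\<phi> w) \<le> M" if "cmod (x - w) = r / 4" for w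
          using sub that by (intro M) (auto simp: dist_norm)
      qed (use r in simp)
      then show ?thesis by (simp add: f_def numeral_2_eq_2 power2_eq_square field_simps)
    qed
  qed
  then show ?thesis by (simp add: f_def power2_eq_square algebra_simps)
qed

text \<open>The second order Taylor estimate is uniform over all functionals of norm one, so the difference
  quotients form a Cauchy family in norm.\<close>

lemma weak_holomorphic_imp_cderiv:
  fixes f :: "complex \<Rightarrow> 'e::complex_hilbert"
  assumes hol: "\<And>y. (\<lambda>w. cinner (f w) y) holomorphic_on ball z r" and r: "0 < r"
    and M: "\<And>w. w \<in> ball z r \<Longrightarrow> norm (f w) \<le> M"
  shows "\<exists>d. cderiv f d z"
proof -
  define K where "K = 32 * M / r\<^sup>2"
  define q where "q h = inverse h *\<^sub>C (f (z + h) - f z)" for h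
  have M0: "0 \<le> M" using M[of z] r norm_ge_zero order_trans by (metis centre_in_ball)
  have K0: "0 \<le> K" using M0 by (simp add: K_def)
  define D where "D y = deriv (\<lambda>w. cinner (f w) y) z" for y
  have T: "cmod (cinner (q h) y - D y) \<le> K * cmod h * norm y"
    if h: "cmod h < r / 2" "h \<noteq> 0" for h y
  proof -
    have "cmod (cinner (f (z + h)) y - cinner (f z) y - D y * h) \<le> 32 * (M * norm y) / r\<^sup>2 * (cmod h)\<^sup>2"
      unfolding D_def
      by (rule second_order_Taylor[OF hol]) (use h M in \<open>auto intro!: order_trans[OF norm_cinner_le] mult_right_mono\<close>)
    also have "\<dots> = cmod h * (K * cmod h * norm y)"
      by (simp add: K_def power2_eq_square)
    finally have "inverse (cmod h) * cmod (cinner (f (z + h)) y - cinner (f z) y - D y * h)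
        \<le> inverse (cmod h) * (cmod h * (K * cmod h * norm y))"
      by (rule mult_left_mono) simp
    also have "\<dots> = K * cmod h * norm y" using h(2) by simp
    finally have "cmod (inverse h * (cinner (f (z + h)) y - cinner (f z) y - D y * h)) \<le> K * cmod h * norm y"
      by (simp only: norm_mult norm_inverse)
    moreover have "inverse h * (cinner (f (z + h)) y - cinner (f z) y - D y * h) = cinner (q h) y - D y"
      using h(2) by (simp add: q_def cinner_scaleC_left cinner_diff_left field_simps)
    ultimately show ?thesis by simp
  qed
  have Q: "norm (q h - q k) \<le> K * (cmod h + cmod k)"
    if "cmod h < r / 2" "h \<noteq> 0" "cmod k < r / 2" "k \<noteq> 0" for h k
  proof (rule norm_le_of_cinner_le)
    fix y
    have "cmod (cinner (q h - q k) y) = cmod ((cinner (q h) y - D y) - (cinner (q k) y - D y))"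
      by (simp add: cinner_diff_left)
    also have "\<dots> \<le> K * cmod h * norm y + K * cmod k * norm y"
      by (intro order_trans[OF norm_triangle_ineq4] add_mono T that)
    finally show "cmod (cinner (q h - q k) y) \<le> K * (cmod h + cmod k) * norm y"
      by (simp add: algebra_simps)
  qed (use K0 in simp)
  \<comment> \<open>A null sequence of admissible increments; the offset 3 keeps it strictly below
    \<open>r / 2\<close> from the index 0 on.\<close>
  define s where "s n = r / (real n + 3)" for n
  have s: "0 < s n" "s n < r / 2" for n
    unfolding s_def using r divide_strict_left_mono[of 2 "real n + 3" r] by simp_all
  define X where "X n = q (of_real (s n))" for n
  have X: "norm (q h - X n) \<le> K * (cmod h + s n)" if "cmod h < r / 2" "h \<noteq> 0" for h n
    unfolding X_def using Q[OF that, of "of_real (s n)"] s[of n] by simp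
  have r0: "s \<longlonglongrightarrow> 0"
    unfolding s_def using LIMSEQ_ignore_initial_segment[OF lim_const_over_n[of r], of 3] by simp
  have "Cauchy X"
  proof (rule metric_CauchyI)
    fix e :: real assume e: "0 < e"
    have "(\<lambda>n. 2 * K * s n) \<longlonglongrightarrow> 2 * K * 0"
      by (intro tendsto_intros r0)
    then have "\<forall>\<^sub>F n in sequentially. 2 * K * s n < e"
      using e by (intro order_tendstoD(2)) auto
    then obtain N where N: "2 * K * s N < e"
      by (auto simp: eventually_sequentially)
    have "dist (X m) (X n) < e" if "N \<le> m" "N \<le> n" for m n
    proof -
      have "norm (X m - X n) \<le> K * (s m + s n)"
        using X[of "of_real (s m)" n] s[of m] by (simp add: X_def)
      also have "\<dots> \<le> K * (s N + s N)"
        using r that K0 by (intro mult_left_mono add_mono) (auto simp: frac_le s_def)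
      finally show ?thesis using N by (simp add: dist_norm)
    qed
    then show "\<exists>N. \<forall>m\<ge>N. \<forall>n\<ge>N. dist (X m) (X n) < e" by blast
  qed
  then obtain d where d: "X \<longlonglongrightarrow> d"
    by (meson Cauchy_convergent_iff convergent_def)
  have le: "norm (q h - d) \<le> K * cmod h" if h: "cmod h < r / 2" "h \<noteq> 0" for h
  proof (rule LIMSEQ_le)
    show "(\<lambda>n. norm (q h - X n)) \<longlonglongrightarrow> norm (q h - d)" by (intro tendsto_intros d)
    have "(\<lambda>n. K * (cmod h + s n)) \<longlonglongrightarrow> K * (cmod h + 0)"
      by (intro tendsto_intros r0)
    then show "(\<lambda>n. K * (cmod h + s n)) \<longlonglongrightarrow> K * cmod h" by simp
    show "\<exists>N. \<forall>n\<ge>N. norm (q h - X n) \<le> K * (cmod h + s n)" using X[OF h] by blast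
  qed
  have "((\<lambda>h. K * cmod h) \<longlongrightarrow> K * cmod 0) (at 0)" by (intro tendsto_intros)
  then have lim: "((\<lambda>h. K * cmod h) \<longlongrightarrow> 0) (at (0::complex))" by simp
  have "\<forall>\<^sub>F h in at 0. norm (q h - d) \<le> K * cmod h"
    unfolding eventually_at using r le by (intro exI[of _ "r / 2"]) auto
  then have "((\<lambda>h. q h - d) \<longlongrightarrow> 0) (at 0)"
    using lim by (rule Lim_null_comparison)
  then have "(q \<longlongrightarrow> d) (at 0)" by (rule LIM_zero_cancel)
  then show ?thesis unfolding cderiv_def q_def by blast
qed

context shifted_form
begin

section \<open>The inverse of the shifted operator and its part in \<open>H\<close>\<close>

definition J :: "'v antidual \<Rightarrow> 'v" where "J = Rv 0 1"

lemma Lp_J [simp]: "Lp (J x) = x"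
  using Rv_eq[of 0 1 x] by (simp add: J_def)

lemma J_Lp [simp]: "J (Lp u) = u"
  unfolding J_def by (rule Rv_unique) auto

sublocale J: bounded_linear J
  unfolding J_def by (rule Rv_bounded_linear) auto

lemma J_scaleC: "J (z *\<^sub>C x) = z *\<^sub>C J x"
  unfolding J_def by (rule Rv_scaleC) auto

text \<open>The graph of \<open>A + \<kappa>\<close> as an operator in \<open>H\<close>. By
  \<open>AG_iff\<close> it is the reversed graph of the bounded map
  \<open>i \<circ> J \<circ> j\<close>, whence its closedness.\<close>

definition AG :: "'h \<Rightarrow> 'h \<Rightarrow> bool" where
  "AG x y \<longleftrightarrow> (\<exists>u. x = i u \<and> Lp u = j y)"

lemma AG_iff: "AG x y \<longleftrightarrow> x = i (J (j y))"
proof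
  assume "AG x y"
  then obtain u where u: "x = i u" "Lp u = j y" by (auto simp: AG_def)
  then show "x = i (J (j y))" using J_Lp[of u] by simp
qed (auto simp: AG_def)

lemma AG_unique: "AG x y \<Longrightarrow> AG x y' \<Longrightarrow> y = y'"
  by (auto simp: AG_def)

lemma AG_diff: "AG x y \<Longrightarrow> AG x' y' \<Longrightarrow> AG (x - x') (y - y')"
  and AG_scaleC: "AG x y \<Longrightarrow> AG (z *\<^sub>C x) (z *\<^sub>C y)"
  by (simp_all add: AG_iff i.diff j.diff J.diff i_scaleC j_scaleC J_scaleC)

lemma AG_form: "AG (i u) y \<Longrightarrow> ap u v = cinner y (i v)"
  unfolding AG_def using pair_Lp[of u v] by (auto simp: pair_j)

lemma AG_limit:
  assumes "\<And>n. AG (x n) (y n)" "x \<longlonglongrightarrow> x'" "y \<longlonglongrightarrow> y'"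
  shows "AG x' y'"
proof -
  have "(\<lambda>n. i (J (j (y n)))) \<longlonglongrightarrow> i (J (j y'))"
    by (intro i.tendsto J.tendsto j.tendsto assms)
  moreover have "(\<lambda>n. i (J (j (y n)))) = x" using assms(1) by (auto simp: AG_iff)
  ultimately have "x' = i (J (j y'))" using assms(2) LIMSEQ_unique by metis
  then show ?thesis by (simp add: AG_iff)
qed

text \<open>The resolvent \<open>(1 + z (A + \<kappa>))\<^sup>-\<^sup>1\<close> on \<open>H\<close>,
  that is, one step of the implicit Euler method. The value at 0 is set by hand, since
  \<open>Rv\<close> is characterised only for \<open>z \<noteq> 0\<close>.\<close>

definition Rh :: "complex \<Rightarrow> 'h \<Rightarrow> 'h" where
  "Rh z x = (if z = 0 then x else i (Rv 1 z (j x)))"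

lemma Rh_0 [simp]: "Rh 0 x = x"
  by (simp add: Rh_def)

lemma Rh_add: "z \<in> cone \<Longrightarrow> Rh z (x + y) = Rh z x + Rh z y"
  by (simp add: Rh_def Rv_add j.add i.add)

lemma Rh_scaleC: "z \<in> cone \<Longrightarrow> Rh z (w *\<^sub>C x) = w *\<^sub>C Rh z x"
  by (simp add: Rh_def Rv_scaleC j_scaleC i_scaleC)

lemma Rh_diff: "z \<in> cone \<Longrightarrow> Rh z (x - y) = Rh z x - Rh z y"
  using Rh_add[of z "x - y" y] by simp

text \<open>Testing the resolvent equation with its own solution leaves a nonnegative form term. The
  constant is exactly 1, so arbitrarily high powers remain contractions.\<close>

lemma norm_Rh: "z \<in> cone \<Longrightarrow> norm (Rh z x) \<le> norm x"
proof (cases "z = 0")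
  case False
  assume z: "z \<in> cone"
  let ?u = "Rv 1 z (j x)"
  have "(norm (i ?u))\<^sup>2 \<le> Re (cinner x (i ?u))"
    using Rv_energy[of 1 z "j x"] cone_Re_nonneg[OF z, of ?u] z False by (simp add: pair_j)
  also have "\<dots> \<le> norm x * norm (i ?u)"
    using Re_cinner_le[of x "i ?u"] by simp
  finally show ?thesis
    using False by (simp add: Rh_def norm_le_of_sq_le)
qed simp

lemma Rh_lipschitz: "z \<in> cone \<Longrightarrow> norm (Rh z x - Rh z y) \<le> norm (x - y)"
  using norm_Rh[of z "x - y"] by (simp add: Rh_diff)

lemma Rh_commute: "z \<in> cone \<Longrightarrow> w \<in> cone \<Longrightarrow> Rh z (Rh w x) = Rh w (Rh z x)"
  by (simp add: Rh_def Rv_commute)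

lemma AG_Rh_self: "z \<in> cone \<Longrightarrow> z \<noteq> 0 \<Longrightarrow> AG (Rh z x) (inverse z *\<^sub>C (x - Rh z x))"
proof -
  assume z: "z \<in> cone" "z \<noteq> 0"
  let ?u = "Rv 1 z (j x)"
  have "z *\<^sub>C Lp ?u = j x - \<iota> ?u"
    using Rv_eq[of 1 z "j x"] z by (simp add: algebra_simps)
  then have "Lp ?u = j (inverse z *\<^sub>C (x - i ?u))"
    using z(2) by (simp add: j_scaleC j.diff scaleC_scaleC) (metis left_inverse scaleC_one scaleC_scaleC)
  then show ?thesis using z(2) by (auto simp: Rh_def AG_def)
qed

lemma AG_Rh:
  assumes "AG x y" "z \<in> cone"
  shows Rh_AG_diff: "x - Rh z x = z *\<^sub>C Rh z y" and "AG (Rh z x) (Rh z y)"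
proof -
  have "x - Rh z x = z *\<^sub>C Rh z y \<and> AG (Rh z x) (Rh z y)"
  proof (cases "z = 0")
    case False
    obtain u where u: "x = i u" "Lp u = j y" using assms(1) by (auto simp: AG_def)
    define s where "s = Rv 1 z (j y)"
    have s: "\<iota> s + z *\<^sub>C Lp s = j y"
      using Rv_eq[of 1 z "j y"] assms False by (simp add: s_def)
    have R: "Rv 1 z (j x) = u - z *\<^sub>C s"
    proof (rule Rv_unique)
      have "1 *\<^sub>R \<iota> (u - z *\<^sub>C s) + z *\<^sub>C Lp (u - z *\<^sub>C s) = \<iota> u + z *\<^sub>C (Lp u - (\<iota> s + z *\<^sub>C Lp s))"
        by (simp add: i.diff j.diff Lp.diff i_scaleC j_scaleC Lp_scaleC scaleC_add_right scaleC.diff_right)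
      then show "1 *\<^sub>R \<iota> (u - z *\<^sub>C s) + z *\<^sub>C Lp (u - z *\<^sub>C s) = j x"
        by (simp add: s u scaleC.zero_right)
    qed (use assms False in auto)
    have "Lp (u - z *\<^sub>C s) = \<iota> s"
      using s by (simp add: Lp.diff Lp_scaleC u(2) algebra_simps)
    moreover have "Rh z x = i (u - z *\<^sub>C s)" "Rh z y = i s"
      using False R by (simp_all add: Rh_def s_def)
    ultimately have "Rh z x = i (u - z *\<^sub>C s) \<and> Lp (u - z *\<^sub>C s) = j (Rh z y)" by simp
    then have "AG (Rh z x) (Rh z y)" unfolding AG_def by blast
    then show ?thesis
      using \<open>Rh z x = i (u - z *\<^sub>C s)\<close> \<open>Rh z y = i s\<close> by (simp add: u(1) i.diff i_scaleC)
  qed (use assms in simp)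
  then show "x - Rh z x = z *\<^sub>C Rh z y" "AG (Rh z x) (Rh z y)" by auto
qed

lemma Rh_dist_AG: "AG x y \<Longrightarrow> z \<in> cone \<Longrightarrow> norm (Rh z x - x) \<le> cmod z * norm y"
  using Rh_AG_diff[of x y z] norm_Rh[of z y]
  by (subst norm_minus_commute) (simp add: norm_scaleC mult_left_mono)

text \<open>The local error: two steps and one combined step both agree with
  \<open>x - (h + g) *\<^sub>C y\<close> to first order, so they differ by a quantity of second
  order. This requires \<open>x\<close> to lie in the domain of the square of the operator.\<close>

lemma Rh_Rh_diff:
  assumes xy: "AG x y" "AG y y2" and h: "h \<in> cone" and g: "g \<in> cone"
  shows "norm (Rh h (Rh g x) - Rh (h + g) x) \<le> 2 * (cmod h + cmod g)\<^sup>2 * norm y2"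
proof -
  define s where "s = cmod h + cmod g"
  have hg: "h + g \<in> cone" by (rule cone_add[OF h g])
  have dy: "norm (Rh z y - y) \<le> cmod z * norm y2" if "z \<in> cone" for z
    by (rule Rh_dist_AG[OF xy(2) that])
  have P: "norm (Rh (h + g) y - y) \<le> s * norm y2"
    by (rule order_trans[OF dy[OF hg]]) (simp add: s_def mult_right_mono norm_triangle_ineq)
  have G: "norm (Rh g y - y) \<le> s * norm y2"
    by (rule order_trans[OF dy[OF g]]) (simp add: s_def mult_right_mono)
  have Q: "norm (Rh g (Rh h y) - y) \<le> s * norm y2"
  proof -
    have "norm (Rh g (Rh h y) - y) \<le> norm (Rh g (Rh h y) - Rh g y) + norm (Rh g y - y)"
      using norm_triangle_ineq[of "Rh g (Rh h y) - Rh g y" "Rh g y - y"] by simp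
    also have "\<dots> \<le> cmod h * norm y2 + cmod g * norm y2"
      by (intro add_mono dy g h order_trans[OF Rh_lipschitz])
    finally show ?thesis by (simp add: s_def algebra_simps)
  qed
  have "x - Rh h (Rh g x) = (x - Rh g x) + Rh g (x - Rh h x)"
    using Rh_commute[OF h g, of x] by (simp add: Rh_diff g)
  also have "\<dots> = g *\<^sub>C Rh g y + h *\<^sub>C Rh g (Rh h y)"
    using Rh_AG_diff[OF xy(1) h] Rh_AG_diff[OF xy(1) g] by (simp add: Rh_scaleC g)
  finally have "Rh h (Rh g x) - Rh (h + g) x = (h + g) *\<^sub>C Rh (h + g) y - (g *\<^sub>C Rh g y + h *\<^sub>C Rh g (Rh h y))"
    using Rh_AG_diff[OF xy(1) hg] by (simp add: algebra_simps)
  also have "\<dots> = h *\<^sub>C ((Rh (h + g) y - y) - (Rh g (Rh h y) - y)) + g *\<^sub>C ((Rh (h + g) y - y) - (Rh g y - y))"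
    by (simp add: scaleC_add_left scaleC.diff_right)
  also have "norm \<dots> \<le> cmod h * (s * norm y2 + s * norm y2) + cmod g * (s * norm y2 + s * norm y2)"
    by (rule order_trans[OF norm_triangle_ineq])
      (unfold norm_scaleC, intro add_mono mult_left_mono order_trans[OF norm_triangle_ineq4] P G Q norm_ge_zero)
  finally show ?thesis by (simp add: s_def power2_eq_square algebra_simps)
qed

section \<open>Powers of the resolvent and their convergence\<close>

lemma Rh_pow:
  assumes "z \<in> cone"
  shows Rh_pow_add: "(Rh z ^^ n) (x + y) = (Rh z ^^ n) x + (Rh z ^^ n) y"
    and Rh_pow_scaleC: "(Rh z ^^ n) (w *\<^sub>C x) = w *\<^sub>C (Rh z ^^ n) x"
    and norm_Rh_pow: "norm ((Rh z ^^ n) x) \<le> norm x"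
    and AG_Rh_pow: "AG x y \<Longrightarrow> AG ((Rh z ^^ n) x) ((Rh z ^^ n) y)"
  by (induction n) (auto simp: assms Rh_add Rh_scaleC intro: order_trans[OF norm_Rh[OF assms]] AG_Rh(2))

definition F :: "nat \<Rightarrow> complex \<Rightarrow> 'h \<Rightarrow> 'h" where
  "F k z = (Rh (z / 2 ^ k) ^^ (2 ^ k))"

lemma cone_div2: "z \<in> cone \<Longrightarrow> z / 2 ^ k \<in> cone"
  using cone_divide[of z "2 ^ k"] by simp

lemma F_add: "z \<in> cone \<Longrightarrow> F k z (x + y) = F k z x + F k z y"
  and F_scaleC: "z \<in> cone \<Longrightarrow> F k z (w *\<^sub>C x) = w *\<^sub>C F k z x"
  and norm_F: "z \<in> cone \<Longrightarrow> norm (F k z x) \<le> norm x"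
  and AG_F: "z \<in> cone \<Longrightarrow> AG x y \<Longrightarrow> AG (F k z x) (F k z y)"
  unfolding F_def using Rh_pow[OF cone_div2] by auto

lemma F_diff: "z \<in> cone \<Longrightarrow> F k z (x - y) = F k z x - F k z y"
  using F_add[of z k "x - y" y] by simp

lemma F_lipschitz: "z \<in> cone \<Longrightarrow> norm (F k z x - F k z y) \<le> norm (x - y)"
  using norm_F[of z k "x - y"] by (simp add: F_diff)

lemma F_0 [simp]: "F k 0 x = x"
proof -
  have "(Rh 0 ^^ n) x = x" for n by (induction n) auto
  then show ?thesis by (simp add: F_def)
qed

lemma Rh_pair_pow_diff:
  assumes xy: "AG x y" "AG y y2" and h: "h \<in> cone" and g: "g \<in> cone"
  shows "norm (((\<lambda>x. Rh h (Rh g x)) ^^ N) x - (Rh (h + g) ^^ N) x)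
    \<le> N * (2 * (cmod h + cmod g)\<^sup>2 * norm y2)"
proof (rule funpow_diff_le)
  show "norm (Rh h (Rh g u) - Rh h (Rh g v)) \<le> norm (u - v)" for u v
    by (rule order_trans[OF Rh_lipschitz[OF h] Rh_lipschitz[OF g]])
  have hg: "h + g \<in> cone" by (rule cone_add[OF h g])
  fix k
  have "norm (Rh h (Rh g ((Rh (h + g) ^^ k) x)) - Rh (h + g) ((Rh (h + g) ^^ k) x))
      \<le> 2 * (cmod h + cmod g)\<^sup>2 * norm ((Rh (h + g) ^^ k) y2)"
    by (rule Rh_Rh_diff[OF AG_Rh_pow[OF hg xy(1)] AG_Rh_pow[OF hg xy(2)] h g])
  also have "\<dots> \<le> 2 * (cmod h + cmod g)\<^sup>2 * norm y2"
    by (intro mult_left_mono norm_Rh_pow[OF hg]) auto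
  finally show "norm (Rh h (Rh g ((Rh (h + g) ^^ k) x)) - Rh (h + g) ((Rh (h + g) ^^ k) x))
      \<le> 2 * (cmod h + cmod g)\<^sup>2 * norm y2" .
qed

lemma F_F_diff:
  assumes xy: "AG x y" "AG y y2" and z: "z \<in> cone" and w: "w \<in> cone"
  shows "norm (F k z (F k w x) - F k (z + w) x) \<le> 2 * (cmod z + cmod w)\<^sup>2 / 2 ^ k * norm y2"
proof -
  have "norm (((\<lambda>x. Rh (z / 2 ^ k) (Rh (w / 2 ^ k) x)) ^^ (2 ^ k)) x - (Rh (z / 2 ^ k + w / 2 ^ k) ^^ (2 ^ k)) x)
    \<le> real (2 ^ k) * (2 * (cmod (z / 2 ^ k) + cmod (w / 2 ^ k))\<^sup>2 * norm y2)"
    by (intro Rh_pair_pow_diff[OF xy] cone_div2 z w)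
  moreover have "((\<lambda>x. Rh (z / 2 ^ k) (Rh (w / 2 ^ k) x)) ^^ (2 ^ k)) x = F k z (F k w x)"
    unfolding F_def by (intro funpow_comp_commute Rh_commute cone_div2 z w)
  moreover have "real (2 ^ k) * (2 * (cmod (z / 2 ^ k) + cmod (w / 2 ^ k))\<^sup>2 * norm y2)
      = 2 * (cmod z + cmod w)\<^sup>2 / 2 ^ k * norm y2"
    by (simp add: norm_divide norm_power power2_eq_square flip: add_divide_distrib)
  ultimately show ?thesis by (simp add: F_def add_divide_distrib)
qed

lemma F_Suc_diff:
  assumes xy: "AG x y" "AG y y2" and z: "z \<in> cone"
  shows "norm (F (Suc k) z x - F k z x) \<le> 2 * (cmod z)\<^sup>2 / 2 ^ k * norm y2"
proof -
  define h where "h = z / 2 ^ Suc k"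
  have h: "h \<in> cone" unfolding h_def by (rule cone_div2[OF z])
  have hh: "h + h = z / 2 ^ k" by (simp add: h_def)
  have "norm (((\<lambda>x. Rh h (Rh h x)) ^^ (2 ^ k)) x - (Rh (h + h) ^^ (2 ^ k)) x)
    \<le> real (2 ^ k) * (2 * (cmod h + cmod h)\<^sup>2 * norm y2)"
    by (intro Rh_pair_pow_diff[OF xy] h)
  moreover have "(\<lambda>x. Rh h (Rh h x)) = Rh h ^^ 2"
    by (simp add: numeral_2_eq_2 fun_eq_iff)
  then have "((\<lambda>x. Rh h (Rh h x)) ^^ (2 ^ k)) x = F (Suc k) z x"
    by (simp add: F_def h_def funpow_mult)
  moreover have "cmod h + cmod h = cmod z / 2 ^ k"
    by (simp add: h_def norm_divide norm_mult norm_power)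
  then have "real (2 ^ k) * (2 * (cmod h + cmod h)\<^sup>2 * norm y2) = 2 * (cmod z)\<^sup>2 / 2 ^ k * norm y2"
    by (simp add: power2_eq_square)
  ultimately show ?thesis by (simp add: F_def hh)
qed

lemma F_Cauchy:
  assumes xy: "AG x y" "AG y y2" and z: "z \<in> cone"
  shows "norm (F (k + n) z x - F k z x) \<le> 4 * (cmod z)\<^sup>2 / 2 ^ k * norm y2"
proof -
  define B where "B = 2 * (cmod z)\<^sup>2 * norm y2"
  \<comment> \<open>The right-hand side is the exact partial sum of the geometric series of the
    increments, which makes the induction close.\<close>
  have "norm (F (k + n) z x - F k z x) \<le> 2 * B / 2 ^ k - 2 * B / 2 ^ (k + n)" for n
  proof (induction n)
    case (Suc n)
    have "norm (F (k + Suc n) z x - F k z x) \<le>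
        norm (F (Suc (k + n)) z x - F (k + n) z x) + norm (F (k + n) z x - F k z x)"
      using norm_triangle_ineq[of "F (Suc (k + n)) z x - F (k + n) z x" "F (k + n) z x - F k z x"] by simp
    also have "\<dots> \<le> B / 2 ^ (k + n) + (2 * B / 2 ^ k - 2 * B / 2 ^ (k + n))"
      using F_Suc_diff[OF xy z, of "k + n"] Suc by (intro add_mono) (auto simp: B_def)
    finally show ?case by (simp add: field_simps)
  qed simp
  from this[of n] have "norm (F (k + n) z x - F k z x) \<le> 2 * B / 2 ^ k"
    by (rule order_trans) (simp add: B_def)
  then show ?thesis by (simp add: B_def)
qed

text \<open>Testing the resolvent equation with \<open>u - v\<close> turns the part in
  \<open>H\<close> into the square of the distance. Coercivity then bounds \<open>u\<close> in
  \<open>V\<close>, and this bound in turn makes the distance of order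
  \<open>sqrt r\<close>.\<close>

lemma norm_Rv_V:
  assumes r: "0 < r"
  shows "norm (Rv 1 (of_real r) (\<iota> v)) \<le> C / c * norm v"
    and "(norm (i (Rv 1 (of_real r) (\<iota> v)) - i v))\<^sup>2 \<le> r * (C\<^sup>2 / c * (norm v)\<^sup>2)"
proof -
  define u where "u = Rv 1 (of_real r) (\<iota> v)"
  have u: "\<iota> u + r *\<^sub>R Lp u = \<iota> v"
    using Rv_eq[of 1 "of_real r" "\<iota> v"] r cone_of_real[of r] by (simp add: u_def scaleC_of_real)
  have "dual_pairing (\<iota> u + r *\<^sub>R Lp u) (u - v) = dual_pairing (\<iota> v) (u - v)"
    by (simp only: u)
  then have "cinner (i u - i v) (i u - i v) + r * ap u (u - v) = 0"
    by (simp add: dual_pairing_add dual_pairing_scaleR pair_j pair_Lp i.diff cinner_diff_left scaleR_conv_of_real algebra_simps)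
  then have "Re (cinner (i u - i v) (i u - i v) + r * ap u (u - v)) = 0" by simp
  then have "(norm (i u - i v))\<^sup>2 + r * Re (ap u u) = r * Re (ap u v)"
    by (simp add: norm_sq_cinner ap.diff_right algebra_simps)
  moreover have "Re (ap u v) \<le> C * norm u * norm v"
    using ap_bound[of u v] complex_Re_le_cmod[of "ap u v"] by linarith
  then have "r * Re (ap u v) \<le> r * (C * norm u * norm v)"
    using r by simp
  moreover have "r * (c * (norm u)\<^sup>2) \<le> r * Re (ap u u)"
    using r ap_coercive[of u] by simp
  ultimately have E: "(norm (i u - i v))\<^sup>2 + r * (c * (norm u)\<^sup>2) \<le> r * (C * norm u * norm v)"
    by linarith
  have nu: "norm u \<le> C / c * norm v"
  proof (rule norm_le_of_sq_le)
    have "r * (c * (norm u)\<^sup>2) \<le> r * (C * norm u * norm v)"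
      using E zero_le_power2[of "norm (i u - i v)"] by linarith
    then have "c * (norm u)\<^sup>2 \<le> C * norm u * norm v" using r by simp
    then show "(norm u)\<^sup>2 \<le> C / c * norm v * norm u" using c_pos by (simp add: field_simps)
  qed (use c_pos C_pos in simp)
  then show "norm (Rv 1 (of_real r) (\<iota> v)) \<le> C / c * norm v" by (simp add: u_def)
  have "(norm (i u - i v))\<^sup>2 \<le> r * (C * norm u * norm v)"
    using E r c_pos by (smt (verit) mult_nonneg_nonneg zero_le_power2)
  also have "\<dots> \<le> r * (C * (C / c * norm v) * norm v)"
    using r C_pos by (intro mult_left_mono mult_right_mono nu) auto
  finally show "(norm (i (Rv 1 (of_real r) (\<iota> v)) - i v))\<^sup>2 \<le> r * (C\<^sup>2 / c * (norm v)\<^sup>2)"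
    by (simp add: u_def power2_eq_square mult_ac)
qed

lemma dense_i: "closure (range i) = UNIV"
  using emb by (simp add: gelfand_embedding_def)

lemma Rh_tendsto: "((\<lambda>r. Rh (of_real r) x) \<longlongrightarrow> x) (at_right 0)"
proof (rule tendsto_dense[where D = "range i" and M = 1])
  have pos: "\<forall>\<^sub>F r::real in at_right 0. 0 < r"
    by (simp add: eventually_at_right_less)
  show "\<forall>\<^sub>F r in at_right 0. \<forall>x y. norm (Rh (of_real r) x - Rh (of_real r) y) \<le> 1 * norm (x - y)"
    using pos by eventually_elim (use Rh_lipschitz[OF cone_of_real] in simp)
  fix x assume "x \<in> range i"
  then obtain v where v: "x = i v" by auto
  define B where "B = C\<^sup>2 / c * (norm v)\<^sup>2"
  have B: "0 \<le> B" using c_pos by (simp add: B_def)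
  have "((\<lambda>r. sqrt (r * B)) \<longlongrightarrow> sqrt (0 * B)) (at_right 0)"
    by (intro tendsto_intros)
  then have lim: "((\<lambda>r. sqrt (r * B)) \<longlongrightarrow> 0) (at_right 0)" by simp
  have "\<forall>\<^sub>F r in at_right 0. norm (Rh (of_real r) x - x) \<le> sqrt (r * B)"
    using pos
  proof eventually_elim
    case (elim r)
    then have "(norm (Rh (of_real r) x - x))\<^sup>2 \<le> r * B"
      using norm_Rv_V(2)[OF elim, of v] by (simp add: Rh_def v B_def)
    then show ?case by (simp add: real_le_rsqrt)
  qed
  then have "((\<lambda>r. Rh (of_real r) x - x) \<longlongrightarrow> 0) (at_right 0)"
    using lim by (rule Lim_null_comparison)
  then show "((\<lambda>r. Rh (of_real r) x) \<longlongrightarrow> x) (at_right 0)" by (rule LIM_zero_cancel)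
qed (auto simp: dense_i)

lemma AG_dense: "closure {x. \<exists>y. AG x y} = UNIV"
proof -
  have "x \<in> closure {x. \<exists>y. AG x y}" for x
  proof (rule closureI_tendsto[OF Rh_tendsto])
    show "\<forall>\<^sub>F r in at_right 0. Rh (of_real r) x \<in> {x. \<exists>y. AG x y}"
      using eventually_at_right_less[of 0]
    proof eventually_elim
      case (elim r)
      have "of_real r \<in> cone" "of_real r \<noteq> (0::complex)" using elim cone_of_real by auto
      then show ?case using AG_Rh_self by blast
    qed
  qed simp
  then show ?thesis by blast
qed

text \<open>Resolvents with small real parameter map the domain into the domain of the square and
  tend strongly to the identity, so one more approximation preserves density.\<close>

lemma AG2_dense: "closure {x. \<exists>y y2. AG x y \<and> AG y y2} = UNIV"
proof -
  let ?D = "{x. \<exists>y y2. AG x y \<and> AG y y2}"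
  have "{x. \<exists>y. AG x y} \<subseteq> closure ?D"
  proof safe
    fix x y assume xy: "AG x y"
    show "x \<in> closure ?D"
    proof (rule closureI_tendsto[OF Rh_tendsto])
      show "\<forall>\<^sub>F r in at_right 0. Rh (of_real r) x \<in> ?D"
        using eventually_at_right_less[of 0]
      proof eventually_elim
        case (elim r)
        have "of_real r \<in> cone" "of_real r \<noteq> (0::complex)" using elim cone_of_real by auto
        then show ?case using AG_Rh(2)[OF xy] AG_Rh_self by blast
      qed
    qed simp
  qed
  then have "closure {x. \<exists>y. AG x y} \<subseteq> closure ?D" by (simp add: closure_minimal)
  then show ?thesis using AG_dense by blast
qed

text \<open>The explicit error bound holds on the domain of the square and depends on
  \<open>z\<close> only through its modulus; contractivity extends it to all \<open>x\<close>
  without losing uniformity. Uniformity on bounded parts of the cone is what makes the limit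
  holomorphic.\<close>

lemma F_uniformly_Cauchy:
  assumes e: "0 < e"
  shows "\<exists>N. \<forall>k\<ge>N. \<forall>m\<ge>N. \<forall>z\<in>cone. cmod z \<le> r \<longrightarrow> norm (F m z x - F k z x) < e"
proof -
  have "x \<in> closure {x. \<exists>y y2. AG x y \<and> AG y y2}" unfolding AG2_dense by simp
  from this[unfolded closure_approachable, rule_format, of "e / 8"] e
  obtain x' y y2 where x': "AG x' y" "AG y y2" "dist x' x < e / 8"
    by auto
  have "(\<lambda>k. 4 * r\<^sup>2 * norm y2 / 2 ^ k) \<longlonglongrightarrow> 0"
    by (rule LIMSEQ_divide_realpow_zero) simp
  then have "\<forall>\<^sub>F k in sequentially. 4 * r\<^sup>2 * norm y2 / 2 ^ k < e / 8"
    using e by (intro order_tendstoD(2)) auto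
  then obtain N where N: "4 * r\<^sup>2 * norm y2 / 2 ^ N < e / 8"
    by (auto simp: eventually_sequentially)
  have *: "norm (F k z x - F N z x) < e / 2" if k: "N \<le> k" and z: "z \<in> cone" "cmod z \<le> r" for k z
  proof -
    have "norm (F k z x' - F N z x') \<le> 4 * (cmod z)\<^sup>2 / 2 ^ N * norm y2"
      using F_Cauchy[OF x'(1,2) z(1), of N "k - N"] k by simp
    also have "\<dots> \<le> 4 * r\<^sup>2 * norm y2 / 2 ^ N"
      using z by (simp add: divide_right_mono mult_right_mono power_mono)
    finally have 1: "norm (F k z x' - F N z x') < e / 8" using N by simp
    have 2: "norm (F m z x - F m z x') < e / 8" for m
      using F_lipschitz[OF z(1), of m x x'] x'(3) by (simp add: dist_norm norm_minus_commute)
    have "norm (F k z x - F N z x) \<le> norm (F k z x - F k z x') + norm (F k z x' - F N z x') + norm (F N z x - F N z x')"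
      by norm
    also have "\<dots> < e / 2" using 1 2[of k] 2[of N] e by linarith
    finally show ?thesis .
  qed
  have "norm (F m z x - F k z x) < e" if "N \<le> k" "N \<le> m" "z \<in> cone" "cmod z \<le> r" for k m z
    using *[OF that(1,3,4)] *[OF that(2,3,4)] norm_triangle_ineq4[of "F m z x - F N z x" "F k z x - F N z x"]
    by simp
  then show ?thesis by blast
qed

section \<open>The limit semigroup and its generator\<close>

definition U :: "complex \<Rightarrow> 'h \<Rightarrow> 'h" where "U z x = lim (\<lambda>k. F k z x)"

lemma F_tendsto_U:
  assumes "z \<in> cone"
  shows "(\<lambda>k. F k z x) \<longlonglongrightarrow> U z x"
proof -
  have "Cauchy (\<lambda>k. F k z x)"
  proof (rule metric_CauchyI)
    fix e :: real assume "0 < e"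
    from F_uniformly_Cauchy[OF this, of "cmod z" x] assms
    show "\<exists>M. \<forall>m\<ge>M. \<forall>n\<ge>M. dist (F m z x) (F n z x) < e" by (fastforce simp: dist_norm)
  qed
  then show ?thesis
    unfolding U_def by (simp add: Cauchy_convergent_iff convergent_LIMSEQ_iff)
qed

lemma F_uniform_limit_U: "uniform_limit {z \<in> cone. cmod z \<le> r} (\<lambda>k z. F k z x) (\<lambda>z. U z x) sequentially"
proof (rule uniform_limitI)
  fix e :: real assume e: "0 < e"
  obtain N where N: "\<And>k m z. N \<le> k \<Longrightarrow> N \<le> m \<Longrightarrow> z \<in> cone \<Longrightarrow> cmod z \<le> r \<Longrightarrow> norm (F m z x - F k z x) < e / 2"
    using F_uniformly_Cauchy[of "e / 2" r x] e by auto
  have "dist (F k z x) (U z x) < e" if "N \<le> k" "z \<in> cone" "cmod z \<le> r" for k z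
  proof -
    have "norm (F k z x - U z x) \<le> e / 2"
      by (rule LIMSEQ_le_const2[of "\<lambda>m. norm (F k z x - F m z x)"])
        (use N[OF _ that(1) that(2,3)] in
          \<open>auto intro!: tendsto_intros F_tendsto_U that exI[of _ N] simp: norm_minus_commute less_imp_le\<close>)
    then show ?thesis using e by (simp add: dist_norm)
  qed
  then show "\<forall>\<^sub>F k in sequentially. \<forall>z\<in>{z \<in> cone. cmod z \<le> r}. dist (F k z x) (U z x) < e"
    by (auto simp: eventually_sequentially)
qed

lemma U_0 [simp]: "U 0 x = x"
  by (rule LIMSEQ_unique[OF F_tendsto_U]) auto

lemma norm_U: "z \<in> cone \<Longrightarrow> norm (U z x) \<le> norm x"
  by (rule LIMSEQ_le_const2[OF tendsto_norm[OF F_tendsto_U]]) (auto simp: norm_F)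

lemma U_add: "z \<in> cone \<Longrightarrow> U z (x + y) = U z x + U z y"
  by (rule LIMSEQ_unique[OF F_tendsto_U]) (auto simp: F_add intro!: tendsto_add F_tendsto_U)

lemma U_scaleC: "z \<in> cone \<Longrightarrow> U z (w *\<^sub>C x) = w *\<^sub>C U z x"
  by (rule LIMSEQ_unique[OF F_tendsto_U]) (auto simp: F_scaleC intro!: scaleC.tendsto F_tendsto_U)

lemma U_diff: "z \<in> cone \<Longrightarrow> U z (x - y) = U z x - U z y"
  using U_add[of z "x - y" y] by simp

lemma U_lipschitz: "z \<in> cone \<Longrightarrow> norm (U z x - U z y) \<le> norm (x - y)"
  using norm_U[of z "x - y"] by (simp add: U_diff)

lemma U_bounded_clinear: "z \<in> cone \<Longrightarrow> bounded_clinear (U z)"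
  unfolding bounded_clinear_def
  by (intro conjI allI U_scaleC bounded_linear_intro[where K = 1])
    (use norm_U U_scaleC[of z "of_real r" for r] in \<open>simp_all add: U_add scaleC_of_real\<close>)

lemma AG_U: "z \<in> cone \<Longrightarrow> AG x y \<Longrightarrow> AG (U z x) (U z y)"
  by (rule AG_limit[OF _ F_tendsto_U F_tendsto_U]) (auto intro: AG_F)

text \<open>The approximants satisfy the law only up to a defect, which by \<open>F_F_diff\<close>
  is of order \<open>2 ^ (-k)\<close> on the domain of the square and hence disappears in the
  limit.\<close>

lemma U_semigroup:
  assumes z: "z \<in> cone" and w: "w \<in> cone"
  shows "U z (U w x) = U (z + w) x"
proof -
  have zw: "z + w \<in> cone" by (rule cone_add[OF z w])
  have "((\<lambda>k. F k z (F k w x) - F k (z + w) x) \<longlongrightarrow> U z (U w x) - U (z + w) x) sequentially" for x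
  proof (intro tendsto_diff F_tendsto_U zw)
    have "(\<lambda>k. F k z (F k w x) - F k z (U w x)) \<longlonglongrightarrow> 0"
      by (rule Lim_null_comparison[OF always_eventually tendsto_norm_zero[OF LIM_zero[OF F_tendsto_U[OF w]]]])
        (use F_lipschitz[OF z] in auto)
    from tendsto_add[OF this F_tendsto_U[OF z, of "U w x"]] show "(\<lambda>k. F k z (F k w x)) \<longlonglongrightarrow> U z (U w x)"
      by simp
  qed
  moreover have "(\<lambda>k. F k z (F k w x) - F k (z + w) x) \<longlonglongrightarrow> 0"
  proof (rule tendsto_dense[where D = "{x. \<exists>y y2. AG x y \<and> AG y y2}" and M = 2 and L = "\<lambda>_. 0"])
    have "norm (F k z (F k w x) - F k (z + w) x - (F k z (F k w y) - F k (z + w) y)) \<le> 2 * norm (x - y)" for k x y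
    proof -
      have "F k z (F k w x) - F k (z + w) x - (F k z (F k w y) - F k (z + w) y)
          = F k z (F k w (x - y)) - F k (z + w) (x - y)"
        using z w zw by (simp add: F_diff)
      also have "norm \<dots> \<le> norm (x - y) + norm (x - y)"
        by (intro order_trans[OF norm_triangle_ineq4] add_mono norm_F order_trans[OF norm_F[OF z]] w zw)
      finally show ?thesis by simp
    qed
    then show "\<forall>\<^sub>F k in sequentially. \<forall>x y. norm (F k z (F k w x) - F k (z + w) x - (F k z (F k w y) - F k (z + w) y))
        \<le> 2 * norm (x - y)" by simp
    fix x assume "x \<in> {x. \<exists>y y2. AG x y \<and> AG y y2}"
    then obtain y y2 where xy: "AG x y" "AG y y2" by blast
    show "(\<lambda>k. F k z (F k w x) - F k (z + w) x) \<longlonglongrightarrow> 0"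
    proof (rule Lim_null_comparison)
      show "\<forall>\<^sub>F k in sequentially. norm (F k z (F k w x) - F k (z + w) x) \<le> 2 * (cmod z + cmod w)\<^sup>2 / 2 ^ k * norm y2"
        using F_F_diff[OF xy z w] by simp
      show "(\<lambda>k. 2 * (cmod z + cmod w)\<^sup>2 / 2 ^ k * norm y2) \<longlonglongrightarrow> 0"
        by (intro tendsto_mult_left_zero LIMSEQ_divide_realpow_zero) simp
    qed
  qed (unfold AG2_dense, simp_all)
  ultimately have "U z (U w x) - U (z + w) x = 0" by (rule LIMSEQ_unique)
  then show ?thesis by simp
qed

lemma Rh_pow_dist_AG: "AG x y \<Longrightarrow> z \<in> cone \<Longrightarrow> norm ((Rh z ^^ n) x - x) \<le> n * (cmod z * norm y)"
  using funpow_diff_le[of "Rh z" n id x "cmod z * norm y"] Rh_lipschitz Rh_dist_AG by simp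

lemma U_dist_AG:
  assumes "AG x y" "z \<in> cone"
  shows "norm (U z x - x) \<le> cmod z * norm y"
proof (rule LIMSEQ_le_const2)
  show "(\<lambda>k. norm (F k z x - x)) \<longlonglongrightarrow> norm (U z x - x)"
    by (intro tendsto_intros F_tendsto_U assms)
  have "norm (F k z x - x) \<le> cmod z * norm y" for k
    using Rh_pow_dist_AG[OF assms(1) cone_div2[OF assms(2)], of "2 ^ k" k]
    by (simp add: F_def norm_divide norm_power)
  then show "\<exists>N. \<forall>k\<ge>N. norm (F k z x - x) \<le> cmod z * norm y" by blast
qed

lemma U_tendsto_0: "((\<lambda>z. U z x) \<longlongrightarrow> x) (at 0 within cone)"
proof (rule tendsto_dense[where D = "{x. \<exists>y. AG x y}" and M = 1])
  show "\<forall>\<^sub>F z in at 0 within cone. \<forall>x y. norm (U z x - U z y) \<le> 1 * norm (x - y)"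
    using U_lipschitz by (auto simp: eventually_at_filter)
  fix x assume "x \<in> {x. \<exists>y. AG x y}"
  then obtain y where y: "AG x y" by blast
  have "((\<lambda>z. U z x - x) \<longlongrightarrow> 0) (at 0 within cone)"
  proof (rule Lim_null_comparison)
    show "\<forall>\<^sub>F z in at 0 within cone. norm (U z x - x) \<le> cmod z * norm y"
      using U_dist_AG[OF y] by (auto simp: eventually_at_filter)
    have "((\<lambda>z. cmod z * norm y) \<longlongrightarrow> cmod 0 * norm y) (at 0 within cone)" by (intro tendsto_intros)
    then show "((\<lambda>z. cmod z * norm y) \<longlongrightarrow> 0) (at 0 within cone)" by simp
  qed
  then show "((\<lambda>z. U z x) \<longlongrightarrow> x) (at 0 within cone)" by (rule LIM_zero_cancel)
qed (auto simp: AG_dense)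

text \<open>The expansion at 0 is proved for the powers, with a bound depending only on the total
  time \<open>n * cmod z\<close>. The derivative of \<open>U\<close> at 0 is then read off without
  exchanging a limit with a derivative.\<close>

lemma Rh_pow_second_order:
  assumes xy: "AG x y" "AG y y2" and z: "z \<in> cone"
  shows "norm ((Rh z ^^ n) x - x + (of_nat n * z) *\<^sub>C y) \<le> (real n * cmod z)\<^sup>2 * norm y2"
proof (induction n)
  case (Suc n)
  let ?R = "Rh z ^^ n"
  have d: "?R x - Rh z (?R x) = z *\<^sub>C Rh z (?R y)"
    by (intro Rh_AG_diff AG_Rh_pow xy z)
  have "(Rh z ^^ Suc n) x - x + (of_nat (Suc n) * z) *\<^sub>C y
      = (?R x - x + (of_nat n * z) *\<^sub>C y) - z *\<^sub>C ((Rh z ^^ Suc n) y - y)"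
    using d by (simp add: scaleC_add_left scaleC.diff_right distrib_right algebra_simps)
  also have "norm \<dots> \<le> (real n * cmod z)\<^sup>2 * norm y2 + cmod z * (real (Suc n) * (cmod z * norm y2))"
    unfolding norm_scaleC[symmetric]
    by (intro order_trans[OF norm_triangle_ineq4] add_mono Suc)
      (simp only: norm_scaleC mult_left_mono[OF Rh_pow_dist_AG[OF xy(2) z] norm_ge_zero])
  also have "\<dots> \<le> (real (Suc n) * cmod z)\<^sup>2 * norm y2"
    by (simp add: power2_eq_square algebra_simps)
  finally show ?case .
qed simp

lemma U_second_order:
  assumes xy: "AG x y" "AG y y2" and z: "z \<in> cone"
  shows "norm (U z x - x + z *\<^sub>C y) \<le> (cmod z)\<^sup>2 * norm y2"
proof (rule LIMSEQ_le_const2)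
  show "(\<lambda>k. norm (F k z x - x + z *\<^sub>C y)) \<longlonglongrightarrow> norm (U z x - x + z *\<^sub>C y)"
    by (intro tendsto_intros F_tendsto_U z)
  have "norm (F k z x - x + z *\<^sub>C y) \<le> (cmod z)\<^sup>2 * norm y2" for k
    using Rh_pow_second_order[OF xy cone_div2[OF z], of "2 ^ k" k]
    by (simp add: F_def norm_divide norm_power)
  then show "\<exists>N. \<forall>k\<ge>N. norm (F k z x - x + z *\<^sub>C y) \<le> (cmod z)\<^sup>2 * norm y2" by blast
qed

lemma generator_U_AG:
  assumes "AG x y"
  shows "((\<lambda>h. (U (of_real h) x - x) /\<^sub>R h) \<longlongrightarrow> - y) (at_right 0)"
proof -
  \<comment> \<open>The domain is parametrised by \<open>G\<close>, the inverse of the operator. As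
    functions of \<open>y\<close> the difference quotients at \<open>G y\<close> are contractions,
    so it suffices to treat the dense set of those \<open>y\<close> that lie in the domain.\<close>
  define G where "G y = i (J (j y))" for y
  have G: "AG (G y) y" for y by (simp add: AG_iff G_def)
  have Gdiff: "G (y - y') = G y - G y'" for y y' by (simp add: G_def i.diff j.diff J.diff)
  have pos: "\<forall>\<^sub>F h::real in at_right 0. 0 < h"
    by (simp add: eventually_at_right_less)
  have "((\<lambda>h. (U (of_real h) (G y) - G y) /\<^sub>R h) \<longlongrightarrow> - y) (at_right 0)"
  proof (rule tendsto_dense[where S = "\<lambda>h y. (U (of_real h) (G y) - G y) /\<^sub>R h" and L = uminus
        and D = "{x. \<exists>y. AG x y}" and M = 1])
    show "\<forall>\<^sub>F h in at_right 0. \<forall>x y. norm ((U (of_real h) (G x) - G x) /\<^sub>R h - (U (of_real h) (G y) - G y) /\<^sub>R h)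
        \<le> 1 * norm (x - y)"
      using pos
    proof eventually_elim
      case (elim h)
      have "norm ((U (of_real h) (G x) - G x) /\<^sub>R h - (U (of_real h) (G y) - G y) /\<^sub>R h) \<le> norm (x - y)" for x y
      proof -
        have h: "of_real h \<in> cone" using elim cone_of_real by simp
        have "(U (of_real h) (G x) - G x) /\<^sub>R h - (U (of_real h) (G y) - G y) /\<^sub>R h
            = (U (of_real h) (G (x - y)) - G (x - y)) /\<^sub>R h"
          using h by (simp only: U_diff[OF h] Gdiff scaleR_diff_right) simp
        moreover have "norm ((U (of_real h) (G (x - y)) - G (x - y)) /\<^sub>R h) \<le> norm (x - y)"
          using U_dist_AG[OF G h, of "x - y"] elim by (simp only: norm_scaleR) (simp add: field_simps)
        ultimately show ?thesis by simp
      qed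
      then show ?case by simp
    qed
    fix y assume "y \<in> {x. \<exists>y. AG x y}"
    then obtain y2 where y2: "AG y y2" by blast
    have "((\<lambda>h. (U (of_real h) (G y) - G y) /\<^sub>R h - (- y)) \<longlongrightarrow> 0) (at_right 0)"
    proof (rule Lim_null_comparison)
      show "\<forall>\<^sub>F h in at_right 0. norm ((U (of_real h) (G y) - G y) /\<^sub>R h - (- y)) \<le> h * norm y2"
        using pos
      proof eventually_elim
        case (elim h)
        have "(U (of_real h) (G y) - G y) /\<^sub>R h - (- y) = (U (of_real h) (G y) - G y + h *\<^sub>R y) /\<^sub>R h"
          using elim by (simp add: algebra_simps)
        moreover have "norm ((U (of_real h) (G y) - G y + h *\<^sub>R y) /\<^sub>R h) \<le> h * norm y2"
          using U_second_order[OF G y2, of "of_real h"] cone_of_real[of h] elim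
          by (simp only: norm_scaleR) (simp add: scaleC_of_real field_simps power2_eq_square)
        ultimately show ?case by (simp only:)
      qed
      have "((\<lambda>h. h * norm y2) \<longlongrightarrow> 0 * norm y2) (at_right 0)" by (intro tendsto_intros)
      then show "((\<lambda>h. h * norm y2) \<longlongrightarrow> 0) (at_right 0)" by simp
    qed
    then show "((\<lambda>h. (U (of_real h) (G y) - G y) /\<^sub>R h) \<longlongrightarrow> - y) (at_right 0)" by (rule LIM_zero_cancel)
  qed (auto simp: AG_dense norm_minus_commute)
  then show ?thesis using assms by (simp add: AG_iff G_def)
qed

lemma generator_U_iff:
  "((\<lambda>h. (U (of_real h) x - x) /\<^sub>R h) \<longlongrightarrow> y) (at_right 0) \<longleftrightarrow> AG x (- y)"
proof
  assume lim: "((\<lambda>h. (U (of_real h) x - x) /\<^sub>R h) \<longlongrightarrow> y) (at_right 0)"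
  \<comment> \<open>Maximality: \<open>x'\<close> in the domain solves
    \<open>x' + (A + \<kappa>) x' = x - y\<close>. The difference quotients of
    \<open>e = x - x'\<close> then tend to \<open>e\<close>, whereas contractivity makes their inner
    products with \<open>e\<close> nonpositive in real part; hence \<open>e = 0\<close>.\<close>
  define w where "w = x - y"
  define x' where "x' = Rh 1 w"
  have x': "AG x' (w - x')"
    using AG_Rh_self[of 1 w] by (simp add: x'_def)
  define e where "e = x - x'"
  have pos: "\<forall>\<^sub>F h::real in at_right 0. 0 < h"
    by (simp add: eventually_at_right_less)
  have "((\<lambda>h. (U (of_real h) x - x) /\<^sub>R h - (U (of_real h) x' - x') /\<^sub>R h) \<longlongrightarrow> y - (- (w - x'))) (at_right 0)"
    by (intro tendsto_diff lim generator_U_AG x')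
  moreover have "y - (- (w - x')) = e" by (simp add: w_def e_def)
  ultimately have "((\<lambda>h. (U (of_real h) x - x) /\<^sub>R h - (U (of_real h) x' - x') /\<^sub>R h) \<longlongrightarrow> e) (at_right 0)"
    by simp
  then have "((\<lambda>h. (U (of_real h) e - e) /\<^sub>R h) \<longlongrightarrow> e) (at_right 0)"
    by (rule Lim_transform_eventually)
      (use pos in eventually_elim, use cone_of_real in \<open>simp add: e_def U_diff algebra_simps\<close>)
  then have "((\<lambda>h. Re (cinner ((U (of_real h) e - e) /\<^sub>R h) e)) \<longlongrightarrow> Re (cinner e e)) (at_right 0)"
    by (intro tendsto_Re cinner.tendsto tendsto_const)
  moreover have "\<forall>\<^sub>F h in at_right 0. Re (cinner ((U (of_real h) e - e) /\<^sub>R h) e) \<le> 0"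
    using pos
  proof eventually_elim
    case (elim h)
    have "Re (cinner (U (of_real h) e) e) \<le> norm (U (of_real h) e) * norm e"
      using Re_cinner_le[of "U (of_real h) e" e] by simp
    also have "\<dots> \<le> norm e * norm e"
      using elim cone_of_real by (intro mult_right_mono norm_U) auto
    finally have "Re (cinner (U (of_real h) e - e) e) \<le> 0"
      by (simp add: cinner_diff_left cinner_self power2_eq_square)
    then show ?case
      using elim by (simp only: cinner_scaleR_left Re_complex_of_real times_complex.sel)
        (simp add: mult_le_0_iff)
  qed
  ultimately have "Re (cinner e e) \<le> 0"
    by (rule tendsto_upperbound) simp
  then have "e = 0" by (simp add: cinner_self)
  then show "AG x (- y)" using x' by (simp add: e_def w_def)
next
  assume "AG x (- y)"
  from generator_U_AG[OF this] show "((\<lambda>h. (U (of_real h) x - x) /\<^sub>R h) \<longlongrightarrow> y) (at_right 0)" by simp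
qed

end

section \<open>Holomorphy of the semigroup and its boundedness on \<open>V\<close>\<close>

lemma norm_sq_has_derivative:
  fixes f :: "real \<Rightarrow> 'e::complex_hilbert"
  assumes "(f has_vector_derivative f') (at t)"
  shows "((\<lambda>t. (norm (f t))\<^sup>2) has_real_derivative 2 * Re (cinner f' (f t))) (at t)"
proof -
  have "((\<lambda>t. cinner (f t) (f t)) has_vector_derivative (cinner (f t) f' + cinner f' (f t))) (at t)"
    by (rule cinner.has_vector_derivative[OF assms assms])
  from bounded_linear.has_vector_derivative[OF bounded_linear_Re this]
  show ?thesis
    by (simp add: norm_sq_cinner Re_cinner_commute[of "f t" f'] has_real_derivative_iff_has_vector_derivative)
qed

lemma cderiv_imp_has_vector_derivative:
  assumes "cderiv f d (of_real t * \<omega>)" "\<omega> \<noteq> 0"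
  shows "((\<lambda>t. f (of_real t * \<omega>)) has_vector_derivative \<omega> *\<^sub>C d) (at t)"
proof -
  define z where "z = of_real t * \<omega>"
  have "filterlim (\<lambda>h::real. of_real h * \<omega>) (at 0) (at 0)"
    unfolding filterlim_at
  proof
    show "\<forall>\<^sub>F h::real in at 0. of_real h * \<omega> \<in> UNIV \<and> of_real h * \<omega> \<noteq> 0"
      using assms(2) by (auto simp: eventually_at intro: exI[of _ 1])
    have "((\<lambda>h::real. of_real h * \<omega>) \<longlongrightarrow> of_real 0 * \<omega>) (at 0)" by (intro tendsto_intros)
    then show "((\<lambda>h::real. of_real h * \<omega>) \<longlongrightarrow> 0) (at 0)" by simp
  qed
  from filterlim_compose[OF assms(1)[unfolded cderiv_def] this]
  have "((\<lambda>h::real. inverse (of_real h * \<omega>) *\<^sub>C (f (z + of_real h * \<omega>) - f z)) \<longlongrightarrow> d) (at 0)"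
    by (simp add: z_def)
  then have "((\<lambda>h::real. \<omega> *\<^sub>C (inverse (of_real h * \<omega>) *\<^sub>C (f (z + of_real h * \<omega>) - f z))) \<longlongrightarrow> \<omega> *\<^sub>C d) (at 0)"
    by (intro scaleC.tendsto tendsto_const)
  moreover have "\<omega> *\<^sub>C (inverse (of_real h * \<omega>) *\<^sub>C x) = x /\<^sub>R h" for h :: real and x :: 'a
    using assms(2) by (simp add: scaleC_scaleC field_simps flip: scaleC_of_real)
  ultimately have "((\<lambda>h::real. (f (z + of_real h * \<omega>) - f z) /\<^sub>R h) \<longlongrightarrow> \<omega> *\<^sub>C d) (at 0)"
    by simp
  then have "((\<lambda>h::real. norm ((f (z + of_real h * \<omega>) - f z) /\<^sub>R h - \<omega> *\<^sub>C d)) \<longlongrightarrow> 0) (at 0)"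
    by (intro tendsto_norm_zero LIM_zero)
  then have "((\<lambda>h::real. norm (f (z + of_real h * \<omega>) - f z - h *\<^sub>R (\<omega> *\<^sub>C d)) / norm h) \<longlongrightarrow> 0) (at 0)"
  proof (rule Lim_transform_eventually)
    show "\<forall>\<^sub>F h::real in at 0. norm ((f (z + of_real h * \<omega>) - f z) /\<^sub>R h - \<omega> *\<^sub>C d) =
        norm (f (z + of_real h * \<omega>) - f z - h *\<^sub>R (\<omega> *\<^sub>C d)) / norm h"
    proof (rule eventually_at_topological[THEN iffD2], intro exI[of _ UNIV] conjI ballI impI)
      fix h :: real assume "h \<noteq> 0"
      then have "(f (z + of_real h * \<omega>) - f z) /\<^sub>R h - \<omega> *\<^sub>C d
          = inverse h *\<^sub>R (f (z + of_real h * \<omega>) - f z - h *\<^sub>R (\<omega> *\<^sub>C d))"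
        by (simp add: scaleR_diff_right)
      then show "norm ((f (z + of_real h * \<omega>) - f z) /\<^sub>R h - \<omega> *\<^sub>C d) =
          norm (f (z + of_real h * \<omega>) - f z - h *\<^sub>R (\<omega> *\<^sub>C d)) / norm h"
        by (simp only: norm_scaleR) (simp add: divide_inverse)
    qed auto
  qed
  then show ?thesis
    unfolding has_vector_derivative_def has_derivative_at
    by (auto simp: z_def distrib_right intro: bounded_linear_scaleR_left)
qed

lemma cderiv_unique: "cderiv f d z \<Longrightarrow> cderiv f d' z \<Longrightarrow> d = d'"
  unfolding cderiv_def by (rule LIM_unique)

lemma cderiv_bounded_clinear:
  assumes "cderiv f d z" "bounded_clinear L"
  shows "cderiv (\<lambda>w. L (f w)) (L d) z"
proof -
  interpret L: bounded_linear L using assms(2) by (simp add: bounded_clinear_def)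
  have "L (c *\<^sub>C x) = c *\<^sub>C L x" for c x using assms(2) by (simp add: bounded_clinear_def)
  then show ?thesis
    using L.tendsto[OF assms(1)[unfolded cderiv_def]] by (simp add: cderiv_def L.diff)
qed

lemma cderiv_cong_ev:
  assumes "cderiv f d z" "open S" "z \<in> S" "\<And>w. w \<in> S \<Longrightarrow> f w = g w"
  shows "cderiv g d z"
  unfolding cderiv_def
proof (rule Lim_transform_eventually[OF assms(1)[unfolded cderiv_def]])
  have "((\<lambda>h. z + h) \<longlongrightarrow> z + 0) (at 0)" by (intro tendsto_intros)
  then have "\<forall>\<^sub>F h in at 0. z + h \<in> S"
    using topological_tendstoD[OF _ assms(2)] assms(3) by simp
  then show "\<forall>\<^sub>F h in at 0. inverse h *\<^sub>C (f (z + h) - f z) = inverse h *\<^sub>C (g (z + h) - g z)"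
    by eventually_elim (simp add: assms)
qed

lemma cderiv_shift: "cderiv f d (z - s) \<Longrightarrow> cderiv (\<lambda>w. f (w - s)) d z"
  by (simp add: cderiv_def algebra_simps)

lemma open_sector: "\<theta> \<le> 1 \<Longrightarrow> open (sector \<theta>)"
proof -
  assume \<theta>: "\<theta> \<le> 1"
  have *: "0 < Re z" if "z \<in> sector \<theta>" for z
  proof -
    have "z \<noteq> 0" "\<bar>Arg z\<bar> < pi / 2"
      using that \<theta> pi_gt3 by (auto simp: sector_def)
    then show ?thesis using Re_Ln_pos_lt[of z] by (simp add: Arg_eq_Im_Ln)
  qed
  have "continuous_on {z. 0 < Re z} Arg"
    by (intro continuous_at_imp_continuous_on ballI continuous_at_Arg) (auto simp: complex_nonpos_Reals_iff)
  then have "open ({z. 0 < Re z} \<inter> Arg -` {-\<theta><..<\<theta>})"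
    by (intro continuous_open_preimage open_halfspace_Re_gt open_greaterThanLessThan)
  also have "{z. 0 < Re z} \<inter> Arg -` {-\<theta><..<\<theta>} = sector \<theta>"
    using * by (auto simp: sector_def abs_less_iff)
  finally show ?thesis .
qed

text \<open>Only a right limit at 0 is assumed, because orbits of an analytic semigroup need not be
  differentiable there.\<close>

lemma bound_from_derivative_at_0:
  fixes f :: "real \<Rightarrow> real"
  assumes d: "\<And>t. 0 < t \<Longrightarrow> \<exists>D. (f has_real_derivative D) (at t) \<and> D \<le> K"
    and lim: "(f \<longlongrightarrow> L) (at_right 0)" and t: "0 < t"
  shows "f t \<le> L + K * t"
proof -
  have mono: "f t - K * t \<le> f s - K * s" if "0 < s" "s \<le> t" for s
  proof (rule DERIV_nonpos_imp_nonincreasing[OF that(2)])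
    fix x assume x: "s \<le> x" "x \<le> t"
    then obtain D where "(f has_real_derivative D) (at x)" "D \<le> K" using d[of x] \<open>0 < s\<close> by auto
    then show "\<exists>y. ((\<lambda>t. f t - K * t) has_real_derivative y) (at x) \<and> y \<le> 0"
      by (intro exI[of _ "D - K"]) (auto intro!: derivative_eq_intros)
  qed
  have "((\<lambda>s. f s - K * s) \<longlongrightarrow> L - K * 0) (at_right 0)"
    by (intro tendsto_intros lim)
  moreover have "\<forall>\<^sub>F s in at_right 0. f t - K * t \<le> f s - K * s"
    unfolding eventually_at_right[OF t] using mono t by (intro exI[of _ t]) auto
  ultimately have "f t - K * t \<le> L - K * 0"
    by (intro tendsto_lowerbound) auto
  then show ?thesis by simp
qed

context shifted_form
begin

text \<open>Holomorphy needs an open set of parameters. Away from 0 the operators \<open>U z\<close>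
  map \<open>H\<close> into \<open>V\<close>, and \<open>Rh z\<close> is given by its resolvent
  formula.\<close>

definition open_cone :: "complex set" where "open_cone = interior cone - {0}"

lemma open_open_cone: "open open_cone"
  unfolding open_cone_def by (intro open_Diff) auto

lemma open_coneD: "z \<in> open_cone \<Longrightarrow> z \<in> cone" "z \<in> open_cone \<Longrightarrow> z \<noteq> 0"
  using interior_subset by (auto simp: open_cone_def)

lemma sector_subset_open_cone: "\<exists>\<theta>. 0 < \<theta> \<and> \<theta> \<le> 1 \<and> sector \<theta> \<subseteq> open_cone"
proof -
  obtain \<theta> where \<theta>: "0 < \<theta>" "\<theta> \<le> 1" "sector \<theta> \<subseteq> cone"
    using sector_subset_cone by blast
  have "sector \<theta> \<subseteq> interior cone"
    by (rule interior_maximal[OF \<theta>(3) open_sector[OF \<theta>(2)]])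
  then show ?thesis using \<theta> by (intro exI[of _ \<theta>]) (auto simp: open_cone_def sector_def)
qed

lemma open_cone_scale: "z \<in> open_cone \<Longrightarrow> 0 < r \<Longrightarrow> of_real r * z \<in> open_cone"
proof -
  assume z: "z \<in> open_cone" and r: "0 < r"
  obtain e where e: "0 < e" "ball z e \<subseteq> cone"
    using z by (auto simp: open_cone_def mem_interior)
  have "ball (of_real r * z) (r * e) \<subseteq> cone"
  proof
    fix w assume "w \<in> ball (of_real r * z) (r * e)"
    moreover have "of_real r * z - w = of_real r * (z - w / of_real r)"
      using r by (simp add: field_simps)
    ultimately have "w / of_real r \<in> ball z e"
      using r by (simp add: dist_norm norm_mult del: right_diff_distrib')
    then show "w \<in> cone"
      using e(2) cone_scale[of "w / of_real r" r] r by auto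
  qed
  then have "of_real r * z \<in> interior cone"
    unfolding mem_interior using e(1) r by (intro exI[of _ "r * e"]) simp
  then show ?thesis using z r by (auto simp: open_cone_def)
qed

lemma open_cone_of_real: "0 < r \<Longrightarrow> of_real r \<in> open_cone"
proof -
  assume r: "0 < r"
  obtain \<theta> where "0 < \<theta>" "sector \<theta> \<subseteq> open_cone" using sector_subset_open_cone by blast
  then show ?thesis using r by (auto simp: sector_def)
qed

lemma open_cone_add: "z \<in> open_cone \<Longrightarrow> \<forall>\<^sub>F h in at 0. z + h \<in> open_cone"
proof -
  assume z: "z \<in> open_cone"
  have "((\<lambda>h. z + h) \<longlongrightarrow> z + 0) (at 0)" by (intro tendsto_intros)
  then show ?thesis using topological_tendstoD[OF _ open_open_cone] z by simp
qed

lemma Rh_diff_z: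
  assumes "z \<in> cone" "z \<noteq> 0" "z + h \<in> cone"
  shows "Rh (z + h) x - Rh z x = - (h *\<^sub>C Rh (z + h) (inverse z *\<^sub>C (x - Rh z x)))"
proof -
  define y where "y = inverse z *\<^sub>C (x - Rh z x)"
  have zy: "z *\<^sub>C y = x - Rh z x" using assms(2) by (simp add: y_def scaleC_scaleC)
  have "Rh z x - Rh (z + h) (Rh z x) = (z + h) *\<^sub>C Rh (z + h) y"
    unfolding y_def by (rule Rh_AG_diff[OF AG_Rh_self]) fact+
  moreover have "Rh (z + h) x - Rh (z + h) (Rh z x) = z *\<^sub>C Rh (z + h) y"
    using assms(3) by (simp add: zy flip: Rh_diff Rh_scaleC)
  ultimately show ?thesis
    by (simp add: y_def[symmetric] scaleC_add_left algebra_simps)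
qed

lemma Rh_continuous:
  assumes z: "z \<in> open_cone"
  shows "((\<lambda>h. Rh (z + h) x) \<longlongrightarrow> Rh z x) (at 0)"
proof -
  have zc: "z \<in> cone" "z \<noteq> 0" using open_coneD z by auto
  have "((\<lambda>h. Rh (z + h) x - Rh z x) \<longlongrightarrow> 0) (at 0)"
  proof (rule Lim_null_comparison)
    show "\<forall>\<^sub>F h in at 0. norm (Rh (z + h) x - Rh z x) \<le> cmod h * norm (inverse z *\<^sub>C (x - Rh z x))"
      using open_cone_add[OF z]
    proof eventually_elim
      case (elim h)
      then have c: "z + h \<in> cone" by (rule open_coneD)
      show ?case
        unfolding Rh_diff_z[OF zc c] norm_minus_cancel norm_scaleC[of h] by (intro mult_left_mono norm_Rh c) simp
    qed
    have "((\<lambda>h::complex. cmod h * norm (inverse z *\<^sub>C (x - Rh z x))) \<longlongrightarrow> cmod 0 * norm (inverse z *\<^sub>C (x - Rh z x))) (at 0)"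
      by (intro tendsto_intros)
    then show "((\<lambda>h::complex. cmod h * norm (inverse z *\<^sub>C (x - Rh z x))) \<longlongrightarrow> 0) (at 0)" by simp
  qed
  then show ?thesis by (rule LIM_zero_cancel)
qed

text \<open>A product rule by induction: the increment of the inner power passes through the
  contraction \<open>Rh (z + h)\<close>, and the change of the outer factor is given by the
  resolvent identity \<open>Rh_diff_z\<close>.\<close>

lemma Rh_pow_cderiv: "z \<in> open_cone \<Longrightarrow> \<exists>d. cderiv (\<lambda>z. (Rh z ^^ n) x) d z"
proof (induction n)
  case 0
  then show ?case by (intro exI[of _ 0]) (simp add: cderiv_def scaleC.zero_right)
next
  case (Suc n)
  note z = Suc.prems
  have zc: "z \<in> cone" "z \<noteq> 0" using open_coneD z by auto
  obtain d where d: "cderiv (\<lambda>z. (Rh z ^^ n) x) d z" using Suc by blast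
  define T where "T z = (Rh z ^^ n) x" for z
  define q where "q h = inverse h *\<^sub>C (T (z + h) - T z)" for h
  have q: "(q \<longlongrightarrow> d) (at 0)" using d unfolding cderiv_def q_def[abs_def] T_def .
  define y where "y = inverse z *\<^sub>C (T z - Rh z (T z))"
  have "((\<lambda>h. (Rh (z + h) (q h) - Rh (z + h) d) + Rh (z + h) d - Rh (z + h) y) \<longlongrightarrow> 0 + Rh z d - Rh z y) (at 0)"
  proof (intro tendsto_diff tendsto_add Rh_continuous z)
    show "((\<lambda>h. Rh (z + h) (q h) - Rh (z + h) d) \<longlongrightarrow> 0) (at 0)"
    proof (rule Lim_null_comparison[OF _ tendsto_norm_zero[OF LIM_zero[OF q]]])
      show "\<forall>\<^sub>F h in at 0. norm (Rh (z + h) (q h) - Rh (z + h) d) \<le> norm (q h - d)"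
        using open_cone_add[OF z] by eventually_elim (intro Rh_lipschitz open_coneD)
    qed
  qed
  then have "((\<lambda>h. inverse h *\<^sub>C ((Rh (z + h) ^^ Suc n) x - (Rh z ^^ Suc n) x)) \<longlongrightarrow> 0 + Rh z d - Rh z y) (at 0)"
  proof (rule Lim_transform_eventually)
    have "\<forall>\<^sub>F h in at (0::complex). h \<noteq> 0" by (simp add: eventually_at_filter)
    with open_cone_add[OF z]
    show "\<forall>\<^sub>F h in at 0. (Rh (z + h) (q h) - Rh (z + h) d) + Rh (z + h) d - Rh (z + h) y
        = inverse h *\<^sub>C ((Rh (z + h) ^^ Suc n) x - (Rh z ^^ Suc n) x)"
    proof eventually_elim
      case (elim h)
      then have c: "z + h \<in> cone" by (intro open_coneD)
      have "(Rh (z + h) ^^ Suc n) x - (Rh z ^^ Suc n) x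
          = Rh (z + h) (T (z + h) - T z) + (Rh (z + h) (T z) - Rh z (T z))"
        using c by (simp add: T_def Rh_diff)
      also have "\<dots> = Rh (z + h) (T (z + h) - T z) - h *\<^sub>C Rh (z + h) y"
        unfolding Rh_diff_z[OF zc c, of "T z"] y_def by simp
      finally show ?case
        using elim c scaleC.diff_right[of "inverse h" "Rh (z + h) (T (z + h) - T z)" "h *\<^sub>C Rh (z + h) y"]
        by (simp add: q_def Rh_scaleC scaleC_scaleC)
    qed
  qed
  then show ?case unfolding cderiv_def by blast
qed

lemma F_holomorphic: "(\<lambda>z. cinner (F k z x) y) holomorphic_on open_cone"
proof -
  have bl: "bounded_linear (\<lambda>u. cinner u y)" by (rule cinner.bounded_linear_left)
  have "(\<lambda>w. cinner ((Rh w ^^ 2 ^ k) x) y) holomorphic_on open_cone"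
    unfolding holomorphic_on_open[OF open_open_cone]
    using Rh_pow_cderiv cderiv_imp_DERIV[OF _ bl] cinner_scaleC_left by meson
  moreover have "(\<lambda>z::complex. z / 2 ^ k) holomorphic_on open_cone"
    by (intro holomorphic_intros) auto
  moreover have "z / 2 ^ k \<in> open_cone" if "z \<in> open_cone" for z
    using open_cone_scale[OF that, of "inverse (2 ^ k)"] by (simp add: field_simps)
  ultimately have "((\<lambda>w. cinner ((Rh w ^^ 2 ^ k) x) y) \<circ> (\<lambda>z. z / 2 ^ k)) holomorphic_on open_cone"
    by (intro holomorphic_on_compose_gen[where t = open_cone]) auto
  then show ?thesis by (simp add: F_def o_def)
qed

text \<open>Locally uniform limits of holomorphic functions are holomorphic. The scalar statement is
  enough, since \<open>weak_holomorphic_imp_cderiv\<close> upgrades it to differentiability in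
  norm.\<close>

lemma U_holomorphic: "(\<lambda>z. cinner (U z x) y) holomorphic_on open_cone"
proof (rule holomorphic_uniform_sequence[OF open_open_cone F_holomorphic])
  fix z assume z: "z \<in> open_cone"
  obtain d where d: "0 < d" "cball z d \<subseteq> open_cone"
    using open_open_cone z open_contains_cball by blast
  have "cball z d \<subseteq> {w \<in> cone. cmod w \<le> cmod z + d}"
  proof
    fix w assume w: "w \<in> cball z d"
    then have "cmod w \<le> cmod z + d"
      using norm_triangle_ineq2[of w z] by (simp add: dist_norm norm_minus_commute)
    then show "w \<in> {w \<in> cone. cmod w \<le> cmod z + d}" using w d open_coneD by auto
  qed
  then have "uniform_limit (cball z d) (\<lambda>k z. F k z x) (\<lambda>z. U z x) sequentially"
    using F_uniform_limit_U uniform_limit_on_subset by blast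
  then have "uniform_limit (cball z d) (\<lambda>k z. cinner (F k z x) y) (\<lambda>z. cinner (U z x) y) sequentially"
    by (rule bounded_linear.uniform_limit[OF cinner.bounded_linear_left])
  then show "\<exists>d>0. cball z d \<subseteq> open_cone \<and>
      uniform_limit (cball z d) (\<lambda>k z. cinner (F k z x) y) (\<lambda>z. cinner (U z x) y) sequentially"
    using d by blast
qed

text \<open>Restricting the complex difference quotient at \<open>z\<close> to positive real
  increments gives the limit that defines the generator at \<open>U z x\<close>. Thus
  differentiability already forces the range of \<open>U z\<close> into the domain.\<close>

lemma U_cderiv_AG:
  assumes z: "z \<in> open_cone"
  shows "\<exists>y. AG (U z x) y \<and> cderiv (\<lambda>z. U z x) (- y) z"
proof -
  obtain r where r: "0 < r" "ball z r \<subseteq> open_cone"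
    using open_open_cone z open_contains_ball by blast
  have "\<exists>d. cderiv (\<lambda>z. U z x) d z"
  proof (rule weak_holomorphic_imp_cderiv[OF _ r(1)])
    show "(\<lambda>w. cinner (U w x) y) holomorphic_on ball z r" for y
      by (rule holomorphic_on_subset[OF U_holomorphic r(2)])
    show "norm (U w x) \<le> norm x" if "w \<in> ball z r" for w
      using that r(2) open_coneD by (intro norm_U) auto
  qed
  then obtain d where d: "cderiv (\<lambda>z. U z x) d z" by blast
  have "AG (U z x) (- d)"
    unfolding generator_U_iff[symmetric]
  proof (rule Lim_transform_eventually)
    have "filterlim (\<lambda>h::real. complex_of_real h) (at 0) (at_right 0)"
      unfolding filterlim_at
      by (auto simp: eventually_at_filter intro!: tendsto_eq_intros)
    from filterlim_compose[OF d[unfolded cderiv_def] this]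
    show "((\<lambda>h::real. inverse (of_real h) *\<^sub>C (U (z + of_real h) x - U z x)) \<longlongrightarrow> d) (at_right 0)" .
    show "\<forall>\<^sub>F h::real in at_right 0. inverse (of_real h) *\<^sub>C (U (z + of_real h) x - U z x)
        = (U (of_real h) (U z x) - U z x) /\<^sub>R h"
      using eventually_at_right_less[of 0]
    proof eventually_elim
      case (elim h)
      then have "U (of_real h) (U z x) = U (z + of_real h) x"
        using U_semigroup[of "of_real h" z x] cone_of_real open_coneD[OF z] by (simp add: add.commute)
      then show ?case by (simp flip: scaleC_of_real)
    qed
  qed
  then show ?thesis using d by (intro exI[of _ "- d"]) simp
qed

text \<open>The derivative of the semigroup is minus the generator part, so Cauchy's inequality on
  the circle of radius \<open>r / 2\<close>, where \<open>U\<close> is contractive, bounds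
  it.\<close>

lemma AG_U_bound:
  assumes r: "0 < r" "ball z r \<subseteq> open_cone" and y: "AG (U z x) y"
  shows "norm y \<le> 2 / r * norm x"
proof -
  have z: "z \<in> open_cone" using r by auto
  obtain y' where y': "AG (U z x) y'" "cderiv (\<lambda>z. U z x) (- y') z"
    using U_cderiv_AG[OF z] by blast
  then have d: "cderiv (\<lambda>z. U z x) (- y) z" using AG_unique y by blast
  show ?thesis
  proof (rule norm_le_of_cinner_le)
    fix v
    have "((\<lambda>w. cinner (U w x) v) has_field_derivative cinner (- y) v) (at z)"
      by (rule cderiv_imp_DERIV[OF d cinner.bounded_linear_left]) (rule cinner_scaleC_left)
    then have "deriv (\<lambda>w. cinner (U w x) v) z = - cinner y v"
      by (simp add: DERIV_imp_deriv cinner_minus_left)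
    moreover have "cmod ((deriv ^^ 1) (\<lambda>w. cinner (U w x) v) z) \<le> fact 1 * (norm x * norm v) / (r / 2) ^ 1"
    proof (rule Cauchy_inequality)
      have sub: "cball z (r / 2) \<subseteq> open_cone" using r by (force simp: subset_eq)
      show "(\<lambda>w. cinner (U w x) v) holomorphic_on ball z (r / 2)"
        by (rule holomorphic_on_subset[OF U_holomorphic]) (use sub in auto)
      show "continuous_on (cball z (r / 2)) (\<lambda>w. cinner (U w x) v)"
        by (rule continuous_on_subset[OF holomorphic_on_imp_continuous_on[OF U_holomorphic] sub])
      show "cmod (cinner (U w x) v) \<le> norm x * norm v" if "cmod (z - w) = r / 2" for w
        using sub that open_coneD by (intro order_trans[OF norm_cinner_le] mult_right_mono norm_U) (auto simp: dist_norm)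
    qed (use r in simp)
    ultimately show "cmod (cinner y v) \<le> 2 / r * norm x * norm v" by (simp add: field_simps)
  qed (use r in simp)
qed

lemma AG_V_norm: "AG (i u) y \<Longrightarrow> c * (norm u)\<^sup>2 \<le> norm y * norm (i u)"
  using ap_coercive[of u] AG_form[of u y u] Re_cinner_le[of y "i u"] by simp

definition UV :: "complex \<Rightarrow> 'h \<Rightarrow> 'v" where "UV z x = inv i (U z x)"

lemma i_UV: "z \<in> open_cone \<Longrightarrow> i (UV z x) = U z x"
proof -
  assume z: "z \<in> open_cone"
  obtain y where "AG (U z x) y" using U_cderiv_AG[OF z] by blast
  then have "U z x \<in> range i" by (auto simp: AG_def)
  then show ?thesis unfolding UV_def by (rule f_inv_into_f)
qed

lemma UV_eqI: "z \<in> open_cone \<Longrightarrow> U z x = i u \<Longrightarrow> UV z x = u"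
  by (simp add: UV_def)

lemma UV_add: "z \<in> open_cone \<Longrightarrow> UV z (x + y) = UV z x + UV z y"
  and UV_scaleC: "z \<in> open_cone \<Longrightarrow> UV z (w *\<^sub>C x) = w *\<^sub>C UV z x"
  by (rule UV_eqI; simp add: U_add U_scaleC open_coneD i.add i_scaleC i_UV)+

lemma UV_diff: "z \<in> open_cone \<Longrightarrow> UV z (x - y) = UV z x - UV z y"
  using UV_add[of z "x - y" y] by simp

lemma UV_bounded_clinear:
  assumes z: "z \<in> open_cone"
  shows "bounded_clinear (UV z)"
proof -
  obtain r where r: "0 < r" "ball z r \<subseteq> open_cone"
    using open_open_cone z open_contains_ball by blast
  define K where "K = sqrt (2 / (r * c))"
  have "norm (UV z x) \<le> norm x * K" for x
  proof -
    obtain y where y: "AG (U z x) y" using U_cderiv_AG[OF z] by blast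
    have "c * (norm (UV z x))\<^sup>2 \<le> norm y * norm (U z x)"
      using AG_V_norm[of "UV z x" y] y by (simp add: i_UV[OF z])
    also have "\<dots> \<le> (2 / r * norm x) * norm x"
      using r by (intro mult_mono AG_U_bound[OF r y] norm_U open_coneD z) auto
    finally have "(norm (UV z x))\<^sup>2 \<le> (norm x * K)\<^sup>2"
      using c_pos r by (simp add: K_def power_mult_distrib field_simps power2_eq_square)
    then show ?thesis
      by (rule power2_le_imp_le) (use c_pos r in \<open>simp add: K_def\<close>)
  qed
  then show ?thesis
    unfolding bounded_clinear_def
    by (intro conjI allI UV_scaleC z bounded_linear_intro[where K = K])
      (use UV_scaleC[OF z, of "of_real r" for r] in \<open>simp_all add: UV_add z scaleC_of_real\<close>)
qed

lemma UV_cderiv: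
  assumes z: "z \<in> open_cone"
  shows "\<exists>d. cderiv (\<lambda>z. UV z x) d z \<and> AG (U z x) (- i d)"
proof -
  obtain r where r: "0 < r" "ball z r \<subseteq> open_cone"
    using open_open_cone z open_contains_ball by blast
  \<comment> \<open>A short real time \<open>s\<close> is split off: near \<open>z\<close>, the map
    into \<open>V\<close> is the bounded operator \<open>UV s\<close> applied to the differentiable
    \<open>H\<close>-valued function \<open>U (w - s) x\<close>.\<close>
  define s where "s = r / 2"
  have s: "0 < s" "z - of_real s \<in> open_cone"
    using r by (auto simp: s_def dist_norm intro!: subsetD[OF r(2)])
  have so: "of_real s \<in> open_cone" by (rule open_cone_of_real[OF s(1)])
  obtain y where y: "cderiv (\<lambda>z. U z x) (- y) (z - of_real s)"
    using U_cderiv_AG[OF s(2)] by blast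
  have "cderiv (\<lambda>w. UV (of_real s) (U (w - of_real s) x)) (UV (of_real s) (- y)) z"
    by (rule cderiv_bounded_clinear[OF cderiv_shift[OF y] UV_bounded_clinear[OF so]])
  then have d: "cderiv (\<lambda>w. UV w x) (UV (of_real s) (- y)) z"
  proof (rule cderiv_cong_ev)
    show "open (ball z (r / 2))" "z \<in> ball z (r / 2)" using r by auto
    fix w assume w: "w \<in> ball z (r / 2)"
    have "w - of_real s \<in> ball z r"
      using w r norm_triangle_ineq[of "z - w" "of_real s"] by (simp add: dist_norm s_def algebra_simps)
    then have ws: "w - of_real s \<in> open_cone" using r(2) by auto
    have "UV (of_real s) (U (w - of_real s) x) = inv i (U (of_real s + (w - of_real s)) x)"
      unfolding UV_def by (subst U_semigroup) (use ws so open_coneD in auto)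
    then show "UV (of_real s) (U (w - of_real s) x) = UV w x"
      by (simp add: UV_def)
  qed
  have "cderiv (\<lambda>w. i (UV w x)) (i (UV (of_real s) (- y))) z"
    by (rule cderiv_bounded_clinear[OF d i_clinear])
  then have "cderiv (\<lambda>w. U w x) (i (UV (of_real s) (- y))) z"
    by (rule cderiv_cong_ev[OF _ open_open_cone z]) (rule i_UV)
  moreover obtain y' where "AG (U z x) y'" "cderiv (\<lambda>z. U z x) (- y') z"
    using U_cderiv_AG[OF z] by blast
  ultimately show ?thesis
    using d cderiv_unique by (metis minus_minus)
qed

lemma UV_has_vector_derivative:
  assumes z: "of_real t * \<omega> \<in> open_cone" and y: "AG x y"
  shows "((\<lambda>t. UV (of_real t * \<omega>) x) has_vector_derivative - (\<omega> *\<^sub>C UV (of_real t * \<omega>) y)) (at t)"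
proof -
  obtain d where d: "cderiv (\<lambda>z. UV z x) d (of_real t * \<omega>)" "AG (U (of_real t * \<omega>) x) (- i d)"
    using UV_cderiv[OF z] by blast
  have "- i d = U (of_real t * \<omega>) y"
    by (rule AG_unique[OF d(2) AG_U]) (use y z open_coneD in auto)
  then have "d = - UV (of_real t * \<omega>) y"
    using i_UV[OF z, of y] by (metis i.neg i_eq_iff minus_minus)
  moreover have "\<omega> \<noteq> 0" using open_coneD(2)[OF z] by auto
  ultimately show ?thesis
    using cderiv_imp_has_vector_derivative[OF d(1)] by (simp add: scaleC.minus_right)
qed

lemma U_has_vector_derivative:
  assumes z: "of_real t * \<omega> \<in> open_cone" and y: "AG (U (of_real t * \<omega>) x) y"
  shows "((\<lambda>t. U (of_real t * \<omega>) x) has_vector_derivative - (\<omega> *\<^sub>C y)) (at t)"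
proof -
  obtain y' where "AG (U (of_real t * \<omega>) x) y'" "cderiv (\<lambda>z. U z x) (- y') (of_real t * \<omega>)"
    using U_cderiv_AG[OF z] by blast
  then have "cderiv (\<lambda>z. U z x) (- y) (of_real t * \<omega>)" using y AG_unique by blast
  moreover have "\<omega> \<noteq> 0" using open_coneD(2)[OF z] by auto
  ultimately show ?thesis
    using cderiv_imp_has_vector_derivative by (fastforce simp: scaleC.minus_right)
qed

text \<open>Young's inequality absorbs the mixed term into half of the coercive one. In the Lyapunov
  estimate it is used twice, once for the pair \<open>w\<close>, \<open>p\<close> and once for the
  pair \<open>v\<close>, \<open>v - w\<close>.\<close>

lemma form_absorb:
  assumes "\<omega> \<in> cone" "cmod \<omega> = 1"
  shows "2 * Re (\<omega> * ap v w) - 2 * Re (\<omega> * ap w w) \<le> 2 * C\<^sup>2 / c * (norm v)\<^sup>2 - c / 2 * (norm w)\<^sup>2"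
proof -
  have "Re (\<omega> * ap v w) \<le> cmod (\<omega> * ap v w)" by (rule complex_Re_le_cmod)
  also have "\<dots> \<le> C * norm v * norm w" using ap_bound assms by (simp add: norm_mult)
  finally have 1: "Re (\<omega> * ap v w) \<le> C * norm v * norm w" .
  have 2: "c / 2 * (norm w)\<^sup>2 \<le> Re (\<omega> * ap w w)" using coneD[OF assms(1), of w] assms(2) by simp
  have "0 \<le> c / 2 * (norm w - 2 * C / c * norm v)\<^sup>2" using c_pos by simp
  also have "\<dots> = c / 2 * (norm w)\<^sup>2 - 2 * (C * norm v * norm w) + 2 * C\<^sup>2 / c * (norm v)\<^sup>2"
    using c_pos by (simp add: power2_eq_square field_simps)
  finally show ?thesis using 1 2 by linarith
qed

text \<open>Uniform boundedness on \<open>V\<close> comes from a Lyapunov function for \<open>w(t) = e\<^sup>-\<^sup>t\<^sup>\<omega>\<^sup>Av\<close> along the ray through \<open>\<omega>\<close>,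
  which combines the \<open>H\<close>-energies of \<open>v - w\<close> and \<open>t w'\<close>.\<close>

definition KV :: real where
  "KV = 2 * (2 + 4 * C\<^sup>2 / c\<^sup>2) + 4 * (2 + 4 * C\<^sup>2 / c\<^sup>2) / c * (2 * C\<^sup>2 / c)"

lemma KV_nonneg: "0 \<le> KV"
  using c_pos by (simp add: KV_def)

lemma norm_UV_AG:
  assumes om: "\<omega> \<in> open_cone" "cmod \<omega> = 1" and t: "0 < t" and v: "AG (i v) y"
  shows "(norm (UV (of_real t * \<omega>) (i v)))\<^sup>2 \<le> KV * (norm v)\<^sup>2"
proof -
  \<comment> \<open>\<open>A\<close> collects the coefficients of the squared norm of
    \<open>w\<close> in the derivative of \<open>\<Phi>\<close>: 1 from the factor \<open>t\<close>,
    1 from Young's inequality, and \<open>4 * C\<^sup>2 / c\<^sup>2\<close> from the energy of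
    \<open>p\<close>. The weight \<open>2 / c\<close> in \<open>\<Phi>\<close> cancels the norm of
    \<open>p\<close>, and \<open>\<gamma>\<close> is chosen to cancel \<open>2 * A\<close> times the
    squared norm of \<open>v - w\<close>.\<close>
  define A where "A = 2 + 4 * C\<^sup>2 / c\<^sup>2"
  define \<gamma> where "\<gamma> = 4 * A / c"
  have A: "0 \<le> A" using c_pos by (simp add: A_def)
  have \<gamma>: "0 \<le> \<gamma>" "\<gamma> * (c / 2) = 2 * A" using A c_pos by (auto simp: \<gamma>_def)
  have KV: "KV = 2 * A + \<gamma> * (2 * C\<^sup>2 / c)" by (simp add: KV_def A_def \<gamma>_def)
  define w where "w t = UV (of_real t * \<omega>) (i v)" for t
  \<comment> \<open>This is \<open>- t w'(t)\<close>; the factor \<open>t\<close> makes it vanish at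
    0.\<close>
  define p where "p t = (of_real t * \<omega>) *\<^sub>C UV (of_real t * \<omega>) y" for t
  have oc: "of_real t * \<omega> \<in> open_cone" if "0 < t" for t by (rule open_cone_scale[OF om(1) that])
  have omc: "\<omega> \<in> cone" using om open_coneD by blast
  define \<Phi> where "\<Phi> t = t * (norm (w t))\<^sup>2 + 2 / c * (norm (i (p t)))\<^sup>2 + \<gamma> * (norm (i (v - w t)))\<^sup>2" for t
  have der: "\<exists>D. (\<Phi> has_real_derivative D) (at t) \<and> D \<le> KV * (norm v)\<^sup>2" if t: "0 < t" for t
  proof -
    note z = oc[OF t]
    have zc: "of_real t * \<omega> \<in> cone" using open_coneD z by blast
    obtain y' where y': "AG (U (of_real t * \<omega>) y) y'" using U_cderiv_AG[OF z] by blast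
    have ip: "i (p s) = (of_real s * \<omega>) *\<^sub>C U (of_real s * \<omega>) y" if "0 < s" for s
      by (simp add: p_def i_scaleC i_UV oc that)
    have AGw: "AG (i (w t)) (U (of_real t * \<omega>) y)"
      using AG_U[OF zc v] by (simp add: w_def i_UV z)
    have AGp: "AG (i (p t)) ((of_real t * \<omega>) *\<^sub>C y')"
      unfolding ip[OF t] by (rule AG_scaleC[OF y'])
    have dw: "(w has_vector_derivative - (\<omega> *\<^sub>C UV (of_real t * \<omega>) y)) (at t)"
      unfolding w_def by (rule UV_has_vector_derivative[OF z v])
    have dW: "((\<lambda>t. i (v - w t)) has_vector_derivative \<omega> *\<^sub>C U (of_real t * \<omega>) y) (at t)"
    proof -
      have "((\<lambda>t. v - w t) has_vector_derivative 0 - - (\<omega> *\<^sub>C UV (of_real t * \<omega>) y)) (at t)"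
        by (intro has_vector_derivative_diff dw has_vector_derivative_const)
      from i.has_vector_derivative[OF this] show ?thesis by (simp add: i_scaleC i_UV z)
    qed
    have dp: "((\<lambda>t. i (p t)) has_vector_derivative
        \<omega> *\<^sub>C U (of_real t * \<omega>) y - \<omega> *\<^sub>C (of_real t * \<omega>) *\<^sub>C y') (at t)"
    proof -
      have "((\<lambda>t. of_real t * \<omega>) has_vector_derivative \<omega>) (at t)"
        by (auto intro!: derivative_eq_intros)
      from scaleC.has_vector_derivative[OF this U_has_vector_derivative[OF z y']]
      have "((\<lambda>t. (of_real t * \<omega>) *\<^sub>C U (of_real t * \<omega>) y) has_vector_derivative
          \<omega> *\<^sub>C U (of_real t * \<omega>) y - \<omega> *\<^sub>C (of_real t * \<omega>) *\<^sub>C y') (at t)"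
        by (simp add: scaleC.minus_right scaleC_scaleC mult_ac)
      then show ?thesis
        by (rule has_vector_derivative_transform_within_open[where S = "{0<..}"]) (use t ip in auto)
    qed
    define D where "D = (norm (w t))\<^sup>2 + t * (2 * Re (cinner (- (\<omega> *\<^sub>C UV (of_real t * \<omega>) y)) (w t)))
      + 2 / c * (2 * Re (cinner (\<omega> *\<^sub>C U (of_real t * \<omega>) y - \<omega> *\<^sub>C (of_real t * \<omega>) *\<^sub>C y') (i (p t))))
      + \<gamma> * (2 * Re (cinner (\<omega> *\<^sub>C U (of_real t * \<omega>) y) (i (v - w t))))"
    have "(\<Phi> has_real_derivative
        1 * (norm (w t))\<^sup>2 + 2 * Re (cinner (- (\<omega> *\<^sub>C UV (of_real t * \<omega>) y)) (w t)) * t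
      + 2 / c * (2 * Re (cinner (\<omega> *\<^sub>C U (of_real t * \<omega>) y - \<omega> *\<^sub>C (of_real t * \<omega>) *\<^sub>C y') (i (p t))))
      + \<gamma> * (2 * Re (cinner (\<omega> *\<^sub>C U (of_real t * \<omega>) y) (i (v - w t))))) (at t)"
      unfolding \<Phi>_def
      by (intro DERIV_add DERIV_mult DERIV_cmult DERIV_ident norm_sq_has_derivative dw dW dp)
    then have "(\<Phi> has_real_derivative D) (at t)"
      by (simp only: D_def mult.commute[of t] mult_1)
    moreover have "D \<le> KV * (norm v)\<^sup>2"
    proof -
      have 1: "t * (2 * Re (cinner (- (\<omega> *\<^sub>C UV (of_real t * \<omega>) y)) (w t))) \<le> (norm (p t))\<^sup>2 + (norm (w t))\<^sup>2"
      proof -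
        have "t * (2 * Re (cinner (- (\<omega> *\<^sub>C UV (of_real t * \<omega>) y)) (w t))) = - 2 * Re (cinner (p t) (w t))"
          by (simp add: p_def cinner_minus_left cinner_scaleC_left algebra_simps)
        also have "\<dots> \<le> (norm (p t))\<^sup>2 + (norm (w t))\<^sup>2"
          using norm_sq_add[of "p t" "w t"] zero_le_power2[of "norm (p t + w t)"] by linarith
        finally show ?thesis .
      qed
      have 2: "2 * Re (cinner (\<omega> *\<^sub>C U (of_real t * \<omega>) y - \<omega> *\<^sub>C (of_real t * \<omega>) *\<^sub>C y') (i (p t)))
          \<le> 2 * C\<^sup>2 / c * (norm (w t))\<^sup>2 - c / 2 * (norm (p t))\<^sup>2"
        using form_absorb[OF omc om(2), of "w t" "p t"] AG_form[OF AGw, of "p t"] AG_form[OF AGp, of "p t"]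
        by (simp add: cinner_diff_left cinner_scaleC_left)
      have 3: "2 * Re (cinner (\<omega> *\<^sub>C U (of_real t * \<omega>) y) (i (v - w t)))
          \<le> 2 * C\<^sup>2 / c * (norm v)\<^sup>2 - c / 2 * (norm (v - w t))\<^sup>2"
        using form_absorb[OF omc om(2), of v "v - w t"] AG_form[OF AGw, of "v - w t"]
        by (simp add: cinner_scaleC_left ap.diff_left right_diff_distrib)
      have 4: "(norm (w t))\<^sup>2 \<le> 2 * (norm v)\<^sup>2 + 2 * (norm (v - w t))\<^sup>2"
      proof -
        have "norm (w t) \<le> norm v + norm (v - w t)"
          using norm_triangle_ineq4[of v "v - w t"] by simp
        then have "(norm (w t))\<^sup>2 \<le> (norm v + norm (v - w t))\<^sup>2" by (intro power_mono) auto
        then show ?thesis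
          using zero_le_power2[of "norm v - norm (v - w t)"] by (simp add: power2_sum power2_diff)
      qed
      have b2: "2 / c * (2 * Re (cinner (\<omega> *\<^sub>C U (of_real t * \<omega>) y - \<omega> *\<^sub>C (of_real t * \<omega>) *\<^sub>C y') (i (p t))))
          \<le> 4 * C\<^sup>2 / c\<^sup>2 * (norm (w t))\<^sup>2 - (norm (p t))\<^sup>2"
      proof -
        have "2 / c * (2 * Re (cinner (\<omega> *\<^sub>C U (of_real t * \<omega>) y - \<omega> *\<^sub>C (of_real t * \<omega>) *\<^sub>C y') (i (p t))))
            \<le> 2 / c * (2 * C\<^sup>2 / c * (norm (w t))\<^sup>2 - c / 2 * (norm (p t))\<^sup>2)"
          by (intro mult_left_mono 2) (use c_pos in simp)
        also have "\<dots> = 4 * C\<^sup>2 / c\<^sup>2 * (norm (w t))\<^sup>2 - (norm (p t))\<^sup>2"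
          using c_pos by (simp add: field_simps power2_eq_square)
        finally show ?thesis .
      qed
      have b3: "\<gamma> * (2 * Re (cinner (\<omega> *\<^sub>C U (of_real t * \<omega>) y) (i (v - w t))))
          \<le> \<gamma> * (2 * C\<^sup>2 / c) * (norm v)\<^sup>2 - 2 * A * (norm (v - w t))\<^sup>2"
        using mult_left_mono[OF 3 \<gamma>(1)] by (simp add: right_diff_distrib \<gamma>(2)[symmetric] mult.assoc)
      have "D \<le> A * (norm (w t))\<^sup>2 + \<gamma> * (2 * C\<^sup>2 / c) * (norm v)\<^sup>2 - 2 * A * (norm (v - w t))\<^sup>2"
        using 1 b2 b3 unfolding D_def A_def by (simp add: distrib_right)
      also have "\<dots> \<le> A * (2 * (norm v)\<^sup>2 + 2 * (norm (v - w t))\<^sup>2) + \<gamma> * (2 * C\<^sup>2 / c) * (norm v)\<^sup>2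
          - 2 * A * (norm (v - w t))\<^sup>2"
        using mult_left_mono[OF 4 A] by simp
      also have "\<dots> = KV * (norm v)\<^sup>2" by (simp add: KV algebra_simps)
      finally show ?thesis .
    qed
    ultimately show ?thesis by blast
  qed
  \<comment> \<open>The regularity \<open>AG (i v) y\<close> is used here quantitatively, but the
    norm of \<open>y\<close> affects only the rate of convergence and not the final bound, which
    therefore extends to all of \<open>V\<close> by density.\<close>
  have lim: "(\<Phi> \<longlongrightarrow> 0) (at_right 0)"
  proof -
    have pos: "\<forall>\<^sub>F t::real in at_right 0. 0 < t" by (simp add: eventually_at_right_less)
    have "((\<lambda>t. t * (norm y * norm (i v) / c)) \<longlongrightarrow> 0 * (norm y * norm (i v) / c)) (at_right 0)"
      by (intro tendsto_intros)
    then have l1: "((\<lambda>t. t * (norm y * norm (i v) / c)) \<longlongrightarrow> 0) (at_right 0)" by simp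
    have 1: "((\<lambda>t. t * (norm (w t))\<^sup>2) \<longlongrightarrow> 0) (at_right 0)"
    proof (rule Lim_null_comparison[OF _ l1])
      show "\<forall>\<^sub>F t in at_right 0. norm (t * (norm (w t))\<^sup>2) \<le> t * (norm y * norm (i v) / c)"
        using pos
      proof eventually_elim
        case (elim t)
        have zc: "of_real t * \<omega> \<in> cone" using oc[OF elim] open_coneD by blast
        have "AG (i (w t)) (U (of_real t * \<omega>) y)"
          using AG_U[OF zc v] oc[OF elim] by (simp add: w_def i_UV)
        then have "c * (norm (w t))\<^sup>2 \<le> norm (U (of_real t * \<omega>) y) * norm (i (w t))"
          by (rule AG_V_norm)
        also have "\<dots> \<le> norm y * norm (i v)"
          unfolding w_def i_UV[OF oc[OF elim]] by (intro mult_mono norm_U zc) auto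
        finally have "(norm (w t))\<^sup>2 \<le> norm y * norm (i v) / c" using c_pos by (simp add: field_simps)
        then have "t * (norm (w t))\<^sup>2 \<le> t * (norm y * norm (i v) / c)"
          using elim by (intro mult_left_mono) auto
        then show ?case using elim by (simp add: abs_mult)
      qed
    qed
    have "((\<lambda>t. t * norm y) \<longlongrightarrow> 0 * norm y) (at_right 0)"
      by (intro tendsto_intros)
    then have l2: "((\<lambda>t. t * norm y) \<longlongrightarrow> 0) (at_right 0)" by simp
    have 2: "((\<lambda>t. norm (i (p t))) \<longlongrightarrow> 0) (at_right 0)"
    proof (rule Lim_null_comparison[OF _ l2])
      show "\<forall>\<^sub>F t in at_right 0. norm (norm (i (p t))) \<le> t * norm y"
        using pos
      proof eventually_elim
        case (elim t)
        have zc: "of_real t * \<omega> \<in> cone" using oc[OF elim] open_coneD by blast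
        have "norm (i (p t)) = t * norm (U (of_real t * \<omega>) y)"
          using elim om(2) by (simp add: p_def i_scaleC i_UV oc norm_scaleC norm_mult)
        then show ?case using norm_U[OF zc, of y] elim by simp
      qed
    qed
    have "((\<lambda>t. t * norm y) \<longlongrightarrow> 0) (at_right 0)" by (rule l2)
    then have 3: "((\<lambda>t. norm (i (v - w t))) \<longlongrightarrow> 0) (at_right 0)"
    proof (rule Lim_null_comparison[rotated])
      show "\<forall>\<^sub>F t in at_right 0. norm (norm (i (v - w t))) \<le> t * norm y"
        using pos
      proof eventually_elim
        case (elim t)
        have zc: "of_real t * \<omega> \<in> cone" using oc[OF elim] open_coneD by blast
        show ?case
          using U_dist_AG[OF v zc] elim om(2)
          by (simp add: w_def i.diff i_UV oc norm_minus_commute norm_mult)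
      qed
    qed
    have "(\<Phi> \<longlongrightarrow> 0 + 2 / c * 0\<^sup>2 + \<gamma> * 0\<^sup>2) (at_right 0)"
      unfolding \<Phi>_def by (intro tendsto_intros 1 2 3)
    then show ?thesis by simp
  qed
  have "t * (norm (w t))\<^sup>2 \<le> \<Phi> t"
    using c_pos \<gamma> by (simp add: \<Phi>_def)
  also have "\<dots> \<le> 0 + KV * (norm v)\<^sup>2 * t"
    by (rule bound_from_derivative_at_0[OF der lim t])
  finally show ?thesis using t by (simp add: w_def mult.commute)
qed

text \<open>In \<open>V\<close> the domain is the image under the isomorphism \<open>J\<close> of
  the copy of \<open>H\<close>, which is dense in the antidual.\<close>

lemma AG_dense_V: "closure {v. \<exists>y. AG (i v) y} = UNIV"
proof -
  have "{v. \<exists>y. AG (i v) y} = J ` range j"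
    by (auto simp: AG_iff)
  moreover have "v \<in> closure (J ` range j)" for v
  proof -
    have "Lp v \<in> closure (range j)" using dense_dual_embed[OF emb] by simp
    then obtain X where X: "\<And>n. X n \<in> range j" "X \<longlonglongrightarrow> Lp v"
      unfolding closure_sequential by blast
    then have "(\<lambda>n. J (X n)) \<longlonglongrightarrow> v" using J.tendsto[OF X(2)] by simp
    then show ?thesis unfolding closure_sequential using X(1) by (intro exI[of _ "\<lambda>n. J (X n)"]) auto
  qed
  ultimately show ?thesis by auto
qed

lemma norm_UV:
  assumes z: "z \<in> open_cone"
  shows "norm (UV z (i v)) \<le> sqrt KV * norm v"
proof -
  define \<omega> where "\<omega> = of_real (inverse (cmod z)) * z"
  have nz: "0 < cmod z" using open_coneD(2)[OF z] by simp
  have om: "\<omega> \<in> open_cone" "cmod \<omega> = 1" "z = of_real (cmod z) * \<omega>"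
    using open_cone_scale[OF z, of "inverse (cmod z)"] nz
    by (auto simp: \<omega>_def norm_mult norm_inverse)
  interpret UV: bounded_linear "UV z"
    using UV_bounded_clinear[OF z] by (simp add: bounded_clinear_def)
  have bound: "norm (UV z (i v)) \<le> sqrt KV * norm v" if v: "AG (i v) y" for v y
  proof -
    have "(norm (UV z (i v)))\<^sup>2 \<le> (sqrt KV * norm v)\<^sup>2"
      using norm_UV_AG[OF om(1,2) nz v] om(3) KV_nonneg by (simp add: power_mult_distrib)
    then show ?thesis by (rule power2_le_imp_le) (use KV_nonneg in simp)
  qed
  have "v \<in> closure {v. \<exists>y. AG (i v) y}" unfolding AG_dense_V by simp
  then obtain X where X: "\<And>n. X n \<in> {v. \<exists>y. AG (i v) y}" "X \<longlonglongrightarrow> v"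
    unfolding closure_sequential by blast
  show ?thesis
  proof (rule LIMSEQ_le)
    show "(\<lambda>n. norm (UV z (i (X n)))) \<longlonglongrightarrow> norm (UV z (i v))"
      by (intro tendsto_norm UV.tendsto i.tendsto X)
    show "(\<lambda>n. sqrt KV * norm (X n)) \<longlonglongrightarrow> sqrt KV * norm v"
      by (intro tendsto_intros X)
    show "\<exists>N. \<forall>n\<ge>N. norm (UV z (i (X n))) \<le> sqrt KV * norm (X n)"
      using X(1) bound by blast
  qed
qed

text \<open>On the dense domain \<open>AG_V_norm\<close> estimates the squared distance in
  \<open>V\<close> by a product of two distances in \<open>H\<close>, both of which tend to 0;
  \<open>norm_UV\<close> carries the convergence to all of \<open>V\<close>.\<close>

lemma UV_tendsto_0: "((\<lambda>z. UV z (i v)) \<longlongrightarrow> v) (at 0 within open_cone)"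
proof (rule tendsto_dense[where S = "\<lambda>z v. UV z (i v)" and L = "\<lambda>v. v"
      and D = "{v. \<exists>y. AG (i v) y}" and M = "max 1 (sqrt KV)"])
  have "norm (UV z (i x) - UV z (i y)) \<le> max 1 (sqrt KV) * norm (x - y)" if "z \<in> open_cone" for z x y
  proof -
    have "norm (UV z (i (x - y))) \<le> sqrt KV * norm (x - y)" by (rule norm_UV[OF that])
    also have "\<dots> \<le> max 1 (sqrt KV) * norm (x - y)" by (intro mult_right_mono) auto
    finally show ?thesis using that by (simp add: i.diff UV_diff)
  qed
  then show "\<forall>\<^sub>F z in at 0 within open_cone. \<forall>x y. norm (UV z (i x) - UV z (i y)) \<le> max 1 (sqrt KV) * norm (x - y)"
    by (auto simp: eventually_at_filter)
  show "norm (x - y) \<le> max 1 (sqrt KV) * norm (x - y)" for x y :: 'v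
    using mult_right_mono[of 1 "max 1 (sqrt KV)" "norm (x - y)"] by simp
  show "closure {v. \<exists>y. AG (i v) y} = UNIV" by (rule AG_dense_V)
  fix v assume "v \<in> {v. \<exists>y. AG (i v) y}"
  then obtain y where y: "AG (i v) y" by blast
  have "((\<lambda>z. U z x) \<longlongrightarrow> x) (at 0 within open_cone)" for x
    by (rule tendsto_within_subset[OF U_tendsto_0]) (use open_coneD in auto)
  then have "((\<lambda>z. sqrt (norm (U z y - y) * norm (U z (i v) - i v) / c)) \<longlongrightarrow> sqrt (norm (y - y) * norm (i v - i v) / c))
      (at 0 within open_cone)"
    by (intro tendsto_intros) (use c_pos in auto)
  then have lim: "((\<lambda>z. sqrt (norm (U z y - y) * norm (U z (i v) - i v) / c)) \<longlongrightarrow> 0) (at 0 within open_cone)"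
    by simp
  have "((\<lambda>z. UV z (i v) - v) \<longlongrightarrow> 0) (at 0 within open_cone)"
  proof (rule Lim_null_comparison[OF _ lim])
    have "norm (UV z (i v) - v) \<le> sqrt (norm (U z y - y) * norm (U z (i v) - i v) / c)" if z: "z \<in> open_cone" for z
    proof -
      have "AG (i (UV z (i v) - v)) (U z y - y)"
        unfolding i.diff i_UV[OF z] using open_coneD[OF z] by (intro AG_diff AG_U y)
      from AG_V_norm[OF this] have "(norm (UV z (i v) - v))\<^sup>2 \<le> norm (U z y - y) * norm (U z (i v) - i v) / c"
        using c_pos by (simp add: i.diff i_UV[OF z] field_simps)
      then show ?thesis by (simp add: real_le_rsqrt)
    qed
    then show "\<forall>\<^sub>F z in at 0 within open_cone. norm (UV z (i v) - v) \<le> sqrt (norm (U z y - y) * norm (U z (i v) - i v) / c)"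
      by (auto simp: eventually_at_filter)
  qed
  then show "((\<lambda>z. UV z (i v)) \<longlongrightarrow> v) (at 0 within open_cone)" by (rule LIM_zero_cancel)
qed

end

section \<open>The semigroups generated by \<open>-A\<close>\<close>

lemma bounded_clinearD:
  assumes "bounded_clinear L"
  shows "bounded_linear L" "L (z *\<^sub>C x) = z *\<^sub>C L x" "L (x + y) = L x + L y" "L (x - y) = L x - L y"
    "L 0 = 0"
proof -
  show bl: "bounded_linear L" "L (z *\<^sub>C x) = z *\<^sub>C L x"
    using assms by (auto simp: bounded_clinear_def)
  interpret bounded_linear L by (rule bl)
  show "L (x + y) = L x + L y" "L (x - y) = L x - L y" "L 0 = 0" by (rule add diff zero)+
qed

lemma bounded_clinear_compose:
  "bounded_clinear f \<Longrightarrow> bounded_clinear g \<Longrightarrow> bounded_clinear (\<lambda>x. f (g x))"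
  by (auto simp: bounded_clinear_def intro: bounded_linear_compose)

lemma bounded_clinear_scaleC: "bounded_clinear (\<lambda>x. z *\<^sub>C x)"
  by (simp add: bounded_clinear_def scaleC.bounded_linear_right scaleC_scaleC mult.commute)

lemma cderiv_scaleC:
  assumes g: "(g has_field_derivative g') (at z)" and f: "cderiv f d z"
  shows "cderiv (\<lambda>z. g z *\<^sub>C f z) (g z *\<^sub>C d + g' *\<^sub>C f z) z"
  unfolding cderiv_def
proof (rule Lim_transform_eventually)
  have "isCont g z" by (rule DERIV_isCont[OF g])
  then have "((\<lambda>h. g (z + h)) \<longlongrightarrow> g z) (at 0)" by (simp add: isCont_iff)
  then show "((\<lambda>h. g (z + h) *\<^sub>C (inverse h *\<^sub>C (f (z + h) - f z)) + ((g (z + h) - g z) / h) *\<^sub>C f z)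
      \<longlongrightarrow> g z *\<^sub>C d + g' *\<^sub>C f z) (at 0)"
    using f[unfolded cderiv_def] g[unfolded DERIV_def]
    by (intro tendsto_add scaleC.tendsto tendsto_const)
  have "g (z + h) *\<^sub>C (inverse h *\<^sub>C (f (z + h) - f z)) + ((g (z + h) - g z) / h) *\<^sub>C f z
      = inverse h *\<^sub>C (g (z + h) *\<^sub>C f (z + h) - g z *\<^sub>C f z)" for h
    by (simp add: scaleC.diff_right scaleC.diff_left scaleC_scaleC divide_inverse left_diff_distrib
        mult.commute[of "inverse h"])
  then show "\<forall>\<^sub>F h in at 0. g (z + h) *\<^sub>C (inverse h *\<^sub>C (f (z + h) - f z)) + ((g (z + h) - g z) / h) *\<^sub>C f z
      = inverse h *\<^sub>C (g (z + h) *\<^sub>C f (z + h) - g z *\<^sub>C f z)"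
    by simp
qed

lemma sector_Re_pos: "z \<in> sector \<theta> \<Longrightarrow> \<theta> \<le> 1 \<Longrightarrow> 0 < Re z"
proof -
  assume z: "z \<in> sector \<theta>" and \<theta>: "\<theta> \<le> 1"
  have "z \<noteq> 0" "\<bar>Arg z\<bar> < pi / 2"
    using z \<theta> pi_gt3 by (auto simp: sector_def)
  then show ?thesis using Re_Ln_pos_lt[of z] by (simp add: Arg_eq_Im_Ln)
qed

lemma of_real_sector: "0 < t \<Longrightarrow> 0 < \<theta> \<Longrightarrow> of_real t \<in> sector \<theta>"
  by (simp add: sector_def)

lemma analytic_semigroup_rescaled:
  fixes Z :: "complex \<Rightarrow> 'e::complex_banach \<Rightarrow> 'e"
  assumes \<theta>: "0 < \<theta>" "\<theta> \<le> 1" and Z0: "\<And>x. Z 0 x = x"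
    and lin: "\<And>z. z \<in> sector \<theta> \<Longrightarrow> bounded_clinear (Z z)"
    and semi: "\<And>z w x. z \<in> sector \<theta> \<Longrightarrow> w \<in> sector \<theta> \<Longrightarrow> Z (z + w) x = Z z (Z w x)"
    and diff: "\<And>z x. z \<in> sector \<theta> \<Longrightarrow> \<exists>d. cderiv (\<lambda>z. Z z x) d z"
    and lim: "\<And>x. ((\<lambda>z. Z z x) \<longlongrightarrow> x) (at 0 within sector \<theta>)"
  shows "analytic_semigroup (\<lambda>t x. exp (of_real (k * t)) *\<^sub>C Z (of_real t) x)"
  unfolding analytic_semigroup_def
proof (rule exI[of _ \<theta>], rule exI[of _ "\<lambda>z x. exp (of_real k * z) *\<^sub>C Z z x"],
    intro conjI ballI allI impI)
  let ?Y = "\<lambda>z x. exp (of_real k * z) *\<^sub>C Z z x"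
  show "0 < \<theta>" "\<theta> \<le> pi / 2" using \<theta> pi_gt3 by auto
  show "(\<lambda>x. exp (of_real (k * t)) *\<^sub>C Z (of_real t) x) = ?Y (of_real t)" for t by simp
  show "?Y 0 = id" by (auto simp: Z0)
  show "bounded_clinear (?Y z)" if "z \<in> sector \<theta>" for z
    by (rule bounded_clinear_compose[OF bounded_clinear_scaleC lin[OF that]])
  show "?Y (z + w) = ?Y z \<circ> ?Y w" if "z \<in> sector \<theta>" "w \<in> sector \<theta>" for z w
    using that bounded_clinearD(2)[OF lin]
    by (simp add: fun_eq_iff semi scaleC_scaleC distrib_left exp_add mult.commute)
  show "\<exists>d. ((\<lambda>h. inverse h *\<^sub>C (?Y (z + h) x - ?Y z x)) \<longlongrightarrow> d) (at 0)" if z: "z \<in> sector \<theta>" for x z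
  proof -
    obtain d where d: "cderiv (\<lambda>z. Z z x) d z" using diff[OF z] by blast
    have "((\<lambda>z. exp (of_real k * z)) has_field_derivative of_real k * exp (of_real k * z)) (at z)"
      by (auto intro!: derivative_eq_intros)
    from cderiv_scaleC[OF this d] show ?thesis unfolding cderiv_def by blast
  qed
  show "((\<lambda>z. ?Y z x) \<longlongrightarrow> x) (at 0 within sector \<theta>)" for x
  proof -
    have "((\<lambda>z. ?Y z x) \<longlongrightarrow> exp (of_real k * 0) *\<^sub>C x) (at 0 within sector \<theta>)"
      by (intro scaleC.tendsto lim tendsto_intros)
    then show ?thesis by simp
  qed
qed

lemma generator_rescaled_iff:
  fixes S :: "real \<Rightarrow> 'e::complex_banach \<Rightarrow> 'e"
  shows "(x, y) \<in> generator (\<lambda>t x. exp (of_real (k * t)) *\<^sub>C S t x) \<longleftrightarrow>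
    ((\<lambda>h. (S h x - x) /\<^sub>R h) \<longlongrightarrow> y - k *\<^sub>R x) (at_right 0)" (is "?L \<longleftrightarrow> ?R")
proof -
  define q where "q h = (exp (k * h) *\<^sub>R S h x - x) /\<^sub>R h" for h
  have L: "?L \<longleftrightarrow> (q \<longlongrightarrow> y) (at_right 0)"
    unfolding generator_def q_def exp_of_real scaleC_of_real by simp
  have d: "((\<lambda>h. (exp (m * h) - 1) / h) \<longlongrightarrow> m) (at_right 0)" for m :: real
  proof -
    have "((\<lambda>h. exp (m * h)) has_real_derivative m) (at 0)"
      by (auto intro!: derivative_eq_intros)
    then have "((\<lambda>h. (exp (m * h) - 1) / h) \<longlongrightarrow> m) (at 0)"
      by (simp add: DERIV_def)
    then show ?thesis by (rule filterlim_mono) (auto simp: at_le)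
  qed
  have e: "((\<lambda>h. exp (m * h)) \<longlongrightarrow> 1) (at_right 0)" for m :: real
  proof -
    have "((\<lambda>h. exp (m * h)) \<longlongrightarrow> exp (m * 0)) (at_right 0)" by (intro tendsto_intros)
    then show ?thesis by simp
  qed
  show ?thesis
  proof
    assume ?L
    then have q: "(q \<longlongrightarrow> y) (at_right 0)" by (rule L[THEN iffD1])
    have "((\<lambda>h. exp (- k * h) *\<^sub>R q h + ((exp (- k * h) - 1) / h) *\<^sub>R x) \<longlongrightarrow> 1 *\<^sub>R y + (- k) *\<^sub>R x) (at_right 0)"
      by (intro tendsto_intros q d e)
    moreover have "exp (- k * h) *\<^sub>R q h + ((exp (- k * h) - 1) / h) *\<^sub>R x = (S h x - x) /\<^sub>R h" for h
    proof -
      have "exp (- k * h) *\<^sub>R q h = inverse h *\<^sub>R ((exp (- k * h) * exp (k * h)) *\<^sub>R S h x - exp (- k * h) *\<^sub>R x)"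
        by (simp add: q_def scaleR_diff_right mult_ac)
      also have "exp (- k * h) * exp (k * h) = 1" by (simp flip: exp_add)
      finally show ?thesis
        by (simp add: divide_inverse algebra_simps)
    qed
    ultimately show ?R by simp
  next
    assume R: ?R
    have "((\<lambda>h. exp (k * h) *\<^sub>R ((S h x - x) /\<^sub>R h) + ((exp (k * h) - 1) / h) *\<^sub>R x) \<longlongrightarrow> 1 *\<^sub>R (y - k *\<^sub>R x) + k *\<^sub>R x) (at_right 0)"
      by (intro tendsto_add tendsto_scaleR R d e tendsto_const)
    moreover have "exp (k * h) *\<^sub>R ((S h x - x) /\<^sub>R h) + ((exp (k * h) - 1) / h) *\<^sub>R x = q h" for h
      by (simp add: q_def divide_inverse algebra_simps)
    ultimately show ?L unfolding L by simp
  qed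
qed

text \<open>The chosen semigroups are accessible only through \<open>analytic_semigroup\<close> and
  \<open>generator\<close>; these are the real-variable consequences that later arguments draw
  on.\<close>

lemma analytic_semigroup_D:
  assumes S: "analytic_semigroup S"
  shows analytic_semigroup_0: "S 0 x = x"
    and analytic_semigroup_clinear: "0 \<le> t \<Longrightarrow> bounded_clinear (S t)"
    and analytic_semigroup_deriv:
      "0 < t \<Longrightarrow> \<exists>y. (S t x, y) \<in> generator S \<and> ((\<lambda>t. S t x) has_vector_derivative y) (at t)"
    and analytic_semigroup_continuous: "continuous_on {0..} (\<lambda>t. S t x)"
proof -
  obtain \<theta> Z where \<theta>: "0 < \<theta>" and SZ: "\<And>t. 0 \<le> t \<Longrightarrow> S t = Z (of_real t)" and Z0: "Z 0 = id"
    and lin: "\<And>z. z \<in> sector \<theta> \<Longrightarrow> bounded_clinear (Z z)"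
    and semi: "\<And>z w. z \<in> sector \<theta> \<Longrightarrow> w \<in> sector \<theta> \<Longrightarrow> Z (z + w) = Z z \<circ> Z w"
    and diff: "\<And>z x. z \<in> sector \<theta> \<Longrightarrow> \<exists>d. cderiv (\<lambda>z. Z z x) d z"
    and lim: "\<And>x. ((\<lambda>z. Z z x) \<longlongrightarrow> x) (at 0 within sector \<theta>)"
    using S unfolding analytic_semigroup_def cderiv_def by blast
  show S0: "S 0 x = x" using SZ[of 0] Z0 by simp
  show "bounded_clinear (S t)" if "0 \<le> t"
  proof (cases "t = 0")
    case True
    then show ?thesis using SZ[of 0] Z0 by (simp add: bounded_clinear_def id_def)
  qed (use that SZ[of t] lin[OF of_real_sector] \<theta> in simp)
  show deriv: "\<exists>y. (S t x, y) \<in> generator S \<and> ((\<lambda>t. S t x) has_vector_derivative y) (at t)" if t: "0 < t" for t x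
  proof -
    obtain d where d: "cderiv (\<lambda>z. Z z x) d (of_real t)"
      using diff of_real_sector[OF t \<theta>] by blast
    then have "((\<lambda>t. Z (of_real t * 1) x) has_vector_derivative 1 *\<^sub>C d) (at t)"
      by (intro cderiv_imp_has_vector_derivative) auto
    then have "((\<lambda>t. Z (of_real t) x) has_vector_derivative d) (at t)" by simp
    then have 1: "((\<lambda>t. S t x) has_vector_derivative d) (at t)"
      by (rule has_vector_derivative_transform_within_open[where S = "{0<..}"]) (use t SZ in auto)
    have "filterlim (\<lambda>h::real. complex_of_real h) (at 0) (at_right 0)"
      unfolding filterlim_at
      by (auto simp: eventually_at_filter intro!: tendsto_eq_intros)
    from filterlim_compose[OF d[unfolded cderiv_def] this]
    have "((\<lambda>h::real. inverse (of_real h) *\<^sub>C (Z (of_real t + of_real h) x - Z (of_real t) x)) \<longlongrightarrow> d) (at_right 0)" .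
    then have "((\<lambda>h. (S h (S t x) - S t x) /\<^sub>R h) \<longlongrightarrow> d) (at_right 0)"
    proof (rule Lim_transform_eventually)
      show "\<forall>\<^sub>F h::real in at_right 0. inverse (of_real h) *\<^sub>C (Z (of_real t + of_real h) x - Z (of_real t) x)
          = (S h (S t x) - S t x) /\<^sub>R h"
        using eventually_at_right_less[of 0]
      proof eventually_elim
        case (elim h)
        then have "Z (of_real h + of_real t) = Z (of_real h) \<circ> Z (of_real t)"
          by (intro semi of_real_sector \<theta> t)
        then show ?case using elim t SZ by (simp add: add.commute flip: scaleC_of_real)
      qed
    qed
    then show ?thesis using 1 by (auto simp: generator_def)
  qed
  show "continuous_on {0..} (\<lambda>t. S t x)"
    unfolding continuous_on_eq_continuous_within
  proof
    fix t :: real assume "t \<in> {0..}"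
    then consider "t = 0" | "0 < t" by force
    then show "continuous (at t within {0..}) (\<lambda>t. S t x)"
    proof cases
      case 1
      have "filterlim (\<lambda>h::real. complex_of_real h) (at 0 within sector \<theta>) (at_right 0)"
        unfolding filterlim_at using \<theta> eventually_at_right_less[of "0::real"]
        by (auto elim!: eventually_mono simp: of_real_sector intro!: tendsto_eq_intros)
      from filterlim_compose[OF lim[of x] this]
      have "((\<lambda>t. Z (of_real t) x) \<longlongrightarrow> x) (at_right 0)" .
      then have "((\<lambda>t. S t x) \<longlongrightarrow> x) (at_right 0)"
        by (rule Lim_transform_eventually)
          (use eventually_at_right_less[of "0::real"] in eventually_elim, use SZ in simp)
      then show ?thesis using 1 S0
        by (simp add: continuous_within at_within_Ici_at_right)
    next
      case 2
      then obtain y where "((\<lambda>t. S t x) has_vector_derivative y) (at t)" using deriv by blast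
      then show ?thesis
        by (meson continuous_at_imp_continuous_at_within has_vector_derivative_continuous)
    qed
  qed
qed

lemma analytic_semigroup_injective:
  fixes S :: "real \<Rightarrow> 'e::complex_hilbert \<Rightarrow> 'e"
  assumes S: "analytic_semigroup S" and T: "0 < T" and x: "S T x = 0"
  shows "x = 0"
proof -
  obtain \<theta> Z where \<theta>: "0 < \<theta>" and SZ: "\<And>t. 0 \<le> t \<Longrightarrow> S t = Z (of_real t)"
    and lin: "\<And>z. z \<in> sector \<theta> \<Longrightarrow> bounded_clinear (Z z)"
    and semi: "\<And>z w. z \<in> sector \<theta> \<Longrightarrow> w \<in> sector \<theta> \<Longrightarrow> Z (z + w) = Z z \<circ> Z w"
    and diff: "\<And>z x. z \<in> sector \<theta> \<Longrightarrow> \<exists>d. cderiv (\<lambda>z. Z z x) d z"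
    using S unfolding analytic_semigroup_def cderiv_def by blast
  have "open (sector (min \<theta> 1))" by (rule open_sector) simp
  moreover have "1 \<in> sector (min \<theta> 1)" using of_real_sector[of 1 "min \<theta> 1"] \<theta> by simp
  ultimately obtain \<delta> where \<delta>: "0 < \<delta>" "ball 1 \<delta> \<subseteq> sector (min \<theta> 1)"
    using open_contains_ball by blast
  \<comment> \<open>The cone over a small ball around 1: open and connected by construction,
    contained in the sector and containing the positive axis. The orbit vanishes on the axis beyond
    \<open>T\<close>, hence on all of \<open>D\<close>, in particular at all positive times.\<close>
  define D :: "complex set" where "D = (\<Union>r\<in>{0<..}. (\<lambda>w. r *\<^sub>R w) ` ball 1 \<delta>)"
  have "open D" unfolding D_def by (intro open_UN ballI open_scaling) auto
  moreover have "connected D"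
  proof -
    have "D = (\<lambda>(r, w). r *\<^sub>R w) ` ({0<..} \<times> ball 1 \<delta>)" by (auto simp: D_def)
    also have "connected \<dots>"
      by (intro connected_continuous_image connected_Times) (auto simp: case_prod_beta intro!: continuous_intros)
    finally show ?thesis .
  qed
  moreover have Ds: "D \<subseteq> sector \<theta>"
  proof
    fix z assume "z \<in> D"
    then obtain r w where "0 < r" "w \<in> ball 1 \<delta>" "z = of_real r * w" by (auto simp: D_def scaleR_conv_of_real)
    moreover from this have "w \<in> sector (min \<theta> 1)" using \<delta> by auto
    ultimately show "z \<in> sector \<theta>" by (auto simp: sector_def Arg_times_of_real)
  qed
  have pos: "of_real r \<in> D" if "0 < r" for r
    unfolding D_def using that \<delta> by (auto intro!: bexI[of _ r] image_eqI[of _ _ 1] simp: scaleR_conv_of_real)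
  have "cinner (Z z x) y = 0" if z: "z \<in> D" for z y
  proof (rule analytic_continuation[of "\<lambda>z. cinner (Z z x) y" D "of_real ` {T<..}" "of_real (T + 1)"])
    show "(\<lambda>z. cinner (Z z x) y) holomorphic_on D"
      unfolding holomorphic_on_open[OF \<open>open D\<close>]
    proof
      fix z assume "z \<in> D"
      then obtain d where "cderiv (\<lambda>z. Z z x) d z" using diff Ds by blast
      from cderiv_imp_DERIV[OF this cinner.bounded_linear_left, of y]
      show "\<exists>f'. ((\<lambda>z. cinner (Z z x) y) has_field_derivative f') (at z)"
        by (auto simp: cinner_scaleC_left)
    qed
    show "of_real ` {T<..} \<subseteq> D" "of_real (T + 1) \<in> D" using T pos pos[of "T + 1"] by (auto simp del: of_real_add)
    show "of_real (T + 1) islimpt (of_real ` {T<..} :: complex set)"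
      unfolding islimpt_approachable
    proof (intro allI impI)
      fix e :: real assume "0 < e"
      then show "\<exists>x'\<in>of_real ` {T<..}. x' \<noteq> of_real (T + 1) \<and> dist x' (of_real (T + 1) :: complex) < e"
        by (intro bexI[of _ "of_real (T + 1 + e / 2)"]) (auto simp: dist_norm simp flip: of_real_add of_real_diff)
    qed
    fix w :: complex assume "w \<in> of_real ` {T<..}"
    then obtain s where s: "T < s" "w = of_real s" by auto
    have "Z (of_real (s - T) + of_real T) = Z (of_real (s - T)) \<circ> Z (of_real T)"
      by (intro semi of_real_sector) (use s T \<theta> in auto)
    then have "Z w x = Z (of_real (s - T)) (S T x)"
      using s T SZ[of T] by (simp flip: of_real_add)
    also have "\<dots> = 0"
      unfolding x by (rule bounded_clinearD(5)[OF lin[OF of_real_sector]]) (use s \<theta> in auto)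
    finally show "cinner (Z w x) y = 0" by (simp add: cinner.zero_left)
  qed (use \<open>open D\<close> \<open>connected D\<close> z in auto)
  then have 0: "S t x = 0" if "0 < t" for t
    using cinner_self_eq_0[of "S t x"] pos[OF that] that SZ by simp
  have "((\<lambda>t. S t x) \<longlongrightarrow> S 0 x) (at 0 within {0..})"
    using analytic_semigroup_continuous[OF S, of x] by (auto simp: continuous_on_def)
  then have "((\<lambda>t. S t x) \<longlongrightarrow> x) (at_right 0)"
    by (simp add: analytic_semigroup_0[OF S] at_within_Ici_at_right)
  moreover have "((\<lambda>t. S t x) \<longlongrightarrow> 0) (at_right 0)"
    by (rule Lim_transform_eventually[OF tendsto_const])
      (use eventually_at_right_less[of "0::real"] in eventually_elim, use 0 in simp)
  ultimately show ?thesis by (intro tendsto_unique[of "at_right (0::real)"]) auto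
qed

text \<open>The mean value inequality for \<open>w t - t *\<^sub>R d\<close> on
  \<open>{s..h}\<close>, followed by the limit of \<open>s\<close> to 0, replaces differentiability
  at the endpoint.\<close>

lemma right_derivative_limit:
  fixes w :: "real \<Rightarrow> 'e::real_normed_vector"
  assumes lim0: "(w \<longlongrightarrow> v) (at_right 0)"
    and der: "\<And>t. 0 < t \<Longrightarrow> (w has_vector_derivative w' t) (at t)"
    and lim: "(w' \<longlongrightarrow> d) (at_right 0)"
  shows "((\<lambda>h. (w h - v) /\<^sub>R h) \<longlongrightarrow> d) (at_right 0)"
proof (rule tendstoI)
  fix e :: real assume e: "0 < e"
  from tendstoD[OF lim, of "e / 2"] e obtain b where b: "0 < b" "\<And>t. 0 < t \<Longrightarrow> t < b \<Longrightarrow> dist (w' t) d < e / 2"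
    by (auto simp: eventually_at_right[of 0 1])
  have "dist ((w h - v) /\<^sub>R h) d < e" if h: "0 < h" "h < b" for h
  proof -
    have le: "norm ((w h - h *\<^sub>R d) - (w s - s *\<^sub>R d)) \<le> e / 2 * norm (h - s)" if s: "0 < s" "s \<le> h" for s
    proof (rule differentiable_bound[where S = "{s..h}" and f' = "\<lambda>t r. r *\<^sub>R (w' t - d)"])
      fix t assume t: "t \<in> {s..h}"
      have "((\<lambda>t. w t - t *\<^sub>R d) has_vector_derivative w' t - d) (at t within {s..h})"
        by (rule has_vector_derivative_at_within) (use t s in \<open>auto intro!: derivative_eq_intros der\<close>)
      then show "((\<lambda>t. w t - t *\<^sub>R d) has_derivative (\<lambda>r. r *\<^sub>R (w' t - d))) (at t within {s..h})"
        by (simp add: has_vector_derivative_def)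
      have "norm (w' t - d) < e / 2" using b(2)[of t] t s h by (simp add: dist_norm)
      then have "norm (r *\<^sub>R (w' t - d)) \<le> e / 2 * norm r" for r :: real
        using \<open>norm (w' t - d) < e / 2\<close> mult_left_mono[of "norm (w' t - d)" "e / 2" "norm r"] by (simp add: mult_ac)
      then show "onorm (\<lambda>r. r *\<^sub>R (w' t - d)) \<le> e / 2"
        using e by (intro onorm_bound) auto
    qed (use s in auto)
    have "norm ((w h - h *\<^sub>R d) - (v - 0 *\<^sub>R d)) \<le> e / 2 * norm (h - 0)"
    proof (rule tendsto_le)
      show "((\<lambda>s. e / 2 * norm (h - s)) \<longlongrightarrow> e / 2 * norm (h - 0)) (at_right 0)" by (intro tendsto_intros)
      show "((\<lambda>s. norm ((w h - h *\<^sub>R d) - (w s - s *\<^sub>R d))) \<longlongrightarrow> norm ((w h - h *\<^sub>R d) - (v - 0 *\<^sub>R d))) (at_right 0)"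
        by (intro tendsto_intros lim0)
      show "\<forall>\<^sub>F s in at_right 0. norm ((w h - h *\<^sub>R d) - (w s - s *\<^sub>R d)) \<le> e / 2 * norm (h - s)"
        unfolding eventually_at_right[OF h(1)] using le h by (intro exI[of _ h]) auto
    qed simp
    then have "norm (w h - v - h *\<^sub>R d) \<le> e / 2 * h" using h by (simp add: algebra_simps)
    then have "inverse h * norm (w h - v - h *\<^sub>R d) \<le> e / 2" using h by (simp add: field_simps)
    moreover have "(w h - v) /\<^sub>R h - d = inverse h *\<^sub>R (w h - v - h *\<^sub>R d)"
      using h by (simp add: scaleR_diff_right)
    ultimately have "norm ((w h - v) /\<^sub>R h - d) \<le> e / 2"
      using h by (simp only: norm_scaleR) simp
    then show ?thesis using e by (simp add: dist_norm)
  qed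
  then show "\<forall>\<^sub>F h in at_right 0. dist ((w h - v) /\<^sub>R h) d < e"
    unfolding eventually_at_right[OF b(1)] using b(1) by (intro exI[of _ b]) auto
qed

context shifted_form
begin

section \<open>Existence of the semigroups on \<open>H\<close> and on the antidual, and their
  identification\<close>

abbreviation "La \<equiv> lax_milgram_ext a"

lemma La_eq: "La u = Lp u - \<kappa> *\<^sub>R \<iota> u"
  by (simp add: Lp_def)

sublocale La: bounded_linear La
proof -
  have "bounded_linear (\<lambda>u. Lp u - \<kappa> *\<^sub>R \<iota> u)"
    by (intro bounded_linear_sub Lp.bounded_linear_axioms bounded_linear_const_scaleR
        bounded_linear_compose[OF j.bounded_linear_axioms i.bounded_linear_axioms])
  then show "bounded_linear La" by (simp add: La_eq[abs_def])
qed

lemma Lp_clinear: "bounded_clinear Lp" and J_clinear: "bounded_clinear J" and j_clinear: "bounded_clinear j"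
  by (simp_all add: bounded_clinear_def Lp.bounded_linear_axioms J.bounded_linear_axioms
      j.bounded_linear_axioms Lp_scaleC J_scaleC j_scaleC)

text \<open>The semigroup on \<open>V\<close> conjugated by the isomorphism \<open>Lp\<close>. Its
  strong continuity and boundedness are therefore those of \<open>UV\<close> in the norm of
  \<open>V\<close>.\<close>

definition Us :: "complex \<Rightarrow> 'v antidual \<Rightarrow> 'v antidual" where
  "Us z f = (if z = 0 then f else Lp (UV z (i (J f))))"

text \<open>The rescaled \<open>U\<close> witnesses that the choice behind \<open>exp_minus\<close>
  is not vacuous. From here on only these two properties of \<open>exp_minus\<close> enter.\<close>

lemma exp_minus_props:
  "analytic_semigroup (exp_minus i a)" "generator (exp_minus i a) = neg_op (lax_milgram i a)"
proof -
  define S where "S = (\<lambda>t x. exp (of_real (\<kappa> * t)) *\<^sub>C U (of_real t) x)"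
  obtain \<theta> where \<theta>: "0 < \<theta>" "\<theta> \<le> 1" "sector \<theta> \<subseteq> open_cone"
    using sector_subset_open_cone by blast
  have cone: "z \<in> cone" if "z \<in> sector \<theta>" for z using that \<theta> open_coneD by blast
  have "analytic_semigroup S"
    unfolding S_def
  proof (rule analytic_semigroup_rescaled[OF \<theta>(1,2)])
    show "\<exists>d. cderiv (\<lambda>z. U z x) d z" if "z \<in> sector \<theta>" for z x
      using U_cderiv_AG \<theta> that by blast
    show "((\<lambda>z. U z x) \<longlongrightarrow> x) (at 0 within sector \<theta>)" for x
      by (rule tendsto_within_subset[OF U_tendsto_0]) (use cone in auto)
  qed (auto simp: U_bounded_clinear U_semigroup cone)
  moreover have "generator S = neg_op (lax_milgram i a)"
  proof (rule set_eqI, safe)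
    fix x y
    have "(x, y) \<in> generator S \<longleftrightarrow> AG x (- (y - \<kappa> *\<^sub>R x))"
      unfolding S_def generator_rescaled_iff generator_U_iff ..
    also have "\<dots> \<longleftrightarrow> (\<exists>u. x = i u \<and> (\<forall>v. a u v = cinner (- y) (i v)))"
    proof -
      have "Lp u = j (- (y - \<kappa> *\<^sub>R i u)) \<longleftrightarrow> (\<forall>v. a u v = cinner (- y) (i v))" for u
      proof -
        have "Lp u = j (- (y - \<kappa> *\<^sub>R i u)) \<longleftrightarrow> (\<forall>v. ap u v = cinner (- (y - \<kappa> *\<^sub>R i u)) (i v))"
          by (metis antidual_eqI pair_Lp pair_j)
        also have "\<dots> \<longleftrightarrow> (\<forall>v. a u v = cinner (- y) (i v))"
          by (simp add: ap_def cinner_minus_left cinner_diff_left cinner_scaleR_left algebra_simps)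
            (simp add: add_eq_0_iff2)
        finally show ?thesis .
      qed
      then show ?thesis by (auto simp: AG_def)
    qed
    also have "\<dots> \<longleftrightarrow> (x, y) \<in> neg_op (lax_milgram i a)"
      unfolding neg_op_def lax_milgram_def by (auto simp: minus_equation_iff[of y] intro!: exI[of _ "- y"])
    finally have iff: "(x, y) \<in> generator S \<longleftrightarrow> (x, y) \<in> neg_op (lax_milgram i a)" .
    show "(x, y) \<in> generator S \<Longrightarrow> (x, y) \<in> neg_op (lax_milgram i a)"
      and "(x, y) \<in> neg_op (lax_milgram i a) \<Longrightarrow> (x, y) \<in> generator S"
      using iff by auto
  qed
  ultimately have "analytic_semigroup (exp_minus i a) \<and> generator (exp_minus i a) = neg_op (lax_milgram i a)"
    unfolding exp_minus_def generated_semigroup_def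
    by (intro someI[of "\<lambda>S. analytic_semigroup S \<and> generator S = neg_op (lax_milgram i a)" S]) simp
  then show "analytic_semigroup (exp_minus i a)" "generator (exp_minus i a) = neg_op (lax_milgram i a)" by auto
qed

lemma UV_real_tendsto: "((\<lambda>t. UV (of_real t) (i v)) \<longlongrightarrow> v) (at_right 0)"
proof (rule filterlim_compose[OF UV_tendsto_0])
  have "((\<lambda>t::real. complex_of_real t) \<longlongrightarrow> of_real 0) (at_right 0)" by (intro tendsto_intros)
  then show "filterlim (\<lambda>t::real. complex_of_real t) (at 0 within open_cone) (at_right 0)"
    unfolding filterlim_at using eventually_at_right_less[of "0::real"]
    by (auto elim!: eventually_mono simp: open_cone_of_real)
qed

text \<open>Conjugation turns the statement into one about \<open>v = J f\<close>. If
  \<open>f\<close> is in the image of \<open>V\<close>, the derivative is taken in the norm of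
  \<open>V\<close>; conversely, a limit in the antidual yields one in \<open>H\<close>, to which
  \<open>generator_U_iff\<close> applies.\<close>

lemma generator_Us_iff:
  "((\<lambda>h. (Us (of_real h) f - f) /\<^sub>R h) \<longlongrightarrow> g) (at_right 0) \<longleftrightarrow> (\<exists>u. f = \<iota> u \<and> g = - Lp u)" (is "?L \<longleftrightarrow> ?R")
proof
  assume ?R
  then obtain u where u: "f = \<iota> u" "g = - Lp u" by blast
  define v where "v = J f"
  have AG: "AG (i v) (i u)" by (simp add: AG_iff v_def u)
  have "((\<lambda>h. (UV (of_real h) (i v) - v) /\<^sub>R h) \<longlongrightarrow> - u) (at_right 0)"
  proof (rule right_derivative_limit[OF UV_real_tendsto])
    show "((\<lambda>t. UV (of_real t) (i v)) has_vector_derivative - UV (of_real t) (i u)) (at t)" if "0 < t" for t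
      using UV_has_vector_derivative[of t 1, OF _ AG] open_cone_of_real[OF that] by simp
    show "((\<lambda>t. - UV (of_real t) (i u)) \<longlongrightarrow> - u) (at_right 0)"
      by (intro tendsto_minus UV_real_tendsto)
  qed
  from Lp.tendsto[OF this] have "((\<lambda>h. Lp ((UV (of_real h) (i v) - v) /\<^sub>R h)) \<longlongrightarrow> - Lp u) (at_right 0)"
    by (simp add: Lp.neg)
  then show ?L unfolding u(2)
    by (rule Lim_transform_eventually)
      (use eventually_at_right_less[of "0::real"] in eventually_elim,
        simp add: Us_def v_def Lp.scaleR Lp.diff)
next
  assume L: ?L
  define v where "v = J f"
  have "((\<lambda>h. J ((Us (of_real h) f - f) /\<^sub>R h)) \<longlongrightarrow> J g) (at_right 0)"
    by (rule J.tendsto[OF L])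
  then have "((\<lambda>h. (UV (of_real h) (i v) - v) /\<^sub>R h) \<longlongrightarrow> J g) (at_right 0)"
    by (rule Lim_transform_eventually)
      (use eventually_at_right_less[of "0::real"] in eventually_elim,
        simp add: Us_def v_def J.scaleR J.diff)
  from i.tendsto[OF this] have "((\<lambda>h. (U (of_real h) (i v) - i v) /\<^sub>R h) \<longlongrightarrow> i (J g)) (at_right 0)"
    by (rule Lim_transform_eventually)
      (use eventually_at_right_less[of "0::real"] in eventually_elim,
        simp add: i_UV open_cone_of_real i.scaleR i.diff)
  then have "AG (i v) (- i (J g))" by (simp add: generator_U_iff)
  then have "v = J (j (- i (J g)))" by (simp only: AG_iff i_eq_iff)
  then have "v = J (\<iota> (- J g))" by (simp only: i.neg)
  then have "f = \<iota> (- J g)" by (metis Lp_J v_def)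
  then show ?R by (intro exI[of _ "- J g"]) (simp add: Lp.neg)
qed

lemma Us_semigroup:
  assumes "z \<in> open_cone" "w \<in> open_cone" "z + w \<noteq> 0"
  shows "Us (z + w) f = Us z (Us w f)"
proof -
  have "UV z (i (UV w x)) = UV (z + w) x" for x
    using assms open_coneD by (simp add: i_UV) (simp add: UV_def U_semigroup)
  then show ?thesis using assms open_coneD by (simp add: Us_def)
qed

lemma Us_clinear: "z \<in> open_cone \<Longrightarrow> bounded_clinear (Us z)"
  using open_coneD(2)[of z] unfolding Us_def[abs_def]
  by (auto intro!: bounded_clinear_compose[OF Lp_clinear] bounded_clinear_compose[OF UV_bounded_clinear]
      bounded_clinear_compose[OF i_clinear] J_clinear)

lemma Us_semigroup_props:
  defines "S \<equiv> \<lambda>t x. exp (of_real (\<kappa> * t)) *\<^sub>C Us (of_real t) x"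
  shows "analytic_semigroup S" "generator S = neg_op (lax_milgram_ext_graph i a)"
proof -
  obtain \<theta> where \<theta>: "0 < \<theta>" "\<theta> \<le> 1" "sector \<theta> \<subseteq> open_cone"
    using sector_subset_open_cone by blast
  show "analytic_semigroup S"
    unfolding S_def
  proof (rule analytic_semigroup_rescaled[OF \<theta>(1,2)])
    fix z x assume z: "z \<in> sector \<theta>"
    then have zo: "z \<in> open_cone" using \<theta> by blast
    show "bounded_clinear (Us z)" by (rule Us_clinear[OF zo])
    obtain d where "cderiv (\<lambda>z. UV z (i (J x))) d z" using UV_cderiv[OF zo] by blast
    from cderiv_bounded_clinear[OF this Lp_clinear]
    have "cderiv (\<lambda>z. Us z x) (Lp d) z"
      by (rule cderiv_cong_ev[OF _ open_open_cone zo]) (use open_coneD in \<open>auto simp: Us_def\<close>)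
    then show "\<exists>d. cderiv (\<lambda>z. Us z x) d z" by blast
  next
    fix z w x assume zw: "z \<in> sector \<theta>" "w \<in> sector \<theta>"
    have "0 < Re (z + w)" using zw sector_Re_pos \<theta> by (simp add: add_pos_pos)
    then have "z + w \<noteq> 0" by (metis less_irrefl zero_complex.sel(1))
    then show "Us (z + w) x = Us z (Us w x)" using zw \<theta> by (intro Us_semigroup) auto
  next
    fix x
    have "((\<lambda>z. Lp (UV z (i (J x)))) \<longlongrightarrow> Lp (J x)) (at 0 within sector \<theta>)"
      by (intro Lp.tendsto tendsto_within_subset[OF UV_tendsto_0] \<theta>)
    then have "((\<lambda>z. Lp (UV z (i (J x)))) \<longlongrightarrow> x) (at 0 within sector \<theta>)" by simp
    then show "((\<lambda>z. Us z x) \<longlongrightarrow> x) (at 0 within sector \<theta>)"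
      by (rule Lim_transform_eventually) (auto simp: Us_def eventually_at_filter)
  qed (simp add: Us_def)
  show "generator S = neg_op (lax_milgram_ext_graph i a)"
  proof (rule set_eqI, safe)
    fix x y
    have "(x, y) \<in> generator S \<longleftrightarrow> (\<exists>u. x = \<iota> u \<and> y - \<kappa> *\<^sub>R x = - Lp u)"
      unfolding S_def generator_rescaled_iff generator_Us_iff ..
    also have "\<dots> \<longleftrightarrow> (\<exists>u. x = \<iota> u \<and> y = - La u)"
      by (auto simp: La_eq algebra_simps)
    also have "\<dots> \<longleftrightarrow> (x, y) \<in> neg_op (lax_milgram_ext_graph i a)"
      unfolding neg_op_def lax_milgram_ext_graph_def by auto
    finally have iff: "(x, y) \<in> generator S \<longleftrightarrow> (x, y) \<in> neg_op (lax_milgram_ext_graph i a)" .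
    show "(x, y) \<in> generator S \<Longrightarrow> (x, y) \<in> neg_op (lax_milgram_ext_graph i a)"
      and "(x, y) \<in> neg_op (lax_milgram_ext_graph i a) \<Longrightarrow> (x, y) \<in> generator S"
      using iff by auto
  qed
qed

lemma exp_minus_ext_props:
  "analytic_semigroup (exp_minus_ext i a)"
  "generator (exp_minus_ext i a) = neg_op (lax_milgram_ext_graph i a)"
proof -
  have "analytic_semigroup (exp_minus_ext i a) \<and> generator (exp_minus_ext i a) = neg_op (lax_milgram_ext_graph i a)"
    unfolding exp_minus_ext_def generated_semigroup_def
    by (rule someI[of "\<lambda>S. analytic_semigroup S \<and> generator S = neg_op (lax_milgram_ext_graph i a)",
          OF conjI[OF Us_semigroup_props]])
  then show "analytic_semigroup (exp_minus_ext i a)"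
    "generator (exp_minus_ext i a) = neg_op (lax_milgram_ext_graph i a)" by auto
qed

text \<open>The class is wide enough for orbits of any semigroup with the right generator and for
  images of orbits in \<open>H\<close>, with no differentiability at 0. Uniqueness in it identifies
  semigroups given by different choices.\<close>

definition classical_sol :: "(real \<Rightarrow> 'v antidual) \<Rightarrow> bool" where
  "classical_sol w \<longleftrightarrow> continuous_on {0..} w \<and>
    (\<forall>t>0. \<exists>u. w t = \<iota> u \<and> (w has_vector_derivative - La u) (at t))"

lemma classical_sol_diff:
  assumes "classical_sol w" "classical_sol w'"
  shows "classical_sol (\<lambda>t. w t - w' t)"
  unfolding classical_sol_def
proof (intro conjI allI impI)
  show "continuous_on {0..} (\<lambda>t. w t - w' t)"
    using assms by (intro continuous_intros) (auto simp: classical_sol_def)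
  fix t :: real assume t: "0 < t"
  obtain u where u: "w t = \<iota> u" "(w has_vector_derivative - La u) (at t)"
    using assms(1) t by (auto simp: classical_sol_def)
  obtain u' where u': "w' t = \<iota> u'" "(w' has_vector_derivative - La u') (at t)"
    using assms(2) t by (auto simp: classical_sol_def)
  show "\<exists>u. w t - w' t = \<iota> u \<and> ((\<lambda>t. w t - w' t) has_vector_derivative - La u) (at t)"
    using has_vector_derivative_diff[OF u(2) u'(2)]
    by (intro exI[of _ "u - u'"]) (simp add: u(1) u'(1) i.diff j.diff La.diff)
qed

text \<open>Near 0 a solution is bounded only in the antidual, so the energy is taken for
  \<open>q = J (w t)\<close> instead. Its derivative contains \<open>- i u\<close> with
  \<open>Lp q = \<iota> u\<close>, which contributes minus the real part of \<open>ap q q\<close>;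
  the weight \<open>exp (- 2 * \<kappa> * t)\<close> cancels the rest.\<close>

lemma classical_sol_unique:
  assumes w: "classical_sol w" and w0: "w 0 = 0" and t: "0 \<le> t"
  shows "w t = 0"
proof (cases "t = 0")
  case False
  then have t: "0 < t" using t by simp
  define q where "q t = J (w t)" for t
  define f where "f t = exp (- 2 * \<kappa> * t) * (norm (i (q t)))\<^sup>2" for t
  have "f t \<le> 0 + 0 * t"
  proof (rule bound_from_derivative_at_0[OF _ _ t])
    fix t :: real assume t: "0 < t"
    obtain u where u: "w t = \<iota> u" "(w has_vector_derivative - La u) (at t)"
      using w t by (auto simp: classical_sol_def)
    have "((\<lambda>t. i (q t)) has_vector_derivative i (J (- La u))) (at t)"
      unfolding q_def by (intro i.has_vector_derivative J.has_vector_derivative u)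
    moreover have "i (J (- La u)) = \<kappa> *\<^sub>R i (q t) - i u"
      by (simp add: La_eq q_def u J.diff J.scaleR i.diff i.scaleR)
    ultimately have d: "((\<lambda>t. i (q t)) has_vector_derivative \<kappa> *\<^sub>R i (q t) - i u) (at t)" by simp
    have "cinner (i u) (i (q t)) = ap (q t) (q t)"
      using pair_Lp[of "q t" "q t"] by (simp add: q_def u pair_j)
    then have "Re (cinner (\<kappa> *\<^sub>R i (q t) - i u) (i (q t))) = \<kappa> * (norm (i (q t)))\<^sup>2 - Re (ap (q t) (q t))"
      by (simp add: cinner_diff_left cinner_scaleR_left cinner_self)
    moreover have "0 \<le> Re (ap (q t) (q t))" using cone_Re_nonneg[of 1 "q t"] by simp
    ultimately have le: "2 * Re (cinner (\<kappa> *\<^sub>R i (q t) - i u) (i (q t))) \<le> 2 * \<kappa> * (norm (i (q t)))\<^sup>2"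
      by simp
    have "((\<lambda>t. exp (- 2 * \<kappa> * t)) has_real_derivative - 2 * \<kappa> * exp (- 2 * \<kappa> * t)) (at t)"
      by (auto intro!: derivative_eq_intros)
    from DERIV_mult[OF this norm_sq_has_derivative[OF d]]
    have "(f has_real_derivative - 2 * \<kappa> * exp (- 2 * \<kappa> * t) * (norm (i (q t)))\<^sup>2 +
        2 * Re (cinner (\<kappa> *\<^sub>R i (q t) - i u) (i (q t))) * exp (- 2 * \<kappa> * t)) (at t)"
      unfolding f_def .
    moreover have "- 2 * \<kappa> * exp (- 2 * \<kappa> * t) * (norm (i (q t)))\<^sup>2 +
        2 * Re (cinner (\<kappa> *\<^sub>R i (q t) - i u) (i (q t))) * exp (- 2 * \<kappa> * t) \<le> 0"
      using mult_right_mono[OF le, of "exp (- 2 * \<kappa> * t)"] by (simp add: mult_ac)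
    ultimately show "\<exists>D. (f has_real_derivative D) (at t) \<and> D \<le> 0" by blast
  next
    have "(w \<longlongrightarrow> w 0) (at 0 within {0..})"
      using w by (auto simp: classical_sol_def continuous_on_def)
    then have "(w \<longlongrightarrow> 0) (at_right 0)" by (simp add: w0 at_within_Ici_at_right)
    then have "(f \<longlongrightarrow> exp (- 2 * \<kappa> * 0) * (norm (i (J 0)))\<^sup>2) (at_right 0)"
      unfolding f_def q_def by (intro tendsto_intros i.tendsto J.tendsto)
    then show "(f \<longlongrightarrow> 0) (at_right 0)" by (simp add: J.zero i.zero)
  qed
  then have "norm (i (q t)) = 0" by (simp add: f_def mult_le_0_iff)
  then have "q t = 0" using i_eq_iff[of "q t" 0] by (simp add: i.zero)
  then show ?thesis using Lp_J[of "w t"] by (simp add: q_def Lp.zero)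
qed (use w0 in simp)

lemma classical_sol_semigroup:
  assumes S: "analytic_semigroup S" "generator S = neg_op (lax_milgram_ext_graph i a)"
  shows "classical_sol (\<lambda>t. S t f)"
  unfolding classical_sol_def
proof (intro conjI allI impI analytic_semigroup_continuous[OF S(1)])
  fix t :: real assume "0 < t"
  then obtain y where "(S t f, y) \<in> neg_op (lax_milgram_ext_graph i a)" "((\<lambda>t. S t f) has_vector_derivative y) (at t)"
    using analytic_semigroup_deriv[OF S(1)] S(2) by metis
  then show "\<exists>u. S t f = \<iota> u \<and> ((\<lambda>t. S t f) has_vector_derivative - La u) (at t)"
    by (auto simp: neg_op_def lax_milgram_ext_graph_def)
qed

text \<open>Needed because a bound in operator norm is available only for the explicit
  semigroup.\<close>

lemma exp_minus_ext_eq: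
  assumes "0 \<le> t"
  shows "exp_minus_ext i a t f = exp (\<kappa> * t) *\<^sub>R Us (of_real t) f"
proof -
  let ?S = "\<lambda>t x. exp (of_real (\<kappa> * t)) *\<^sub>C Us (of_real t) x"
  have "classical_sol (\<lambda>t. exp_minus_ext i a t f - ?S t f)"
    by (intro classical_sol_diff classical_sol_semigroup exp_minus_ext_props Us_semigroup_props)
  moreover have "exp_minus_ext i a 0 f - ?S 0 f = 0"
    by (simp add: analytic_semigroup_0[OF exp_minus_ext_props(1)] Us_def)
  ultimately have "exp_minus_ext i a t f - ?S t f = 0"
    using assms by (rule classical_sol_unique)
  then show ?thesis by (simp add: exp_of_real scaleC_of_real del: of_real_mult)
qed

lemma exp_minus_ext_j:
  assumes "0 \<le> t"
  shows "exp_minus_ext i a t (j x) = j (exp_minus i a t x)"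
proof -
  have "classical_sol (\<lambda>t. j (exp_minus i a t x))"
    unfolding classical_sol_def
  proof (intro conjI allI impI)
    show "continuous_on {0..} (\<lambda>t. j (exp_minus i a t x))"
      by (intro j.continuous_on analytic_semigroup_continuous exp_minus_props)
    fix t :: real assume "0 < t"
    then obtain y where y: "(exp_minus i a t x, y) \<in> neg_op (lax_milgram i a)"
        "((\<lambda>t. exp_minus i a t x) has_vector_derivative y) (at t)"
      using analytic_semigroup_deriv[OF exp_minus_props(1)] exp_minus_props(2) by metis
    then obtain u f where u: "exp_minus i a t x = i u" "y = - f" "\<And>v. a u v = cinner f (i v)"
      by (auto simp: neg_op_def lax_milgram_def)
    have "La u = j f"
      by (rule antidual_eqI) (simp add: dual_pairing_lax_milgram_ext[OF form] pair_j u)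
    then show "\<exists>u. j (exp_minus i a t x) = \<iota> u \<and> ((\<lambda>t. j (exp_minus i a t x)) has_vector_derivative - La u) (at t)"
      using j.has_vector_derivative[OF y(2)] u by (intro exI[of _ u]) (simp add: j.neg)
  qed
  then have "classical_sol (\<lambda>t. exp_minus_ext i a t (j x) - j (exp_minus i a t x))"
    by (rule classical_sol_diff[OF classical_sol_semigroup[OF exp_minus_ext_props]])
  moreover have "exp_minus_ext i a 0 (j x) - j (exp_minus i a 0 x) = 0"
    by (simp add: analytic_semigroup_0 exp_minus_ext_props(1) exp_minus_props(1))
  ultimately have "exp_minus_ext i a t (j x) - j (exp_minus i a t x) = 0"
    using assms by (rule classical_sol_unique)
  then show ?thesis by simp
qed

text \<open>The bound of the semigroup on \<open>V\<close> is conjugated by \<open>Lp\<close> and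
  \<open>J\<close>; the maximum with 1 accounts for time 0. Uniformity on \<open>[0,T]\<close> is
  what convolution with the semigroup requires.\<close>

lemma exp_minus_ext_bound: "\<exists>M>0. \<forall>t f. 0 \<le> t \<and> t \<le> T \<longrightarrow> norm (exp_minus_ext i a t f) \<le> M * norm f"
proof -
  obtain B where B: "0 < B" "\<And>x. norm (J x) \<le> norm x * B"
    using J.pos_bounded by blast
  define M where "M = exp (\<kappa> * T) * max 1 (C * (sqrt KV * B))"
  have "norm (exp_minus_ext i a t f) \<le> M * norm f" if t: "0 \<le> t" "t \<le> T" for t f
  proof -
    have "norm (Us (of_real t) f) \<le> max 1 (C * (sqrt KV * B)) * norm f"
    proof (cases "t = 0")
      case True
      then show ?thesis
        using mult_right_mono[of 1 "max 1 (C * (sqrt KV * B))" "norm f"] by (simp add: Us_def)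
    next
      case False
      then have "of_real t \<in> open_cone" using t open_cone_of_real by simp
      have "norm (Us (of_real t) f) \<le> C * norm (UV (of_real t) (i (J f)))"
        using False by (simp add: Us_def norm_Lp)
      also have "\<dots> \<le> C * (sqrt KV * norm (J f))"
        using C_pos \<open>of_real t \<in> open_cone\<close> by (intro mult_left_mono norm_UV) auto
      also have "\<dots> \<le> C * (sqrt KV * (norm f * B))"
        using C_pos KV_nonneg by (intro mult_left_mono B) auto
      also have "\<dots> \<le> max 1 (C * (sqrt KV * B)) * norm f"
        using mult_right_mono[of "C * (sqrt KV * B)" "max 1 (C * (sqrt KV * B))" "norm f"] by (simp add: mult_ac)
      finally show ?thesis .
    qed
    then have "exp (\<kappa> * t) * norm (Us (of_real t) f) \<le> exp (\<kappa> * T) * (max 1 (C * (sqrt KV * B)) * norm f)"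
      using t kappa_nonneg by (intro mult_mono) (auto intro: mult_left_mono)
    then show ?thesis using t by (simp add: exp_minus_ext_eq M_def mult.assoc)
  qed
  moreover have "0 < M" by (simp add: M_def)
  ultimately show ?thesis by blast
qed

lemma exp_minus_injective: "0 < t \<Longrightarrow> inj (exp_minus i a t)"
proof (rule injI)
  fix x y assume t: "0 < t" and eq: "exp_minus i a t x = exp_minus i a t y"
  have "exp_minus i a t (x - y) = 0"
    using bounded_clinearD(4)[OF analytic_semigroup_clinear[OF exp_minus_props(1)], of t x y] t eq by simp
  then show "x = y"
    using analytic_semigroup_injective[OF exp_minus_props(1) t, of "x - y"] by simp
qed

end

section \<open>Bochner integrals and convolutions\<close>

lemma sigma_finite_lebesgue: "sigma_finite_measure (lebesgue :: 'a::euclidean_space measure)"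
proof
  obtain A :: "'a set set" where A: "countable A" "A \<subseteq> sets lborel" "\<Union>A = space lborel"
      "\<forall>a\<in>A. emeasure lborel a \<noteq> \<infinity>"
    using lborel.sigma_finite_countable by blast
  then show "\<exists>A::'a set set. countable A \<and> A \<subseteq> sets lebesgue \<and> \<Union>A = space lebesgue \<and>
      (\<forall>a\<in>A. emeasure lebesgue a \<noteq> \<infinity>)"
    by (intro exI[of _ A]) (auto simp: subset_eq)
qed

interpretation lebesgue: sigma_finite_measure "lebesgue :: real measure"
  by (rule sigma_finite_lebesgue)

interpretation lebesgue_pair: pair_sigma_finite "lebesgue :: real measure" "lebesgue :: real measure" ..

lemma ident_measurable_lebesgue [measurable]: "(\<lambda>x::real. x) \<in> borel_measurable lebesgue"
  by (rule measurable_completion) simp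

lemma AE_lebesgue_neq: "AE x in lebesgue. x \<noteq> (c::real)"
  by (rule AE_completion[OF AE_lborel_singleton])

text \<open>Completeness: every subset of a null set is measurable, so a change on a null set cannot
  destroy measurability. It serves where an identity holds only almost everywhere, as for values
  that lie in \<open>V\<close> at almost all times.\<close>

lemma measurable_lebesgue_AE:
  fixes f g :: "real \<Rightarrow> 'b::topological_space"
  assumes f: "f \<in> borel_measurable lebesgue" and ae: "AE x in lebesgue. f x = g x"
  shows "g \<in> borel_measurable lebesgue"
proof (rule measurableI)
  fix A :: "'b set" assume A: "A \<in> sets borel"
  obtain N where N: "N \<in> null_sets lebesgue" "\<And>x. x \<notin> N \<Longrightarrow> f x = g x"
    using ae unfolding completion.AE_iff_null_sets by auto
  have sub: "B \<in> sets lebesgue" if "B \<subseteq> N" for B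
  proof -
    have "negligible N" using N(1) by (simp add: negligible_iff_null_sets)
    then have "negligible B" using that by (rule negligible_subset)
    then show ?thesis by (auto simp: negligible_iff_null_sets)
  qed
  have "g -` A \<inter> space lebesgue = ((f -` A \<inter> space lebesgue) - N) \<union> (g -` A \<inter> N)"
    using N(2) by auto
  also have "\<dots> \<in> sets lebesgue"
    by (intro sets.Un sets.Diff measurable_sets[OF f A] sub) (use N(1) in auto)
  finally show "g -` A \<inter> space lebesgue \<in> sets lebesgue" .
qed auto

definition pint :: "(real \<Rightarrow> 'e::{banach, second_countable_topology}) \<Rightarrow> real \<Rightarrow> 'e" where
  "pint g t = (LINT s:{0<..<t}|lebesgue. g s)"

lemma pint_alt: "pint g t = (\<integral>s. indicat_real {0<..<t} s *\<^sub>R g s \<partial>lebesgue)"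
  by (simp add: pint_def set_lebesgue_integral_def)

lemma pint_cong: "(\<And>s. 0 < s \<Longrightarrow> s < t \<Longrightarrow> f s = g s) \<Longrightarrow> pint f t = pint g t"
  unfolding pint_alt by (intro Bochner_Integration.integral_cong) (auto simp: indicator_def)

lemma set_integrable_sub:
  fixes g :: "real \<Rightarrow> 'e::{banach, second_countable_topology}"
  shows "set_integrable lebesgue {0<..<T} g \<Longrightarrow> t \<le> T \<Longrightarrow> set_integrable lebesgue {0<..<t} g"
  by (rule set_integrable_subset[of lebesgue "{0<..<T}"]) auto

lemma pint_bounded_linear:
  assumes "bounded_linear L" "set_integrable lebesgue {0<..<t} g"
  shows "pint (\<lambda>s. L (g s)) t = L (pint g t)"
proof -
  interpret L: bounded_linear L by fact
  have "L (pint g t) = (\<integral>s. L (indicat_real {0<..<t} s *\<^sub>R g s) \<partial>lebesgue)"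
    unfolding pint_alt using assms(2) unfolding set_integrable_def
    by (rule integral_bounded_linear[OF assms(1), symmetric])
  then show ?thesis by (simp add: pint_alt L.scaleR)
qed

lemma set_integrable_bounded_linear:
  assumes "bounded_linear L" "set_integrable lebesgue A g"
  shows "set_integrable lebesgue A (\<lambda>s. L (g s))"
proof -
  interpret L: bounded_linear L by fact
  show ?thesis using integrable_bounded_linear[OF assms(1) assms(2)[unfolded set_integrable_def]]
    by (simp add: set_integrable_def L.scaleR)
qed

lemma pint_add:
  "set_integrable lebesgue {0<..<t} f \<Longrightarrow> set_integrable lebesgue {0<..<t} g \<Longrightarrow>
    pint (\<lambda>s. f s + g s) t = pint f t + pint g t"
  and pint_diff:
  "set_integrable lebesgue {0<..<t} f \<Longrightarrow> set_integrable lebesgue {0<..<t} g \<Longrightarrow>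
    pint (\<lambda>s. f s - g s) t = pint f t - pint g t"
  unfolding pint_def by (simp_all add: set_integral_add set_integral_diff)

lemma pint_cong_AE:
  assumes "set_integrable lebesgue {0<..<t} f" "AE s\<in>{0<..<t} in lebesgue. f s = g s"
  shows "pint f t = pint g t" and "set_integrable lebesgue {0<..<t} g"
proof -
  have ae: "AE s in lebesgue. indicat_real {0<..<t} s *\<^sub>R f s = indicat_real {0<..<t} s *\<^sub>R g s"
    using assms(2) by eventually_elim (auto simp: indicator_def)
  have f: "integrable lebesgue (\<lambda>s. indicat_real {0<..<t} s *\<^sub>R f s)"
    using assms(1) by (simp add: set_integrable_def)
  have g: "(\<lambda>s. indicat_real {0<..<t} s *\<^sub>R g s) \<in> borel_measurable lebesgue"
    by (rule measurable_lebesgue_AE[OF borel_measurable_integrable[OF f] ae])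
  show "pint f t = pint g t"
    unfolding pint_alt by (rule integral_cong_AE[OF borel_measurable_integrable[OF f] g ae])
  show "set_integrable lebesgue {0<..<t} g"
    unfolding set_integrable_def
    using integrable_cong_AE[OF borel_measurable_integrable[OF f] g ae] f by simp
qed

lemma pint_0 [simp]: "pint g 0 = 0"
  by (simp add: pint_alt)

lemma continuous_imp_set_integrable:
  fixes p :: "real \<Rightarrow> 'e::{banach, second_countable_topology}"
  assumes "continuous_on {0..T} p"
  shows "set_integrable lebesgue {0<..<T} p"
proof -
  have "integrable lborel (\<lambda>x. indicator {0..T} x *\<^sub>R p x)"
    using borel_integrable_compact[OF compact_Icc assms] .
  then have "integrable lebesgue (\<lambda>x. indicator {0..T} x *\<^sub>R p x)"
    by (subst integrable_completion) (auto intro: borel_measurable_integrable)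
  then have "set_integrable lebesgue {0..T} p" by (simp add: set_integrable_def)
  then show ?thesis by (rule set_integrable_subset) auto
qed

text \<open>Fubini on the triangle \<open>s < r\<close> and its mirror image yields integration by parts.\<close>

lemma fubini_triangle:
  fixes f :: "real \<Rightarrow> 'a::{banach, second_countable_topology}"
    and g :: "real \<Rightarrow> 'b::{banach, second_countable_topology}"
    and B :: "'a \<Rightarrow> 'b \<Rightarrow> 'c::{banach, second_countable_topology}"
  assumes B: "bounded_bilinear B" and f: "integrable lebesgue f" and g: "integrable lebesgue g"
  defines "P r \<equiv> \<integral>s. indicat_real {..<r} s *\<^sub>R f s \<partial>lebesgue"
    and "Q s \<equiv> \<integral>r. indicat_real {..<s} r *\<^sub>R g r \<partial>lebesgue"
  shows "integrable lebesgue (\<lambda>s. B (f s) (Q s))" "integrable lebesgue (\<lambda>r. B (P r) (g r))"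
    and "B (integral\<^sup>L lebesgue f) (integral\<^sup>L lebesgue g) =
      (\<integral>s. B (f s) (Q s) \<partial>lebesgue) + (\<integral>r. B (P r) (g r) \<partial>lebesgue)"
proof -
  interpret B: bounded_bilinear B by fact
  note [measurable] = borel_measurable_integrable[OF f] borel_measurable_integrable[OF g]
  obtain K where K: "0 < K" "\<And>x y. norm (B x y) \<le> norm x * norm y * K"
    using B.pos_bounded by blast
  have contB: "continuous_on UNIV (\<lambda>x. B (fst x) (snd x))"
    by (intro B.continuous_on continuous_intros)
  have Bm: "(\<lambda>p. B (f (fst p)) (g (snd p))) \<in> borel_measurable (lebesgue \<Otimes>\<^sub>M lebesgue)"
    by (rule borel_measurable_continuous_Pair[OF _ _ contB]) measurable
  have int: "integrable (lebesgue \<Otimes>\<^sub>M lebesgue) (\<lambda>p. B (f (fst p)) (g (snd p)))"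
  proof (rule lebesgue_pair.Fubini_integrable[OF Bm])
    have gx: "integrable lebesgue (\<lambda>y. B (f x) (g y))" for x
      by (rule integrable_bounded_linear[OF B.bounded_linear_right g])
    then show "AE x in lebesgue. integrable lebesgue (\<lambda>y. B (f (fst (x, y))) (g (snd (x, y))))" by simp
    show "integrable lebesgue (\<lambda>x. \<integral>y. norm (B (f (fst (x, y))) (g (snd (x, y)))) \<partial>lebesgue)"
    proof (rule Bochner_Integration.integrable_bound)
      show "integrable lebesgue (\<lambda>x. norm (f x) * (\<integral>y. norm (g y) \<partial>lebesgue) * K)"
        using f by (intro integrable_mult_left integrable_norm)
      show "(\<lambda>x. \<integral>y. norm (B (f (fst (x, y))) (g (snd (x, y)))) \<partial>lebesgue) \<in> borel_measurable lebesgue"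
        by (rule lebesgue.borel_measurable_lebesgue_integral) (use Bm in measurable)
      have "(\<integral>y. norm (B (f x) (g y)) \<partial>lebesgue) \<le> (\<integral>y. norm (f x) * norm (g y) * K \<partial>lebesgue)" for x
        using gx g by (intro integral_mono integrable_norm integrable_mult_left integrable_mult_right K(2)) auto
      then show "AE x in lebesgue. norm (\<integral>y. norm (B (f (fst (x, y))) (g (snd (x, y)))) \<partial>lebesgue)
          \<le> norm (norm (f x) * (\<integral>y. norm (g y) \<partial>lebesgue) * K)"
        using K by (intro AE_I2) (simp add: abs_mult integral_nonneg_AE)
    qed
  qed
  have int1: "integrable (lebesgue \<Otimes>\<^sub>M lebesgue) (\<lambda>(s, r). indicat_real {..<s} r *\<^sub>R B (f s) (g r))"
    by (rule Bochner_Integration.integrable_bound[OF int])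
      (use Bm in \<open>auto simp: indicator_def split_beta' intro!: borel_measurable_scaleR\<close>)
  have int2: "integrable (lebesgue \<Otimes>\<^sub>M lebesgue) (\<lambda>(s, r). indicat_real {..<r} s *\<^sub>R B (f s) (g r))"
    by (rule Bochner_Integration.integrable_bound[OF int])
      (use Bm in \<open>auto simp: indicator_def split_beta' intro!: borel_measurable_scaleR\<close>)
  have ig: "integrable lebesgue (\<lambda>r. indicat_real {..<s} r *\<^sub>R g r)" for s
    by (rule integrable_mult_indicator[OF _ g]) auto
  have "(\<integral>r. indicat_real {..<s} r *\<^sub>R B (f s) (g r) \<partial>lebesgue) = B (f s) (Q s)" for s
    unfolding Q_def integral_bounded_linear[OF B.bounded_linear_right ig, symmetric] by (simp add: B.scaleR_right)
  then have 1: "integrable lebesgue (\<lambda>s. B (f s) (Q s))"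
    "(\<integral>s. B (f s) (Q s) \<partial>lebesgue) = (\<integral>(s, r). indicat_real {..<s} r *\<^sub>R B (f s) (g r) \<partial>(lebesgue \<Otimes>\<^sub>M lebesgue))"
    using lebesgue_pair.integrable_fst[OF int1] lebesgue_pair.integral_fst[OF int1] by simp_all
  have fi: "integrable lebesgue (\<lambda>s. indicat_real {..<r} s *\<^sub>R f s)" for r
    by (rule integrable_mult_indicator[OF _ f]) auto
  have "(\<integral>s. indicat_real {..<r} s *\<^sub>R B (f s) (g r) \<partial>lebesgue) = B (P r) (g r)" for r
    unfolding P_def integral_bounded_linear[OF B.bounded_linear_left fi, symmetric] by (simp add: B.scaleR_left)
  then have 2: "integrable lebesgue (\<lambda>r. B (P r) (g r))"
    "(\<integral>r. B (P r) (g r) \<partial>lebesgue) = (\<integral>(s, r). indicat_real {..<r} s *\<^sub>R B (f s) (g r) \<partial>(lebesgue \<Otimes>\<^sub>M lebesgue))"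
    using lebesgue_pair.integrable_snd[OF int2] lebesgue_pair.integral_snd[OF int2] by simp_all
  show "integrable lebesgue (\<lambda>s. B (f s) (Q s))" "integrable lebesgue (\<lambda>r. B (P r) (g r))"
    by (rule 1 2)+
  have "B (integral\<^sup>L lebesgue f) (integral\<^sup>L lebesgue g) = (\<integral>s. (\<integral>r. B (f s) (g r) \<partial>lebesgue) \<partial>lebesgue)"
    by (simp add: integral_bounded_linear[OF B.bounded_linear_right g]
        integral_bounded_linear[OF B.bounded_linear_left f])
  also have "\<dots> = (\<integral>s. (\<integral>r. indicat_real {..<s} r *\<^sub>R B (f s) (g r) + indicat_real {..<r} s *\<^sub>R B (f s) (g r) \<partial>lebesgue) \<partial>lebesgue)"
  proof (rule Bochner_Integration.integral_cong[OF refl])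
    fix s
    have ae: "AE r in lebesgue. B (f s) (g r) = indicat_real {..<s} r *\<^sub>R B (f s) (g r) + indicat_real {..<r} s *\<^sub>R B (f s) (g r)"
      using AE_lebesgue_neq[of s] by eventually_elim (auto simp: indicator_def)
    have m: "(\<lambda>r. B (f s) (g r)) \<in> borel_measurable lebesgue"
      by (rule borel_measurable_integrable[OF integrable_bounded_linear[OF B.bounded_linear_right g]])
    show "(\<integral>r. B (f s) (g r) \<partial>lebesgue) =
        (\<integral>r. indicat_real {..<s} r *\<^sub>R B (f s) (g r) + indicat_real {..<r} s *\<^sub>R B (f s) (g r) \<partial>lebesgue)"
      by (rule integral_cong_AE[OF m measurable_lebesgue_AE[OF m ae] ae])
  qed
  also have "\<dots> = (\<integral>(s, r). indicat_real {..<s} r *\<^sub>R B (f s) (g r) + indicat_real {..<r} s *\<^sub>R B (f s) (g r) \<partial>(lebesgue \<Otimes>\<^sub>M lebesgue))"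
    using Bochner_Integration.integrable_add[OF int1 int2]
    by (intro lebesgue_pair.integral_fst) (simp add: split_beta')
  also have "\<dots> = (\<integral>s. B (f s) (Q s) \<partial>lebesgue) + (\<integral>r. B (P r) (g r) \<partial>lebesgue)"
    using Bochner_Integration.integral_add[OF int1 int2] 1 2 by (simp add: split_beta')
  finally show "B (integral\<^sup>L lebesgue f) (integral\<^sup>L lebesgue g) =
      (\<integral>s. B (f s) (Q s) \<partial>lebesgue) + (\<integral>r. B (P r) (g r) \<partial>lebesgue)" .
qed

text \<open>The integral form of the product rule for primitives of integrable functions; no
  pointwise differentiability is involved. The triangle lemma treats primitives that vanish at 0,
  and the initial values are added by bilinearity.\<close>

lemma product_rule_pint:
  fixes p' :: "real \<Rightarrow> 'a::{banach, second_countable_topology}"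
    and q' :: "real \<Rightarrow> 'b::{banach, second_countable_topology}"
    and B :: "'a \<Rightarrow> 'b \<Rightarrow> 'c::{banach, second_countable_topology}"
  assumes B: "bounded_bilinear B"
    and p': "set_integrable lebesgue {0<..<T} p'" and q': "set_integrable lebesgue {0<..<T} q'"
    and p: "\<And>t. t \<in> {0..T} \<Longrightarrow> p t = p 0 + pint p' t" and q: "\<And>t. t \<in> {0..T} \<Longrightarrow> q t = q 0 + pint q' t"
    and t: "t \<in> {0..T}"
  shows "set_integrable lebesgue {0<..<t} (\<lambda>s. B (p' s) (q s) + B (p s) (q' s))"
    and "B (p t) (q t) = B (p 0) (q 0) + pint (\<lambda>s. B (p' s) (q s) + B (p s) (q' s)) t"
proof -
  interpret B: bounded_bilinear B by fact
  define f g where "f s = indicat_real {0<..<t} s *\<^sub>R p' s" and "g s = indicat_real {0<..<t} s *\<^sub>R q' s" for s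
  have f: "integrable lebesgue f" and g: "integrable lebesgue g"
    using set_integrable_sub[OF p'] set_integrable_sub[OF q'] t
    unfolding f_def[abs_def] g_def[abs_def] set_integrable_def by auto
  define P Q where "P r = (\<integral>s. indicat_real {..<r} s *\<^sub>R f s \<partial>lebesgue)"
    and "Q r = (\<integral>s. indicat_real {..<r} s *\<^sub>R g s \<partial>lebesgue)" for r
  have PQ: "p 0 + P r = p r" "q 0 + Q r = q r" if r: "r \<in> {0<..<t}" for r
  proof -
    have "P r = pint p' r" "Q r = pint q' r"
      unfolding P_def Q_def pint_alt f_def g_def using r
      by (auto intro!: Bochner_Integration.integral_cong simp: indicator_def)
    then show "p 0 + P r = p r" "q 0 + Q r = q r" using p[of r] q[of r] r t by simp_all
  qed
  note tri = fubini_triangle[OF B f g, folded P_def Q_def]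
  have i1: "integrable lebesgue (\<lambda>s. B (f s) (q 0) + B (f s) (Q s))"
    by (intro Bochner_Integration.integrable_add tri integrable_bounded_linear[OF B.bounded_linear_left] f)
  have i2: "integrable lebesgue (\<lambda>s. B (p 0) (g s) + B (P s) (g s))"
    by (intro Bochner_Integration.integrable_add tri integrable_bounded_linear[OF B.bounded_linear_right] g)
  have eq: "(B (f s) (q 0) + B (f s) (Q s)) + (B (p 0) (g s) + B (P s) (g s))
      = indicat_real {0<..<t} s *\<^sub>R (B (p' s) (q s) + B (p s) (q' s))" for s
  proof (cases "s \<in> {0<..<t}")
    case True
    then have "f s = p' s" "g s = q' s" by (auto simp: f_def g_def)
    then show ?thesis
      using PQ[OF True] True B.add_right[of "p' s" "q 0" "Q s"] B.add_left[of "p 0" "P s" "q' s"] by simp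
  next
    case False
    then have "f s = 0" "g s = 0" by (auto simp: f_def g_def)
    then show ?thesis using False by (simp add: B.zero_left B.zero_right)
  qed
  show "set_integrable lebesgue {0<..<t} (\<lambda>s. B (p' s) (q s) + B (p s) (q' s))"
    unfolding set_integrable_def eq[symmetric] by (intro Bochner_Integration.integrable_add i1 i2)
  have pt: "p t = p 0 + integral\<^sup>L lebesgue f" "q t = q 0 + integral\<^sup>L lebesgue g"
    using p[OF t] q[OF t] unfolding pint_alt f_def[abs_def] g_def[abs_def] by simp_all
  have "pint (\<lambda>s. B (p' s) (q s) + B (p s) (q' s)) t
      = (\<integral>s. B (f s) (q 0) + B (f s) (Q s) \<partial>lebesgue) + (\<integral>s. B (p 0) (g s) + B (P s) (g s) \<partial>lebesgue)"
    unfolding pint_alt eq[symmetric] by (intro Bochner_Integration.integral_add i1 i2)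
  also have "\<dots> = B (integral\<^sup>L lebesgue f) (q 0) + B (p 0) (integral\<^sup>L lebesgue g)
      + B (integral\<^sup>L lebesgue f) (integral\<^sup>L lebesgue g)"
    using tri f g
    by (simp add: Bochner_Integration.integral_add integrable_bounded_linear[OF B.bounded_linear_left]
        integrable_bounded_linear[OF B.bounded_linear_right] integral_bounded_linear[OF B.bounded_linear_left]
        integral_bounded_linear[OF B.bounded_linear_right])
  finally show "B (p t) (q t) = B (p 0) (q 0) + pint (\<lambda>s. B (p' s) (q s) + B (p s) (q' s)) t"
    unfolding pt by (simp add: B.add_left B.add_right)
qed

text \<open>The half-lines form an intersection-stable generator of the Borel sets, so the integral
  vanishes over all Borel sets, then over all Lebesgue sets up to null sets, and hence the function
  vanishes almost everywhere.\<close>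

lemma set_integral_zero_imp_AE_zero:
  fixes g :: "real \<Rightarrow> 'e::{banach, second_countable_topology}"
  assumes g: "set_integrable lebesgue {0<..<T} g" and zero: "\<And>t. t \<in> {0..T} \<Longrightarrow> pint g t = 0"
  shows "AE t\<in>{0<..<T} in lebesgue. g t = 0"
proof (cases "0 < T")
  case T: True
  define D where "D s = indicat_real {0<..<T} s *\<^sub>R g s" for s
  have D: "integrable lebesgue D" using g by (simp add: set_integrable_def D_def[abs_def])
  have ID: "integrable lebesgue (\<lambda>s. indicat_real A s *\<^sub>R D s)" if "A \<in> sets lebesgue" for A
    by (rule integrable_mult_indicator[OF that D])
  have borel: "set_lebesgue_integral lebesgue A D = 0" if "A \<in> sets borel" for A
  proof -
    have ss: "sigma_sets UNIV (range (lessThan :: real \<Rightarrow> real set)) = sets borel"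
      by (simp add: borel_Iio)
    have "Int_stable (range (lessThan :: real \<Rightarrow> real set))"
    proof -
      have "{..<x} \<inter> {..<y} = {..<min x y}" for x y :: real by auto
      then show ?thesis unfolding Int_stable_def by auto
    qed
    moreover have "range (lessThan :: real \<Rightarrow> real set) \<subseteq> Pow UNIV" by simp
    moreover have "A \<in> sigma_sets UNIV (range lessThan)" using that ss by simp
    ultimately show ?thesis
    proof (induction rule: sigma_sets_induct_disjoint)
      case (basic A)
      then obtain b where b: "A = {..<b}" by auto
      have "set_lebesgue_integral lebesgue A D = pint g (max 0 (min b T))"
        unfolding set_lebesgue_integral_def pint_alt D_def b
        by (intro Bochner_Integration.integral_cong) (auto simp: indicator_def)
      also have "\<dots> = 0" using T by (intro zero) auto
      finally show ?case .
    next
      case (compl A)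
      then have A: "A \<in> sets lebesgue" using ss by simp
      have "set_lebesgue_integral lebesgue (UNIV - A) D
          = (\<integral>s. D s - indicat_real A s *\<^sub>R D s \<partial>lebesgue)"
        unfolding set_lebesgue_integral_def
        by (intro Bochner_Integration.integral_cong) (auto simp: indicator_def)
      also have "\<dots> = integral\<^sup>L lebesgue D - set_lebesgue_integral lebesgue A D"
        unfolding set_lebesgue_integral_def by (intro Bochner_Integration.integral_diff D ID A)
      also have "integral\<^sup>L lebesgue D = pint g T" by (simp add: pint_alt D_def[abs_def])
      also have "\<dots> = 0" using T by (intro zero) auto
      finally show ?case using compl by simp
    next
      case (union A)
      have A: "A k \<in> sets lebesgue" for k using union(2) ss by auto
      have "set_lebesgue_integral lebesgue (\<Union>k. A k) D = (\<Sum>k. set_lebesgue_integral lebesgue (A k) D)"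
        by (rule lebesgue_integral_countable_add)
          (use A union(1) ID[of "\<Union>k. A k"] in \<open>auto simp: disjoint_family_on_def set_integrable_def\<close>)
      then show ?case using union by simp
    qed (simp add: set_lebesgue_integral_def)
  qed
  have "AE s in lebesgue. D s = 0"
  proof (rule lebesgue.density_zero[OF D])
    fix A :: "real set" assume A: "A \<in> sets lebesgue"
    obtain S N N' where S: "A = S \<union> N" "N \<subseteq> N'" "N' \<in> null_sets lborel" "S \<in> sets lborel"
      using sets_completionE[OF A] by metis
    have "AE x in lborel. x \<notin> N'" by (rule AE_not_in[OF S(3)])
    then have "AE x in lebesgue. x \<notin> N'" by (rule AE_completion)
    then have ae: "AE x in lebesgue. indicat_real A x *\<^sub>R D x = indicat_real S x *\<^sub>R D x"
      by eventually_elim (use S in \<open>auto simp: indicator_def\<close>)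
    have "set_lebesgue_integral lebesgue A D = set_lebesgue_integral lebesgue S D"
      unfolding set_lebesgue_integral_def
      by (rule integral_cong_AE[OF _ _ ae]) (use ID A S(4) in \<open>auto intro!: borel_measurable_integrable\<close>)
    then show "set_lebesgue_integral lebesgue A D = 0" using borel S(4) by simp
  qed
  then show ?thesis by eventually_elim (auto simp: D_def)
qed simp

text \<open>Strongly continuous families of uniformly Lipschitz maps on a bounded time interval.
  Instances are the semigroup, its time integral, and the constant family of identities, for which
  the convolution is \<open>pint\<close> itself.\<close>

locale kernel =
  fixes \<Phi> :: "real \<Rightarrow> 'e::{banach, second_countable_topology} \<Rightarrow> 'e" and T M :: real
  assumes T: "0 \<le> T"
    and lip: "\<And>r x y. r \<in> {0..T} \<Longrightarrow> norm (\<Phi> r x - \<Phi> r y) \<le> M * norm (x - y)"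
    and zero: "\<And>r. r \<in> {0..T} \<Longrightarrow> \<Phi> r 0 = 0"
    and cont: "\<And>x. continuous_on {0..T} (\<lambda>r. \<Phi> r x)"
begin

text \<open>Clipping the time makes the family jointly continuous on the whole product space, so
  measurability of the convolution integrand needs no discussion at the endpoints.\<close>

definition \<Psi> :: "real \<Rightarrow> 'e \<Rightarrow> 'e" where "\<Psi> r x = \<Phi> (max 0 (min T r)) x"

lemma clip: "max 0 (min T r) \<in> {0..T}"
  using T by auto

lemma \<Psi>_eq: "r \<in> {0..T} \<Longrightarrow> \<Psi> r x = \<Phi> r x"
  by (simp add: \<Psi>_def)

lemma norm_\<Psi>: "norm (\<Psi> r x) \<le> M * norm x"
  using lip[OF clip, of r x 0] zero[OF clip] by (simp add: \<Psi>_def)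

lemma \<Psi>_0 [simp]: "\<Psi> r 0 = 0"
  using zero[OF clip] by (simp add: \<Psi>_def)

lemma \<Psi>_continuous_left: "continuous_on UNIV (\<lambda>r. \<Psi> r x)"
  unfolding \<Psi>_def
  by (rule continuous_on_compose2[OF cont]) (use T in \<open>auto intro!: continuous_intros\<close>)

lemma \<Psi>_continuous: "continuous_on UNIV (\<lambda>p. \<Psi> (fst p) (snd p))"
  unfolding continuous_on_def
proof
  fix p :: "real \<times> 'e"
  obtain r x where p: "p = (r, x)" by force
  have "((\<lambda>q. \<Psi> (fst q) x) \<longlongrightarrow> \<Psi> r x) (at p)"
    using \<Psi>_continuous_left[of x] unfolding p
    by (intro continuous_on_tendsto_compose[of UNIV "\<lambda>r. \<Psi> r x"] tendsto_eq_intros) auto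
  moreover have "((\<lambda>q. \<Psi> (fst q) (snd q) - \<Psi> (fst q) x) \<longlongrightarrow> 0) (at p)"
  proof (rule Lim_null_comparison)
    show "\<forall>\<^sub>F q in at p. norm (\<Psi> (fst q) (snd q) - \<Psi> (fst q) x) \<le> M * norm (snd q - x)"
      using lip[OF clip] by (simp add: \<Psi>_def)
    have "((\<lambda>q. M * norm (snd q - x)) \<longlongrightarrow> M * norm (snd p - x)) (at p)"
      by (intro tendsto_intros)
    then show "((\<lambda>q. M * norm (snd q - x)) \<longlongrightarrow> 0) (at p)" by (simp add: p)
  qed
  ultimately have "((\<lambda>q. \<Psi> (fst q) x + (\<Psi> (fst q) (snd q) - \<Psi> (fst q) x)) \<longlongrightarrow> \<Psi> r x + 0) (at p)"
    by (rule tendsto_add)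
  then show "((\<lambda>q. \<Psi> (fst q) (snd q)) \<longlongrightarrow> \<Psi> (fst p) (snd p)) (at p)"
    by (simp add: p)
qed

context
  fixes g :: "real \<Rightarrow> 'e"
  assumes g: "set_integrable lebesgue {0<..<T} g"
begin

definition cut :: "real \<Rightarrow> 'e" where "cut s = indicat_real {0<..<T} s *\<^sub>R g s"

lemma cut_integrable: "integrable lebesgue cut"
  using g unfolding cut_def[abs_def] set_integrable_def .

lemma cut_measurable [measurable]: "cut \<in> borel_measurable lebesgue"
  by (rule borel_measurable_integrable[OF cut_integrable])

lemma conv_cut:
  "t \<in> {0..T} \<Longrightarrow> indicat_real {0<..<t} s *\<^sub>R \<Phi> (t - s) (g s) = indicat_real {0<..<t} s *\<^sub>R \<Psi> (t - s) (cut s)"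
  by (auto simp: indicator_def cut_def \<Psi>_eq)

lemma conv_measurable: "(\<lambda>s. indicat_real {0<..<t} s *\<^sub>R \<Psi> (t - s) (cut s)) \<in> borel_measurable lebesgue"
proof -
  have "(\<lambda>s. \<Psi> (t - s) (cut s)) \<in> borel_measurable lebesgue"
    by (rule borel_measurable_continuous_Pair[OF _ _ \<Psi>_continuous]) measurable
  then show ?thesis by (intro borel_measurable_scaleR) auto
qed

lemma conv_bound: "norm (indicat_real A s *\<^sub>R \<Psi> r (cut s)) \<le> M * norm (cut s)"
  using norm_\<Psi>[of r "cut s"] order_trans[OF norm_ge_zero norm_\<Psi>[of r "cut s"]] by (auto simp: indicator_def)

lemma conv_integrable: "t \<in> {0..T} \<Longrightarrow> set_integrable lebesgue {0<..<t} (\<lambda>s. \<Phi> (t - s) (g s))"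
  unfolding set_integrable_def
proof (subst conv_cut, assumption)
  show "integrable lebesgue (\<lambda>s. indicat_real {0<..<t} s *\<^sub>R \<Psi> (t - s) (cut s))"
  proof (rule Bochner_Integration.integrable_bound[OF _ conv_measurable])
    show "integrable lebesgue (\<lambda>s. M * norm (cut s))"
      by (intro integrable_mult_right integrable_norm cut_integrable)
    show "AE s in lebesgue. norm (indicat_real {0<..<t} s *\<^sub>R \<Psi> (t - s) (cut s)) \<le> norm (M * norm (cut s))"
      by (intro AE_I2 order_trans[OF conv_bound]) simp
  qed
qed

definition conv :: "real \<Rightarrow> 'e" where "conv t = pint (\<lambda>s. \<Phi> (t - s) (g s)) t"

lemma conv_alt: "t \<in> {0..T} \<Longrightarrow> conv t = (\<integral>s. indicat_real {0<..<t} s *\<^sub>R \<Psi> (t - s) (cut s) \<partial>lebesgue)"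
  unfolding conv_def pint_alt by (intro Bochner_Integration.integral_cong refl conv_cut)

lemma conv_continuous: "continuous_on {0..T} conv"
  unfolding continuous_on_sequentially
proof (intro allI ballI impI, elim conjE)
  fix X t assume t: "t \<in> {0..T}" and X: "\<forall>n. X n \<in> {0..T}" "X \<longlonglongrightarrow> t"
  have "(\<lambda>n. \<integral>s. indicat_real {0<..<X n} s *\<^sub>R \<Psi> (X n - s) (cut s) \<partial>lebesgue)
      \<longlonglongrightarrow> (\<integral>s. indicat_real {0<..<t} s *\<^sub>R \<Psi> (t - s) (cut s) \<partial>lebesgue)"
  proof (rule integral_dominated_convergence)
    show "integrable lebesgue (\<lambda>s. M * norm (cut s))"
      by (intro integrable_mult_right integrable_norm cut_integrable)
    \<comment> \<open>The indicators of \<open>{0<..<X n}\<close> need not converge at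
      \<open>s = t\<close>, which is a null set; elsewhere they are eventually constant.\<close>
    show "AE s in lebesgue. (\<lambda>n. indicat_real {0<..<X n} s *\<^sub>R \<Psi> (X n - s) (cut s))
        \<longlonglongrightarrow> indicat_real {0<..<t} s *\<^sub>R \<Psi> (t - s) (cut s)"
      using AE_lebesgue_neq[of t]
    proof eventually_elim
      case (elim s)
      have "(\<lambda>n. \<Psi> (X n - s) (cut s)) \<longlonglongrightarrow> \<Psi> (t - s) (cut s)"
        by (rule continuous_on_tendsto_compose[OF \<Psi>_continuous_left]) (auto intro!: tendsto_intros X)
      moreover have "\<forall>\<^sub>F n in sequentially. indicat_real {0<..<t} s = indicat_real {0<..<X n} s"
      proof (cases "s < t")
        case True
        then have "\<forall>\<^sub>F n in sequentially. s < X n" using X(2) by (rule order_tendstoD[rotated])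
        then show ?thesis by eventually_elim (use True in \<open>auto simp: indicator_def\<close>)
      next
        case False
        then have "t < s" using elim by simp
        then have "\<forall>\<^sub>F n in sequentially. X n < s" using X(2) by (rule order_tendstoD[rotated])
        then show ?thesis by eventually_elim (use \<open>t < s\<close> in \<open>auto simp: indicator_def\<close>)
      qed
      then have "(\<lambda>n. indicat_real {0<..<X n} s) \<longlonglongrightarrow> indicat_real {0<..<t} s"
        by (rule Lim_transform_eventually[OF tendsto_const])
      ultimately show ?case by (intro tendsto_scaleR)
    qed
    show "AE s in lebesgue. norm (indicat_real {0<..<X n} s *\<^sub>R \<Psi> (X n - s) (cut s)) \<le> M * norm (cut s)" for n
      by (intro AE_I2 conv_bound)
  qed (rule conv_measurable)+
  then show "(conv \<circ> X) \<longlonglongrightarrow> conv t"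
    using X t by (simp add: o_def conv_alt)
qed

text \<open>Integrating a convolution in time amounts to integrating its kernel: exchange the two
  integrals and substitute \<open>s = \<sigma> + r\<close>.\<close>

lemma conv_fubini:
  assumes t: "t \<in> {0..T}"
  shows "pint conv t = pint (\<lambda>\<sigma>. pint (\<lambda>r. \<Phi> r (g \<sigma>)) (t - \<sigma>)) t"
proof -
  define h where "h s \<sigma> = indicat_real {0<..<t} s *\<^sub>R indicat_real {0<..<s} \<sigma> *\<^sub>R \<Psi> (s - \<sigma>) (cut \<sigma>)" for s \<sigma>
  have fs [measurable]: "(\<lambda>p::real \<times> real. fst p) \<in> borel_measurable (lebesgue \<Otimes>\<^sub>M lebesgue)"
    "(\<lambda>p::real \<times> real. snd p) \<in> borel_measurable (lebesgue \<Otimes>\<^sub>M lebesgue)"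
    by (rule measurable_compose[OF measurable_fst ident_measurable_lebesgue],
        rule measurable_compose[OF measurable_snd ident_measurable_lebesgue])
  have "(\<lambda>p. \<Psi> (fst p - snd p) (cut (snd p))) \<in> borel_measurable (lebesgue \<Otimes>\<^sub>M lebesgue)"
    by (rule borel_measurable_continuous_Pair[OF _ _ \<Psi>_continuous]) measurable
  moreover have "(\<lambda>p. indicat_real {0<..<t} (fst p)) \<in> borel_measurable (lebesgue \<Otimes>\<^sub>M lebesgue)"
    unfolding indicator_def of_bool_def greaterThanLessThan_iff by measurable
  moreover have "(\<lambda>p::real \<times> real. indicat_real {0<..<fst p} (snd p)) \<in> borel_measurable (lebesgue \<Otimes>\<^sub>M lebesgue)"
    unfolding indicator_def of_bool_def greaterThanLessThan_iff
    by (rule measurable_If[OF borel_measurable_const borel_measurable_const predE[OF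
          pred_intros_logic(3)[OF borel_measurable_pred_less[OF borel_measurable_const fs(2)]
            borel_measurable_pred_less[OF fs(2,1)]]]])
  ultimately have hm: "(\<lambda>p. h (fst p) (snd p)) \<in> borel_measurable (lebesgue \<Otimes>\<^sub>M lebesgue)"
    unfolding h_def by (intro borel_measurable_scaleR)
  have hb: "norm (h s \<sigma>) \<le> indicat_real {0<..<t} s * (M * norm (cut \<sigma>))" for s \<sigma>
    using norm_\<Psi>[of "s - \<sigma>" "cut \<sigma>"] order_trans[OF norm_ge_zero norm_\<Psi>[of "s - \<sigma>" "cut \<sigma>"]]
    by (auto simp: h_def indicator_def)
  have hi: "integrable lebesgue (\<lambda>\<sigma>. h s \<sigma>)" for s
    unfolding h_def
    by (intro integrable_scaleR_right Bochner_Integration.integrable_bound[where f = "\<lambda>\<sigma>. M * norm (cut \<sigma>)",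
          OF _ conv_measurable] integrable_mult_right integrable_norm cut_integrable AE_I2 order_trans[OF conv_bound])
      simp
  have hint: "integrable (lebesgue \<Otimes>\<^sub>M lebesgue) (\<lambda>(s, \<sigma>). h s \<sigma>)"
    unfolding split_beta'
  proof (rule lebesgue_pair.Fubini_integrable[OF hm])
    show "AE s in lebesgue. integrable lebesgue (\<lambda>\<sigma>. h (fst (s, \<sigma>)) (snd (s, \<sigma>)))" using hi by simp
    show "integrable lebesgue (\<lambda>s. \<integral>\<sigma>. norm (h (fst (s, \<sigma>)) (snd (s, \<sigma>))) \<partial>lebesgue)"
    proof (rule Bochner_Integration.integrable_bound)
      have "integrable lebesgue (indicat_real {0<..<t})"
        by (simp flip: lmeasurable_iff_integrable)
      then show "integrable lebesgue (\<lambda>s. indicat_real {0<..<t} s * (M * (\<integral>\<sigma>. norm (cut \<sigma>) \<partial>lebesgue)))"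
        by (rule integrable_mult_left)
      show "(\<lambda>s. \<integral>\<sigma>. norm (h (fst (s, \<sigma>)) (snd (s, \<sigma>))) \<partial>lebesgue) \<in> borel_measurable lebesgue"
        by (rule lebesgue.borel_measurable_lebesgue_integral) (use hm in measurable)
      have "(\<integral>\<sigma>. norm (h s \<sigma>) \<partial>lebesgue) \<le> (\<integral>\<sigma>. indicat_real {0<..<t} s * (M * norm (cut \<sigma>)) \<partial>lebesgue)" for s
        by (intro integral_mono integrable_norm hi integrable_mult_right cut_integrable hb)
      then show "AE s in lebesgue. norm (\<integral>\<sigma>. norm (h (fst (s, \<sigma>)) (snd (s, \<sigma>))) \<partial>lebesgue)
          \<le> norm (indicat_real {0<..<t} s * (M * (\<integral>\<sigma>. norm (cut \<sigma>) \<partial>lebesgue)))"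
        by (intro AE_I2) (simp add: integral_nonneg_AE order_trans[OF _ abs_ge_self])
    qed
  qed
  have "pint conv t = (\<integral>s. (\<integral>\<sigma>. h s \<sigma> \<partial>lebesgue) \<partial>lebesgue)"
    unfolding pint_alt
  proof (rule Bochner_Integration.integral_cong[OF refl])
    fix s show "indicat_real {0<..<t} s *\<^sub>R conv s = (\<integral>\<sigma>. h s \<sigma> \<partial>lebesgue)"
      using conv_alt[of s] t by (cases "s \<in> {0<..<t}") (simp_all add: h_def)
  qed
  also have "\<dots> = (\<integral>\<sigma>. (\<integral>s. h s \<sigma> \<partial>lebesgue) \<partial>lebesgue)"
    by (rule lebesgue_pair.Fubini_integral[OF hint, symmetric])
  also have "\<dots> = pint (\<lambda>\<sigma>. pint (\<lambda>r. \<Phi> r (g \<sigma>)) (t - \<sigma>)) t"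
    unfolding pint_alt[of "\<lambda>\<sigma>. pint (\<lambda>r. \<Phi> r (g \<sigma>)) (t - \<sigma>)"]
  proof (rule Bochner_Integration.integral_cong[OF refl])
    fix \<sigma>
    show "(\<integral>s. h s \<sigma> \<partial>lebesgue) = indicat_real {0<..<t} \<sigma> *\<^sub>R pint (\<lambda>r. \<Phi> r (g \<sigma>)) (t - \<sigma>)"
    proof (cases "\<sigma> \<in> {0<..<t}")
      case False
      then have "h s \<sigma> = 0" for s by (auto simp: h_def indicator_def)
      then show ?thesis using False by simp
    next
      case True
      \<comment> \<open>For fixed \<open>\<sigma>\<close> the integrand is Borel measurable in
        \<open>r\<close>, so the integral can be moved to \<open>lborel\<close>, where the
        translation is carried out, and back.\<close>
      define k where "k r = indicat_real {0<..<t - \<sigma>} r *\<^sub>R \<Psi> r (g \<sigma>)" for r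
      have "(\<lambda>r. \<Psi> r (g \<sigma>)) \<in> borel_measurable borel"
        by (rule borel_measurable_continuous_onI[OF \<Psi>_continuous_left])
      then have km: "k \<in> borel_measurable lborel"
        unfolding k_def by (intro borel_measurable_scaleR) auto
      have "cut \<sigma> = g \<sigma>" using True t by (simp add: cut_def)
      then have hk: "h s \<sigma> = k (- \<sigma> + 1 * s)" for s
        using True by (auto simp: h_def k_def indicator_def)
      have "(\<integral>s. h s \<sigma> \<partial>lebesgue) = (\<integral>s. k (- \<sigma> + 1 * s) \<partial>lborel)"
        unfolding hk by (rule integral_completion) (use km in measurable)
      also have "\<dots> = (\<integral>r. k r \<partial>lborel)"
        using lborel_integral_real_affine[of 1 k "- \<sigma>"] by simp
      also have "\<dots> = (\<integral>r. k r \<partial>lebesgue)"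
        by (rule integral_completion[OF km, symmetric])
      also have "\<dots> = pint (\<lambda>r. \<Phi> r (g \<sigma>)) (t - \<sigma>)"
        unfolding pint_alt
        by (intro Bochner_Integration.integral_cong) (use True t in \<open>auto simp: k_def indicator_def \<Psi>_eq\<close>)
      finally show ?thesis using True by simp
    qed
  qed
  finally show ?thesis .
qed

end

end

lemma pint_continuous:
  fixes g :: "real \<Rightarrow> 'e::{banach, second_countable_topology}"
  assumes "set_integrable lebesgue {0<..<T} g" "0 \<le> T"
  shows "continuous_on {0..T} (pint g)"
proof -
  interpret kernel "\<lambda>_ x. x" T 1 by standard (use assms in auto)
  show ?thesis using conv_continuous[OF assms(1)] by (simp add: conv_def[OF assms(1), abs_def])
qed

section \<open>Stability properties of the space of square integrable functions\<close>

lemma L2_space_iff: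
  "g \<in> L2_space T \<longleftrightarrow> set_borel_measurable lebesgue {0<..<T} g \<and>
    set_integrable lebesgue {0<..<T} (\<lambda>t. (norm (g t))\<^sup>2)"
  by (simp add: L2_space_def)

lemma set_borel_measurable_norm_sq:
  fixes g :: "real \<Rightarrow> 'e::{real_normed_vector, second_countable_topology}"
  assumes "set_borel_measurable M A g"
  shows "set_borel_measurable M A (\<lambda>t. (norm (g t))\<^sup>2)"
proof -
  have "(\<lambda>t. (norm (indicat_real A t *\<^sub>R g t))\<^sup>2) \<in> borel_measurable M"
    using assms unfolding set_borel_measurable_def by measurable
  moreover have "(norm (indicat_real A t *\<^sub>R g t))\<^sup>2 = indicat_real A t *\<^sub>R (norm (g t))\<^sup>2" for t
    by (simp add: indicator_def)
  ultimately show ?thesis unfolding set_borel_measurable_def by simp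
qed

lemma L2_spaceI_bound:
  fixes g :: "real \<Rightarrow> 'e::{complex_banach, second_countable_topology}"
  assumes "set_borel_measurable lebesgue {0<..<T} g" "set_integrable lebesgue {0<..<T} h"
    and "AE t\<in>{0<..<T} in lebesgue. (norm (g t))\<^sup>2 \<le> h t"
  shows "g \<in> L2_space T"
  unfolding L2_space_iff
proof
  show "set_integrable lebesgue {0<..<T} (\<lambda>t. (norm (g t))\<^sup>2)"
    by (rule set_integrable_bound[OF assms(2) set_borel_measurable_norm_sq[OF assms(1)]])
      (use assms(3) in \<open>eventually_elim, auto\<close>)
qed fact

lemma L2_bounded_linear:
  assumes "bounded_linear L" and g: "g \<in> L2_space T"
  shows "(\<lambda>t. L (g t)) \<in> L2_space T"
proof -
  interpret L: bounded_linear L by fact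
  obtain K where K: "0 < K" "\<And>x. norm (L x) \<le> norm x * K" using L.pos_bounded by blast
  show ?thesis
  proof (rule L2_spaceI_bound)
    have "(\<lambda>t. L (indicat_real {0<..<T} t *\<^sub>R g t)) \<in> borel_measurable lebesgue"
      by (rule measurable_compose[OF _ borel_measurable_continuous_onI[OF linear_continuous_on[OF assms(1)]]])
        (use g in \<open>simp add: L2_space_iff set_borel_measurable_def\<close>)
    then show "set_borel_measurable lebesgue {0<..<T} (\<lambda>t. L (g t))"
      by (simp add: set_borel_measurable_def L.scaleR)
    show "set_integrable lebesgue {0<..<T} (\<lambda>t. K\<^sup>2 * (norm (g t))\<^sup>2)"
      using g by (simp add: L2_space_iff)
    have "(norm (L (g t)))\<^sup>2 \<le> K\<^sup>2 * (norm (g t))\<^sup>2" for t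
      using power_mono[OF K(2)[of "g t"], of 2] by (simp add: power_mult_distrib mult.commute)
    then show "AE t\<in>{0<..<T} in lebesgue. (norm (L (g t)))\<^sup>2 \<le> K\<^sup>2 * (norm (g t))\<^sup>2" by simp
  qed
qed

lemma L2_add:
  assumes "f \<in> L2_space T" "g \<in> L2_space T"
  shows "(\<lambda>t. f t + g t) \<in> L2_space T"
proof (rule L2_spaceI_bound)
  show "set_borel_measurable lebesgue {0<..<T} (\<lambda>t. f t + g t)"
    using assms unfolding L2_space_iff set_borel_measurable_def scaleR_add_right
    by (intro borel_measurable_add) auto
  show "set_integrable lebesgue {0<..<T} (\<lambda>t. 2 * (norm (f t))\<^sup>2 + 2 * (norm (g t))\<^sup>2)"
    using assms by (intro set_integral_add) (auto simp: L2_space_iff)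
  have "(norm (f t + g t))\<^sup>2 \<le> 2 * (norm (f t))\<^sup>2 + 2 * (norm (g t))\<^sup>2" for t
  proof -
    have "(norm (f t + g t))\<^sup>2 \<le> (norm (f t) + norm (g t))\<^sup>2" by (intro power_mono norm_triangle_ineq) simp
    then show ?thesis using zero_le_power2[of "norm (f t) - norm (g t)"] by (simp add: power2_sum power2_diff)
  qed
  then show "AE t\<in>{0<..<T} in lebesgue. (norm (f t + g t))\<^sup>2 \<le> 2 * (norm (f t))\<^sup>2 + 2 * (norm (g t))\<^sup>2" by simp
qed

lemma L2_diff:
  assumes "f \<in> L2_space T" "g \<in> L2_space T"
  shows "(\<lambda>t. f t - g t) \<in> L2_space T"
  using L2_add[OF assms(1) L2_bounded_linear[OF bounded_linear_minus[OF bounded_linear_ident] assms(2)]] by simp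

lemma L2_cong_AE:
  assumes f: "f \<in> L2_space T" and ae: "AE t\<in>{0<..<T} in lebesgue. f t = g t"
  shows "g \<in> L2_space T"
proof (rule L2_spaceI_bound)
  have ae': "AE t in lebesgue. indicat_real {0<..<T} t *\<^sub>R f t = indicat_real {0<..<T} t *\<^sub>R g t"
    using ae by eventually_elim (auto simp: indicator_def)
  show "set_borel_measurable lebesgue {0<..<T} g"
    using measurable_lebesgue_AE[OF _ ae'] f unfolding L2_space_iff set_borel_measurable_def by auto
  show "set_integrable lebesgue {0<..<T} (\<lambda>t. (norm (f t))\<^sup>2)" using f by (simp add: L2_space_iff)
  show "AE t\<in>{0<..<T} in lebesgue. (norm (g t))\<^sup>2 \<le> (norm (f t))\<^sup>2"
    using ae by eventually_elim simp
qed

lemma L2_continuous: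
  fixes p :: "real \<Rightarrow> 'e::{complex_banach, second_countable_topology}"
  assumes "continuous_on {0..T} p"
  shows "p \<in> L2_space T"
  unfolding L2_space_iff
proof
  show "set_borel_measurable lebesgue {0<..<T} p"
    using continuous_imp_set_integrable[OF assms] unfolding set_integrable_def set_borel_measurable_def
    by (rule borel_measurable_integrable)
  show "set_integrable lebesgue {0<..<T} (\<lambda>t. (norm (p t))\<^sup>2)"
    by (rule continuous_imp_set_integrable[OF continuous_on_power[OF continuous_on_norm[OF assms]]])
qed

section \<open>Test functions and weak derivatives\<close>

text \<open>The standard bump \<open>exp (- 1 / (1 - x\<^sup>2))\<close> multiplied by all the
  rational factors that differentiation produces. The family is closed under derivatives, which
  gives smoothness without formulas for higher derivatives.\<close>

definition bumpf :: "real poly \<Rightarrow> nat \<Rightarrow> real \<Rightarrow> real" where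
  "bumpf P k x = (if \<bar>x\<bar> < 1 then poly P x * (1 / (1 - x\<^sup>2)) ^ k * exp (- (1 / (1 - x\<^sup>2))) else 0)"

text \<open>The numerator of the derivative over the common denominator
  \<open>(1 - x\<^sup>2) ^ (k + 2)\<close>; the polynomial \<open>[:1, 0, -1:]\<close> is
  \<open>1 - x\<^sup>2\<close>.\<close>

definition bumpf_deriv :: "real poly \<Rightarrow> nat \<Rightarrow> real poly" where
  "bumpf_deriv P k = pderiv P * [:1, 0, -1:]\<^sup>2 + smult (2 * real k) ([:0, 1:] * [:1, 0, -1:] * P) - smult 2 ([:0, 1:] * P)"

lemma exp_ge_power_div_fact:
  assumes "0 \<le> (x::real)"
  shows "x ^ n / fact n \<le> exp x"
proof -
  have "(\<Sum>k\<in>{n}. x ^ k /\<^sub>R fact k) \<le> (\<Sum>k. x ^ k /\<^sub>R fact k)"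
    by (rule sum_le_suminf) (use assms summable_exp_generic[of x] in auto)
  then show ?thesis by (simp add: exp_def divide_inverse mult.commute)
qed

lemma bumpf_has_derivative: "(bumpf P k has_real_derivative bumpf (bumpf_deriv P k) (k + 2) x) (at x)"
proof -
  consider "\<bar>x\<bar> < 1" | "\<bar>x\<bar> > 1" | "\<bar>x\<bar> = 1" by linarith
  then show ?thesis
  proof cases
    case 1
    define u where "u y = 1 / (1 - y\<^sup>2)" for y :: real
    have sq: "1 - x\<^sup>2 \<noteq> 0" using 1 abs_square_less_1[of x] by auto
    have du: "(u has_real_derivative 2 * x * (u x)\<^sup>2) (at x)"
      unfolding u_def[abs_def] using sq
      by (auto intro!: derivative_eq_intros simp: divide_simps power2_eq_square)
    have uk: "u x ^ k = u x ^ (k + 2) * (1 - x\<^sup>2)\<^sup>2" "real k * u x ^ (k - 1) * (u x)\<^sup>2 = real k * (u x ^ (k + 2) * (1 - x\<^sup>2))"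
    proof -
      have "u x * (1 - x\<^sup>2) = 1" using sq by (simp add: u_def)
      then have *: "u x * (1 - x\<^sup>2) * z = z" for z by simp
      have "u x ^ (k + 2) * (1 - x\<^sup>2)\<^sup>2 = u x ^ k * (u x * (1 - x\<^sup>2))\<^sup>2"
        by (simp only: power_add power_mult_distrib mult.assoc)
      then show "u x ^ k = u x ^ (k + 2) * (1 - x\<^sup>2)\<^sup>2"
        unfolding \<open>u x * (1 - x\<^sup>2) = 1\<close> by simp
      show "real k * u x ^ (k - 1) * (u x)\<^sup>2 = real k * (u x ^ (k + 2) * (1 - x\<^sup>2))"
      proof (cases k)
        case (Suc m)
        then show ?thesis using *[of "u x ^ m * (u x)\<^sup>2"] by (simp add: power2_eq_square mult_ac)
      qed simp
    qed
    have "((\<lambda>y. poly P y * u y ^ k * exp (- u y)) has_real_derivative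
        (poly (pderiv P) x * u x ^ k + real k * u x ^ (k - 1) * (2 * x * (u x)\<^sup>2) * poly P x) * exp (- u x)
        + exp (- u x) * - (2 * x * (u x)\<^sup>2) * (poly P x * u x ^ k)) (at x)"
      by (rule derivative_eq_intros du poly_DERIV refl)+ (simp add: mult_ac)
    also have "(poly (pderiv P) x * u x ^ k + real k * u x ^ (k - 1) * (2 * x * (u x)\<^sup>2) * poly P x) * exp (- u x)
        + exp (- u x) * - (2 * x * (u x)\<^sup>2) * (poly P x * u x ^ k)
      = poly (bumpf_deriv P k) x * u x ^ (k + 2) * exp (- u x)"
    proof -
      have "real k * u x ^ (k - 1) * (2 * x * (u x)\<^sup>2) * poly P x = (real k * u x ^ (k - 1) * (u x)\<^sup>2) * 2 * x * poly P x"
        by simp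
      also have "\<dots> = real k * (u x ^ (k + 2) * (1 - x\<^sup>2)) * 2 * x * poly P x" by (simp only: uk(2))
      finally have a: "real k * u x ^ (k - 1) * (2 * x * (u x)\<^sup>2) * poly P x
        = real k * (u x ^ (k + 2) * (1 - x\<^sup>2)) * 2 * x * poly P x" .
      have b: "exp (- u x) * - (2 * x * (u x)\<^sup>2) * (poly P x * u x ^ k) = - (2 * x * poly P x * u x ^ (k + 2) * exp (- u x))"
        by (simp add: power_add mult_ac power2_eq_square)
      have d: "poly (pderiv P) x * u x ^ k = poly (pderiv P) x * (u x ^ (k + 2) * (1 - x\<^sup>2)\<^sup>2)"
        by (simp only: uk(1))
      have "poly (bumpf_deriv P k) x = poly (pderiv P) x * (1 - x\<^sup>2)\<^sup>2 + 2 * real k * (x * (1 - x\<^sup>2) * poly P x) - 2 * (x * poly P x)"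
        by (simp add: bumpf_deriv_def power2_eq_square algebra_simps)
      then show ?thesis unfolding a b d by (simp only:) (simp add: algebra_simps)
    qed
    finally have "((\<lambda>y. poly P y * u y ^ k * exp (- u y)) has_real_derivative bumpf (bumpf_deriv P k) (k + 2) x) (at x)"
      using 1 by (simp add: bumpf_def u_def)
    then show ?thesis
      by (rule has_field_derivative_transform_within_open[where S = "{-1<..<1}"])
        (use 1 in \<open>auto simp: bumpf_def u_def\<close>)
  next
    case 2
    have "((\<lambda>_. 0) has_real_derivative 0) (at x)" by simp
    then have "(bumpf P k has_real_derivative 0) (at x)"
      by (rule has_field_derivative_transform_within_open[where S = "- {-1..1}"])
        (use 2 in \<open>auto simp: bumpf_def\<close>)
    then show ?thesis using 2 by (simp add: bumpf_def)
  next
    case 3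
    have x2: "x\<^sup>2 = 1" using 3 by (metis abs_square_eq_1)
    have "bounded (poly P ` {-1..1})"
      by (intro compact_imp_bounded compact_continuous_image compact_Icc continuous_intros)
    then obtain B where "\<forall>y\<in>poly P ` {-1..1}. norm y \<le> B" unfolding bounded_iff by blast
    then have B: "\<bar>poly P y\<bar> \<le> B" if "y \<in> {-1..1}" for y using that by auto
    \<comment> \<open>At the endpoints the exponential beats the pole:
      \<open>u ^ (k + 2) * exp (- u) \<le> fact (k + 2)\<close> leaves a factor
      \<open>(1 - y\<^sup>2)\<^sup>2\<close>. Since \<open>1 - y\<^sup>2 = (x - y) * (x + y)\<close>
      with \<open>\<bar>x + y\<bar> \<le> 2\<close>, whence the 4, the function is quadratically
      small at \<open>x\<close> and its derivative there is 0.\<close>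
    define K where "K = B * (fact (k + 2) * 4)"
    have bound: "\<bar>bumpf P k y\<bar> \<le> K * (y - x)\<^sup>2" for y
    proof (cases "\<bar>y\<bar> < 1")
      case True
      define u where "u = 1 / (1 - y\<^sup>2)"
      have y2: "0 < 1 - y\<^sup>2" using True abs_square_less_1[of y] by simp
      then have u: "0 < u" "u * (1 - y\<^sup>2) = 1" by (auto simp: u_def)
      have "u ^ n \<le> fact n * exp u" for n
        using exp_ge_power_div_fact[of u n] u by (simp add: divide_le_eq mult.commute)
      then have "u ^ n * exp (- u) \<le> fact n" for n
        by (simp add: exp_minus divide_inverse[symmetric] divide_le_eq)
      then have A: "u ^ (k + 2) * exp (- u) \<le> fact (k + 2)" .
      have E: "u ^ k * exp (- u) = u ^ (k + 2) * exp (- u) * (1 - y\<^sup>2)\<^sup>2"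
      proof -
        have "u ^ (k + 2) * (1 - y\<^sup>2)\<^sup>2 = u ^ k * (u * (1 - y\<^sup>2))\<^sup>2"
          by (simp only: power_add power_mult_distrib mult.assoc)
        then show ?thesis by (simp add: u(2))
      qed
      have 1: "u ^ k * exp (- u) \<le> fact (k + 2) * (1 - y\<^sup>2)\<^sup>2"
        unfolding E by (rule mult_right_mono[OF A]) simp
      have "1 - y\<^sup>2 = (x - y) * (x + y)" using x2 by (simp add: power2_eq_square algebra_simps)
      then have "(1 - y\<^sup>2)\<^sup>2 = (y - x)\<^sup>2 * (x + y)\<^sup>2" by (simp add: power_mult_distrib power2_commute)
      also have "\<dots> \<le> (y - x)\<^sup>2 * 2\<^sup>2"
        using 3 True by (intro mult_left_mono power2_le_iff_abs_le[THEN iffD2]) auto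
      finally have 2: "(1 - y\<^sup>2)\<^sup>2 \<le> 4 * (y - x)\<^sup>2" by simp
      have By: "\<bar>poly P y\<bar> \<le> B" using True by (intro B) auto
      have X: "u ^ k * exp (- u) \<le> fact (k + 2) * (4 * (y - x)\<^sup>2)"
        by (rule order_trans[OF 1]) (intro mult_left_mono 2, simp)
      have "\<bar>poly P y\<bar> * (u ^ k * exp (- u)) \<le> B * (fact (k + 2) * (4 * (y - x)\<^sup>2))"
        by (rule mult_mono[OF By X order_trans[OF abs_ge_zero By]]) (use u in simp)
      also have "\<dots> = K * (y - x)\<^sup>2" by (simp only: K_def mult.assoc)
      finally show ?thesis using True u by (simp add: bumpf_def u_def[symmetric] abs_mult mult.assoc)
    next
      case False
      have "0 \<le> B" using B[of 0] by force
      then show ?thesis using False by (simp add: bumpf_def K_def)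
    qed
    have "((\<lambda>h. (bumpf P k (x + h) - bumpf P k x) / h) \<longlongrightarrow> 0) (at 0)"
    proof (rule Lim_null_comparison)
      have "norm ((bumpf P k (x + h) - bumpf P k x) / h) \<le> K * \<bar>h\<bar>" for h
      proof (cases "h = 0")
        case False
        have "\<bar>bumpf P k (x + h)\<bar> \<le> K * \<bar>h\<bar> * \<bar>h\<bar>" using bound[of "x + h"] by (simp add: power2_eq_square mult.assoc)
        then have "\<bar>bumpf P k (x + h)\<bar> / \<bar>h\<bar> \<le> K * \<bar>h\<bar>" using False by (simp add: divide_le_eq)
        then show ?thesis using 3 by (simp add: bumpf_def[of P k x] abs_divide)
      qed simp
      then show "\<forall>\<^sub>F h in at 0. norm ((bumpf P k (x + h) - bumpf P k x) / h) \<le> K * \<bar>h\<bar>" by simp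
      have "((\<lambda>h. K * \<bar>h\<bar>) \<longlongrightarrow> K * \<bar>0\<bar>) (at 0)" by (intro tendsto_intros)
      then show "((\<lambda>h. K * \<bar>h\<bar>) \<longlongrightarrow> 0) (at 0)" by simp
    qed
    then show ?thesis using 3 by (simp add: DERIV_def bumpf_def[of _ _ x])
  qed
qed

section \<open>Smooth steps and test functions\<close>

definition bump :: "real \<Rightarrow> real" where "bump = bumpf 1 0"

text \<open>The lower limit -2 lies strictly to the left of the support \<open>[-1,1]\<close> of
  \<open>bump\<close>, so the fundamental theorem applies at interior points, including -1.\<close>

definition step :: "real \<Rightarrow> real" where "step x = integral {-2..x} bump"

lemma bump_nonneg: "0 \<le> bump x" and bump_outside: "1 \<le> \<bar>x\<bar> \<Longrightarrow> bump x = 0" and bump_0: "0 < bump 0"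
  by (auto simp: bump_def bumpf_def)

lemma bump_continuous: "continuous_on A bump"
  unfolding bump_def
  by (intro continuous_at_imp_continuous_on ballI DERIV_isCont[OF bumpf_has_derivative])

lemma step_left: "x \<le> -1 \<Longrightarrow> step x = 0"
  unfolding step_def
  by (rule integral_unique[OF has_integral_is_0]) (auto intro!: bump_outside)

lemma step_has_derivative: "(step has_real_derivative bump x) (at x)"
proof (cases "x < -1")
  case True
  have "((\<lambda>_. 0) has_real_derivative 0) (at x)" by simp
  then have "(step has_real_derivative 0) (at x)"
    by (rule has_field_derivative_transform_within_open[where S = "{..<-1}"])
      (use True step_left in auto)
  then show ?thesis using True bump_outside[of x] by simp
next
  case False
  have "((\<lambda>u. integral {-2..u} bump) has_real_derivative bump x) (at x within {-2..x + 1})"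
    by (rule integral_has_real_derivative[OF bump_continuous]) (use False in auto)
  then have "(step has_real_derivative bump x) (at x within {-2..x + 1})"
    by (simp add: step_def[abs_def])
  then show ?thesis
    using False by (subst (asm) at_within_interior) (auto simp: interior_atLeastAtMost_real)
qed

lemma step_right: "1 \<le> x \<Longrightarrow> step x = step 1"
proof -
  assume x: "1 \<le> x"
  have "(step has_real_derivative 0) (at y within {1..x})" if "y \<in> {1..x}" for y
    using step_has_derivative[of y] bump_outside[of y] that by (auto intro: has_field_derivative_at_within)
  then show ?thesis
    using has_field_derivative_zero_constant[of "{1..x}" step] x by (metis atLeastAtMost_iff convex_real_interval(5) order_refl)
qed

lemma step_1_pos: "0 < step 1"
proof -
  have mono: "step x \<le> step y" if "x \<le> y" for x y
    by (rule DERIV_nonneg_imp_nondecreasing[OF that]) (use step_has_derivative bump_nonneg in blast)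
  have "step 1 \<noteq> 0"
  proof
    assume 0: "step 1 = 0"
    have "step x = 0" for x
      using mono[of "min x (-1)" x] mono[of x "max x 1"] step_left[of "min x (-1)"] step_right[of "max x 1"] 0 by simp
    then have "(step has_real_derivative 0) (at 0)" by (simp add: fun_eq_iff[of step "\<lambda>_. 0", THEN iffD2])
    then show False using DERIV_unique[OF step_has_derivative[of 0]] bump_0 by simp
  qed
  then show ?thesis using mono[of "-1" 1] step_left[of "-1"] by simp
qed

text \<open>Smoothness by invariance: if every member of a class has a derivative in the class, the
  iterated derivatives never leave it.\<close>

lemma smooth_if_closed:
  assumes f: "f \<in> A" and A: "\<And>f. f \<in> A \<Longrightarrow> \<exists>f'\<in>A. \<forall>t. (f has_vector_derivative f' t) (at t)"
  shows "nth_deriv n f differentiable (at t)"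
proof -
  have "nth_deriv n f \<in> A" for n
  proof (induction n)
    case 0
    then show ?case using f by (simp add: nth_deriv_def)
  next
    case (Suc n)
    obtain f' where f': "f' \<in> A" "\<And>t. (nth_deriv n f has_vector_derivative f' t) (at t)"
      using A[OF Suc] by blast
    have "nth_deriv (Suc n) f = (\<lambda>t. vector_derivative (nth_deriv n f) (at t))"
      by (simp add: nth_deriv_def)
    also have "\<dots> = f'" using f'(2) by (auto simp: vector_derivative_at)
    finally show ?case using f'(1) by simp
  qed
  then show ?thesis using A by (meson differentiableI_vector)
qed

lemma nth_deriv_has_derivative:
  assumes "\<phi> \<in> test_functions T"
  shows "(nth_deriv n \<phi> has_vector_derivative nth_deriv (Suc n) \<phi> t) (at t)"
  using assms unfolding test_functions_def
  by (simp add: nth_deriv_def vector_derivative_works[symmetric])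

lemma test_functions_lincomb:
  assumes \<phi>: "\<phi> \<in> test_functions T" and \<psi>: "\<psi> \<in> test_functions T"
  shows "(\<lambda>t. z * \<phi> t + \<psi> t) \<in> test_functions T"
proof -
  have "nth_deriv n (\<lambda>t. z * \<phi> t + \<psi> t) differentiable (at t)" for n t
  proof (rule smooth_if_closed[where A = "range (\<lambda>n t. z * nth_deriv n \<phi> t + nth_deriv n \<psi> t)"])
    show "(\<lambda>t. z * \<phi> t + \<psi> t) \<in> range (\<lambda>n t. z * nth_deriv n \<phi> t + nth_deriv n \<psi> t)"
      by (rule image_eqI[of _ _ 0]) (simp_all add: nth_deriv_def)
    fix f assume "f \<in> range (\<lambda>n t. z * nth_deriv n \<phi> t + nth_deriv n \<psi> t)"
    then obtain n where f: "f = (\<lambda>t. z * nth_deriv n \<phi> t + nth_deriv n \<psi> t)" by auto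
    show "\<exists>f'\<in>range (\<lambda>n t. z * nth_deriv n \<phi> t + nth_deriv n \<psi> t). \<forall>t. (f has_vector_derivative f' t) (at t)"
      unfolding f
      by (intro bexI[of _ "\<lambda>t. z * nth_deriv (Suc n) \<phi> t + nth_deriv (Suc n) \<psi> t"] allI rangeI
          has_vector_derivative_add has_vector_derivative_mult_right nth_deriv_has_derivative[OF \<phi>]
          nth_deriv_has_derivative[OF \<psi>])
  qed
  moreover have "closure {t. z * \<phi> t + \<psi> t \<noteq> 0} \<subseteq> closure ({t. \<phi> t \<noteq> 0} \<union> {t. \<psi> t \<noteq> 0})"
    by (rule closure_mono) auto
  then have "closure {t. z * \<phi> t + \<psi> t \<noteq> 0} \<subseteq> {0<..<T}"
    using \<phi> \<psi> unfolding closure_Un test_functions_def by auto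
  ultimately show ?thesis unfolding test_functions_def by blast
qed

lemma test_function_props:
  assumes \<phi>: "\<phi> \<in> test_functions T"
  shows test_function_outside: "t \<notin> {0<..<T} \<Longrightarrow> \<phi> t = 0"
    and test_function_deriv: "(\<phi> has_vector_derivative vector_derivative \<phi> (at t)) (at t)"
    and test_function_continuous: "continuous_on A \<phi>"
    and test_function_deriv_continuous: "continuous_on A (\<lambda>t. vector_derivative \<phi> (at t))"
proof -
  show "\<phi> t = 0" if "t \<notin> {0<..<T}"
    using \<phi> closure_subset[of "{t. \<phi> t \<noteq> 0}"] that unfolding test_functions_def by blast
  have d: "(nth_deriv n \<phi> has_vector_derivative nth_deriv (Suc n) \<phi> t) (at t)" for n t
    by (rule nth_deriv_has_derivative[OF \<phi>])
  have c: "continuous_on A (nth_deriv n \<phi>)" for n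
    by (intro continuous_at_imp_continuous_on ballI has_vector_derivative_continuous[OF d])
  show "(\<phi> has_vector_derivative vector_derivative \<phi> (at t)) (at t)"
    using d[of 0 t] by (simp add: nth_deriv_def)
  show "continuous_on A \<phi>" using c[of 0] by (simp add: nth_deriv_def)
  show "continuous_on A (\<lambda>t. vector_derivative \<phi> (at t))" using c[of 1] by (simp add: nth_deriv_def)
qed

lemma FTC_pint:
  fixes F :: "real \<Rightarrow> 'e::euclidean_space"
  assumes "0 \<le> t" and F: "continuous_on {0..t} F" "\<And>s. s \<in> {0<..<t} \<Longrightarrow> (F has_vector_derivative f s) (at s)"
    and f: "continuous_on {0..t} f"
  shows "F t = F 0 + pint f t"
proof -
  have "(f has_integral (F t - F 0)) {0..t}"
    by (rule fundamental_theorem_of_calculus_interior) (use assms in auto)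
  then have "(f has_integral (F t - F 0)) {0<..<t}"
    by (simp add: has_integral_Icc_iff_Ioo)
  moreover have "pint f t = integral {0<..<t} f"
    unfolding pint_def by (rule set_lebesgue_integral_eq_integral(2)[OF continuous_imp_set_integrable[OF f]])
  ultimately show ?thesis by (simp add: integral_unique)
qed

text \<open>A single step does not vanish on the right; the difference of two steps of equal height
  does. Its derivative is the difference of two narrow bumps, which is what compares averages at
  \<open>s\<close> and \<open>r\<close>.\<close>

lemma step_test_function:
  assumes e: "0 < e" and s: "e < s" "s + e < T" and r: "e < r" "r + e < T"
  defines "\<phi> \<equiv> \<lambda>t. complex_of_real (step ((t - s) / e) - step ((t - r) / e))"
  shows "\<phi> \<in> test_functions T"
    and "vector_derivative \<phi> (at t) = complex_of_real ((bump ((t - s) / e) - bump ((t - r) / e)) / e)"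
proof -
  define \<phi>' where "\<phi>' t = complex_of_real ((bump ((t - s) / e) - bump ((t - r) / e)) / e)" for t
  have aff: "((\<lambda>t. (t - a) / e) has_real_derivative 1 / e) (at t)" for a t
    using e by (auto intro!: derivative_eq_intros)
  have d\<phi>: "(\<phi> has_vector_derivative \<phi>' t) (at t)" for t
  proof -
    have "((\<lambda>t. step ((t - s) / e) - step ((t - r) / e)) has_real_derivative
        bump ((t - s) / e) * (1 / e) - bump ((t - r) / e) * (1 / e)) (at t)"
      by (intro DERIV_diff DERIV_chain2[OF step_has_derivative aff])
    then show ?thesis
      unfolding \<phi>_def \<phi>'_def
      by (intro has_vector_derivative_of_real)
        (simp add: diff_divide_distrib has_real_derivative_iff_has_vector_derivative[symmetric])
  qed
  then show vd: "vector_derivative \<phi> (at t) = complex_of_real ((bump ((t - s) / e) - bump ((t - r) / e)) / e)"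
    by (simp add: vector_derivative_at \<phi>'_def)
  \<comment> \<open>The derivatives of \<open>\<phi>\<close> are multiples of differences of members
    of the bump family; together with \<open>\<phi>\<close> they form a class closed under
    differentiation.\<close>
  define A where "A = {\<lambda>t. complex_of_real (a * (bumpf P k ((t - s) / e) - bumpf P k ((t - r) / e))) | a P k. True}"
  have closed: "\<exists>f'\<in>insert \<phi> A. \<forall>t. (f has_vector_derivative f' t) (at t)" if "f \<in> insert \<phi> A" for f
  proof -
    from that consider "f = \<phi>" | "f \<in> A" by blast
    then show ?thesis
    proof cases
      case 1
      have "\<phi>' \<in> A"
      proof -
        have "\<phi>' = (\<lambda>t. complex_of_real (1 / e * (bumpf 1 0 ((t - s) / e) - bumpf 1 0 ((t - r) / e))))"
          by (simp add: fun_eq_iff \<phi>'_def bump_def)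
        then show ?thesis unfolding A_def by blast
      qed
      then show ?thesis using d\<phi> 1 by blast
    next
      case 2
      then obtain a P k where f: "f = (\<lambda>t. complex_of_real (a * (bumpf P k ((t - s) / e) - bumpf P k ((t - r) / e))))"
        by (auto simp: A_def)
      define f' where "f' t = complex_of_real (a / e * (bumpf (bumpf_deriv P k) (k + 2) ((t - s) / e)
        - bumpf (bumpf_deriv P k) (k + 2) ((t - r) / e)))" for t
      have "((\<lambda>t. a * (bumpf P k ((t - s) / e) - bumpf P k ((t - r) / e))) has_real_derivative
          a * (bumpf (bumpf_deriv P k) (k + 2) ((t - s) / e) * (1 / e)
            - bumpf (bumpf_deriv P k) (k + 2) ((t - r) / e) * (1 / e))) (at t)" for t
        by (intro DERIV_cmult DERIV_diff DERIV_chain2[OF bumpf_has_derivative aff])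
      then have "(f has_vector_derivative f' t) (at t)" for t
        unfolding f f'_def
        by (intro has_vector_derivative_of_real)
          (simp add: diff_divide_distrib right_diff_distrib has_real_derivative_iff_has_vector_derivative[symmetric])
      moreover have "f' \<in> A" unfolding A_def f'_def by blast
      ultimately show ?thesis by blast
    qed
  qed
  have "{t. \<phi> t \<noteq> 0} \<subseteq> {min s r - e..max s r + e}"
  proof (intro subsetI, rule ccontr)
    fix t assume t: "t \<in> {t. \<phi> t \<noteq> 0}" "t \<notin> {min s r - e..max s r + e}"
    then consider "t < min s r - e" | "max s r + e < t" by force
    then have "\<phi> t = 0"
    proof cases
      case 1
      then have "(t - s) / e \<le> -1" "(t - r) / e \<le> -1" using e by (auto simp: field_simps)
      then show ?thesis by (simp add: \<phi>_def step_left)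
    next
      case 2
      then have "1 \<le> (t - s) / e" "1 \<le> (t - r) / e" using e by (auto simp: field_simps)
      then show ?thesis by (simp add: \<phi>_def step_right[of "(t - s) / e"] step_right[of "(t - r) / e"])
    qed
    then show False using t by simp
  qed
  then have "closure {t. \<phi> t \<noteq> 0} \<subseteq> {min s r - e..max s r + e}" by (simp add: closure_minimal)
  also have "\<dots> \<subseteq> {0<..<T}" using s r e by auto
  finally have "closure {t. \<phi> t \<noteq> 0} \<subseteq> {0<..<T}" .
  moreover have "nth_deriv n \<phi> differentiable (at t)" for n t
    by (rule smooth_if_closed[OF _ closed]) auto
  ultimately show "\<phi> \<in> test_functions T" unfolding test_functions_def by blast
qed

text \<open>The lemma of du Bois-Reymond for continuous functions: testing with differences of smooth
  step functions compares the averages of \<open>h\<close> near two points.\<close>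

lemma du_bois_reymond:
  fixes h :: "real \<Rightarrow> complex"
  assumes h: "continuous_on {0..T} h"
    and zero: "\<And>\<phi>. \<phi> \<in> test_functions T \<Longrightarrow> pint (\<lambda>t. vector_derivative \<phi> (at t) * h t) T = 0"
    and s: "s \<in> {0<..<T}" and r: "r \<in> {0<..<T}"
  shows "h s = h r"
proof -
  have T: "0 < T" using s by simp
  have "norm (h s - h r) \<le> 2 * \<delta>" if \<delta>: "0 < \<delta>" for \<delta>
  proof -
    have cont: "\<exists>d>0. \<forall>t\<in>{0..T}. \<bar>t - x\<bar> < d \<longrightarrow> norm (h t - h x) < \<delta>" if "x \<in> {0<..<T}" for x
      using h that \<delta> unfolding continuous_on_iff by (force simp: dist_norm)
    obtain d1 where d1: "0 < d1" "\<And>t. t \<in> {0..T} \<Longrightarrow> \<bar>t - s\<bar> < d1 \<Longrightarrow> norm (h t - h s) < \<delta>" using cont[OF s] by blast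
    obtain d2 where d2: "0 < d2" "\<And>t. t \<in> {0..T} \<Longrightarrow> \<bar>t - r\<bar> < d2 \<Longrightarrow> norm (h t - h r) < \<delta>" using cont[OF r] by blast
    define e where "e = Min {d1, d2, s / 2, (T - s) / 2, r / 2, (T - r) / 2}"
    have e: "0 < e" "e \<le> d1" "e \<le> d2" "e < s" "s + e < T" "e < r" "r + e < T"
    proof -
      show "0 < e" unfolding e_def by (subst Min_gr_iff) (use d1 d2 s r in auto)
      have le: "x \<in> {d1, d2, s / 2, (T - s) / 2, r / 2, (T - r) / 2} \<Longrightarrow> e \<le> x" for x
        unfolding e_def by (rule Min_le) auto
      show "e \<le> d1" "e \<le> d2" by (rule le, blast)+
      show "e < s" using le[of "s / 2"] s by simp
      show "s + e < T" using le[of "(T - s) / 2"] s by simp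
      show "e < r" using le[of "r / 2"] r by simp
      show "r + e < T" using le[of "(T - r) / 2"] r by simp
    qed
    define \<rho> where "\<rho> x t = bump ((t - x) / e)" for x t
    \<comment> \<open>The mass of a bump of width \<open>e\<close>, the same at both points, so the
      two averages can be compared without normalising them.\<close>
    define I where "I = e * step 1"
    have I: "0 < I" using e step_1_pos by (simp add: I_def)
    have \<rho>c: "continuous_on A (\<rho> x)" for A x
      unfolding \<rho>_def by (rule continuous_on_compose2[OF bump_continuous[of UNIV]]) (use e in \<open>auto intro!: continuous_intros\<close>)
    have \<rho>I: "pint (\<rho> x) T = I" if x: "e < x" "x + e < T" for x
    proof -
      have d: "((\<lambda>t. e * step ((t - x) / e)) has_vector_derivative \<rho> x t) (at t)" for t
      proof -
        have aff: "((\<lambda>t. (t - x) / e) has_real_derivative 1 / e) (at t)"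
          using e by (auto intro!: derivative_eq_intros)
        have "((\<lambda>t. e * step ((t - x) / e)) has_real_derivative e * (bump ((t - x) / e) * (1 / e))) (at t)"
          by (intro DERIV_cmult DERIV_chain2[OF step_has_derivative aff])
        then show ?thesis using e by (simp add: \<rho>_def has_real_derivative_iff_has_vector_derivative)
      qed
      have "e * step ((T - x) / e) = e * step ((0 - x) / e) + pint (\<rho> x) T"
        by (rule FTC_pint)
          (use T d in \<open>auto intro!: continuous_at_imp_continuous_on has_vector_derivative_continuous[OF d] \<rho>c\<close>)
      moreover have "step ((0 - x) / e) = 0" "step ((T - x) / e) = step 1"
        using x e by (auto intro!: step_left step_right simp: field_simps)
      ultimately show ?thesis by (simp add: I_def)
    qed
    have hi: "set_integrable lebesgue {0<..<T} (\<lambda>t. \<rho> x t *\<^sub>R k t)" if "continuous_on {0..T} k" for x and k :: "real \<Rightarrow> complex"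
      by (intro continuous_imp_set_integrable continuous_on_scaleR \<rho>c that)
    have near: "norm (I *\<^sub>R h x - pint (\<lambda>t. \<rho> x t *\<^sub>R h t) T) \<le> \<delta> * I"
      if x: "e < x" "x + e < T" and dx: "\<And>t. t \<in> {0..T} \<Longrightarrow> \<bar>t - x\<bar> < e \<Longrightarrow> norm (h t - h x) < \<delta>" for x
    proof -
      have "I *\<^sub>R h x = pint (\<lambda>t. \<rho> x t *\<^sub>R h x) T"
        using pint_bounded_linear[OF bounded_linear_scaleR_left continuous_imp_set_integrable[OF \<rho>c]] \<rho>I[OF x] by metis
      then have "I *\<^sub>R h x - pint (\<lambda>t. \<rho> x t *\<^sub>R h t) T = pint (\<lambda>t. \<rho> x t *\<^sub>R h x - \<rho> x t *\<^sub>R h t) T"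
        by (simp add: pint_diff hi h)
      also have "norm \<dots> \<le> pint (\<lambda>t. \<delta> * \<rho> x t) T"
        unfolding pint_alt
      proof (rule Bochner_Integration.integral_norm_bound_integral)
        show "integrable lebesgue (\<lambda>t. indicat_real {0<..<T} t *\<^sub>R (\<rho> x t *\<^sub>R h x - \<rho> x t *\<^sub>R h t))"
          using set_integral_diff(1)[OF hi[of "\<lambda>_. h x" x] hi[OF h, of x]] by (simp add: set_integrable_def)
        show "integrable lebesgue (\<lambda>t. indicat_real {0<..<T} t *\<^sub>R (\<delta> * \<rho> x t))"
          using continuous_imp_set_integrable[OF continuous_on_mult_left[OF \<rho>c[of "{0..T}" x], of \<delta>]] by (simp add: set_integrable_def)
        fix t
        show "norm (indicat_real {0<..<T} t *\<^sub>R (\<rho> x t *\<^sub>R h x - \<rho> x t *\<^sub>R h t)) \<le> indicat_real {0<..<T} t *\<^sub>R (\<delta> * \<rho> x t)"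
        proof (cases "t \<in> {0<..<T} \<and> \<bar>t - x\<bar> < e")
          case True
          then have "norm (h x - h t) \<le> \<delta>" using dx[of t] by (simp add: norm_minus_commute)
          then have "norm (\<rho> x t *\<^sub>R (h x - h t)) \<le> \<delta> * \<rho> x t"
            using bump_nonneg[of "(t - x) / e"] mult_left_mono[of "norm (h x - h t)" \<delta> "bump ((t - x) / e)"]
            by (simp only: norm_scaleR) (simp add: \<rho>_def mult.commute)
          then show ?thesis using True by (simp add: scaleR_diff_right)
        next
          case False
          have "\<rho> x t = 0 \<or> t \<notin> {0<..<T}"
            using False e by (auto simp: \<rho>_def abs_divide le_divide_eq intro!: bump_outside)
          then show ?thesis by auto
        qed
      qed
      also have "\<dots> = \<delta> * pint (\<rho> x) T"
        using pint_bounded_linear[OF bounded_linear_mult_right continuous_imp_set_integrable[OF \<rho>c]] by metis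
      finally show ?thesis by (simp add: \<rho>I[OF x])
    qed
    have "pint (\<lambda>t. \<rho> s t *\<^sub>R h t) T = pint (\<lambda>t. \<rho> r t *\<^sub>R h t) T"
    proof -
      define \<phi> where "\<phi> t = complex_of_real (step ((t - s) / e) - step ((t - r) / e))" for t
      have "pint (\<lambda>t. vector_derivative \<phi> (at t) * h t) T = 0"
        unfolding \<phi>_def by (intro zero step_test_function) (use e in auto)
      also have "(\<lambda>t. vector_derivative \<phi> (at t) * h t) = (\<lambda>t. inverse e *\<^sub>R (\<rho> s t *\<^sub>R h t - \<rho> r t *\<^sub>R h t))"
      proof -
        have vd: "vector_derivative \<phi> (at t) = complex_of_real ((\<rho> s t - \<rho> r t) / e)" for t
          using step_test_function(2)[OF e(1,4-7), of t] unfolding \<phi>_def[abs_def] \<rho>_def .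
        show ?thesis
          by (simp add: fun_eq_iff vd scaleR_conv_of_real divide_inverse algebra_simps)
      qed
      also have "pint \<dots> T = inverse e *\<^sub>R pint (\<lambda>t. \<rho> s t *\<^sub>R h t - \<rho> r t *\<^sub>R h t) T"
        by (rule pint_bounded_linear[OF bounded_linear_scaleR_right]) (intro set_integral_diff hi h)
      finally have "pint (\<lambda>t. \<rho> s t *\<^sub>R h t - \<rho> r t *\<^sub>R h t) T = 0" using e by simp
      then show ?thesis by (simp add: pint_diff hi h)
    qed
    moreover have "norm (I *\<^sub>R h s - pint (\<lambda>t. \<rho> s t *\<^sub>R h t) T) \<le> \<delta> * I"
      by (rule near) (use e d1 in auto)
    moreover have "norm (I *\<^sub>R h r - pint (\<lambda>t. \<rho> r t *\<^sub>R h t) T) \<le> \<delta> * I"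
      by (rule near) (use e d2 in auto)
    ultimately have "norm (I *\<^sub>R h s - I *\<^sub>R h r) \<le> \<delta> * I + \<delta> * I"
      by (smt (verit) norm_diff_triangle_le norm_minus_commute)
    then have "I * norm (h s - h r) \<le> I * (2 * \<delta>)"
      using I by (simp flip: scaleR_diff_right add: mult_ac)
    then show ?thesis using I by simp
  qed
  note le = this
  have "norm (h s - h r) \<le> 0 + \<epsilon>" if "0 < \<epsilon>" for \<epsilon>
    using le[of "\<epsilon> / 2"] that by simp
  then have "norm (h s - h r) \<le> 0" by (rule field_le_epsilon)
  then show ?thesis by simp
qed

section \<open>Distributional derivatives as integrands\<close>

lemma regular_distr_pint: "regular_distr T g \<phi> = pint (\<lambda>t. \<phi> t *\<^sub>C g t) T"
  by (simp add: regular_distr_def pint_def)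

lemma test_scaleC_integrable:
  fixes g :: "real \<Rightarrow> 'e::{complex_banach, second_countable_topology}"
  assumes g: "set_integrable lebesgue {0<..<T} g" and \<phi>: "continuous_on {0..T} \<phi>"
  shows "set_integrable lebesgue {0<..<T} (\<lambda>t. \<phi> t *\<^sub>C g t)"
proof -
  have "bounded (\<phi> ` {0..T})"
    by (intro compact_imp_bounded compact_continuous_image compact_Icc \<phi>)
  then obtain B where B: "\<And>t. t \<in> {0..T} \<Longrightarrow> cmod (\<phi> t) \<le> B" unfolding bounded_iff by blast
  show ?thesis
    unfolding set_integrable_def
  proof (rule Bochner_Integration.integrable_bound)
    show "integrable lebesgue (\<lambda>t. B * norm (indicat_real {0<..<T} t *\<^sub>R g t))"
      using g unfolding set_integrable_def by (intro integrable_mult_right integrable_norm)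
    have "(\<lambda>t. (indicat_real {0<..<T} t *\<^sub>R \<phi> t) *\<^sub>C (indicat_real {0<..<T} t *\<^sub>R g t)) \<in> borel_measurable lebesgue"
    proof (rule borel_measurable_continuous_Pair[where H = scaleC])
      show "(\<lambda>t. indicat_real {0<..<T} t *\<^sub>R \<phi> t) \<in> borel_measurable lebesgue"
        using continuous_imp_set_integrable[OF \<phi>] unfolding set_integrable_def by (rule borel_measurable_integrable)
      show "(\<lambda>t. indicat_real {0<..<T} t *\<^sub>R g t) \<in> borel_measurable lebesgue"
        using g unfolding set_integrable_def by (rule borel_measurable_integrable)
      show "continuous_on UNIV (\<lambda>x. fst x *\<^sub>C (snd x :: 'e))"
        by (intro scaleC.continuous_on continuous_intros)
    qed
    moreover have "(indicat_real {0<..<T} t *\<^sub>R \<phi> t) *\<^sub>C (indicat_real {0<..<T} t *\<^sub>R g t)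
        = indicat_real {0<..<T} t *\<^sub>R (\<phi> t *\<^sub>C g t)" for t
      by (simp add: indicator_def)
    ultimately show "(\<lambda>t. indicat_real {0<..<T} t *\<^sub>R (\<phi> t *\<^sub>C g t)) \<in> borel_measurable lebesgue" by simp
    show "AE t in lebesgue. norm (indicat_real {0<..<T} t *\<^sub>R (\<phi> t *\<^sub>C g t))
        \<le> norm (B * norm (indicat_real {0<..<T} t *\<^sub>R g t))"
    proof (rule AE_I2)
      fix t
      show "norm (indicat_real {0<..<T} t *\<^sub>R (\<phi> t *\<^sub>C g t)) \<le> norm (B * norm (indicat_real {0<..<T} t *\<^sub>R g t))"
        using mult_right_mono[OF order_trans[OF B[of t] abs_ge_self], of "norm (g t)"]
        by (auto simp: indicator_def norm_scaleC abs_mult)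
    qed
  qed
qed

text \<open>\<open>distr_eq\<close> demands that both sides belong to \<open>distributions\<close>;
  a functional inherits this from one with the same values on test functions, since these are closed
  under the linear operations in question.\<close>

lemma distributions_cong:
  assumes \<Lambda>: "\<Lambda> \<in> distributions T" and eq: "\<And>\<phi>. \<phi> \<in> test_functions T \<Longrightarrow> \<Lambda>' \<phi> = \<Lambda> \<phi>"
  shows "\<Lambda>' \<in> distributions T"
proof -
  have add: "(\<lambda>t. \<phi> t + \<psi> t) \<in> test_functions T" if "\<phi> \<in> test_functions T" "\<psi> \<in> test_functions T" for \<phi> \<psi>
    using test_functions_lincomb[OF that, of 1] by simp
  have "(\<lambda>t. 0) \<in> test_functions T" if "\<phi> \<in> test_functions T" for \<phi>
    using test_functions_lincomb[OF that that, of "-1"] by simp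
  then have scale: "(\<lambda>t. z * \<phi> t) \<in> test_functions T" if "\<phi> \<in> test_functions T" for \<phi> z
    using test_functions_lincomb[OF that, of "\<lambda>_. 0" z] that by simp
  show ?thesis
    using \<Lambda> unfolding distributions_def mem_Collect_eq by (simp add: eq add scale cong: ball_cong)
qed

lemma distr_deriv_pint:
  fixes w :: "real \<Rightarrow> 'e::{complex_banach, second_countable_topology}"
  assumes T: "0 \<le> T" and g: "set_integrable lebesgue {0<..<T} g"
    and w: "\<And>t. t \<in> {0..T} \<Longrightarrow> w t = w 0 + pint g t" and \<phi>: "\<phi> \<in> test_functions T"
  shows "distr_deriv (regular_distr T w) \<phi> = regular_distr T g \<phi>"
proof -
  let ?\<phi>' = "\<lambda>t. vector_derivative \<phi> (at t)"
  have wc: "continuous_on {0..T} w"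
    by (rule continuous_on_cong[THEN iffD1, OF refl _ continuous_on_add[OF continuous_on_const pint_continuous[OF g T]]])
      (rule w[symmetric])
  have \<phi>': "\<phi> t = \<phi> 0 + pint ?\<phi>' t" if "t \<in> {0..T}" for t
    by (rule FTC_pint) (use that test_function_props[OF \<phi>] in auto)
  have i\<phi>': "set_integrable lebesgue {0<..<T} ?\<phi>'"
    by (rule continuous_imp_set_integrable[OF test_function_deriv_continuous[OF \<phi>]])
  have "\<phi> T *\<^sub>C w T = \<phi> 0 *\<^sub>C w 0 + pint (\<lambda>s. ?\<phi>' s *\<^sub>C w s + \<phi> s *\<^sub>C g s) T"
    by (rule product_rule_pint(2)[OF bounded_bilinear_scaleC i\<phi>' g \<phi>' w]) (use T in auto)
  then have "pint (\<lambda>s. ?\<phi>' s *\<^sub>C w s + \<phi> s *\<^sub>C g s) T = 0"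
    using test_function_outside[OF \<phi>, of 0] test_function_outside[OF \<phi>, of T] by simp
  moreover have "pint (\<lambda>s. ?\<phi>' s *\<^sub>C w s + \<phi> s *\<^sub>C g s) T = pint (\<lambda>s. ?\<phi>' s *\<^sub>C w s) T + pint (\<lambda>s. \<phi> s *\<^sub>C g s) T"
    by (intro pint_add test_scaleC_integrable continuous_imp_set_integrable[OF wc] g
        test_function_continuous[OF \<phi>] test_function_deriv_continuous[OF \<phi>])
  ultimately show ?thesis
    unfolding distr_deriv_def regular_distr_pint neg_eq_iff_add_eq_0 by simp
qed

text \<open>For continuous \<open>w\<close> the weak equation makes \<open>d = w - pint g\<close>
  have zero distributional derivative. Pairing with a fixed \<open>v\<close> reduces its constancy
  to the scalar lemma on the open interval, and continuity includes the endpoints.\<close>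

lemma is_weak_deriv_iff:
  fixes w :: "real \<Rightarrow> 'v::{complex_hilbert, second_countable_topology} antidual"
  assumes T: "0 < T" and w: "continuous_on {0..T} w"
  shows "is_weak_deriv T w g \<longleftrightarrow> g \<in> L2_space T \<and> (\<forall>t\<in>{0..T}. w t = w 0 + pint g t)"
proof (cases "g \<in> L2_space T")
  case g: True
  have gi: "set_integrable lebesgue {0<..<T} g" by (rule L2_space_imp_integrable[OF g])
  have wi: "set_integrable lebesgue {0<..<T} w" by (rule continuous_imp_set_integrable[OF w])
  have mem: "regular_distr T g \<in> distributions T" "distr_deriv (regular_distr T w) \<in> distributions T"
    by (intro regular_distr_mem_distributions distr_deriv_mem_distributions g L2_continuous w)+
  have gc: "continuous_on {0..T} (pint g)" by (rule pint_continuous[OF gi]) (use T in simp)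
  have "(\<forall>\<phi>\<in>test_functions T. distr_deriv (regular_distr T w) \<phi> = regular_distr T g \<phi>)
      \<longleftrightarrow> (\<forall>t\<in>{0..T}. w t = w 0 + pint g t)"
  proof
    assume "\<forall>t\<in>{0..T}. w t = w 0 + pint g t"
    then show "\<forall>\<phi>\<in>test_functions T. distr_deriv (regular_distr T w) \<phi> = regular_distr T g \<phi>"
      using distr_deriv_pint[OF _ gi] T by (meson less_imp_le)
  next
    assume eq: "\<forall>\<phi>\<in>test_functions T. distr_deriv (regular_distr T w) \<phi> = regular_distr T g \<phi>"
    define d where "d t = w t - pint g t" for t
    have dc: "continuous_on {0..T} d" unfolding d_def by (intro continuous_intros w gc)
    have const: "d s = d r" if "s \<in> {0<..<T}" "r \<in> {0<..<T}" for s r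
    proof (rule antidual_eqI)
      fix v
      show "dual_pairing (d s) v = dual_pairing (d r) v"
      proof (rule du_bois_reymond[OF _ _ that])
        show "continuous_on {0..T} (\<lambda>t. dual_pairing (d t) v)"
          by (intro bounded_linear.continuous_on[OF dual_pairing.bounded_linear_left] dc)
        fix \<phi> assume \<phi>: "\<phi> \<in> test_functions T"
        let ?\<phi>' = "\<lambda>t. vector_derivative \<phi> (at t)"
        note c' = test_function_deriv_continuous[OF \<phi>, of "{0..T}"]
        have i: "set_integrable lebesgue {0<..<T} (\<lambda>t. ?\<phi>' t *\<^sub>C w t)"
          "set_integrable lebesgue {0<..<T} (\<lambda>t. ?\<phi>' t *\<^sub>C pint g t)"
          by (intro test_scaleC_integrable c' wi continuous_imp_set_integrable[OF gc])+
        have "distr_deriv (regular_distr T (pint g)) \<phi> = regular_distr T g \<phi>"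
          by (rule distr_deriv_pint[OF _ gi _ \<phi>]) (use T in auto)
        then have "pint (\<lambda>t. ?\<phi>' t *\<^sub>C w t) T = pint (\<lambda>t. ?\<phi>' t *\<^sub>C pint g t) T"
          using eq \<phi> unfolding distr_deriv_def regular_distr_pint by (metis neg_equal_iff_equal)
        then have "pint (\<lambda>t. ?\<phi>' t *\<^sub>C d t) T = 0"
          unfolding d_def scaleC.diff_right by (simp add: pint_diff i)
        moreover have "pint (\<lambda>t. dual_pairing (?\<phi>' t *\<^sub>C d t) v) T = dual_pairing (pint (\<lambda>t. ?\<phi>' t *\<^sub>C d t) T) v"
          by (intro pint_bounded_linear dual_pairing.bounded_linear_left test_scaleC_integrable c'
              continuous_imp_set_integrable[OF dc])
        ultimately show "pint (\<lambda>t. ?\<phi>' t * dual_pairing (d t) v) T = 0"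
          by (simp add: dual_pairing_scaleC dual_pairing.zero_left)
      qed
    qed
    have dT: "d t = d (T / 2)" if "t \<in> {0..T}" for t
    proof (rule continuous_constant_on_closure[where S = "{0<..<T}" and f = d])
      show "continuous_on (closure {0<..<T}) d" using dc T by simp
      show "d x = d (T / 2)" if "x \<in> {0<..<T}" for x using const[OF that] T by simp
      show "t \<in> closure {0<..<T}" using that T by simp
    qed
    show "\<forall>t\<in>{0..T}. w t = w 0 + pint g t"
    proof
      fix t assume t: "t \<in> {0..T}"
      have "d t = d 0" using dT[OF t] dT[of 0] T by simp
      then show "w t = w 0 + pint g t" by (simp add: d_def algebra_simps)
    qed
  qed
  then show ?thesis by (simp add: is_weak_deriv_def distr_eq_def g mem)
qed (simp add: is_weak_deriv_def)

text \<open>\<open>weak_deriv\<close> is a choice; its integrals, and with them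
  \<open>X_norm\<close>, can be computed from any other weak derivative.\<close>

lemma weak_deriv_AE_unique:
  fixes w :: "real \<Rightarrow> 'v::{complex_hilbert, second_countable_topology} antidual"
  assumes T: "0 < T" and w: "continuous_on {0..T} w"
    and g: "is_weak_deriv T w g" and g': "is_weak_deriv T w g'"
  shows "AE t\<in>{0<..<T} in lebesgue. g t = g' t"
proof -
  have gi: "set_integrable lebesgue {0<..<T} g" "set_integrable lebesgue {0<..<T} g'"
    using g g' by (auto simp: is_weak_deriv_def intro: L2_space_imp_integrable)
  have "AE t\<in>{0<..<T} in lebesgue. g t - g' t = 0"
  proof (rule set_integral_zero_imp_AE_zero)
    show "set_integrable lebesgue {0<..<T} (\<lambda>t. g t - g' t)" by (intro set_integral_diff gi)
    fix t assume t: "t \<in> {0..T}"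
    have "w t = w 0 + pint g t" "w t = w 0 + pint g' t"
      using g g' t unfolding is_weak_deriv_iff[OF T w] by blast+
    then show "pint (\<lambda>t. g t - g' t) t = 0"
      using set_integrable_sub[OF gi(1), of t] set_integrable_sub[OF gi(2), of t] t by (simp add: pint_diff)
  qed
  then show ?thesis by eventually_elim simp
qed

section \<open>Energy estimates\<close>

lemma pint_mono:
  fixes f g :: "real \<Rightarrow> real"
  assumes "set_integrable lebesgue {0<..<t} f" "set_integrable lebesgue {0<..<t} g"
    and "\<And>s. s \<in> {0<..<t} \<Longrightarrow> f s \<le> g s"
  shows "pint f t \<le> pint g t"
  unfolding pint_def by (rule set_integral_mono) (use assms in auto)

lemma pint_nonneg:
  fixes f :: "real \<Rightarrow> real"
  shows "(\<And>s. s \<in> {0<..<t} \<Longrightarrow> 0 \<le> f s) \<Longrightarrow> 0 \<le> pint f t"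
  unfolding pint_alt by (intro integral_nonneg_AE AE_I2) (auto simp: indicator_def)

lemma pint_mult: "pint (\<lambda>s. (k::real) * f s) t = k * pint f t"
  unfolding pint_def by simp

lemma pint_const: "0 \<le> t \<Longrightarrow> pint (\<lambda>_. k::real) t = k * t"
  by (simp add: pint_alt)

lemma pint_mono_set:
  fixes f :: "real \<Rightarrow> real"
  assumes "set_integrable lebesgue {0<..<T} f" "\<And>s. s \<in> {0<..<T} \<Longrightarrow> 0 \<le> f s" "t \<le> T"
  shows "pint f t \<le> pint f T"
  unfolding pint_alt
proof (rule integral_mono)
  show "integrable lebesgue (\<lambda>s. indicat_real {0<..<t} s *\<^sub>R f s)"
    using set_integrable_sub[OF assms(1,3)] by (simp add: set_integrable_def)
  show "integrable lebesgue (\<lambda>s. indicat_real {0<..<T} s *\<^sub>R f s)"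
    using assms(1) by (simp add: set_integrable_def)
  show "indicat_real {0<..<t} s *\<^sub>R f s \<le> indicat_real {0<..<T} s *\<^sub>R f s" for s
    using assms(2)[of s] assms(3) by (auto simp: indicator_def)
qed

lemma L2_sq_integrable: "f \<in> L2_space T \<Longrightarrow> set_integrable lebesgue {0<..<T} (\<lambda>t. (norm (f t))\<^sup>2)"
  by (simp add: L2_space_def)

lemma norm_sq_diff_le: "(norm (x - y))\<^sup>2 \<le> 2 * (norm x)\<^sup>2 + 2 * (norm y)\<^sup>2"
proof -
  have "(norm (x - y))\<^sup>2 \<le> (norm x + norm y)\<^sup>2" by (intro power_mono norm_triangle_ineq4) simp
  then show ?thesis using zero_le_power2[of "norm x - norm y"] by (simp add: power2_sum power2_diff)
qed

text \<open>A maximum of \<open>y t * exp (- (2 * k * t))\<close> is attained. Because the exponent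
  is \<open>2 * k\<close> and not \<open>k\<close>, the integral term contributes at most half of
  that maximum and can be absorbed; the price is the factor 2.\<close>

lemma gronwall:
  fixes y :: "real \<Rightarrow> real"
  assumes T: "0 \<le> T" and y: "continuous_on {0..T} y" and k: "0 \<le> k" and E: "0 \<le> E"
    and le: "\<And>t. t \<in> {0..T} \<Longrightarrow> y t \<le> E + k * pint y t" and t: "t \<in> {0..T}"
  shows "y t \<le> 2 * E * exp (2 * k * t)"
proof -
  have "continuous_on {0..T} (\<lambda>t. y t * exp (- (2 * k * t)))"
    by (intro continuous_intros y)
  then obtain t0 where t0: "t0 \<in> {0..T}" "\<And>t. t \<in> {0..T} \<Longrightarrow> y t * exp (- (2 * k * t)) \<le> y t0 * exp (- (2 * k * t0))"
    using continuous_attains_sup[of "{0..T}" "\<lambda>t. y t * exp (- (2 * k * t))"] T by auto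
  define m where "m = max 0 (y t0 * exp (- (2 * k * t0)))"
  have bound: "y t \<le> m * exp (2 * k * t)" if "t \<in> {0..T}" for t
  proof -
    have "y t * exp (- (2 * k * t)) \<le> m" using t0(2)[OF that] by (simp add: m_def)
    then have "y t * exp (- (2 * k * t)) * exp (2 * k * t) \<le> m * exp (2 * k * t)"
      by (rule mult_right_mono) simp
    then show ?thesis by (simp add: mult.assoc flip: exp_add)
  qed
  have ce: "continuous_on A (\<lambda>s. exp (2 * k * s))" for A by (intro continuous_intros)
  have fe: "k * pint (\<lambda>s. exp (2 * k * s)) t0 \<le> exp (2 * k * t0) / 2"
  proof -
    have "exp (2 * k * t0) / 2 = exp (2 * k * 0) / 2 + pint (\<lambda>s. k * exp (2 * k * s)) t0"
    proof (rule FTC_pint)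
      show "((\<lambda>s. exp (2 * k * s) / 2) has_vector_derivative k * exp (2 * k * s)) (at s)" for s
        unfolding has_real_derivative_iff_has_vector_derivative[symmetric]
        by (auto intro!: derivative_eq_intros)
    qed (use t0 in \<open>auto intro!: continuous_intros\<close>)
    then show ?thesis by (simp add: pint_mult)
  qed
  have "y t0 \<le> E + k * pint y t0" by (rule le[OF t0(1)])
  also have "pint y t0 \<le> pint (\<lambda>s. m * exp (2 * k * s)) t0"
    by (rule pint_mono)
      (use t0 bound in \<open>auto intro!: continuous_imp_set_integrable continuous_intros continuous_on_subset[OF y]\<close>)
  also have "\<dots> = m * pint (\<lambda>s. exp (2 * k * s)) t0" by (rule pint_mult)
  finally have "y t0 \<le> E + k * (m * pint (\<lambda>s. exp (2 * k * s)) t0)"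
    using k by (simp add: mult_left_mono)
  also have "\<dots> \<le> E + m * (exp (2 * k * t0) / 2)"
    using mult_left_mono[OF fe, of m] by (simp add: m_def mult_ac)
  finally have "y t0 * exp (- (2 * k * t0)) \<le> (E + m * (exp (2 * k * t0) / 2)) * exp (- (2 * k * t0))"
    by (rule mult_right_mono) simp
  also have "\<dots> = E * exp (- (2 * k * t0)) + m / 2"
    by (simp add: distrib_right mult.assoc flip: exp_add)
  also have "\<dots> \<le> E + m / 2"
    using mult_left_mono[of "exp (- (2 * k * t0))" 1 E] E k t0(1) by simp
  finally have "m \<le> 2 * E"
    using E by (auto simp: m_def max_def split: if_splits)
  then have "m * exp (2 * k * t) \<le> 2 * E * exp (2 * k * t)" by (rule mult_right_mono) simp
  then show ?thesis using bound[OF t] by linarith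
qed

text \<open>Riesz--Fischer along a subsequence with geometrically decreasing increments.\<close>

lemma L2_Cauchy_AE_convergent:
  fixes p :: "nat \<Rightarrow> real \<Rightarrow> 'e::{banach, second_countable_topology}"
  assumes T: "0 \<le> T" and p: "\<And>n. continuous_on {0..T} (p n)"
    and bound: "\<And>n m. pint (\<lambda>t. (norm (p n t - p m t))\<^sup>2) T \<le> e n + e m"
    and e: "e \<longlonglongrightarrow> (0::real)"
  shows "\<exists>r. strict_mono r \<and> (AE t\<in>{0<..<T} in lebesgue. convergent (\<lambda>k. p (r k) t))"
proof -
  have "\<exists>r. strict_mono r \<and> (\<forall>k::nat. \<forall>m\<ge>r k. e m \<le> 1 / 4 ^ k)"
  proof -
    have "\<exists>N. \<forall>m\<ge>N. e m \<le> 1 / 4 ^ k" for k :: nat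
      using order_tendstoD(2)[OF e, of "1 / 4 ^ k"] by (auto simp: eventually_sequentially intro: less_imp_le)
    then obtain N where N: "\<And>k m. N k \<le> m \<Longrightarrow> e m \<le> 1 / 4 ^ k" by metis
    define r where "r k = (\<Sum>l\<le>k. N l + 1)" for k
    have "strict_mono r" by (rule strict_monoI_Suc) (simp add: r_def)
    moreover have "N k \<le> r k" for k
    proof -
      have "N k + 1 \<le> (\<Sum>l\<le>k. N l + 1)" by (rule member_le_sum) auto
      then show ?thesis by (simp add: r_def)
    qed
    ultimately show ?thesis using N by (intro exI[of _ r]) (meson order_trans)
  qed
  then obtain r where r: "strict_mono r" "\<And>k m. r k \<le> m \<Longrightarrow> e m \<le> 1 / 4 ^ k" by blast
  define d where "d k t = norm (p (r (Suc k)) t - p (r k) t)" for k t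
  have dc: "continuous_on {0..T} (d k)" for k unfolding d_def by (intro continuous_intros p)
  have di: "integrable lebesgue (\<lambda>t. indicat_real {0<..<T} t *\<^sub>R d k t)" for k
    using continuous_imp_set_integrable[OF dc] by (simp add: set_integrable_def)
  have dk: "pint (d k) T \<le> (1 + T / 2) * (1 / 2) ^ k" for k
  proof -
    \<comment> \<open>The inequality between arithmetic and geometric means converts the decay
      \<open>4 ^ (-k)\<close> of the squares into the decay \<open>2 ^ (-k)\<close> of the integrals
      of the norms.\<close>
    have "d k t \<le> 2 ^ k / 2 * (d k t)\<^sup>2 + 1 / (2 * 2 ^ k)" for t
    proof -
      have "0 \<le> (2 ^ k * d k t - 1)\<^sup>2" by simp
      then have "2 * 2 ^ k * d k t \<le> (2 ^ k * d k t)\<^sup>2 + 1" by (simp add: power2_diff)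
      then show ?thesis by (simp add: field_simps power2_eq_square)
    qed
    then have "pint (d k) T \<le> pint (\<lambda>t. 2 ^ k / 2 * (d k t)\<^sup>2 + 1 / (2 * 2 ^ k)) T"
      by (intro pint_mono continuous_imp_set_integrable dc continuous_intros)
    also have "\<dots> = 2 ^ k / 2 * pint (\<lambda>t. (d k t)\<^sup>2) T + 1 / (2 * 2 ^ k) * T"
      by (simp only: pint_add[OF set_integrable_mult_right[OF continuous_imp_set_integrable[OF continuous_on_power[OF dc]]]
            continuous_imp_set_integrable[OF continuous_on_const]] pint_mult pint_const[OF T])
    also have "pint (\<lambda>t. (d k t)\<^sup>2) T \<le> 1 / 4 ^ k + 1 / 4 ^ k"
      unfolding d_def
      by (rule order_trans[OF bound add_mono[OF r(2) r(2)]]) (use r(1) in \<open>auto simp: strict_mono_less_eq\<close>)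
    finally have "pint (d k) T \<le> 2 ^ k / 2 * (1 / 4 ^ k + 1 / 4 ^ k) + 1 / (2 * 2 ^ k) * T"
      by (simp add: mult_left_mono)
    also have "\<dots> = (1 + T / 2) * (1 / 2) ^ k"
    proof -
      have "(4::real) ^ k = 2 ^ k * 2 ^ k" by (simp flip: power_mult_distrib)
      then show ?thesis by (simp add: field_simps power_one_over)
    qed
    finally show ?thesis .
  qed
  have nn: "(\<integral>\<^sup>+t. ennreal (indicat_real {0<..<T} t *\<^sub>R d k t) \<partial>lebesgue) = ennreal (pint (d k) T)" for k
    unfolding pint_alt by (rule nn_integral_eq_integral[OF di]) (simp add: d_def)
  have "(\<integral>\<^sup>+t. (\<Sum>k. ennreal (indicat_real {0<..<T} t *\<^sub>R d k t)) \<partial>lebesgue)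
      = (\<Sum>k. \<integral>\<^sup>+t. ennreal (indicat_real {0<..<T} t *\<^sub>R d k t) \<partial>lebesgue)"
    by (rule nn_integral_suminf) (use di[THEN borel_measurable_integrable] in measurable)
  also have "\<dots> \<le> (\<Sum>k. ennreal ((1 + T / 2) * (1 / 2) ^ k))"
    unfolding nn by (intro suminf_le ennreal_leI dk) auto
  also have "\<dots> = ennreal (\<Sum>k. (1 + T / 2) * (1 / 2) ^ k)"
    by (rule suminf_ennreal2) (use T in \<open>auto intro!: summable_mult summable_geometric\<close>)
  also have "\<dots> < \<infinity>" by simp
  finally have fin: "(\<integral>\<^sup>+t. (\<Sum>k. ennreal (indicat_real {0<..<T} t *\<^sub>R d k t)) \<partial>lebesgue) \<noteq> \<infinity>" by simp
  have "AE t in lebesgue. (\<Sum>k. ennreal (indicat_real {0<..<T} t *\<^sub>R d k t)) \<noteq> \<infinity>"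
    by (rule nn_integral_noteq_infinite[OF _ fin]) (use di[THEN borel_measurable_integrable] in measurable)
  then have "AE t\<in>{0<..<T} in lebesgue. convergent (\<lambda>k. p (r k) t)"
  proof eventually_elim
    case (elim t)
    show ?case
    proof
      assume t: "t \<in> {0<..<T}"
      have "summable (\<lambda>k. d k t)"
        by (rule summable_suminf_not_top) (use elim t in \<open>auto simp: d_def top_ennreal_def\<close>)
      then have "summable (\<lambda>k. p (r (Suc k)) t - p (r k) t)"
        unfolding d_def by (rule summable_norm_cancel)
      then have "convergent (\<lambda>n. \<Sum>k<n. p (r (Suc k)) t - p (r k) t)"
        by (simp add: summable_iff_convergent)
      then have "convergent (\<lambda>n. (p (r n) t - p (r 0) t) + p (r 0) t)"
        by (intro convergent_add convergent_const) (simp add: sum_lessThan_telescope[of "\<lambda>k. p (r k) t"])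
      then show "convergent (\<lambda>k. p (r k) t)" by simp
    qed
  qed
  then show ?thesis using r(1) by blast
qed

context shifted_form
begin

text \<open>The resolvent with step \<open>1 / (n + 1)\<close>, a Yosida-type smoothing that tends
  strongly to the identity on \<open>H\<close> and on the antidual.\<close>

definition Jn :: "nat \<Rightarrow> 'v antidual \<Rightarrow> 'v" where
  "Jn n = Rv 1 (of_real (inverse (real (Suc n))))"

text \<open>Two smoothing factors are used: one alone maps the antidual into \<open>V\<close>, while
  the time derivative of a smoothed mild solution also contains \<open>A\<close> and needs a second
  factor to have values in \<open>V\<close>.\<close>

definition Ln :: "nat \<Rightarrow> 'v antidual \<Rightarrow> 'v" where "Ln n x = Jn n (\<iota> (Jn n x))"

lemma iota_bl: "bounded_linear (\<lambda>v. \<iota> v)"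
  by (rule bounded_linear_compose[OF j.bounded_linear_axioms i.bounded_linear_axioms])

lemma inv_Suc: "0 < inverse (real (Suc n))" "of_real (inverse (real (Suc n))) \<in> cone"
  "of_real (inverse (real (Suc n))) \<noteq> (0::complex)"
  by (simp, rule cone_of_real, simp_all del: of_nat_Suc)

lemma Jn_bl: "bounded_linear (Jn n)"
  unfolding Jn_def by (rule Rv_bounded_linear[OF zero_le_one inv_Suc(2,3)])

lemma Ln_bl: "bounded_linear (Ln n)"
  unfolding Ln_def[abs_def]
  by (rule bounded_linear_compose[OF Jn_bl bounded_linear_compose[OF iota_bl Jn_bl]])

lemma Jn_eq: "\<iota> (Jn n x) + inverse (real (Suc n)) *\<^sub>R Lp (Jn n x) = x"
  using Rv_eq[OF zero_le_one inv_Suc(2,3), of n x] by (simp add: Jn_def scaleC_of_real del: of_nat_Suc of_real_inverse)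

lemma Jn_J: "Jn n (\<iota> (J x)) = J (\<iota> (Jn n x))"
  unfolding Jn_def J_def by (rule Rv_commute[OF zero_le_one inv_Suc(2,3)]) auto

lemma Jn_iota: "Jn n (\<iota> v) = J (\<iota> (Jn n (Lp v)))"
  using Jn_J[of n "Lp v"] by simp

lemma Lp_Jn: "Lp (Jn n (\<iota> v)) = \<iota> (Jn n (Lp v))"
  by (simp add: Jn_iota)

text \<open>A bound for \<open>\<iota> (Jn n x)\<close> that is uniform in \<open>n\<close>: in
  \<open>\<iota> (Jn n x) = x - s *\<^sub>R Lp (Jn n x)\<close> the factor \<open>s\<close>
  compensates the \<open>1 / s\<close> in the bound of \<open>Jn n\<close> from
  \<open>norm_Rv\<close>.\<close>

definition M0 :: real where "M0 = 1 + 2 * C / c"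

lemma M0_pos: "0 < M0"
  using C_pos c_pos by (simp add: M0_def add_pos_pos)

lemma iota_Jn_bound: "norm (\<iota> (Jn n x)) \<le> M0 * norm x"
proof -
  define s where "s = inverse (real (Suc n))"
  have s: "0 < s" unfolding s_def by (rule inv_Suc)
  have "norm (Jn n x) \<le> 2 / (c * s) * norm x"
    using norm_Rv[OF zero_le_one inv_Suc(2,3), of n x] s by (simp add: Jn_def s_def[symmetric] del: of_nat_Suc of_real_inverse)
  then have "s * (C * norm (Jn n x)) \<le> s * (C * (2 / (c * s) * norm x))"
    using s C_pos by (intro mult_left_mono) auto
  also have "\<dots> = 2 * C / c * norm x" using s c_pos by (simp add: field_simps)
  finally have 1: "s * (C * norm (Jn n x)) \<le> 2 * C / c * norm x" .
  have "\<iota> (Jn n x) = x - s *\<^sub>R Lp (Jn n x)" using Jn_eq[of n x] by (simp add: s_def algebra_simps)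
  also have "norm \<dots> \<le> norm x + s * (C * norm (Jn n x))"
    using s norm_Lp[of "Jn n x"] by (intro order_trans[OF norm_triangle_ineq4] add_mono) auto
  finally show ?thesis using 1 by (simp add: M0_def distrib_right)
qed

lemma Jn_H_tendsto: "(\<lambda>n. i (Jn n (j x))) \<longlonglongrightarrow> x"
proof -
  have "filterlim (\<lambda>n. inverse (real (Suc n))) (at_right 0) sequentially"
    unfolding filterlim_at using LIMSEQ_inverse_real_of_nat by auto
  from filterlim_compose[OF Rh_tendsto this]
  show ?thesis by (simp add: Rh_def Jn_def del: of_nat_Suc of_real_inverse)
qed

lemma iota_Jn_tendsto: "(\<lambda>n. \<iota> (Jn n x)) \<longlonglongrightarrow> x"
proof (rule tendsto_dense[where S = "\<lambda>n x. \<iota> (Jn n x)" and L = "\<lambda>x. x" and D = "range j" and M = M0])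
  have lip: "norm (\<iota> (Jn n x) - \<iota> (Jn n y)) \<le> M0 * norm (x - y)" for n x y
  proof -
    interpret Jn: bounded_linear "Jn n" by (rule Jn_bl)
    show ?thesis using iota_Jn_bound[of n "x - y"] by (simp add: Jn.diff i.diff j.diff)
  qed
  then show "\<forall>\<^sub>F n in sequentially. \<forall>x y. norm (\<iota> (Jn n x) - \<iota> (Jn n y)) \<le> M0 * norm (x - y)" by simp
  show "norm (x - y) \<le> M0 * norm (x - y)" for x y :: "'v antidual"
    using mult_right_mono[of 1 M0 "norm (x - y)"] C_pos c_pos by (simp add: M0_def)
  show "closure (range j) = UNIV" by (rule dense_dual_embed[OF emb])
  show "(\<lambda>n. \<iota> (Jn n x)) \<longlonglongrightarrow> x" if "x \<in> range j" for x
    using that by (auto intro!: j.tendsto Jn_H_tendsto)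
qed

lemma iota_Ln_bound: "norm (\<iota> (Ln n x)) \<le> M0\<^sup>2 * norm x"
proof -
  have "norm (\<iota> (Ln n x)) \<le> M0 * norm (\<iota> (Jn n x))" unfolding Ln_def by (rule iota_Jn_bound)
  also have "\<dots> \<le> M0 * (M0 * norm x)" using M0_pos by (intro mult_left_mono iota_Jn_bound) auto
  finally show ?thesis by (simp add: power2_eq_square)
qed

lemma Jn_seq_tendsto:
  assumes "x \<longlonglongrightarrow> y"
  shows "(\<lambda>n. \<iota> (Jn n (x n))) \<longlonglongrightarrow> y"
proof -
  have "(\<lambda>n. \<iota> (Jn n (x n)) - \<iota> (Jn n y)) \<longlonglongrightarrow> 0"
  proof (rule Lim_null_comparison)
    show "\<forall>\<^sub>F n in sequentially. norm (\<iota> (Jn n (x n)) - \<iota> (Jn n y)) \<le> M0 * norm (x n - y)"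
    proof (rule always_eventually, rule allI)
      fix n
      interpret Jn: bounded_linear "Jn n" by (rule Jn_bl)
      show "norm (\<iota> (Jn n (x n)) - \<iota> (Jn n y)) \<le> M0 * norm (x n - y)"
        using iota_Jn_bound[of n "x n - y"] by (simp add: Jn.diff i.diff j.diff)
    qed
    have "(\<lambda>n. M0 * norm (x n - y)) \<longlonglongrightarrow> M0 * norm (y - y)" by (intro tendsto_intros assms)
    then show "(\<lambda>n. M0 * norm (x n - y)) \<longlonglongrightarrow> 0" by simp
  qed
  from tendsto_add[OF this iota_Jn_tendsto[of y]] show ?thesis by simp
qed

lemma iota_Ln_tendsto: "(\<lambda>n. \<iota> (Ln n x)) \<longlonglongrightarrow> x"
  unfolding Ln_def by (rule Jn_seq_tendsto[OF iota_Jn_tendsto])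

lemma norm_i_Jn: "norm (i (Jn n (j x))) \<le> norm x"
  using norm_Rh[OF inv_Suc(2)[of n], of x] inv_Suc(3)[of n] by (simp add: Rh_def Jn_def)

lemma i_Ln_tendsto: "(\<lambda>n. i (Ln n (j x))) \<longlonglongrightarrow> x"
proof -
  have "(\<lambda>n. i (Ln n (j x)) - i (Jn n (j x))) \<longlonglongrightarrow> 0"
  proof (rule Lim_null_comparison)
    show "\<forall>\<^sub>F n in sequentially. norm (i (Ln n (j x)) - i (Jn n (j x))) \<le> norm (i (Jn n (j x)) - x)"
    proof (rule always_eventually, rule allI)
      fix n
      interpret Jn: bounded_linear "Jn n" by (rule Jn_bl)
      show "norm (i (Ln n (j x)) - i (Jn n (j x))) \<le> norm (i (Jn n (j x)) - x)"
        using norm_i_Jn[of n "i (Jn n (j x)) - x"] by (simp add: Ln_def Jn.diff i.diff j.diff)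
    qed
    show "(\<lambda>n. norm (i (Jn n (j x)) - x)) \<longlonglongrightarrow> 0"
      by (rule tendsto_norm_zero[OF LIM_zero[OF Jn_H_tendsto]])
  qed
  from tendsto_add[OF this Jn_H_tendsto[of x]] show ?thesis by simp
qed

text \<open>Both \<open>p\<close> and its derivative \<open>g\<close> take values in
  \<open>V\<close>, so the product rule in \<open>H\<close> applies to the squared norm and the
  equation may be tested with \<open>p\<close> at every time.\<close>

definition strong_sol :: "real \<Rightarrow> (real \<Rightarrow> 'v) \<Rightarrow> (real \<Rightarrow> 'v antidual) \<Rightarrow> bool" where
  "strong_sol T p h \<longleftrightarrow> continuous_on {0..T} p \<and> h \<in> L2_space T \<and>
    (\<exists>g. set_integrable lebesgue {0<..<T} g \<and> (\<forall>t\<in>{0..T}. p t = p 0 + pint g t) \<and>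
      (\<forall>s\<in>{0<..<T}. \<iota> (g s) = h s - La (p s)))"

lemma strong_sol_diff:
  assumes "strong_sol T p h" "strong_sol T q k"
  shows "strong_sol T (\<lambda>t. p t - q t) (\<lambda>t. h t - k t)"
proof -
  obtain g where g: "set_integrable lebesgue {0<..<T} g" "\<forall>t\<in>{0..T}. p t = p 0 + pint g t"
    "\<forall>s\<in>{0<..<T}. \<iota> (g s) = h s - La (p s)"
    using assms(1) unfolding strong_sol_def by blast
  obtain l where l: "set_integrable lebesgue {0<..<T} l" "\<forall>t\<in>{0..T}. q t = q 0 + pint l t"
    "\<forall>s\<in>{0<..<T}. \<iota> (l s) = k s - La (q s)"
    using assms(2) unfolding strong_sol_def by blast
  show ?thesis
    unfolding strong_sol_def
  proof (intro conjI exI[of _ "\<lambda>t. g t - l t"] ballI)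
    show "continuous_on {0..T} (\<lambda>t. p t - q t)" "(\<lambda>t. h t - k t) \<in> L2_space T"
      using assms unfolding strong_sol_def by (auto intro: continuous_on_diff L2_diff)
    show "set_integrable lebesgue {0<..<T} (\<lambda>t. g t - l t)" by (intro set_integral_diff g l)
    show "p t - q t = p 0 - q 0 + pint (\<lambda>t. g t - l t) t" if t: "t \<in> {0..T}" for t
    proof -
      have "pint (\<lambda>t. g t - l t) t = pint g t - pint l t"
        using t by (intro pint_diff set_integrable_sub[OF g(1)] set_integrable_sub[OF l(1)]) auto
      moreover have "p t = p 0 + pint g t" "q t = q 0 + pint l t" using g(2) l(2) t by blast+
      ultimately show ?thesis by simp
    qed
    show "\<iota> (g s - l s) = h s - k s - La (p s - q s)" if "s \<in> {0<..<T}" for s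
    proof -
      have "\<iota> (g s) = h s - La (p s)" "\<iota> (l s) = k s - La (q s)" using g(3) l(3) that by blast+
      then show ?thesis by (simp add: i.diff j.diff La.diff)
    qed
  qed
qed

text \<open>The Gronwall factor for the norm in \<open>H\<close>, plus the constant that it entails
  for the integral of the squared norm in \<open>V\<close>; the sum serves in both
  estimates.\<close>

definition GT :: "real \<Rightarrow> real" where
  "GT T = 2 * exp (4 * \<kappa> * T) + (1 + 2 * \<kappa> * T * (2 * exp (4 * \<kappa> * T))) / c"

definition energy :: "real \<Rightarrow> 'h \<Rightarrow> (real \<Rightarrow> 'v antidual) \<Rightarrow> real" where
  "energy T x h = (norm x)\<^sup>2 + 1 / c * pint (\<lambda>t. (norm (h t))\<^sup>2) T"

lemma energy_nonneg: "0 \<le> energy T x h"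
  using c_pos by (simp add: energy_def pint_nonneg)

lemma GT_nonneg: "0 \<le> T \<Longrightarrow> 0 \<le> GT T"
  using c_pos kappa_nonneg by (simp add: GT_def)

text \<open>The equation is tested with \<open>p\<close>. Coercivity provides \<open>2 * c\<close>
  times the squared norm of \<open>p\<close>; one half of it absorbs the right-hand side by Young's
  inequality, which puts the weight \<open>1 / c\<close> into \<open>energy\<close>, and the other
  half is kept. Gronwall's lemma handles the shift term.\<close>

lemma energy_estimate:
  assumes T: "0 \<le> T" and sol: "strong_sol T p h"
  shows "t \<in> {0..T} \<Longrightarrow> (norm (i (p t)))\<^sup>2 \<le> GT T * energy T (i (p 0)) h"
    and "pint (\<lambda>t. (norm (p t))\<^sup>2) T \<le> GT T * energy T (i (p 0)) h"
proof -
  obtain g where g: "set_integrable lebesgue {0<..<T} g" "\<And>t. t \<in> {0..T} \<Longrightarrow> p t = p 0 + pint g t"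
    "\<And>s. s \<in> {0<..<T} \<Longrightarrow> \<iota> (g s) = h s - La (p s)"
    and p: "continuous_on {0..T} p" and h: "h \<in> L2_space T"
    using sol unfolding strong_sol_def by blast
  define E where "E = energy T (i (p 0)) h"
  have E: "0 \<le> E" by (simp add: E_def energy_nonneg)
  define y where "y t = (norm (i (p t)))\<^sup>2" for t
  have ip: "continuous_on {0..T} (\<lambda>t. i (p t))" by (rule i.continuous_on[OF p])
  have yc: "continuous_on {0..T} y" unfolding y_def by (intro continuous_intros ip)
  have pc: "continuous_on {0..T} (\<lambda>t. (norm (p t))\<^sup>2)" by (intro continuous_intros p)
  have hi: "set_integrable lebesgue {0<..<T} (\<lambda>t. (norm (h t))\<^sup>2)" by (rule L2_sq_integrable[OF h])
  have bil: "bounded_bilinear (\<lambda>x y::'h. Re (cinner x y))"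
  proof
    show "\<exists>K. \<forall>x y::'h. norm (Re (cinner x y)) \<le> norm x * norm y * K"
      by (rule exI[of _ 1]) (simp add: Re_cinner_le)
  qed (simp_all add: cinner_add_left cinner_add_right cinner_scaleR_left cinner_scaleR_right)
  have gi: "set_integrable lebesgue {0<..<T} (\<lambda>t. i (g t))"
    by (rule set_integrable_bounded_linear[OF i_bl g(1)])
  have ipt: "i (p t) = i (p 0) + pint (\<lambda>s. i (g s)) t" if t: "t \<in> {0..T}" for t
  proof -
    have "pint (\<lambda>s. i (g s)) t = i (pint g t)"
      by (rule pint_bounded_linear[OF i_bl set_integrable_sub[OF g(1)]]) (use t in auto)
    then show ?thesis by (subst g(2)[OF t]) (simp add: i.add)
  qed
  define D where "D s = Re (cinner (i (g s)) (i (p s))) + Re (cinner (i (p s)) (i (g s)))" for s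
  define R where "R s = 1 / c * (norm (h s))\<^sup>2 - c * (norm (p s))\<^sup>2 + 2 * \<kappa> * y s" for s
  have DR: "D s \<le> R s" if s: "s \<in> {0<..<T}" for s
  proof -
    have "D s = 2 * Re (dual_pairing (\<iota> (g s)) (p s))"
      by (simp add: D_def pair_j Re_cinner_commute[of "i (p s)"])
    also have "dual_pairing (\<iota> (g s)) (p s) = dual_pairing (h s) (p s) - a (p s) (p s)"
      by (simp add: g(3)[OF s] dual_pairing.diff_left dual_pairing_lax_milgram_ext[OF form])
    also have "a (p s) (p s) = ap (p s) (p s) - \<kappa> * of_real (y s)"
      by (simp add: ap_def y_def cinner_self)
    finally have D: "D s = 2 * Re (dual_pairing (h s) (p s)) - 2 * Re (ap (p s) (p s)) + 2 * \<kappa> * y s"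
      by simp
    have "Re (dual_pairing (h s) (p s)) \<le> norm (h s) * norm (p s)"
      using norm_dual_pairing_le[of "h s" "p s"] complex_Re_le_cmod order_trans by blast
    moreover have "2 * (norm (h s) * norm (p s)) \<le> 1 / c * (norm (h s))\<^sup>2 + c * (norm (p s))\<^sup>2"
    proof -
      have "0 \<le> 1 / c * (norm (h s) - c * norm (p s))\<^sup>2" using c_pos by simp
      also have "\<dots> = 1 / c * (norm (h s))\<^sup>2 - 2 * (norm (h s) * norm (p s)) + c * (norm (p s))\<^sup>2"
        using c_pos by (simp add: power2_eq_square field_simps)
      finally show ?thesis by simp
    qed
    ultimately show ?thesis using ap_coercive[of "p s"] D unfolding R_def by linarith
  qed
  have Ri: "set_integrable lebesgue {0<..<T} R"
    unfolding R_def
    by (intro set_integral_add set_integral_diff set_integrable_mult_right hi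
        continuous_imp_set_integrable[OF pc] continuous_imp_set_integrable[OF yc])
  have main: "y t + c * pint (\<lambda>s. (norm (p s))\<^sup>2) t \<le> E + 2 * \<kappa> * pint y t" if t: "t \<in> {0..T}" for t
  proof -
    have tT: "t \<le> T" using t by simp
    have "Re (cinner (i (p t)) (i (p t))) = Re (cinner (i (p 0)) (i (p 0))) + pint D t"
      unfolding D_def by (rule product_rule_pint(2)[OF bil gi gi ipt ipt t])
    moreover have "set_integrable lebesgue {0<..<t} D"
      unfolding D_def by (rule product_rule_pint(1)[OF bil gi gi ipt ipt t])
    then have "pint D t \<le> pint R t"
      by (rule pint_mono[OF _ set_integrable_sub[OF Ri tT]]) (use DR t in auto)
    moreover have "pint R t = 1 / c * pint (\<lambda>s. (norm (h s))\<^sup>2) t - c * pint (\<lambda>s. (norm (p s))\<^sup>2) t + 2 * \<kappa> * pint y t"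
    proof -
      note i = set_integrable_sub[OF hi tT] set_integrable_sub[OF continuous_imp_set_integrable[OF pc] tT]
        set_integrable_sub[OF continuous_imp_set_integrable[OF yc] tT]
      show ?thesis
        unfolding R_def
        by (simp only: pint_add[OF set_integral_diff(1)[OF set_integrable_mult_right[OF i(1)] set_integrable_mult_right[OF i(2)]]
              set_integrable_mult_right[OF i(3)]]
            pint_diff[OF set_integrable_mult_right[OF i(1)] set_integrable_mult_right[OF i(2)]] pint_mult)
    qed
    moreover have "1 / c * pint (\<lambda>s. (norm (h s))\<^sup>2) t \<le> 1 / c * pint (\<lambda>s. (norm (h s))\<^sup>2) T"
      using c_pos by (intro mult_left_mono pint_mono_set[OF hi _ tT]) auto
    ultimately show ?thesis
      unfolding E_def energy_def y_def norm_sq_cinner[of "i (p t)"] norm_sq_cinner[of "i (p 0)"] by linarith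
  qed
  have yb: "y t \<le> 2 * exp (4 * \<kappa> * T) * E" if t: "t \<in> {0..T}" for t
  proof -
    have "y t \<le> 2 * E * exp (2 * (2 * \<kappa>) * t)"
    proof (rule gronwall[OF T yc _ E _ t])
      fix s assume s: "s \<in> {0..T}"
      have "0 \<le> c * pint (\<lambda>s. (norm (p s))\<^sup>2) s" using c_pos by (simp add: pint_nonneg)
      then show "y s \<le> E + 2 * \<kappa> * pint y s" using main[OF s] by linarith
    qed (use kappa_nonneg in simp)
    also have "\<dots> \<le> 2 * E * exp (4 * \<kappa> * T)"
      using t kappa_nonneg E by (intro mult_left_mono) (auto simp: mult_left_mono)
    finally show ?thesis by (simp add: mult_ac)
  qed
  have GE: "GT T * E = 2 * exp (4 * \<kappa> * T) * E + (E + 2 * \<kappa> * T * (2 * exp (4 * \<kappa> * T)) * E) / c"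
    by (simp add: GT_def distrib_right add_divide_distrib)
  have nn: "0 \<le> (E + 2 * \<kappa> * T * (2 * exp (4 * \<kappa> * T)) * E) / c" "0 \<le> 2 * exp (4 * \<kappa> * T) * E"
    using E T kappa_nonneg c_pos by simp_all
  show "(norm (i (p t)))\<^sup>2 \<le> GT T * energy T (i (p 0)) h" if "t \<in> {0..T}"
    using yb[OF that] nn unfolding E_def[symmetric] GE y_def by linarith
  have "pint y T \<le> pint (\<lambda>_. 2 * exp (4 * \<kappa> * T) * E) T"
    by (rule pint_mono[OF continuous_imp_set_integrable[OF yc] continuous_imp_set_integrable[OF continuous_on_const]])
      (use yb in auto)
  also have "\<dots> = 2 * exp (4 * \<kappa> * T) * E * T" by (rule pint_const[OF T])
  finally have "2 * \<kappa> * pint y T \<le> 2 * \<kappa> * (2 * exp (4 * \<kappa> * T) * E * T)"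
    using kappa_nonneg by (intro mult_left_mono) auto
  moreover have "0 \<le> y T" by (simp add: y_def)
  ultimately have "c * pint (\<lambda>s. (norm (p s))\<^sup>2) T \<le> E + 2 * \<kappa> * T * (2 * exp (4 * \<kappa> * T)) * E"
    using main[of T] T by (simp add: mult_ac)
  then have "pint (\<lambda>s. (norm (p s))\<^sup>2) T \<le> (E + 2 * \<kappa> * T * (2 * exp (4 * \<kappa> * T)) * E) / c"
    using c_pos by (simp add: field_simps)
  then show "pint (\<lambda>t. (norm (p t))\<^sup>2) T \<le> GT T * energy T (i (p 0)) h"
    using nn unfolding E_def[symmetric] GE by linarith
qed

text \<open>The equation \<open>P' + AP = f\<close>, integrated in time and smoothed by \<open>J\<close>. In this form it makes
  sense for functions that are merely continuous with values in the antidual of \<open>V\<close>.\<close>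

definition mild_sol :: "real \<Rightarrow> (real \<Rightarrow> 'v antidual) \<Rightarrow> (real \<Rightarrow> 'v antidual) \<Rightarrow> bool" where
  "mild_sol T P f \<longleftrightarrow> continuous_on {0..T} P \<and> f \<in> L2_space T \<and>
    (\<forall>t\<in>{0..T}. \<iota> (J (P t)) = \<iota> (J (P 0)) + pint (\<lambda>s. \<iota> (J (f s)) - P s + \<kappa> *\<^sub>R \<iota> (J (P s))) t)"

lemma iotaJ_bl: "bounded_linear (\<lambda>x. \<iota> (J x))"
  by (rule bounded_linear_compose[OF iota_bl J.bounded_linear_axioms])

lemma rhs_y_bl: "bounded_linear (\<lambda>y. - y + \<kappa> *\<^sub>R \<iota> (J y))"
  by (intro bounded_linear_add bounded_linear_minus bounded_linear_ident bounded_linear_const_scaleR iotaJ_bl)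

lemma rhs_integrable:
  assumes "set_integrable lebesgue {0<..<T} f" "set_integrable lebesgue {0<..<T} P"
  shows "set_integrable lebesgue {0<..<T} (\<lambda>s. \<iota> (J (f s)) - P s + \<kappa> *\<^sub>R \<iota> (J (P s)))"
proof -
  have "set_integrable lebesgue {0<..<T} (\<lambda>s. \<iota> (J (f s)) + (- P s + \<kappa> *\<^sub>R \<iota> (J (P s))))"
    by (intro set_integral_add set_integrable_bounded_linear[OF iotaJ_bl] set_integrable_bounded_linear[OF rhs_y_bl] assms)
  moreover have "\<iota> (J (f s)) - P s + \<kappa> *\<^sub>R \<iota> (J (P s)) = \<iota> (J (f s)) + (- P s + \<kappa> *\<^sub>R \<iota> (J (P s)))" for s by simp
  ultimately show ?thesis by (simp only:)
qed

lemma mild_solD: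
  assumes "mild_sol T P f"
  shows "continuous_on {0..T} P" "f \<in> L2_space T" "set_integrable lebesgue {0<..<T} f"
    "set_integrable lebesgue {0<..<T} P"
    "set_integrable lebesgue {0<..<T} (\<lambda>s. \<iota> (J (f s)) - P s + \<kappa> *\<^sub>R \<iota> (J (P s)))"
    "t \<in> {0..T} \<Longrightarrow> \<iota> (J (P t)) = \<iota> (J (P 0)) + pint (\<lambda>s. \<iota> (J (f s)) - P s + \<kappa> *\<^sub>R \<iota> (J (P s))) t"
proof -
  show 1: "continuous_on {0..T} P" "f \<in> L2_space T"
    using assms unfolding mild_sol_def by blast+
  show 2: "set_integrable lebesgue {0<..<T} f" by (rule L2_space_imp_integrable[OF 1(2)])
  show 3: "set_integrable lebesgue {0<..<T} P" by (rule continuous_imp_set_integrable[OF 1(1)])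
  show "set_integrable lebesgue {0<..<T} (\<lambda>s. \<iota> (J (f s)) - P s + \<kappa> *\<^sub>R \<iota> (J (P s)))"
    by (rule rhs_integrable[OF 2 3])
  show "t \<in> {0..T} \<Longrightarrow> \<iota> (J (P t)) = \<iota> (J (P 0)) + pint (\<lambda>s. \<iota> (J (f s)) - P s + \<kappa> *\<^sub>R \<iota> (J (P s))) t"
    using assms unfolding mild_sol_def by blast
qed

lemma mild_sol_add:
  assumes P: "mild_sol T P f" and Q: "mild_sol T Q g"
  shows "mild_sol T (\<lambda>t. P t + Q t) (\<lambda>t. f t + g t)"
    and "mild_sol T (\<lambda>t. P t - Q t) (\<lambda>t. f t - g t)"
proof -
  note P' = mild_solD[OF P] and Q' = mild_solD[OF Q]
  have i: "set_integrable lebesgue {0<..<t} (\<lambda>s. \<iota> (J (f s)) - P s + \<kappa> *\<^sub>R \<iota> (J (P s)))"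
    "set_integrable lebesgue {0<..<t} (\<lambda>s. \<iota> (J (g s)) - Q s + \<kappa> *\<^sub>R \<iota> (J (Q s)))" if "t \<in> {0..T}" for t
    using set_integrable_sub[OF P'(5), of t] set_integrable_sub[OF Q'(5), of t] that by auto
  show "mild_sol T (\<lambda>t. P t + Q t) (\<lambda>t. f t + g t)"
    unfolding mild_sol_def
  proof (intro conjI ballI continuous_on_add L2_add P'(1,2) Q'(1,2))
    fix t assume t: "t \<in> {0..T}"
    have "pint (\<lambda>s. \<iota> (J (f s + g s)) - (P s + Q s) + \<kappa> *\<^sub>R \<iota> (J (P s + Q s))) t
        = pint (\<lambda>s. (\<iota> (J (f s)) - P s + \<kappa> *\<^sub>R \<iota> (J (P s))) + (\<iota> (J (g s)) - Q s + \<kappa> *\<^sub>R \<iota> (J (Q s)))) t"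
      by (simp add: J.add i.add j.add scaleR_add_right algebra_simps)
    also have "\<dots> = pint (\<lambda>s. \<iota> (J (f s)) - P s + \<kappa> *\<^sub>R \<iota> (J (P s))) t + pint (\<lambda>s. \<iota> (J (g s)) - Q s + \<kappa> *\<^sub>R \<iota> (J (Q s))) t"
      by (rule pint_add[OF i[OF t]])
    finally show "\<iota> (J (P t + Q t)) = \<iota> (J (P 0 + Q 0)) +
        pint (\<lambda>s. \<iota> (J (f s + g s)) - (P s + Q s) + \<kappa> *\<^sub>R \<iota> (J (P s + Q s))) t"
      using P'(6)[OF t] Q'(6)[OF t] by (simp only: J.add i.add j.add) (simp only: add_ac)
  qed
  show "mild_sol T (\<lambda>t. P t - Q t) (\<lambda>t. f t - g t)"
    unfolding mild_sol_def
  proof (intro conjI ballI continuous_on_diff L2_diff P'(1,2) Q'(1,2))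
    fix t assume t: "t \<in> {0..T}"
    have "pint (\<lambda>s. \<iota> (J (f s - g s)) - (P s - Q s) + \<kappa> *\<^sub>R \<iota> (J (P s - Q s))) t
        = pint (\<lambda>s. (\<iota> (J (f s)) - P s + \<kappa> *\<^sub>R \<iota> (J (P s))) - (\<iota> (J (g s)) - Q s + \<kappa> *\<^sub>R \<iota> (J (Q s)))) t"
      by (simp add: J.diff i.diff j.diff scaleR_diff_right algebra_simps)
    also have "\<dots> = pint (\<lambda>s. \<iota> (J (f s)) - P s + \<kappa> *\<^sub>R \<iota> (J (P s))) t - pint (\<lambda>s. \<iota> (J (g s)) - Q s + \<kappa> *\<^sub>R \<iota> (J (Q s))) t"
      by (rule pint_diff[OF i[OF t]])
    finally show "\<iota> (J (P t - Q t)) = \<iota> (J (P 0 - Q 0)) +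
        pint (\<lambda>s. \<iota> (J (f s - g s)) - (P s - Q s) + \<kappa> *\<^sub>R \<iota> (J (P s - Q s))) t"
      using P'(6)[OF t] Q'(6)[OF t] by (simp only: J.diff i.diff j.diff) (simp only: add_diff_add)
  qed
qed

lemma mild_sol_strong:
  assumes P: "mild_sol T P f"
  shows "strong_sol T (\<lambda>t. Ln n (P t)) (\<lambda>t. \<iota> (Ln n (f t)))"
proof -
  note P' = mild_solD[OF P]
  interpret Jn: bounded_linear "Jn n" by (rule Jn_bl)
  interpret Ln: bounded_linear "Ln n" by (rule Ln_bl)
  \<comment> \<open>\<open>K\<close> is chosen to undo the smoothing in the mild equation:
    \<open>K (\<iota> (J x)) = Ln n x\<close>, while \<open>\<iota> (K x) = Lp (Ln n x)\<close>.
    Applying it to the integrated equation therefore produces the strong one.\<close>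
  define K where "K x = Jn n (Lp (Jn n x))" for x
  have K: "bounded_linear K"
    unfolding K_def[abs_def]
    by (rule bounded_linear_compose[OF Jn_bl bounded_linear_compose[OF Lp.bounded_linear_axioms Jn_bl]])
  interpret K: bounded_linear K by (rule K)
  have KJ: "K (\<iota> (J x)) = Ln n x" for x
    by (simp add: K_def Jn_J Ln_def)
  have iK: "\<iota> (K x) = Lp (Ln n x)" for x
    by (simp add: K_def Ln_def Lp_Jn)
  define g where "g s = Ln n (f s) - K (P s) + \<kappa> *\<^sub>R Ln n (P s)" for s
  have Kg: "K (\<iota> (J (f s)) - P s + \<kappa> *\<^sub>R \<iota> (J (P s))) = g s" for s
    by (simp add: K.add K.diff K.scaleR KJ g_def)
  show ?thesis
    unfolding strong_sol_def
  proof (intro conjI exI[of _ g] ballI)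
    show "continuous_on {0..T} (\<lambda>t. Ln n (P t))" by (rule Ln.continuous_on[OF P'(1)])
    show "(\<lambda>t. \<iota> (Ln n (f t))) \<in> L2_space T"
      by (rule L2_bounded_linear[OF bounded_linear_compose[OF iota_bl Ln_bl] P'(2)])
    show "set_integrable lebesgue {0<..<T} g"
      using set_integrable_bounded_linear[OF K P'(5)] by (simp add: Kg)
    show "Ln n (P t) = Ln n (P 0) + pint g t" if t: "t \<in> {0..T}" for t
    proof -
      have "K (\<iota> (J (P t))) = K (\<iota> (J (P 0))) + K (pint (\<lambda>s. \<iota> (J (f s)) - P s + \<kappa> *\<^sub>R \<iota> (J (P s))) t)"
        by (subst P'(6)[OF t]) (rule K.add)
      also have "K (pint (\<lambda>s. \<iota> (J (f s)) - P s + \<kappa> *\<^sub>R \<iota> (J (P s))) t) = pint g t"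
        using pint_bounded_linear[OF K set_integrable_sub[OF P'(5)], of t] t by (simp add: Kg)
      finally show ?thesis by (simp only: KJ)
    qed
    show "\<iota> (g s) = \<iota> (Ln n (f s)) - La (Ln n (P s))" for s
      by (simp add: g_def i.add j.add i.diff j.diff i.scaleR j.scaleR iK La_eq)
  qed
qed

end

section \<open>Regularity of mild solutions\<close>

lemma pint_dominated:
  fixes g :: "nat \<Rightarrow> real \<Rightarrow> real"
  assumes g: "\<And>n. set_integrable lebesgue {0<..<T} (g n)" and l: "set_integrable lebesgue {0<..<T} l"
    and w: "set_integrable lebesgue {0<..<T} w"
    and lim: "\<And>s. (\<lambda>n. g n s) \<longlonglongrightarrow> l s" and le: "\<And>n s. \<bar>g n s\<bar> \<le> w s"
  shows "(\<lambda>n. pint (g n) T) \<longlonglongrightarrow> pint l T"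
  unfolding pint_alt
proof (rule integral_dominated_convergence[where w = "\<lambda>s. indicat_real {0<..<T} s *\<^sub>R w s"])
  show "(\<lambda>s. indicat_real {0<..<T} s *\<^sub>R l s) \<in> borel_measurable lebesgue"
    "(\<lambda>s. indicat_real {0<..<T} s *\<^sub>R g n s) \<in> borel_measurable lebesgue" for n
    using l g[of n] by (auto simp: set_integrable_def intro: borel_measurable_integrable)
  show "integrable lebesgue (\<lambda>s. indicat_real {0<..<T} s *\<^sub>R w s)"
    using w by (simp add: set_integrable_def)
  show "AE s in lebesgue. (\<lambda>n. indicat_real {0<..<T} s *\<^sub>R g n s) \<longlonglongrightarrow> indicat_real {0<..<T} s *\<^sub>R l s"
    by (intro AE_I2 tendsto_scaleR tendsto_const lim)
  show "AE s in lebesgue. norm (indicat_real {0<..<T} s *\<^sub>R g n s) \<le> indicat_real {0<..<T} s *\<^sub>R w s" for n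
    using le by (intro AE_I2) (auto simp: indicator_def)
qed

lemma pint_Fatou:
  fixes p :: "nat \<Rightarrow> real \<Rightarrow> 'e::{complex_banach, second_countable_topology}"
  assumes p: "\<And>n. continuous_on {0..T} (p n)"
    and lim: "AE t\<in>{0<..<T} in lebesgue. (\<lambda>n. p n t) \<longlonglongrightarrow> q t"
    and bound: "\<And>n. pint (\<lambda>t. (norm (p n t))\<^sup>2) T \<le> b n" and b: "b \<longlonglongrightarrow> B"
  shows "q \<in> L2_space T" "pint (\<lambda>t. (norm (q t))\<^sup>2) T \<le> B"
proof -
  let ?I = "\<lambda>t. indicat_real {0<..<T} t"
  have pm: "(\<lambda>t. ?I t *\<^sub>R p n t) \<in> borel_measurable lebesgue" for n
    using continuous_imp_set_integrable[OF p] unfolding set_integrable_def by (rule borel_measurable_integrable)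
  have pi: "integrable lebesgue (\<lambda>t. ?I t *\<^sub>R (norm (p n t))\<^sup>2)" for n
    using continuous_imp_set_integrable[OF continuous_on_power[OF continuous_on_norm[OF p]]]
    unfolding set_integrable_def .
  \<comment> \<open>The limit function \<open>q\<close> is not known to be measurable. The function
    \<open>l\<close> is, as a limit of measurable functions, and it agrees with \<open>q\<close> on
    the interval almost everywhere, whatever default \<open>lim\<close> takes elsewhere.\<close>
  define l where "l t = lim (\<lambda>n. ?I t *\<^sub>R p n t)" for t
  have lm: "l \<in> borel_measurable lebesgue"
    unfolding l_def by (rule borel_measurable_lim_metric[OF pm])
  have AE: "AE t in lebesgue. (\<lambda>n. ?I t *\<^sub>R p n t) \<longlonglongrightarrow> ?I t *\<^sub>R q t"
    using lim by eventually_elim (auto simp: indicator_def)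
  then have "AE t in lebesgue. l t = ?I t *\<^sub>R q t"
    unfolding l_def by eventually_elim (rule limI)
  then have qm: "(\<lambda>t. ?I t *\<^sub>R q t) \<in> borel_measurable lebesgue"
    by (rule measurable_lebesgue_AE[OF lm])
  have q2m: "(\<lambda>t. ?I t *\<^sub>R (norm (q t))\<^sup>2) \<in> borel_measurable lebesgue"
    using set_borel_measurable_norm_sq[of lebesgue "{0<..<T}" q] qm by (simp add: set_borel_measurable_def)
  have "0 \<le> b n" for n
    by (rule order_trans[OF pint_nonneg bound[of n]]) simp
  then have B: "0 \<le> B" by (intro LIMSEQ_le_const[OF b]) auto
  have "(\<integral>\<^sup>+t. ennreal (?I t *\<^sub>R (norm (q t))\<^sup>2) \<partial>lebesgue)
      = (\<integral>\<^sup>+t. liminf (\<lambda>n. ennreal (?I t *\<^sub>R (norm (p n t))\<^sup>2)) \<partial>lebesgue)"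
  proof (rule nn_integral_cong_AE)
    show "AE t in lebesgue. ennreal (?I t *\<^sub>R (norm (q t))\<^sup>2) = liminf (\<lambda>n. ennreal (?I t *\<^sub>R (norm (p n t))\<^sup>2))"
      using lim
    proof eventually_elim
      case (elim t)
      have "(\<lambda>n. ?I t *\<^sub>R (norm (p n t))\<^sup>2) \<longlonglongrightarrow> ?I t *\<^sub>R (norm (q t))\<^sup>2"
        using elim by (cases "t \<in> {0<..<T}") (auto intro!: tendsto_intros)
      from lim_imp_Liminf[OF _ tendsto_ennrealI[OF this]] show ?case by simp
    qed
  qed
  also have "\<dots> \<le> liminf (\<lambda>n. \<integral>\<^sup>+t. ennreal (?I t *\<^sub>R (norm (p n t))\<^sup>2) \<partial>lebesgue)"
    by (rule nn_integral_liminf) (use pi[THEN borel_measurable_integrable] in measurable)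
  also have "\<dots> = liminf (\<lambda>n. ennreal (pint (\<lambda>t. (norm (p n t))\<^sup>2) T))"
    unfolding pint_alt by (subst nn_integral_eq_integral[OF pi]) auto
  also have "\<dots> \<le> liminf (\<lambda>n. ennreal (b n))"
    by (intro Liminf_mono always_eventually allI ennreal_leI bound)
  also have "\<dots> = ennreal B"
    using lim_imp_Liminf[OF _ tendsto_ennrealI[OF b]] by simp
  finally have fin: "(\<integral>\<^sup>+t. ennreal (?I t *\<^sub>R (norm (q t))\<^sup>2) \<partial>lebesgue) \<le> ennreal B" .
  have qi: "integrable lebesgue (\<lambda>t. ?I t *\<^sub>R (norm (q t))\<^sup>2)"
    by (rule integrableI_nonneg[OF q2m]) (use fin in \<open>auto simp: less_top[symmetric] top_unique\<close>)
  show "q \<in> L2_space T"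
    using qm qi unfolding L2_space_iff set_borel_measurable_def set_integrable_def by blast
  show "pint (\<lambda>t. (norm (q t))\<^sup>2) T \<le> B"
    using fin nn_integral_eq_integral[OF qi] B by (simp add: pint_alt)
qed

context shifted_form
begin

lemma energy_diff_le:
  assumes h: "h \<in> L2_space T" "k \<in> L2_space T" "f \<in> L2_space T"
  shows "energy T (x - y) (\<lambda>t. h t - k t)
    \<le> 2 * energy T (x - z) (\<lambda>t. h t - f t) + 2 * energy T (y - z) (\<lambda>t. k t - f t)"
proof -
  have 1: "(norm (x - y))\<^sup>2 \<le> 2 * (norm (x - z))\<^sup>2 + 2 * (norm (y - z))\<^sup>2"
    using norm_sq_diff_le[of "x - z" "y - z"] by simp
  have "pint (\<lambda>t. (norm (h t - k t))\<^sup>2) T \<le> pint (\<lambda>t. 2 * (norm (h t - f t))\<^sup>2 + 2 * (norm (k t - f t))\<^sup>2) T"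
  proof (rule pint_mono)
    show "(norm (h t - k t))\<^sup>2 \<le> 2 * (norm (h t - f t))\<^sup>2 + 2 * (norm (k t - f t))\<^sup>2" for t
      using norm_sq_diff_le[of "h t - f t" "k t - f t"] by simp
  qed (intro set_integral_add set_integrable_mult_right L2_sq_integrable L2_diff h)+
  also have "\<dots> = 2 * pint (\<lambda>t. (norm (h t - f t))\<^sup>2) T + 2 * pint (\<lambda>t. (norm (k t - f t))\<^sup>2) T"
    by (simp only: pint_add[OF set_integrable_mult_right[OF L2_sq_integrable[OF L2_diff[OF h(1,3)]]]
          set_integrable_mult_right[OF L2_sq_integrable[OF L2_diff[OF h(2,3)]]]] pint_mult)
  finally have "1 / c * pint (\<lambda>t. (norm (h t - k t))\<^sup>2) T
      \<le> 1 / c * (2 * pint (\<lambda>t. (norm (h t - f t))\<^sup>2) T + 2 * pint (\<lambda>t. (norm (k t - f t))\<^sup>2) T)"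
    using c_pos by (intro mult_left_mono) auto
  with 1 show ?thesis unfolding energy_def by (simp add: distrib_left add_divide_distrib)
qed

lemma iota_Ln_sq_bound: "(norm (\<iota> (Ln n x)))\<^sup>2 \<le> M0 ^ 4 * (norm x)\<^sup>2"
  using power_mono[OF iota_Ln_bound[of n x], of 2] by (simp add: power_mult_distrib)

lemma energy_Ln_tendsto:
  assumes f: "f \<in> L2_space T"
  shows "(\<lambda>n. energy T (i (Ln n (j x))) (\<lambda>t. \<iota> (Ln n (f t)))) \<longlonglongrightarrow> energy T x f"
    and "(\<lambda>n. energy T (i (Ln n (j x)) - x) (\<lambda>t. \<iota> (Ln n (f t)) - f t)) \<longlonglongrightarrow> 0"
proof -
  have Lf: "(\<lambda>t. \<iota> (Ln n (f t))) \<in> L2_space T" for n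
    by (rule L2_bounded_linear[OF bounded_linear_compose[OF iota_bl Ln_bl] f])
  have "(\<lambda>n. pint (\<lambda>t. (norm (\<iota> (Ln n (f t))))\<^sup>2) T) \<longlonglongrightarrow> pint (\<lambda>t. (norm (f t))\<^sup>2) T"
    by (rule pint_dominated[where w = "\<lambda>t. M0 ^ 4 * (norm (f t))\<^sup>2"])
      (use iota_Ln_sq_bound in \<open>auto intro!: L2_sq_integrable Lf f tendsto_intros iota_Ln_tendsto set_integrable_mult_right\<close>)
  then show "(\<lambda>n. energy T (i (Ln n (j x))) (\<lambda>t. \<iota> (Ln n (f t)))) \<longlonglongrightarrow> energy T x f"
    unfolding energy_def by (intro tendsto_intros i_Ln_tendsto)
  have "(\<lambda>n. pint (\<lambda>t. (norm (\<iota> (Ln n (f t)) - f t))\<^sup>2) T) \<longlonglongrightarrow> pint (\<lambda>t. (norm (f t - f t))\<^sup>2) T"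
  proof (rule pint_dominated[where w = "\<lambda>t. (2 * M0 ^ 4 + 2) * (norm (f t))\<^sup>2"])
    show "\<bar>(norm (\<iota> (Ln n (f t)) - f t))\<^sup>2\<bar> \<le> (2 * M0 ^ 4 + 2) * (norm (f t))\<^sup>2" for n t
      using norm_sq_diff_le[of "\<iota> (Ln n (f t))" "f t"] iota_Ln_sq_bound[of n "f t"] by (simp add: distrib_right)
    show "(\<lambda>n. (norm (\<iota> (Ln n (f t)) - f t))\<^sup>2) \<longlonglongrightarrow> (norm (f t - f t))\<^sup>2" for t
      by (intro tendsto_intros iota_Ln_tendsto)
  qed (intro L2_sq_integrable L2_diff Lf f set_integrable_mult_right)+
  then have "(\<lambda>n. energy T (i (Ln n (j x)) - x) (\<lambda>t. \<iota> (Ln n (f t)) - f t)) \<longlonglongrightarrow> energy T (x - x) (\<lambda>t. f t - f t)"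
    unfolding energy_def by (intro tendsto_intros i_Ln_tendsto)
  then show "(\<lambda>n. energy T (i (Ln n (j x)) - x) (\<lambda>t. \<iota> (Ln n (f t)) - f t)) \<longlonglongrightarrow> 0"
    by (simp add: energy_def pint_alt)
qed

text \<open>The smoothed solutions \<open>Ln n \<circ> P\<close> are strong solutions, and the energy estimate for their
  differences makes them a Cauchy sequence both in \<open>C([0,T];H)\<close> and in \<open>L\<^sub>2(0,T;V)\<close>.\<close>

lemma mild_regularity:
  assumes T: "0 < T" and P: "mild_sol T P f" and P0: "P 0 = j x0"
  obtains u where "continuous_on {0..T} u" "\<And>t. t \<in> {0..T} \<Longrightarrow> P t = j (u t)"
    "\<And>t. t \<in> {0..T} \<Longrightarrow> (norm (u t))\<^sup>2 \<le> GT T * energy T x0 f"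
    "AE t\<in>{0<..<T} in lebesgue. u t \<in> range i" "(\<lambda>t. inv i (u t)) \<in> L2_space T"
    "pint (\<lambda>t. (norm (inv i (u t)))\<^sup>2) T \<le> GT T * energy T x0 f"
proof -
  have T0: "0 \<le> T" using T by simp
  have f: "f \<in> L2_space T" by (rule mild_solD(2)[OF P])
  define p where "p n t = Ln n (P t)" for n t
  define h where "h n t = \<iota> (Ln n (f t))" for n t
  have sol: "strong_sol T (p n) (h n)" for n
    using mild_sol_strong[OF P, of n] unfolding p_def[abs_def] h_def[abs_def] .
  have pc: "continuous_on {0..T} (p n)" for n using sol unfolding strong_sol_def by blast
  have h: "h n \<in> L2_space T" for n using sol unfolding strong_sol_def by blast
  have p0: "p n 0 = Ln n (j x0)" for n by (simp add: p_def P0)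
  define e where "e n = energy T (i (p n 0) - x0) (\<lambda>t. h n t - f t)" for n
  define E where "E n = energy T (i (p n 0)) (h n)" for n
  have e: "e \<longlonglongrightarrow> 0" using energy_Ln_tendsto(2)[OF f] by (simp add: e_def[abs_def] h_def p0)
  have E: "E \<longlonglongrightarrow> energy T x0 f" using energy_Ln_tendsto(1)[OF f] by (simp add: E_def[abs_def] h_def[abs_def] p0)
  have G: "0 \<le> GT T" by (rule GT_nonneg[OF T0])
  have en: "GT T * energy T (i (p n 0 - p m 0)) (\<lambda>t. h n t - h m t) \<le> GT T * 2 * e n + GT T * 2 * e m" for n m
    using mult_left_mono[OF energy_diff_le[OF h[of n] h[of m] f, where x = "i (p n 0)" and y = "i (p m 0)" and z = x0] G]
    by (simp add: e_def i.diff algebra_simps)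
  have d1: "(norm (i (p n t) - i (p m t)))\<^sup>2 \<le> GT T * 2 * e n + GT T * 2 * e m" if "t \<in> {0..T}" for n m t
    using energy_estimate(1)[OF T0 strong_sol_diff[OF sol sol] that, of n m] en[of n m] by (simp add: i.diff)
  have d2: "pint (\<lambda>t. (norm (p n t - p m t))\<^sup>2) T \<le> GT T * 2 * e n + GT T * 2 * e m" for n m
    using energy_estimate(2)[OF T0 strong_sol_diff[OF sol sol], of n m] en[of n m] by simp
  have Ge: "(\<lambda>n. GT T * 2 * e n) \<longlonglongrightarrow> 0" using tendsto_mult_left[OF e, of "GT T * 2"] by simp
  have "uniformly_Cauchy_on {0..T} (\<lambda>n t. i (p n t))"
    unfolding uniformly_Cauchy_on_def
  proof (intro allI impI)
    fix r :: real assume r: "0 < r"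
    obtain N where N: "\<And>n. N \<le> n \<Longrightarrow> GT T * 2 * e n < r\<^sup>2 / 2"
      using order_tendstoD(2)[OF Ge, of "r\<^sup>2 / 2"] r by (auto simp: eventually_sequentially)
    have "dist (i (p m t)) (i (p n t)) < r" if "t \<in> {0..T}" "N \<le> m" "N \<le> n" for t m n
    proof -
      have "(norm (i (p m t) - i (p n t)))\<^sup>2 < r\<^sup>2"
        using d1[OF that(1), of m n] N[OF that(2)] N[OF that(3)] by linarith
      then show ?thesis using r by (simp add: dist_norm power2_less_imp_less)
    qed
    then show "\<exists>M. \<forall>t\<in>{0..T}. \<forall>m\<ge>M. \<forall>n\<ge>M. dist (i (p m t)) (i (p n t)) < r" by blast
  qed
  then obtain u where u: "uniform_limit {0..T} (\<lambda>n t. i (p n t)) u sequentially"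
    using Cauchy_uniformly_convergent uniformly_convergent_on_def by blast
  have lim: "(\<lambda>n. i (p n t)) \<longlonglongrightarrow> u t" if "t \<in> {0..T}" for t
    by (rule tendsto_uniform_limitI[OF u that])
  have GE: "(\<lambda>n. GT T * E n) \<longlonglongrightarrow> GT T * energy T x0 f" by (intro tendsto_intros E)
  have uc: "continuous_on {0..T} u"
    by (rule uniform_limit_theorem[OF _ u]) (auto intro!: always_eventually i.continuous_on pc)
  have Pu: "P t = j (u t)" if "t \<in> {0..T}" for t
    using LIMSEQ_unique[OF iota_Ln_tendsto[of "P t"] j.tendsto[OF lim[OF that], unfolded p_def]] .
  have ub: "(norm (u t))\<^sup>2 \<le> GT T * energy T x0 f" if t: "t \<in> {0..T}" for t
    by (rule LIMSEQ_le[OF tendsto_power[OF tendsto_norm[OF lim[OF t]]] GE])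
      (use energy_estimate(1)[OF T0 sol t] in \<open>auto simp: E_def\<close>)
  obtain r where r: "strict_mono r" "AE t\<in>{0<..<T} in lebesgue. convergent (\<lambda>k. p (r k) t)"
    using L2_Cauchy_AE_convergent[OF T0 pc d2 Ge] by blast
  \<comment> \<open>At almost every time the subsequence converges in \<open>V\<close>; its image in
    \<open>H\<close> also converges to \<open>u t\<close>, so that value lies in the range of
    \<open>i\<close> and \<open>inv i\<close> returns the limit in \<open>V\<close>.\<close>
  have ae: "AE t\<in>{0<..<T} in lebesgue. u t \<in> range i \<and> (\<lambda>k. p (r k) t) \<longlonglongrightarrow> inv i (u t)"
    using r(2)
  proof eventually_elim
    case (elim t)
    show ?case
    proof
      assume t: "t \<in> {0<..<T}"
      then obtain v where v: "(\<lambda>k. p (r k) t) \<longlonglongrightarrow> v" using elim convergent_def by blast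
      have "(\<lambda>k. i (p (r k) t)) \<longlonglongrightarrow> u t"
        using LIMSEQ_subseq_LIMSEQ[OF lim r(1), of t] t by (simp add: o_def)
      with i.tendsto[OF v] have iv: "i v = u t" by (rule LIMSEQ_unique)
      show "u t \<in> range i \<and> (\<lambda>k. p (r k) t) \<longlonglongrightarrow> inv i (u t)"
        unfolding iv[symmetric] using v by simp
    qed
  qed
  have GEr: "(\<lambda>k. GT T * E (r k)) \<longlonglongrightarrow> GT T * energy T x0 f"
    using LIMSEQ_subseq_LIMSEQ[OF GE r(1)] by (simp add: o_def)
  have ae': "AE t\<in>{0<..<T} in lebesgue. (\<lambda>k. p (r k) t) \<longlonglongrightarrow> inv i (u t)"
    using ae by eventually_elim simp
  have pE: "pint (\<lambda>t. (norm (p (r k) t))\<^sup>2) T \<le> GT T * E (r k)" for k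
    unfolding E_def by (rule energy_estimate(2)[OF T0 sol])
  note Fatou = pint_Fatou[OF pc ae' pE GEr]
  show thesis
    by (rule that[OF uc Pu ub _ Fatou]) (use ae in \<open>auto elim!: eventually_mono\<close>)
qed

text \<open>The difference is a mild solution with zero data, so its energy vanishes and the bound
  in \<open>mild_regularity\<close> makes it zero.\<close>

lemma mild_sol_unique:
  assumes T: "0 < T" and P: "mild_sol T P f" and Q: "mild_sol T Q f" and "P 0 = Q 0" and t: "t \<in> {0..T}"
  shows "P t = Q t"
proof -
  have "P 0 - Q 0 = j 0" using assms by (simp add: j.zero)
  then show ?thesis
  proof (rule mild_regularity[OF T mild_sol_add(2)[OF P Q]])
    fix u assume u: "\<And>t. t \<in> {0..T} \<Longrightarrow> P t - Q t = j (u t)"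
      "\<And>t. t \<in> {0..T} \<Longrightarrow> (norm (u t))\<^sup>2 \<le> GT T * energy T 0 (\<lambda>t. f t - f t)"
    from u(2)[OF t] have "u t = 0" by (simp add: energy_def pint_alt)
    with u(1)[OF t] show ?thesis by (simp add: j.zero)
  qed
qed

end

section \<open>Duhamel's formula\<close>

context shifted_form
begin

lemma smoothing_bl: "bounded_linear (\<lambda>y. \<kappa> *\<^sub>R \<iota> (J y) - y)"
  by (intro bounded_linear_sub bounded_linear_ident bounded_linear_const_scaleR iotaJ_bl)

lemma exp_minus_ext_linear: "0 \<le> t \<Longrightarrow> bounded_linear (exp_minus_ext i a t)"
  using analytic_semigroup_clinear[OF exp_minus_ext_props(1)] by (simp add: bounded_clinear_def)

lemma exp_minus_ext_continuous: "continuous_on {0..T} (\<lambda>t. exp_minus_ext i a t x)"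
  by (rule continuous_on_subset[OF analytic_semigroup_continuous[OF exp_minus_ext_props(1)]]) auto

text \<open>The derivative of an orbit may blow up at 0, but after application of \<open>J\<close>
  it involves only the orbit itself and is continuous up to 0. Pairing with a fixed \<open>v\<close>
  reduces the fundamental theorem to complex-valued functions.\<close>

lemma exp_minus_ext_identity:
  assumes t: "0 \<le> t"
  shows "pint (\<lambda>s. \<kappa> *\<^sub>R \<iota> (J (exp_minus_ext i a s x)) - exp_minus_ext i a s x) t
    = \<iota> (J (exp_minus_ext i a t x)) - \<iota> (J x)"
proof (rule antidual_eqI)
  fix v :: 'v
  let ?S = "\<lambda>s. exp_minus_ext i a s x"
  let ?d = "\<lambda>s. \<kappa> *\<^sub>R \<iota> (J (?S s)) - ?S s"
  have Sc: "continuous_on {0..t} ?S" by (rule exp_minus_ext_continuous)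
  have dc: "continuous_on {0..t} ?d"
    by (rule bounded_linear.continuous_on[OF smoothing_bl Sc])
  have pbl: "bounded_linear (\<lambda>y. dual_pairing y v)" by (rule dual_pairing.bounded_linear_left)
  have "((\<lambda>s. \<iota> (J (?S s))) has_vector_derivative ?d s) (at s)" if "0 < s" for s
  proof -
    obtain u where u: "?S s = \<iota> u" "(?S has_vector_derivative - La u) (at s)"
      using classical_sol_semigroup[OF exp_minus_ext_props, of x] \<open>0 < s\<close> unfolding classical_sol_def by blast
    have "((\<lambda>s. \<iota> (J (?S s))) has_vector_derivative \<iota> (J (- La u))) (at s)"
      by (rule bounded_linear.has_vector_derivative[OF iotaJ_bl u(2)])
    moreover have "\<iota> (J (- La u)) = ?d s"
      unfolding u(1) by (simp add: La_eq J.diff J.scaleR i.diff j.diff i.scaleR j.scaleR J.neg i.neg j.neg)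
    ultimately show ?thesis by simp
  qed
  then have "dual_pairing (\<iota> (J (?S t))) v = dual_pairing (\<iota> (J (?S 0))) v + pint (\<lambda>s. dual_pairing (?d s) v) t"
    by (intro FTC_pint t bounded_linear.continuous_on[OF pbl] bounded_linear.continuous_on[OF iotaJ_bl] Sc dc
        bounded_linear.has_vector_derivative[OF pbl]) auto
  also have "pint (\<lambda>s. dual_pairing (?d s) v) t = dual_pairing (pint ?d t) v"
    by (rule pint_bounded_linear[OF pbl continuous_imp_set_integrable[OF dc]])
  finally show "dual_pairing (pint ?d t) v = dual_pairing (\<iota> (J (?S t)) - \<iota> (J x)) v"
    by (simp add: dual_pairing.diff_left analytic_semigroup_0[OF exp_minus_ext_props(1)])
qed

lemma mild_sol_cong:
  assumes "mild_sol T P f" "\<And>t. t \<in> {0..T} \<Longrightarrow> P t = Q t"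
  shows "mild_sol T Q f"
proof -
  have "\<iota> (J (Q t)) = \<iota> (J (Q 0)) + pint (\<lambda>s. \<iota> (J (f s)) - Q s + \<kappa> *\<^sub>R \<iota> (J (Q s))) t"
    if t: "t \<in> {0..T}" for t
  proof -
    have "pint (\<lambda>s. \<iota> (J (f s)) - P s + \<kappa> *\<^sub>R \<iota> (J (P s))) t = pint (\<lambda>s. \<iota> (J (f s)) - Q s + \<kappa> *\<^sub>R \<iota> (J (Q s))) t"
      by (rule pint_cong) (use assms(2) t in auto)
    moreover have "P t = Q t" "P 0 = Q 0" using t by (auto intro: assms(2))
    ultimately show ?thesis using mild_solD(6)[OF assms(1) t] by (simp only:)
  qed
  then show ?thesis
    unfolding mild_sol_def
    by (intro conjI ballI continuous_on_eq[OF mild_solD(1)[OF assms(1)] assms(2)] mild_solD(2)[OF assms(1)])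
qed

lemma mild_sol_homogeneous: "mild_sol T (\<lambda>t. exp_minus_ext i a t x) (\<lambda>_. 0)"
  unfolding mild_sol_def
proof (intro conjI ballI exp_minus_ext_continuous)
  show "(\<lambda>_. 0) \<in> L2_space T" by (rule L2_continuous) simp
  fix t assume "t \<in> {0..T}"
  then have "0 \<le> t" by simp
  from exp_minus_ext_identity[OF this, of x]
  show "\<iota> (J (exp_minus_ext i a t x)) = \<iota> (J (exp_minus_ext i a 0 x)) +
      pint (\<lambda>s. \<iota> (J 0) - exp_minus_ext i a s x + \<kappa> *\<^sub>R \<iota> (J (exp_minus_ext i a s x))) t"
    by (simp add: J.zero i.zero j.zero analytic_semigroup_0[OF exp_minus_ext_props(1)])
qed

lemma duhamel_pint: "duhamel i a f t = pint (\<lambda>s. exp_minus_ext i a (t - s) (f s)) t"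
  by (simp add: duhamel_def pint_def)

text \<open>Fubini turns the time integral of the convolution into a convolution with integrated
  orbits; there the identity for single orbits applies under the integral sign.\<close>

lemma mild_sol_duhamel:
  assumes T: "0 \<le> T" and f: "f \<in> L2_space T"
  shows "mild_sol T (duhamel i a f) f"
proof -
  let ?S = "exp_minus_ext i a"
  have fi: "set_integrable lebesgue {0<..<T} f" by (rule L2_space_imp_integrable[OF f])
  obtain M where M: "0 < M" "\<And>t f. 0 \<le> t \<Longrightarrow> t \<le> T \<Longrightarrow> norm (?S t f) \<le> M * norm f"
    using exp_minus_ext_bound[of T] by blast
  interpret S: kernel ?S T M
  proof
    fix r :: real and x y :: "'v antidual" assume r: "r \<in> {0..T}"
    then have bl: "bounded_linear (?S r)" by (intro exp_minus_ext_linear) simp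
    show "norm (?S r x - ?S r y) \<le> M * norm (x - y)"
      using M(2)[of r "x - y"] r by (simp add: linear_diff[OF bounded_linear.linear[OF bl]])
    show "?S r 0 = 0" by (rule linear_0[OF bounded_linear.linear[OF bl]])
  qed (use T exp_minus_ext_continuous in auto)
  \<comment> \<open>The time integral of the semigroup is again an admissible kernel, with Lipschitz
    constant \<open>M * T\<close>; its convolution with \<open>f\<close> is the primitive of the
    Duhamel term.\<close>
  define \<Theta> where "\<Theta> r x = pint (\<lambda>s. ?S s x) r" for r x
  interpret \<Theta>: kernel \<Theta> T "M * T"
  proof
    fix r :: real and x y :: "'v antidual" assume r: "r \<in> {0..T}"
    have ci: "set_integrable lebesgue {0<..<r} (\<lambda>s. ?S s x)" for x
      by (rule continuous_imp_set_integrable[OF exp_minus_ext_continuous])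
    have "\<Theta> r x - \<Theta> r y = pint (\<lambda>s. ?S s (x - y)) r"
      unfolding \<Theta>_def pint_diff[OF ci ci, symmetric]
      by (rule pint_cong) (simp add: linear_diff[OF bounded_linear.linear[OF exp_minus_ext_linear]])
    also have "norm \<dots> \<le> pint (\<lambda>s. norm (?S s (x - y))) r"
      unfolding pint_def by (rule set_integral_norm_bound[OF ci])
    also have "\<dots> \<le> pint (\<lambda>_. M * norm (x - y)) r"
      by (rule pint_mono[OF set_integrable_norm[OF ci] continuous_imp_set_integrable[OF continuous_on_const]])
        (use M(2) r in auto)
    also have "\<dots> = M * norm (x - y) * r" using r by (simp add: pint_const)
    also have "\<dots> \<le> M * T * norm (x - y)"
      using mult_left_mono[of r T "M * norm (x - y)"] r M(1) by (simp add: mult_ac)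
    finally show "norm (\<Theta> r x - \<Theta> r y) \<le> M * T * norm (x - y)" .
    have "\<Theta> r 0 = pint (\<lambda>_. 0) r"
      unfolding \<Theta>_def by (rule pint_cong) (simp add: linear_0[OF bounded_linear.linear[OF exp_minus_ext_linear]])
    then show "\<Theta> r 0 = 0" by (simp add: pint_alt)
  next
    show "continuous_on {0..T} (\<lambda>r. \<Theta> r x)" for x
      unfolding \<Theta>_def by (rule pint_continuous[OF continuous_imp_set_integrable[OF exp_minus_ext_continuous] T])
  qed (rule T)
  let ?D = "duhamel i a f"
  have D: "?D t = S.conv f t" for t
    unfolding S.conv_def[OF fi] duhamel_pint ..
  have Dc: "continuous_on {0..T} ?D"
    using S.conv_continuous[OF fi] by (simp add: D[abs_def])
  show ?thesis
    unfolding mild_sol_def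
  proof (intro conjI ballI Dc f)
    fix t assume t: "t \<in> {0..T}"
    then have tT: "t \<le> T" by simp
    have Di: "set_integrable lebesgue {0<..<t} ?D"
      by (rule set_integrable_sub[OF continuous_imp_set_integrable[OF Dc] tT])
    have Jf: "set_integrable lebesgue {0<..<t} (\<lambda>s. \<iota> (J (f s)))"
      by (rule set_integrable_bounded_linear[OF iotaJ_bl set_integrable_sub[OF fi tT]])
    have Si: "set_integrable lebesgue {0<..<t} (\<lambda>s. ?S (t - s) (f s))"
      by (rule S.conv_integrable[OF fi t])
    have "pint (\<lambda>s. \<kappa> *\<^sub>R \<iota> (J (?D s)) - ?D s) t = \<kappa> *\<^sub>R \<iota> (J (pint ?D t)) - pint ?D t"
      by (rule pint_bounded_linear[OF smoothing_bl Di])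
    also have "pint ?D t = pint (\<lambda>\<sigma>. \<Theta> (t - \<sigma>) (f \<sigma>)) t"
      using S.conv_fubini[OF fi t] by (simp add: D[abs_def] \<Theta>_def)
    also have "\<kappa> *\<^sub>R \<iota> (J (pint (\<lambda>\<sigma>. \<Theta> (t - \<sigma>) (f \<sigma>)) t)) - pint (\<lambda>\<sigma>. \<Theta> (t - \<sigma>) (f \<sigma>)) t
        = pint (\<lambda>\<sigma>. \<kappa> *\<^sub>R \<iota> (J (\<Theta> (t - \<sigma>) (f \<sigma>))) - \<Theta> (t - \<sigma>) (f \<sigma>)) t"
      by (rule pint_bounded_linear[OF smoothing_bl \<Theta>.conv_integrable[OF fi t], symmetric])
    also have "\<dots> = pint (\<lambda>\<sigma>. \<iota> (J (?S (t - \<sigma>) (f \<sigma>))) - \<iota> (J (f \<sigma>))) t"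
    proof (rule pint_cong)
      fix \<sigma> assume "0 < \<sigma>" "\<sigma> < t"
      then have "0 \<le> t - \<sigma>" by simp
      have "\<kappa> *\<^sub>R \<iota> (J (\<Theta> (t - \<sigma>) (f \<sigma>))) - \<Theta> (t - \<sigma>) (f \<sigma>)
          = pint (\<lambda>r. \<kappa> *\<^sub>R \<iota> (J (?S r (f \<sigma>))) - ?S r (f \<sigma>)) (t - \<sigma>)"
        unfolding \<Theta>_def
        by (rule pint_bounded_linear[OF smoothing_bl continuous_imp_set_integrable[OF exp_minus_ext_continuous], symmetric])
      then show "\<kappa> *\<^sub>R \<iota> (J (\<Theta> (t - \<sigma>) (f \<sigma>))) - \<Theta> (t - \<sigma>) (f \<sigma>) = \<iota> (J (?S (t - \<sigma>) (f \<sigma>))) - \<iota> (J (f \<sigma>))"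
        using exp_minus_ext_identity[OF \<open>0 \<le> t - \<sigma>\<close>] by simp
    qed
    also have "\<dots> = pint (\<lambda>\<sigma>. \<iota> (J (?S (t - \<sigma>) (f \<sigma>)))) t - pint (\<lambda>\<sigma>. \<iota> (J (f \<sigma>))) t"
      by (rule pint_diff[OF set_integrable_bounded_linear[OF iotaJ_bl Si] Jf])
    also have "pint (\<lambda>\<sigma>. \<iota> (J (?S (t - \<sigma>) (f \<sigma>)))) t = \<iota> (J (?D t))"
      unfolding duhamel_pint by (rule pint_bounded_linear[OF iotaJ_bl Si])
    finally have "\<iota> (J (?D t)) = pint (\<lambda>s. \<iota> (J (f s))) t + pint (\<lambda>s. \<kappa> *\<^sub>R \<iota> (J (?D s)) - ?D s) t"
      by simp
    also have "\<dots> = pint (\<lambda>s. \<iota> (J (f s)) + (\<kappa> *\<^sub>R \<iota> (J (?D s)) - ?D s)) t"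
      by (rule pint_add[OF Jf set_integrable_bounded_linear[OF smoothing_bl Di], symmetric])
    also have "\<dots> = pint (\<lambda>s. \<iota> (J (f s)) - ?D s + \<kappa> *\<^sub>R \<iota> (J (?D s))) t"
      by (rule pint_cong) simp
    finally show "\<iota> (J (?D t)) = \<iota> (J (?D 0)) + pint (\<lambda>s. \<iota> (J (f s)) - ?D s + \<kappa> *\<^sub>R \<iota> (J (?D s))) t"
      by (simp add: duhamel_pint[of f 0] J.zero i.zero j.zero)
  qed
qed

lemma mild_sol_formula:
  assumes "0 \<le> T" "f \<in> L2_space T"
  shows "mild_sol T (\<lambda>t. exp_minus_ext i a t x + duhamel i a f t) f"
  using mild_sol_add(1)[OF mild_sol_homogeneous mild_sol_duhamel[OF assms]] by simp

text \<open>Once \<open>u\<close> takes values in \<open>V\<close> almost everywhere, with a square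
  integrable lift, \<open>A u\<close> is integrable in the antidual. The mild equation is then the
  image under the injective map \<open>\<iota> \<circ> J\<close> of the unsmoothed one.\<close>

lemma mild_sol_iff_integral:
  assumes uc: "continuous_on {0..T} u" and ae: "AE t\<in>{0<..<T} in lebesgue. u t \<in> range i"
    and q: "(\<lambda>t. inv i (u t)) \<in> L2_space T" and f: "f \<in> L2_space T"
  shows "mild_sol T (\<lambda>t. j (u t)) f \<longleftrightarrow>
    (\<forall>t\<in>{0..T}. j (u t) = j (u 0) + pint (\<lambda>s. f s - La (inv i (u s))) t)"
proof -
  have gi: "set_integrable lebesgue {0<..<T} (\<lambda>s. f s - La (inv i (u s)))"
    by (intro L2_space_imp_integrable L2_diff f L2_bounded_linear[OF La.bounded_linear_axioms q])
  have eq: "\<iota> (J (j (u 0) + pint (\<lambda>s. f s - La (inv i (u s))) t))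
      = \<iota> (J (j (u 0))) + pint (\<lambda>s. \<iota> (J (f s)) - j (u s) + \<kappa> *\<^sub>R \<iota> (J (j (u s)))) t"
    if t: "t \<in> {0..T}" for t
  proof -
    have gt: "set_integrable lebesgue {0<..<t} (\<lambda>s. f s - La (inv i (u s)))"
      using set_integrable_sub[OF gi] t by simp
    have "AE s\<in>{0<..<t} in lebesgue. \<iota> (J (f s - La (inv i (u s)))) = \<iota> (J (f s)) - j (u s) + \<kappa> *\<^sub>R \<iota> (J (j (u s)))"
      using ae
    proof eventually_elim
      case (elim s)
      show ?case
      proof
        assume "s \<in> {0<..<t}"
        then obtain v where v: "u s = i v" using elim t by auto
        show "\<iota> (J (f s - La (inv i (u s)))) = \<iota> (J (f s)) - j (u s) + \<kappa> *\<^sub>R \<iota> (J (j (u s)))"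
          unfolding v by (simp add: La_eq J.diff J.scaleR i.diff j.diff i.scaleR j.scaleR)
      qed
    qed
    from pint_cong_AE(1)[OF set_integrable_bounded_linear[OF iotaJ_bl gt] this]
    show ?thesis unfolding pint_bounded_linear[OF iotaJ_bl gt, symmetric]
      by (simp add: J.add i.add j.add pint_bounded_linear[OF iotaJ_bl gt])
  qed
  have inj: "\<iota> (J x) = \<iota> (J y) \<longleftrightarrow> x = y" for x y
    by simp (metis Lp_J)
  have "(\<forall>t\<in>{0..T}. \<iota> (J (j (u t))) = \<iota> (J (j (u 0))) + pint (\<lambda>s. \<iota> (J (f s)) - j (u s) + \<kappa> *\<^sub>R \<iota> (J (j (u s)))) t)
      \<longleftrightarrow> (\<forall>t\<in>{0..T}. j (u t) = j (u 0) + pint (\<lambda>s. f s - La (inv i (u s))) t)"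
  proof (rule ball_cong[OF refl])
    fix t assume t: "t \<in> {0..T}"
    show "\<iota> (J (j (u t))) = \<iota> (J (j (u 0))) + pint (\<lambda>s. \<iota> (J (f s)) - j (u s) + \<kappa> *\<^sub>R \<iota> (J (j (u s)))) t
      \<longleftrightarrow> j (u t) = j (u 0) + pint (\<lambda>s. f s - La (inv i (u s))) t"
      unfolding eq[OF t, symmetric] by (rule inj)
  qed
  then show ?thesis
    unfolding mild_sol_def using f j.continuous_on[OF uc] by blast
qed

lemma mild_sol_regular:
  assumes T: "0 < T" and P: "mild_sol T (\<lambda>t. j (u t)) f"
  shows "continuous_on {0..T} u" "t \<in> {0..T} \<Longrightarrow> (norm (u t))\<^sup>2 \<le> GT T * energy T (u 0) f"
    "AE t\<in>{0<..<T} in lebesgue. u t \<in> range i" "(\<lambda>t. inv i (u t)) \<in> L2_space T"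
    "pint (\<lambda>t. (norm (inv i (u t)))\<^sup>2) T \<le> GT T * energy T (u 0) f"
proof -
  obtain v where v: "continuous_on {0..T} v" "\<And>t. t \<in> {0..T} \<Longrightarrow> j (u t) = j (v t)"
    "\<And>t. t \<in> {0..T} \<Longrightarrow> (norm (v t))\<^sup>2 \<le> GT T * energy T (u 0) f"
    "AE t\<in>{0<..<T} in lebesgue. v t \<in> range i" "(\<lambda>t. inv i (v t)) \<in> L2_space T"
    "pint (\<lambda>t. (norm (inv i (v t)))\<^sup>2) T \<le> GT T * energy T (u 0) f"
    by (rule mild_regularity[OF T P refl]) (rule that)
  have uv: "u t = v t" if "t \<in> {0..T}" for t using v(2)[OF that] by simp
  show "continuous_on {0..T} u" by (rule continuous_on_eq[OF v(1) uv[symmetric]])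
  show "t \<in> {0..T} \<Longrightarrow> (norm (u t))\<^sup>2 \<le> GT T * energy T (u 0) f" using v(3) uv by simp
  show "AE t\<in>{0<..<T} in lebesgue. u t \<in> range i" using v(4) by eventually_elim (use uv in auto)
  show "(\<lambda>t. inv i (u t)) \<in> L2_space T" by (rule L2_cong_AE[OF v(5)]) (use uv in auto)
  have "pint (\<lambda>t. (norm (inv i (u t)))\<^sup>2) T = pint (\<lambda>t. (norm (inv i (v t)))\<^sup>2) T"
    by (rule pint_cong) (use uv in auto)
  then show "pint (\<lambda>t. (norm (inv i (u t)))\<^sup>2) T \<le> GT T * energy T (u 0) f" using v(6) by simp
qed

lemma regular_distr_diff:
  fixes f g :: "real \<Rightarrow> 'v antidual"
  assumes "f \<in> L2_space T" "g \<in> L2_space T" "\<phi> \<in> test_functions T"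
  shows "regular_distr T (\<lambda>t. f t - g t) \<phi> = regular_distr T f \<phi> - regular_distr T g \<phi>"
proof -
  have \<phi>: "continuous_on {0..T} \<phi>" using test_function_props[OF assms(3)] by blast
  show ?thesis
    unfolding regular_distr_pint scaleC.diff_right
    by (rule pint_diff[OF test_scaleC_integrable[OF L2_space_imp_integrable[OF assms(1)] \<phi>]
          test_scaleC_integrable[OF L2_space_imp_integrable[OF assms(2)] \<phi>]])
qed

lemma solves_iff_weak_deriv:
  assumes q: "(\<lambda>t. inv i (u t)) \<in> L2_space T" and f: "f \<in> L2_space T"
    and w: "(\<lambda>t. j (u t)) \<in> L2_space T"
  shows "solves_fvp i a T f uT u \<longleftrightarrow>
    is_weak_deriv T (\<lambda>t. j (u t)) (\<lambda>t. f t - La (inv i (u t))) \<and> u T = uT"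
proof -
  have Lq: "(\<lambda>t. La (inv i (u t))) \<in> L2_space T" by (rule L2_bounded_linear[OF La.bounded_linear_axioms q])
  let ?D = "distr_deriv (regular_distr T (\<lambda>t. j (u t)))"
  have D: "?D \<in> distributions T" by (intro distr_deriv_mem_distributions regular_distr_mem_distributions w)
  have eq: "?D \<phi> + regular_distr T (\<lambda>t. La (inv i (u t))) \<phi> = regular_distr T f \<phi>
      \<longleftrightarrow> ?D \<phi> = regular_distr T (\<lambda>t. f t - La (inv i (u t))) \<phi>" if "\<phi> \<in> test_functions T" for \<phi>
    unfolding regular_distr_diff[OF f Lq that] by (simp add: eq_diff_eq)
  have "(\<lambda>\<phi>. ?D \<phi> + regular_distr T (\<lambda>t. La (inv i (u t))) \<phi>) \<in> distributions T"
    if "\<And>\<phi>. \<phi> \<in> test_functions T \<Longrightarrow> ?D \<phi> + regular_distr T (\<lambda>t. La (inv i (u t))) \<phi> = regular_distr T f \<phi>"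
    by (rule distributions_cong[OF regular_distr_mem_distributions[OF f] that])
  then show ?thesis
    using D regular_distr_mem_distributions[OF f] regular_distr_mem_distributions[OF L2_diff[OF f Lq]] eq L2_diff[OF f Lq]
    unfolding solves_fvp_def is_weak_deriv_def distr_eq_def by blast
qed

text \<open>Membership in \<open>X\<close> is a consequence on the right-hand side. Hence sums,
  differences and explicit formulas need only be checked in the mild sense, which is stable under
  these operations.\<close>

lemma solution_iff_mild_sol:
  assumes T: "0 < T" and f: "f \<in> L2_space T"
  shows "u \<in> X_space i T \<and> solves_fvp i a T f uT u \<longleftrightarrow> mild_sol T (\<lambda>t. j (u t)) f \<and> u T = uT"
proof
  assume u: "u \<in> X_space i T \<and> solves_fvp i a T f uT u"
  then have uc: "continuous_on {0..T} u" and ae: "AE t\<in>{0<..<T} in lebesgue. u t \<in> range i"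
    and q: "(\<lambda>t. inv i (u t)) \<in> L2_space T"
    by (simp_all add: X_space_def)
  note wc = j.continuous_on[OF uc]
  show "mild_sol T (\<lambda>t. j (u t)) f \<and> u T = uT"
    using u unfolding solves_iff_weak_deriv[OF q f L2_continuous[OF wc]] is_weak_deriv_iff[OF T wc]
      mild_sol_iff_integral[OF uc ae q f] by blast
next
  assume u: "mild_sol T (\<lambda>t. j (u t)) f \<and> u T = uT"
  then have P: "mild_sol T (\<lambda>t. j (u t)) f" by blast
  note uc = mild_sol_regular(1)[OF T P] and ae = mild_sol_regular(3)[OF T P] and q = mild_sol_regular(4)[OF T P]
  note wc = j.continuous_on[OF uc]
  have "(\<lambda>t. f t - La (inv i (u t))) \<in> L2_space T"
    by (intro L2_diff f L2_bounded_linear[OF La.bounded_linear_axioms q])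
  then have D: "is_weak_deriv T (\<lambda>t. j (u t)) (\<lambda>t. f t - La (inv i (u t)))"
    using P unfolding is_weak_deriv_iff[OF T wc] mild_sol_iff_integral[OF uc ae q f] by blast
  then have "solves_fvp i a T f uT u" 
    using u unfolding solves_iff_weak_deriv[OF q f L2_continuous[OF wc]] by blast
  moreover have "u \<in> X_space i T"
    using uc ae q D L2_continuous[OF wc] unfolding X_space_def H1_space_def by blast
  ultimately show "u \<in> X_space i T \<and> solves_fvp i a T f uT u" by blast
qed

end

section \<open>The final value problem\<close>

context shifted_form
begin

lemma X_norm_bound:
  assumes T: "0 < T"
  shows "\<exists>K>0. \<forall>f u. f \<in> L2_space T \<and> u \<in> X_space i T \<and> solves_fvp i a T f (u T) u \<longrightarrow>
    X_norm i T u \<le> K * sqrt ((norm (u 0))\<^sup>2 + pint (\<lambda>t. (norm (f t))\<^sup>2) T)"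
proof -
  obtain Kj where Kj: "0 < Kj" "\<And>x. norm (j x) \<le> norm x * Kj" using j.pos_bounded by blast
  obtain Ka where Ka: "0 < Ka" "\<And>x. norm (La x) \<le> norm x * Ka" using La.pos_bounded by blast
  define G where "G = GT T"
  have G: "0 \<le> G" unfolding G_def using T by (intro GT_nonneg) simp
  \<comment> \<open>One summand per part of the norm: \<open>2 * G\<close> for the norm in
    \<open>V\<close> and the supremum in \<open>H\<close>, \<open>Kj\<^sup>2 * G * T\<close> for the
    norm of \<open>u\<close> in the antidual, and the last two for \<open>u' = f - A u\<close>. The
    factor \<open>1 + 1 / c\<close> in \<open>K\<close> passes from \<open>energy\<close> to the
    unweighted sum.\<close>
  define k where "k = 2 * G + Kj\<^sup>2 * G * T + 2 * c + 2 * Ka\<^sup>2 * G"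
  have k: "0 < k" unfolding k_def using G c_pos T by (intro add_nonneg_pos add_pos_nonneg) auto
  define K where "K = sqrt (k * (1 + 1 / c))"
  have K: "0 < K" unfolding K_def using k c_pos by (simp add: add_pos_pos)
  have "X_norm i T u \<le> K * sqrt ((norm (u 0))\<^sup>2 + pint (\<lambda>t. (norm (f t))\<^sup>2) T)"
    if f: "f \<in> L2_space T" and u: "u \<in> X_space i T" "solves_fvp i a T f (u T) u" for f u
  proof -
    have P: "mild_sol T (\<lambda>t. j (u t)) f" using solution_iff_mild_sol[OF T f, of u "u T"] u by blast
    note reg = mild_sol_regular[OF T P]
    define q where "q t = inv i (u t)" for t
    have q: "q \<in> L2_space T" unfolding q_def by (rule reg(4))
    define E where "E = energy T (u 0) f"
    have E: "0 \<le> E" by (simp add: E_def energy_nonneg)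
    have qE: "pint (\<lambda>t. (norm (q t))\<^sup>2) T \<le> G * E" using reg(5) by (simp add: q_def G_def E_def)
    have fE: "pint (\<lambda>t. (norm (f t))\<^sup>2) T \<le> c * E"
      using c_pos by (simp add: E_def energy_def distrib_left)
    have uE: "(norm (u t))\<^sup>2 \<le> G * E" if "t \<in> {0..T}" for t using reg(2)[OF that] by (simp add: G_def E_def)
    have sup: "(SUP t\<in>{0..T}. (norm (u t))\<^sup>2) \<le> G * E"
      by (rule cSUP_least) (use T uE in auto)
    note wc = j.continuous_on[OF reg(1)]
    define g where "g = weak_deriv T (\<lambda>t. j (u t))"
    have D: "is_weak_deriv T (\<lambda>t. j (u t)) (\<lambda>t. f t - La (q t))"
      using u(2) unfolding q_def solves_iff_weak_deriv[OF reg(4) f L2_continuous[OF wc]] by blast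
    then have g: "is_weak_deriv T (\<lambda>t. j (u t)) g"
      unfolding g_def weak_deriv_def by (rule someI[of "is_weak_deriv T (\<lambda>t. j (u t))"])
    then have gL: "g \<in> L2_space T" by (simp add: is_weak_deriv_def)
    have wi: "set_integrable lebesgue {0<..<T} (\<lambda>t. (norm (j (u t)))\<^sup>2)"
      by (rule L2_sq_integrable[OF L2_continuous[OF wc]])
    have "pint (\<lambda>t. (norm (g t))\<^sup>2) T = pint (\<lambda>t. (norm (f t - La (q t)))\<^sup>2) T"
    proof (rule pint_cong_AE(1)[OF L2_sq_integrable[OF gL]])
      show "AE t\<in>{0<..<T} in lebesgue. (norm (g t))\<^sup>2 = (norm (f t - La (q t)))\<^sup>2"
        using weak_deriv_AE_unique[OF T wc g D] by eventually_elim simp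
    qed
    also have "\<dots> \<le> pint (\<lambda>t. 2 * (norm (f t))\<^sup>2 + 2 * Ka\<^sup>2 * (norm (q t))\<^sup>2) T"
    proof (rule pint_mono)
      show "(norm (f t - La (q t)))\<^sup>2 \<le> 2 * (norm (f t))\<^sup>2 + 2 * Ka\<^sup>2 * (norm (q t))\<^sup>2" for t
        using norm_sq_diff_le[of "f t" "La (q t)"] power_mono[OF Ka(2)[of "q t"], of 2]
        by (simp add: power_mult_distrib mult_ac)
    qed (intro set_integral_add set_integrable_mult_right L2_sq_integrable L2_diff f q
        L2_bounded_linear[OF La.bounded_linear_axioms])+
    also have "\<dots> = 2 * pint (\<lambda>t. (norm (f t))\<^sup>2) T + 2 * Ka\<^sup>2 * pint (\<lambda>t. (norm (q t))\<^sup>2) T"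
      by (simp only: pint_add[OF set_integrable_mult_right[OF L2_sq_integrable[OF f]]
            set_integrable_mult_right[OF L2_sq_integrable[OF q]]] pint_mult)
    also have "\<dots> \<le> 2 * (c * E) + 2 * Ka\<^sup>2 * (G * E)"
      by (intro add_mono mult_left_mono fE qE) auto
    finally have gE: "pint (\<lambda>t. (norm (g t))\<^sup>2) T \<le> 2 * (c * E) + 2 * Ka\<^sup>2 * (G * E)" .
    have "pint (\<lambda>t. (norm (j (u t)))\<^sup>2) T \<le> pint (\<lambda>_. Kj\<^sup>2 * (G * E)) T"
    proof (rule pint_mono[OF wi continuous_imp_set_integrable[OF continuous_on_const]])
      fix t assume t: "t \<in> {0<..<T}"
      have "(norm (j (u t)))\<^sup>2 \<le> Kj\<^sup>2 * (norm (u t))\<^sup>2"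
        using power_mono[OF Kj(2)[of "u t"], of 2] by (simp add: power_mult_distrib mult_ac)
      also have "\<dots> \<le> Kj\<^sup>2 * (G * E)" using t by (intro mult_left_mono uE) auto
      finally show "(norm (j (u t)))\<^sup>2 \<le> Kj\<^sup>2 * (G * E)" .
    qed
    also have "\<dots> = Kj\<^sup>2 * (G * E) * T" using T by (simp add: pint_const)
    finally have wE: "pint (\<lambda>t. (norm (j (u t)))\<^sup>2) T \<le> Kj\<^sup>2 * (G * E) * T" .
    have "X_norm i T u = sqrt (pint (\<lambda>t. (norm (q t))\<^sup>2) T + (SUP t\<in>{0..T}. (norm (u t))\<^sup>2)
        + pint (\<lambda>t. (norm (j (u t)))\<^sup>2 + (norm (g t))\<^sup>2) T)"
      unfolding X_norm_def q_def g_def pint_def ..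
    also have "pint (\<lambda>t. (norm (j (u t)))\<^sup>2 + (norm (g t))\<^sup>2) T
        = pint (\<lambda>t. (norm (j (u t)))\<^sup>2) T + pint (\<lambda>t. (norm (g t))\<^sup>2) T"
      by (rule pint_add[OF wi L2_sq_integrable[OF gL]])
    also have "sqrt (pint (\<lambda>t. (norm (q t))\<^sup>2) T + (SUP t\<in>{0..T}. (norm (u t))\<^sup>2)
        + (pint (\<lambda>t. (norm (j (u t)))\<^sup>2) T + pint (\<lambda>t. (norm (g t))\<^sup>2) T)) \<le> sqrt (k * E)"
    proof (rule real_sqrt_le_mono)
      have "k * E = G * E + G * E + (Kj\<^sup>2 * (G * E) * T + (2 * (c * E) + 2 * Ka\<^sup>2 * (G * E)))"
        by (simp add: k_def algebra_simps)
      then show "pint (\<lambda>t. (norm (q t))\<^sup>2) T + (SUP t\<in>{0..T}. (norm (u t))\<^sup>2)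
        + (pint (\<lambda>t. (norm (j (u t)))\<^sup>2) T + pint (\<lambda>t. (norm (g t))\<^sup>2) T) \<le> k * E"
        using qE sup wE gE by linarith
    qed
    also have "\<dots> \<le> sqrt (k * (1 + 1 / c) * ((norm (u 0))\<^sup>2 + pint (\<lambda>t. (norm (f t))\<^sup>2) T))"
    proof (rule real_sqrt_le_mono)
      have nn: "0 \<le> pint (\<lambda>t. (norm (f t))\<^sup>2) T" by (rule pint_nonneg) simp
      have "E \<le> (1 + 1 / c) * ((norm (u 0))\<^sup>2 + pint (\<lambda>t. (norm (f t))\<^sup>2) T)"
        using c_pos nn by (simp add: E_def energy_def distrib_left distrib_right)
      from mult_left_mono[OF this, of k] k
      show "k * E \<le> k * (1 + 1 / c) * ((norm (u 0))\<^sup>2 + pint (\<lambda>t. (norm (f t))\<^sup>2) T)" by (simp add: mult.assoc)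
    qed
    also have "\<dots> = K * sqrt ((norm (u 0))\<^sup>2 + pint (\<lambda>t. (norm (f t))\<^sup>2) T)"
      by (simp add: K_def real_sqrt_mult)
    finally show ?thesis .
  qed
  with K show ?thesis by blast
qed

lemma solution_formula:
  assumes T: "0 < T" and f: "f \<in> L2_space T" and u: "u \<in> X_space i T" "solves_fvp i a T f uT u"
    and t: "t \<in> {0..T}"
  shows "j (u t) = j (exp_minus i a t (u 0)) + duhamel i a f t"
proof -
  have "mild_sol T (\<lambda>t. j (u t)) f" using solution_iff_mild_sol[OF T f] u by blast
  moreover have "mild_sol T (\<lambda>t. exp_minus_ext i a t (j (u 0)) + duhamel i a f t) f"
    using T by (intro mild_sol_formula f) simp
  moreover have "j (u 0) = exp_minus_ext i a 0 (j (u 0)) + duhamel i a f 0"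
    by (simp add: duhamel_pint analytic_semigroup_0[OF exp_minus_ext_props(1)])
  ultimately have "j (u t) = exp_minus_ext i a t (j (u 0)) + duhamel i a f t"
    using t by (rule mild_sol_unique[OF T])
  then show ?thesis using t by (simp add: exp_minus_ext_j)
qed

lemma final_difference_solution:
  assumes T: "0 < T" and f: "f \<in> L2_space T" and u: "u \<in> X_space i T" "solves_fvp i a T f uT u"
  shows "final_difference i a T f uT = j (exp_minus i a T (u 0))"
    and "exp_plus i a T (inv j (final_difference i a T f uT)) = u 0"
    and "(f, uT) \<in> Y_space i a T"
proof -
  have "u T = uT" using u(2) by (simp add: solves_fvp_def)
  then show *: "final_difference i a T f uT = j (exp_minus i a T (u 0))"
    using solution_formula[OF T f u, of T] T by (simp add: final_difference_def)
  show "exp_plus i a T (inv j (final_difference i a T f uT)) = u 0"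
    unfolding * inv_j exp_plus_def by (rule inv_f_f[OF exp_minus_injective[OF T]])
  show "(f, uT) \<in> Y_space i a T"
    using f * by (simp add: Y_space_def exp_plus_dom_def)
qed

lemma solution_exists:
  assumes T: "0 < T" and Y: "(f, uT) \<in> Y_space i a T"
  obtains u where "u \<in> X_space i T" "solves_fvp i a T f uT u"
proof -
  have f: "f \<in> L2_space T" using Y by (simp add: Y_space_def)
  \<comment> \<open>The prospective initial state: the final difference lies in the range of
    \<open>exp_minus i a T\<close>, and starting the forward problem at a preimage \<open>x\<close>
    leads to the prescribed final value.\<close>
  obtain x where x: "j uT - duhamel i a f T = j (exp_minus i a T x)"
    using Y by (auto simp: Y_space_def final_difference_def exp_plus_dom_def)
  let ?P = "\<lambda>t. exp_minus_ext i a t (j x) + duhamel i a f t"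
  have P: "mild_sol T ?P f" using T by (intro mild_sol_formula f) simp
  have P0: "?P 0 = j x" by (simp add: duhamel_pint analytic_semigroup_0[OF exp_minus_ext_props(1)])
  obtain u where u: "\<And>t. t \<in> {0..T} \<Longrightarrow> ?P t = j (u t)"
    by (rule mild_regularity[OF T P P0]) (rule that)
  have "j (u T) = j uT"
    using u[of T] x T by (simp add: exp_minus_ext_j algebra_simps)
  then have "mild_sol T (\<lambda>t. j (u t)) f \<and> u T = uT"
    using mild_sol_cong[OF P u] by simp
  then show thesis using that solution_iff_mild_sol[OF T f] by blast
qed

lemma solution_diff:
  assumes T: "0 < T" and f: "f \<in> L2_space T" and g: "g \<in> L2_space T"
    and u: "u \<in> X_space i T" "solves_fvp i a T f uT u"
    and v: "v \<in> X_space i T" "solves_fvp i a T g vT v"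
  shows "(\<lambda>t. v t - u t) \<in> X_space i T" "solves_fvp i a T (\<lambda>t. g t - f t) (vT - uT) (\<lambda>t. v t - u t)"
proof -
  have "mild_sol T (\<lambda>t. j (u t)) f \<and> u T = uT" using solution_iff_mild_sol[OF T f] u by blast
  moreover have "mild_sol T (\<lambda>t. j (v t)) g \<and> v T = vT" using solution_iff_mild_sol[OF T g] v by blast
  ultimately have "mild_sol T (\<lambda>t. j (v t - u t)) (\<lambda>t. g t - f t) \<and> v T - u T = vT - uT"
    using mild_sol_add(2)[of T "\<lambda>t. j (v t)" g "\<lambda>t. j (u t)" f] by (simp add: j.diff)
  then show "(\<lambda>t. v t - u t) \<in> X_space i T" "solves_fvp i a T (\<lambda>t. g t - f t) (vT - uT) (\<lambda>t. v t - u t)"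
    using solution_iff_mild_sol[OF T L2_diff[OF g f], of "\<lambda>t. v t - u t" "vT - uT"] by blast+
qed

lemma homogeneous_mem_X:
  assumes T: "0 < T"
  shows "(\<lambda>t. exp_minus i a t x) \<in> X_space i T"
proof -
  have "mild_sol T (\<lambda>t. j (exp_minus i a t x)) (\<lambda>_. 0)"
    by (rule mild_sol_cong[OF mild_sol_homogeneous[of T "j x"]]) (simp add: exp_minus_ext_j)
  then show ?thesis
    using solution_iff_mild_sol[OF T, of "\<lambda>_. 0" "\<lambda>t. exp_minus i a t x" "exp_minus i a T x"]
      mild_solD(2) by blast
qed

lemma duhamel_mem:
  assumes T: "0 < T" and f: "f \<in> L2_space T"
  shows "t \<in> {0..T} \<Longrightarrow> duhamel i a f t \<in> range j" and "(\<lambda>t. inv j (duhamel i a f t)) \<in> X_space i T"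
proof -
  have P: "mild_sol T (duhamel i a f) f" using T by (intro mild_sol_duhamel f) simp
  have "duhamel i a f 0 = j 0" by (simp add: duhamel_pint j.zero)
  then obtain u where u: "\<And>t. t \<in> {0..T} \<Longrightarrow> duhamel i a f t = j (u t)"
    by (rule mild_regularity[OF T P]) (rule that)
  show "t \<in> {0..T} \<Longrightarrow> duhamel i a f t \<in> range j" using u by auto
  have "mild_sol T (\<lambda>t. j (inv j (duhamel i a f t))) f"
    by (rule mild_sol_cong[OF P]) (simp add: u)
  then show "(\<lambda>t. inv j (duhamel i a f t)) \<in> X_space i T"
    using solution_iff_mild_sol[OF T f, of "\<lambda>t. inv j (duhamel i a f t)" "inv j (duhamel i a f T)"] by blast
qed

text \<open>The third term of the norm on \<open>Y\<close> is the norm of \<open>u 0\<close>, so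
  this norm dominates the data of the forward problem. The bound holds for every solution and hence
  also for differences of solutions.\<close>

lemma X_norm_le_Y_norm:
  assumes T: "0 < T"
  shows "\<exists>K>0. \<forall>f u uT. f \<in> L2_space T \<and> u \<in> X_space i T \<and> solves_fvp i a T f uT u \<longrightarrow>
    X_norm i T u \<le> K * Y_norm i a T f uT"
proof -
  obtain K where K: "0 < K" "\<And>f u. f \<in> L2_space T \<Longrightarrow> u \<in> X_space i T \<Longrightarrow> solves_fvp i a T f (u T) u \<Longrightarrow>
      X_norm i T u \<le> K * sqrt ((norm (u 0))\<^sup>2 + pint (\<lambda>t. (norm (f t))\<^sup>2) T)"
    using X_norm_bound[OF T] by blast
  have "X_norm i T u \<le> K * Y_norm i a T f uT"
    if f: "f \<in> L2_space T" and u: "u \<in> X_space i T" "solves_fvp i a T f uT u" for f u uT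
  proof -
    have "u T = uT" using u(2) by (simp add: solves_fvp_def)
    then have "X_norm i T u \<le> K * sqrt ((norm (u 0))\<^sup>2 + pint (\<lambda>t. (norm (f t))\<^sup>2) T)"
      using K(2)[OF f u(1)] u(2) by blast
    also have "\<dots> \<le> K * Y_norm i a T f uT"
      unfolding Y_norm_def final_difference_solution(2)[OF T f u] pint_def
      using K(1) by (intro mult_left_mono real_sqrt_le_mono) auto
    finally show ?thesis .
  qed
  with K(1) show ?thesis by blast
qed

lemma final_value_problem:
  assumes T: "0 < T"
  shows "(\<forall>f\<in>L2_space T. \<forall>u\<^sub>T.
        (\<exists>u\<in>X_space i T. solves_fvp i a T f u\<^sub>T u) \<longleftrightarrow> (f, u\<^sub>T) \<in> Y_space i a T)" (is ?iff)
    and "(\<forall>(f, u\<^sub>T)\<in>Y_space i a T. \<forall>u\<in>X_space i T. \<forall>v\<in>X_space i T.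
        solves_fvp i a T f u\<^sub>T u \<and> solves_fvp i a T f u\<^sub>T v \<longrightarrow> (\<forall>t\<in>{0..T}. u t = v t))" (is ?unique)
    and "(\<exists>c>0. \<forall>(f, u\<^sub>T)\<in>Y_space i a T. \<forall>u\<in>X_space i T.
        solves_fvp i a T f u\<^sub>T u \<longrightarrow> X_norm i T u \<le> c * Y_norm i a T f u\<^sub>T)" (is ?bound)
    and "(\<forall>(f, u\<^sub>T)\<in>Y_space i a T. \<forall>\<epsilon>>0. \<exists>\<delta>>0. \<forall>(g, v\<^sub>T)\<in>Y_space i a T.
        Y_norm i a T (\<lambda>t. g t - f t) (v\<^sub>T - u\<^sub>T) < \<delta> \<longrightarrow>
        X_norm i T (\<lambda>t. solution_operator i a T g v\<^sub>T t - solution_operator i a T f u\<^sub>T t) < \<epsilon>)" (is ?cont)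
    and "(\<forall>(f, u\<^sub>T)\<in>Y_space i a T. \<forall>u\<in>X_space i T. solves_fvp i a T f u\<^sub>T u \<longrightarrow>
        (let d = inv (dual_embed i) (final_difference i a T f u\<^sub>T);
             homogeneous = (\<lambda>t. exp_minus i a t (exp_plus i a T d));
             particular = (\<lambda>t. inv (dual_embed i) (duhamel i a f t))
         in (\<forall>t\<in>{0..T}. duhamel i a f t \<in> range (dual_embed i)) \<and>
            (\<forall>t\<in>{0..T}. u t = homogeneous t + particular t) \<and>
            homogeneous \<in> X_space i T \<and> particular \<in> X_space i T \<and>
            d = exp_minus i a T (u 0)))" (is ?formula)
proof -
  have YL: "f \<in> L2_space T" if "(f, uT) \<in> Y_space i a T" for f uT using that by (simp add: Y_space_def)
  have uniq: "u t = v t" if "f \<in> L2_space T" "u \<in> X_space i T" "solves_fvp i a T f uT u"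
      "v \<in> X_space i T" "solves_fvp i a T f uT v" "t \<in> {0..T}" for f uT u v t
  proof -
    have "u 0 = v 0"
      using final_difference_solution(2)[OF T that(1-3)] final_difference_solution(2)[OF T that(1,4,5)] by simp
    then have "j (u t) = j (v t)"
      using solution_formula[OF T that(1-3,6)] solution_formula[OF T that(1,4-6)] by simp
    then show ?thesis by simp
  qed
  obtain K where K: "0 < K" "\<And>f u uT. f \<in> L2_space T \<Longrightarrow> u \<in> X_space i T \<Longrightarrow> solves_fvp i a T f uT u \<Longrightarrow>
      X_norm i T u \<le> K * Y_norm i a T f uT"
    using X_norm_le_Y_norm[OF T] by blast
  have op: "solution_operator i a T f uT \<in> X_space i T" "solves_fvp i a T f uT (solution_operator i a T f uT)"
    if Y: "(f, uT) \<in> Y_space i a T" for f uT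
  proof -
    have "\<exists>u. u \<in> X_space i T \<and> solves_fvp i a T f uT u"
      by (rule solution_exists[OF T Y]) blast
    from someI_ex[OF this] show "solution_operator i a T f uT \<in> X_space i T"
      "solves_fvp i a T f uT (solution_operator i a T f uT)"
      unfolding solution_operator_def by blast+
  qed
  show ?iff
  proof (intro ballI allI iffI)
    fix f :: "real \<Rightarrow> 'v antidual" and uT :: 'h assume f: "f \<in> L2_space T"
    show "(f, uT) \<in> Y_space i a T" if "\<exists>u\<in>X_space i T. solves_fvp i a T f uT u"
      using that final_difference_solution(3)[OF T f] by (elim bexE)
    show "\<exists>u\<in>X_space i T. solves_fvp i a T f uT u" if "(f, uT) \<in> Y_space i a T"
      by (rule bexI) (rule op[OF that])+
  qed
  show ?unique
    by (clarify, rule uniq[OF YL]) assumption+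
  show ?bound
    by (intro exI[of _ K] conjI K(1), clarify, rule K(2)[OF YL]) assumption+
  show ?cont
  proof (clarify)
    fix f uT and \<epsilon> :: real assume Y: "(f, uT) \<in> Y_space i a T" and \<epsilon>: "0 < \<epsilon>"
    have "X_norm i T (\<lambda>t. solution_operator i a T g vT t - solution_operator i a T f uT t) < \<epsilon>"
      if Y': "(g, vT) \<in> Y_space i a T" and small: "Y_norm i a T (\<lambda>t. g t - f t) (vT - uT) < \<epsilon> / K" for g vT
    proof -
      \<comment> \<open>By linearity the difference of two solutions solves the problem for the
        difference of the data, so continuity reduces to the norm bound.\<close>
      note d = solution_diff[OF T YL[OF Y] YL[OF Y'] op[OF Y] op[OF Y']]
      have "X_norm i T (\<lambda>t. solution_operator i a T g vT t - solution_operator i a T f uT t)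
          \<le> K * Y_norm i a T (\<lambda>t. g t - f t) (vT - uT)"
        by (rule K(2)[OF L2_diff[OF YL[OF Y'] YL[OF Y]] d])
      also have "\<dots> < \<epsilon>" using small K(1) by (simp add: field_simps)
      finally show ?thesis .
    qed
    moreover have "0 < \<epsilon> / K" using \<epsilon> K(1) by simp
    ultimately show "\<exists>\<delta>>0. \<forall>(g, vT)\<in>Y_space i a T. Y_norm i a T (\<lambda>t. g t - f t) (vT - uT) < \<delta> \<longrightarrow>
        X_norm i T (\<lambda>t. solution_operator i a T g vT t - solution_operator i a T f uT t) < \<epsilon>"
      by blast
  qed
  show ?formula
  proof (clarify)
    fix f uT u assume Y: "(f, uT) \<in> Y_space i a T" and u: "u \<in> X_space i T" "solves_fvp i a T f uT u"
    note f = YL[OF Y]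
    note fd = final_difference_solution[OF T f u]
    have "u t = exp_minus i a t (u 0) + inv j (duhamel i a f t)" if t: "t \<in> {0..T}" for t
    proof -
      obtain x where x: "duhamel i a f t = j x" using duhamel_mem(1)[OF T f t] by blast
      have "j (u t) = j (exp_minus i a t (u 0) + x)"
        using solution_formula[OF T f u t] by (simp add: x j.add)
      then show ?thesis by (simp add: x)
    qed
    then show "let d = inv (dual_embed i) (final_difference i a T f uT);
             homogeneous = (\<lambda>t. exp_minus i a t (exp_plus i a T d));
             particular = (\<lambda>t. inv (dual_embed i) (duhamel i a f t))
         in (\<forall>t\<in>{0..T}. duhamel i a f t \<in> range (dual_embed i)) \<and>
            (\<forall>t\<in>{0..T}. u t = homogeneous t + particular t) \<and>
            homogeneous \<in> X_space i T \<and> particular \<in> X_space i T \<and>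
            d = exp_minus i a T (u 0)"
      unfolding Let_def fd(2) unfolding fd(1) inv_j
      by (intro conjI ballI duhamel_mem[OF T f] homogeneous_mem_X[OF T] refl) assumption+
  qed
qed

end

lemma shifted_form_exists:
  fixes i :: "'v::{complex_hilbert, second_countable_topology} \<Rightarrow>
      'h::{complex_hilbert, second_countable_topology}"
  assumes emb: "gelfand_embedding i" and form: "bounded_coercive_form i a"
  obtains \<kappa> c C where "shifted_form i a \<kappa> c C"
proof -
  obtain C3 where C3: "0 < C3" "\<And>u v. cmod (a u v) \<le> C3 * norm u * norm v"
    using form unfolding bounded_coercive_form_def by blast
  obtain C4 k where C4: "0 < C4" "\<And>v. C4 * (norm v)\<^sup>2 - k * (norm (i v))\<^sup>2 \<le> Re (a v v)"
    using form unfolding bounded_coercive_form_def by blast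
  have "bounded_linear i"
    using emb by (simp add: gelfand_embedding_def bounded_clinear_def)
  then obtain K where K: "0 < K" "\<And>v. norm (i v) \<le> norm v * K"
    using bounded_linear.pos_bounded by blast
  \<comment> \<open>A negative \<open>k\<close> is raised to 0, which only weakens the coercivity
    hypothesis and secures the sign of \<open>\<kappa>\<close> on which the time-uniform bounds
    rely.\<close>
  define \<kappa> where "\<kappa> = max k 0"
  have "shifted_form i a \<kappa> C4 (C3 + \<kappa> * K\<^sup>2)"
  proof
    show "0 < C3 + \<kappa> * K\<^sup>2" using C3(1) by (simp add: \<kappa>_def add_pos_nonneg)
    show "cmod (a u v + \<kappa> * cinner (i u) (i v)) \<le> (C3 + \<kappa> * K\<^sup>2) * norm u * norm v" for u v
    proof -
      have "cmod (\<kappa> * cinner (i u) (i v)) \<le> \<kappa> * (norm (i u) * norm (i v))"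
        using norm_cinner_le[of "i u" "i v"] by (simp add: norm_mult \<kappa>_def mult_left_mono)
      also have "\<dots> \<le> \<kappa> * ((norm u * K) * (norm v * K))"
        using K by (intro mult_left_mono mult_mono) (auto simp: \<kappa>_def)
      finally have "cmod (a u v + \<kappa> * cinner (i u) (i v)) \<le> C3 * norm u * norm v + \<kappa> * ((norm u * K) * (norm v * K))"
        by (intro norm_triangle_le add_mono C3(2))
      then show ?thesis by (simp add: power2_eq_square algebra_simps)
    qed
    show "C4 * (norm v)\<^sup>2 \<le> Re (a v v + \<kappa> * cinner (i v) (i v))" for v
      using C4(2)[of v] mult_right_mono[of k \<kappa> "(norm (i v))\<^sup>2"]
      by (simp add: \<kappa>_def norm_sq_cinner[of "i v", symmetric])
  qed (use emb form C4(1) in \<open>simp_all add: \<kappa>_def\<close>)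
  then show thesis by (rule that)
qed

theorem theorem1:
  fixes i :: "'v::{complex_hilbert, second_countable_topology} \<Rightarrow>
      'h::{complex_hilbert, second_countable_topology}"
    and a :: "'v \<Rightarrow> 'v \<Rightarrow> complex"
    and T :: real
  assumes "gelfand_embedding i"
    and "bounded_coercive_form i a"
    and "0 < T"
  shows "(\<forall>f\<in>L2_space T. \<forall>u\<^sub>T.
        (\<exists>u\<in>X_space i T. solves_fvp i a T f u\<^sub>T u) \<longleftrightarrow> (f, u\<^sub>T) \<in> Y_space i a T) \<and>
    (\<forall>(f, u\<^sub>T)\<in>Y_space i a T. \<forall>u\<in>X_space i T. \<forall>v\<in>X_space i T.
        solves_fvp i a T f u\<^sub>T u \<and> solves_fvp i a T f u\<^sub>T v \<longrightarrow> (\<forall>t\<in>{0..T}. u t = v t)) \<and>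
    (\<exists>c>0. \<forall>(f, u\<^sub>T)\<in>Y_space i a T. \<forall>u\<in>X_space i T.
        solves_fvp i a T f u\<^sub>T u \<longrightarrow> X_norm i T u \<le> c * Y_norm i a T f u\<^sub>T) \<and>
    (\<forall>(f, u\<^sub>T)\<in>Y_space i a T. \<forall>\<epsilon>>0. \<exists>\<delta>>0. \<forall>(g, v\<^sub>T)\<in>Y_space i a T.
        Y_norm i a T (\<lambda>t. g t - f t) (v\<^sub>T - u\<^sub>T) < \<delta> \<longrightarrow>
        X_norm i T (\<lambda>t. solution_operator i a T g v\<^sub>T t - solution_operator i a T f u\<^sub>T t) < \<epsilon>) \<and>
    (\<forall>(f, u\<^sub>T)\<in>Y_space i a T. \<forall>u\<in>X_space i T. solves_fvp i a T f u\<^sub>T u \<longrightarrow>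
        (let d = inv (dual_embed i) (final_difference i a T f u\<^sub>T);
             homogeneous = (\<lambda>t. exp_minus i a t (exp_plus i a T d));
             particular = (\<lambda>t. inv (dual_embed i) (duhamel i a f t))
         in (\<forall>t\<in>{0..T}. duhamel i a f t \<in> range (dual_embed i)) \<and>
            (\<forall>t\<in>{0..T}. u t = homogeneous t + particular t) \<and>
            homogeneous \<in> X_space i T \<and> particular \<in> X_space i T \<and>
            d = exp_minus i a T (u 0)))"
proof -
  obtain \<kappa> c C where "shifted_form i a \<kappa> c C"
    using shifted_form_exists[OF assms(1,2)] by blast
  then interpret shifted_form i a \<kappa> c C .
  show ?thesis
    by (intro conjI final_value_problem[OF assms(3)])
qed

end
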